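(* Let $\Phi$ be an irreducible root system of rank $>1$, let $R$ be an arbitrary commutative ring with $1$, and let $G$ be a Chevalley group $G_\pi(\Phi,R)$ or a large subgroup of it. (i) Let $\alpha\in\Phi$, excluding the case when $\Phi=\mathbf C_l$, $l\geqslant 2$, and $\alpha$ is short. If $g\in C_G(\Gamma_\alpha)$, then $g=c\,x_\alpha(t)$ for some $t\in R$ and $c\in Z(G)$. (ii) In the case $\Phi=\mathbf C_l=\{\pm e_i\pm e_j\mid 1\leqslant i,j\leqslant l,\ i\neq j\}\cup\{\pm 2e_i\mid 1\leqslant i\leqslant l\}$, $l\geqslant 2$, and $\alpha=e_1+e_2$: if $g\in C_G(\Gamma_\alpha)$, then $g=c\,x_{e_1+e_2}(t_1)\,x_{2e_1}(t_2)\,x_{2e_2}(t_3)$ for some $t_1,t_2,t_3\in R$ and $c\in Z(G)$.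
   Context: Root systems are reduced. Let $\mathcal L$ be the complex semisimple Lie algebra with root system $\Phi$, with Chevalley basis $\{h_i;x_\alpha\}$, and let $\pi$ be a faithful finite-dimensional representation of $\mathcal L$ with weight lattice $\Lambda_\pi$ (a lattice between the root lattice and the lattice of all weights). $G_\pi(\Phi,R)$ denotes the Chevalley group of type $(\Phi,\Lambda_\pi)$ over $R$, i.e. the group of $R$-points of the Chevalley--Demazure group scheme, realized as the subgroup of $\mathrm{SL}_n(R)$, $n=\dim\pi$, given by polynomial equations with integer coefficients in the matrix entries. For $\alpha\in\Phi$, $t\in R$, $x_\alpha(t)=\exp(t\pi(x_\alpha))=1+t\pi(x_\alpha)+t^2\pi(x_\alpha)^2/2!+\cdots$ is the elementary root unipotent, and $X_\alpha=\{x_\alpha(t)\mid t\in R\}$. The elementary subgroup $E_\pi(\Phi,R)$ is generated by all $x_\alpha(t)$, $\alpha\in\Phi$, $t\in R$. A subgroup of $G_\pi(\Phi,R)$ is called large if it contains $E_\pi(\Phi,R)$. For $\alpha\in\Phi$ put $\Gamma_\alpha=\{x_\beta(1)\mid \beta\in\Phi,\ [x_\beta(1),x_\alpha(1)]=e\}$. $C_G(M)$ is the centralizer of the set $M$ in $G$, and $Z(G)$ is the center of $G$. The system $\mathbf C_2$ is identified with $\mathbf B_2$. *)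

theory Defs
  imports "HOL-Analysis.Analysis" "HOL-Algebra.Generated_Groups" "HOL-Library.Poly_Mapping"
begin

section \<open>Root systems\<close>

definition cartan_number :: "'e::euclidean_space \<Rightarrow> 'e \<Rightarrow> real" where
  "cartan_number \<beta> \<alpha> = 2 * (\<beta> \<bullet> \<alpha>) / (\<alpha> \<bullet> \<alpha>)"

definition coroot :: "'e::euclidean_space \<Rightarrow> 'e" where
  "coroot \<alpha> = (2 / (\<alpha> \<bullet> \<alpha>)) *\<^sub>R \<alpha>"

text \<open>A root system spans its ambient space, so its rank is \<open>DIM('e)\<close>.\<close>

definition root_system :: "'e::euclidean_space set \<Rightarrow> bool" where
  "root_system \<Phi> \<longleftrightarrow>
     finite \<Phi> \<and> 0 \<notin> \<Phi> \<and> span \<Phi> = UNIV \<and>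
     (\<forall>\<alpha>\<in>\<Phi>. \<forall>\<beta>\<in>\<Phi>. \<beta> - cartan_number \<beta> \<alpha> *\<^sub>R \<alpha> \<in> \<Phi>) \<and>
     (\<forall>\<alpha>\<in>\<Phi>. \<forall>\<beta>\<in>\<Phi>. cartan_number \<beta> \<alpha> \<in> \<int>) \<and>
     (\<forall>\<alpha>\<in>\<Phi>. \<forall>c. c *\<^sub>R \<alpha> \<in> \<Phi> \<longrightarrow> c = 1 \<or> c = - 1)"

definition irreducible_root_system :: "'e::euclidean_space set \<Rightarrow> bool" where
  "irreducible_root_system \<Phi> \<longleftrightarrow>
     root_system \<Phi> \<and> \<Phi> \<noteq> {} \<and>
     \<not> (\<exists>A B. A \<noteq> {} \<and> B \<noteq> {} \<and> A \<inter> B = {} \<and> A \<union> B = \<Phi> \<and>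
              (\<forall>\<alpha>\<in>A. \<forall>\<beta>\<in>B. \<alpha> \<bullet> \<beta> = 0))"

definition root_base :: "'e::euclidean_space set \<Rightarrow> 'e set \<Rightarrow> bool" where
  "root_base \<Phi> \<Delta> \<longleftrightarrow>
     \<Delta> \<subseteq> \<Phi> \<and> independent \<Delta> \<and> span \<Delta> = UNIV \<and>
     (\<forall>\<beta>\<in>\<Phi>. \<exists>c :: 'e \<Rightarrow> nat.
        \<beta> = (\<Sum>\<delta>\<in>\<Delta>. real (c \<delta>) *\<^sub>R \<delta>) \<or> \<beta> = - (\<Sum>\<delta>\<in>\<Delta>. real (c \<delta>) *\<^sub>R \<delta>))"

definition short_root :: "'e::euclidean_space set \<Rightarrow> 'e \<Rightarrow> bool" where
  "short_root \<Phi> \<alpha> \<longleftrightarrow> \<alpha> \<in> \<Phi> \<and> (\<exists>\<beta>\<in>\<Phi>. norm \<alpha> < norm \<beta>)"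

definition C_roots :: "nat \<Rightarrow> (nat \<Rightarrow> 'e::euclidean_space) \<Rightarrow> 'e set" where
  "C_roots l e =
     {a *\<^sub>R e i + b *\<^sub>R e j | a b i j.
        a \<in> {1, - 1} \<and> b \<in> {1, - 1} \<and> i \<in> {1..l} \<and> j \<in> {1..l} \<and> i \<noteq> j}
     \<union> {a *\<^sub>R (2 *\<^sub>R e i) | a i. a \<in> {1, - 1} \<and> i \<in> {1..l}}"

text \<open>
  \<open>\<Phi> = {\<plusminus>e\<^sub>i \<plusminus> e\<^sub>j} \<union> {\<plusminus>2e\<^sub>i}\<close> in coordinates \<open>e\<^sub>1, \<dots>, e\<^sub>l\<close> that are orthonormal up to one common
  scale factor, since the type of an irreducible root system does not depend on the scaling of
  the inner product. The system \<open>B\<^sub>2\<close> has such coordinates with \<open>l = 2\<close>.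
\<close>

definition C_coordinates :: "'e::euclidean_space set \<Rightarrow> nat \<Rightarrow> (nat \<Rightarrow> 'e) \<Rightarrow> bool" where
  "C_coordinates \<Phi> l e \<longleftrightarrow>
     (\<exists>r>0. \<forall>i\<in>{1..l}. \<forall>j\<in>{1..l}. e i \<bullet> e j = (if i = j then r else 0)) \<and>
     \<Phi> = C_roots l e"

definition type_C :: "'e::euclidean_space set \<Rightarrow> bool" where
  "type_C \<Phi> \<longleftrightarrow> (\<exists>l\<ge>2. \<exists>e. C_coordinates \<Phi> l e)"


section \<open>Complex Lie algebras and Chevalley bases\<close>

locale complex_lie_algebra = vector_space smul
  for smul :: "complex \<Rightarrow> 'l::ab_group_add \<Rightarrow> 'l" +
  fixes bracket :: "'l \<Rightarrow> 'l \<Rightarrow> 'l"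
  assumes bracket_add_left: "bracket (x + y) z = bracket x z + bracket y z"
    and bracket_add_right: "bracket x (y + z) = bracket x y + bracket x z"
    and bracket_scale_left: "bracket (smul c x) y = smul c (bracket x y)"
    and bracket_scale_right: "bracket x (smul c y) = smul c (bracket x y)"
    and bracket_self: "bracket x x = 0"
    and jacobi: "bracket x (bracket y z) + bracket y (bracket z x) + bracket z (bracket x y) = 0"
begin

definition lie_ideal :: "'l set \<Rightarrow> bool" where
  "lie_ideal I \<longleftrightarrow> subspace I \<and> (\<forall>x. \<forall>y\<in>I. bracket x y \<in> I)"

primrec derived_series :: "'l set \<Rightarrow> nat \<Rightarrow> 'l set" where
  "derived_series I 0 = I"
| "derived_series I (Suc k) =
     span {bracket x y | x y. x \<in> derived_series I k \<and> y \<in> derived_series I k}"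

definition solvable_ideal :: "'l set \<Rightarrow> bool" where
  "solvable_ideal I \<longleftrightarrow> lie_ideal I \<and> (\<exists>k. derived_series I k = {0})"

text \<open>
  The element \<open>h \<delta>\<close>, for a simple root \<open>\<delta>\<close>, is the coroot of \<open>\<delta>\<close> in the Cartan subalgebra
  \<open>H = span (h ` \<Delta>)\<close>, and a root \<open>\<alpha>\<close> is identified with the linear form on \<open>H\<close> sending \<open>h \<delta>\<close> to
  \<open>cartan_number \<alpha> \<delta>\<close>. The relations below thus say that \<open>\<Phi>\<close> is the root system of the Lie algebra
  with respect to \<open>H\<close>, with root spaces spanned by the \<open>x \<alpha>\<close>, and that the basis is a Chevalley
  basis. In \<open>[x \<alpha>, x \<beta>] = \<plusminus>(r + 1) x (\<alpha> + \<beta>)\<close>, \<open>r\<close> is the largest integer for which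
  \<open>\<beta> - r\<alpha>\<close> is a root.
\<close>

definition chevalley_basis ::
    "'e::euclidean_space set \<Rightarrow> 'e set \<Rightarrow> ('e \<Rightarrow> 'l) \<Rightarrow> ('e \<Rightarrow> 'l) \<Rightarrow> bool" where
  "chevalley_basis \<Phi> \<Delta> h x \<longleftrightarrow>
     root_base \<Phi> \<Delta> \<and>
     inj_on h \<Delta> \<and> inj_on x \<Phi> \<and> h ` \<Delta> \<inter> x ` \<Phi> = {} \<and>
     independent (h ` \<Delta> \<union> x ` \<Phi>) \<and> span (h ` \<Delta> \<union> x ` \<Phi>) = UNIV \<and>
     (\<forall>\<delta>\<in>\<Delta>. \<forall>\<epsilon>\<in>\<Delta>. bracket (h \<delta>) (h \<epsilon>) = 0) \<and>
     (\<forall>\<delta>\<in>\<Delta>. \<forall>\<alpha>\<in>\<Phi>. bracket (h \<delta>) (x \<alpha>) = smul (of_real (cartan_number \<alpha> \<delta>)) (x \<alpha>)) \<and>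
     (\<forall>\<alpha>\<in>\<Phi>. \<exists>c :: 'e \<Rightarrow> int.
        coroot \<alpha> = (\<Sum>\<delta>\<in>\<Delta>. of_int (c \<delta>) *\<^sub>R coroot \<delta>) \<and>
        bracket (x \<alpha>) (x (- \<alpha>)) = (\<Sum>\<delta>\<in>\<Delta>. smul (of_int (c \<delta>)) (h \<delta>))) \<and>
     (\<forall>\<alpha>\<in>\<Phi>. \<forall>\<beta>\<in>\<Phi>. \<alpha> + \<beta> \<in> \<Phi> \<longrightarrow>
        (let r = Max {k :: nat. \<beta> - real k *\<^sub>R \<alpha> \<in> \<Phi>} in
          bracket (x \<alpha>) (x \<beta>) = smul (of_nat (r + 1)) (x (\<alpha> + \<beta>)) \<or>
          bracket (x \<alpha>) (x \<beta>) = smul (- of_nat (r + 1)) (x (\<alpha> + \<beta>)))) \<and>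
     (\<forall>\<alpha>\<in>\<Phi>. \<forall>\<beta>\<in>\<Phi>. \<alpha> + \<beta> \<notin> \<Phi> \<longrightarrow> \<alpha> + \<beta> \<noteq> 0 \<longrightarrow> bracket (x \<alpha>) (x \<beta>) = 0)"

end

locale complex_semisimple_lie_algebra = complex_lie_algebra smul bracket
  for smul :: "complex \<Rightarrow> 'l::ab_group_add \<Rightarrow> 'l" and bracket :: "'l \<Rightarrow> 'l \<Rightarrow> 'l" +
  assumes finite_dimensional: "\<exists>B. finite B \<and> span B = UNIV"
    and semisimple: "solvable_ideal I \<Longrightarrow> I = {0}"


section \<open>Representations\<close>

definition faithful_representation ::
    "(complex \<Rightarrow> 'l::ab_group_add \<Rightarrow> 'l) \<Rightarrow> ('l \<Rightarrow> 'l \<Rightarrow> 'l) \<Rightarrow> ('l \<Rightarrow> complex^'n^'n) \<Rightarrow> bool" where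
  "faithful_representation smul bracket \<rho> \<longleftrightarrow>
     (\<forall>x y. \<rho> (x + y) = \<rho> x + \<rho> y) \<and>
     (\<forall>c x. \<rho> (smul c x) = map_matrix ((*) c) (\<rho> x)) \<and>
     (\<forall>x y. \<rho> (bracket x y) = \<rho> x ** \<rho> y - \<rho> y ** \<rho> x) \<and>
     inj \<rho>"

text \<open>The library's \<open>A ^ k\<close> on matrices is the entrywise power.\<close>

definition matrix_pow :: "'a::semiring_1^'n^'n \<Rightarrow> nat \<Rightarrow> 'a^'n^'n" where
  "matrix_pow A k = (((**) A) ^^ k) (mat 1)"

text \<open>
  The basis of the representation space in which \<open>\<rho>\<close> is written spans an admissible lattice,
  i.e. one stable under all \<open>\<rho>(x\<^sub>\<alpha>)\<^sup>k/k!\<close>. This is what gives \<open>exp(t\<rho>(x\<^sub>\<alpha>))\<close> a meaning over an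
  arbitrary commutative ring.
\<close>

definition admissible_basis :: "'e set \<Rightarrow> ('e \<Rightarrow> 'l) \<Rightarrow> ('l \<Rightarrow> complex^'n^'n) \<Rightarrow> bool" where
  "admissible_basis \<Phi> x \<rho> \<longleftrightarrow>
     (\<forall>\<alpha>\<in>\<Phi>. \<forall>k i j. matrix_pow (\<rho> (x \<alpha>)) k $ i $ j / fact k \<in> \<int>)"

text \<open>\<open>A\<^sup>k/k!\<close> as an integer matrix; only used when its entries are integers.\<close>

definition divided_power :: "complex^'n^'n \<Rightarrow> nat \<Rightarrow> int^'n^'n" where
  "divided_power A k = map_matrix (\<lambda>z. \<lfloor>Re (z / fact k)\<rfloor>) (matrix_pow A k)"

text \<open>
  \<open>x\<^sub>\<alpha>(t) = 1 + t\<rho>(x\<^sub>\<alpha>) + t\<^sup>2\<rho>(x\<^sub>\<alpha>)\<^sup>2/2! + \<dots>\<close>. As \<open>\<rho>(x\<^sub>\<alpha>)\<close> is a nilpotent matrix, its powers with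
  exponent at least \<open>CARD('n)\<close> vanish.
\<close>

definition root_elt :: "('l \<Rightarrow> complex^'n^'n) \<Rightarrow> ('e \<Rightarrow> 'l) \<Rightarrow> 'e \<Rightarrow> 'r::comm_ring_1 \<Rightarrow> 'r^'n^'n" where
  "root_elt \<rho> x \<alpha> t =
     (\<chi> i j. \<Sum>k<CARD('n). t ^ k * of_int (divided_power (\<rho> (x \<alpha>)) k $ i $ j))"


section \<open>Chevalley groups\<close>

definition SL :: "('r::comm_ring_1^'n^'n) monoid" where
  "SL = \<lparr>carrier = {A. det A = 1}, mult = (**), one = mat 1\<rparr>"

definition elementary_group ::
    "('l \<Rightarrow> complex^'n^'n) \<Rightarrow> ('e \<Rightarrow> 'l) \<Rightarrow> 'e set \<Rightarrow> ('r::comm_ring_1^'n^'n) set" where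
  "elementary_group \<rho> x \<Phi> = generate SL {root_elt \<rho> x \<alpha> t | \<alpha> t. \<alpha> \<in> \<Phi>}"

type_synonym 'n matrix_poly = "('n \<times> 'n \<Rightarrow>\<^sub>0 nat) \<Rightarrow>\<^sub>0 int"

definition eval_matrix_poly :: "'n::finite matrix_poly \<Rightarrow> 'r::comm_ring_1^'n^'n \<Rightarrow> 'r" where
  "eval_matrix_poly p A =
     (\<Sum>m\<in>Poly_Mapping.keys p. of_int (Poly_Mapping.lookup p m) *
        (\<Prod>(i, j)\<in>UNIV. (A $ i $ j) ^ Poly_Mapping.lookup m (i, j)))"

text \<open>
  The Chevalley-Demazure group scheme is the schematic closure over the integers of the complex
  group, and the complex group is generated by its root unipotents: its ring of
  functions is \<open>\<int>[x\<^sub>i\<^sub>j]\<close> modulo the integral polynomials vanishing on the complex group. Hence its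
  \<open>R\<close>-points are the matrices over \<open>R\<close> annihilated by these polynomials (\<open>det - 1\<close> is one of them).
\<close>

definition chevalley_group ::
    "('l \<Rightarrow> complex^'n^'n) \<Rightarrow> ('e \<Rightarrow> 'l) \<Rightarrow> 'e set \<Rightarrow> ('r::comm_ring_1^'n^'n) set" where
  "chevalley_group \<rho> x \<Phi> =
     {A \<in> carrier SL. \<forall>p :: 'n matrix_poly.
        (\<forall>B \<in> (elementary_group \<rho> x \<Phi> :: (complex^'n^'n) set). eval_matrix_poly p B = 0) \<longrightarrow>
        eval_matrix_poly p A = 0}"

definition large_subgroup ::
    "('l \<Rightarrow> complex^'n^'n) \<Rightarrow> ('e \<Rightarrow> 'l) \<Rightarrow> 'e set \<Rightarrow> ('r::comm_ring_1^'n^'n) set \<Rightarrow> bool" where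
  "large_subgroup \<rho> x \<Phi> G \<longleftrightarrow>
     subgroup G (SL\<lparr>carrier := chevalley_group \<rho> x \<Phi>\<rparr>) \<and> elementary_group \<rho> x \<Phi> \<subseteq> G"

definition commutator :: "('a, 'b) monoid_scheme \<Rightarrow> 'a \<Rightarrow> 'a \<Rightarrow> 'a" where
  "commutator K a b = a \<otimes>\<^bsub>K\<^esub> b \<otimes>\<^bsub>K\<^esub> inv\<^bsub>K\<^esub> a \<otimes>\<^bsub>K\<^esub> inv\<^bsub>K\<^esub> b"

definition Gamma_set ::
    "('l \<Rightarrow> complex^'n^'n) \<Rightarrow> ('e \<Rightarrow> 'l) \<Rightarrow> 'e set \<Rightarrow> 'e \<Rightarrow> ('r::comm_ring_1^'n^'n) set" where
  "Gamma_set \<rho> x \<Phi> \<alpha> =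
     {root_elt \<rho> x \<beta> 1 | \<beta>. \<beta> \<in> \<Phi> \<and>
        commutator (SL :: ('r^'n^'n) monoid) (root_elt \<rho> x \<beta> 1) (root_elt \<rho> x \<alpha> 1) = mat 1}"

definition centralizer :: "('r::comm_ring_1^'n^'n) set \<Rightarrow> ('r^'n^'n) set \<Rightarrow> ('r^'n^'n) set" where
  "centralizer G M = {g \<in> G. \<forall>m\<in>M. g ** m = m ** g}"

definition center :: "('r::comm_ring_1^'n^'n) set \<Rightarrow> ('r^'n^'n) set" where
  "center G = centralizer G G"

end

theory Submission
 imports Defs "HOL-Complex_Analysis.Cauchy_Integral_Formula"
begin

text \<open>
  An identity between integral polynomials in the matrix entries that holds on the complex group
  holds on \<open>G(R)\<close>.
  The coefficient of \<open>x\<^sub>\<gamma>\<close> in a matrix of the Lie algebra is an integral linear functional, because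
  \<open>\<rho>(x\<^sub>\<gamma>)\<close> is a primitive integral matrix. If \<open>\<theta>\<close> is long, the complex conjugates of \<open>x\<^sub>\<theta>\<close> with
  \<open>\<theta>\<close>-coordinate \<open>1\<close> are the \<open>u x\<^sub>\<theta> u\<^sup>-\<^sup>1\<close>, where \<open>u\<close> is an explicit product of root elements of negative
  degree with respect to the grading by the coroot of \<open>\<theta>\<close>. Applied to \<open>-\<theta>\<close> and transferred to \<open>R\<close>, this writes
  every \<open>g\<close> that commutes with \<open>x\<^sub>\<theta>(1)\<close> as \<open>g = u c\<close>, where \<open>u\<close> is a product of root elements for
  \<open>\<theta>\<close> and the roots of degree \<open>1\<close>, and \<open>c\<close> preserves the grading. Comparing degrees in the relations
  \<open>g x\<^sub>\<beta>(1) = x\<^sub>\<beta>(1) g\<close> shows that \<open>c\<close> commutes with enough root matrices to be diagonal with respect to the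
  weights, and that the unwanted factors of \<open>u\<close> vanish. The big cell of the complex group shows
  that a diagonal \<open>c\<close> acts on the weights by a multiplicative character; it is central as soon
  as this character is trivial on the roots. For a short root \<open>\<alpha>\<close> outside type C the decomposition is used for a
  long root \<open>\<theta>\<close> with \<open>\<theta> \<bullet> \<alpha> > 0\<close>; there the long roots form an irreducible system. For \<open>\<alpha> = e\<^sub>1 + e\<^sub>2\<close>
  in type C it is used twice, for \<open>2e\<^sub>1\<close> and for \<open>2e\<^sub>2\<close>.
\<close>


section \<open>Square matrices as a ring\<close>

text \<open>R may be finite, have characteristic 2 or 3 or contain nilpotents, and an element of
  G(R) need not be a product of root elements. So nothing can be argued from values of polynomials
  over R, \<open>X \<beta> 1\<close> has no logarithm, and the relations are given at parameter 1
  alone. Divisions by 2, 3 or 4 are made over the complex numbers, and only identities with integral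
  coefficients are carried to R. This forces auxiliary objects to be integral: projectors onto
  weight spaces cannot be interpolation polynomials in the coroot matrices, which have denominators,
  and come from homogeneous parts of a Weyl element; coordinates are read off by integral linear
  forms with value 1 on a primitive matrix, so that \<open>a \<cdot> D1 \<gamma> = 0\<close> still
  gives \<open>a = 0\<close>. The structure constants to be cancelled are signs as soon as a long
  root takes part; in type G2 the constants 2 and 3 remain, and these are coprime. The big cell
  enters only through the vanishing of polynomials, so no cell decomposition of the group is
  involved.\<close>

typedef ('a, 'n::finite) smat = "UNIV :: ('a^'n^'n) set"
 morphisms of_smat smat by auto

setup_lifting type_definition_smat

text \<open>The class product on \<open>'a^'n^'n\<close> is entrywise. The copy \<open>smat\<close>
  of the type carries the matrix product, so that class-based ring rules, powers and
  \<open>prod_list\<close> apply to matrices.\<close>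

instantiation smat :: (comm_ring_1, finite) ring_1
begin
lift_definition zero_smat :: "('a, 'b) smat" is 0 .
lift_definition one_smat :: "('a, 'b) smat" is "mat 1" .
lift_definition plus_smat :: "('a, 'b) smat \<Rightarrow> ('a, 'b) smat \<Rightarrow> ('a, 'b) smat" is "(+)" .
lift_definition minus_smat :: "('a, 'b) smat \<Rightarrow> ('a, 'b) smat \<Rightarrow> ('a, 'b) smat" is "(-)" .
lift_definition uminus_smat :: "('a, 'b) smat \<Rightarrow> ('a, 'b) smat" is "uminus" .
lift_definition times_smat :: "('a, 'b) smat \<Rightarrow> ('a, 'b) smat \<Rightarrow> ('a, 'b) smat" is "(**)" .
instance
proof
 show "(0 :: ('a, 'b) smat) \<noteq> 1" by transfer (auto simp: mat_def vec_eq_iff)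
 fix a b c :: "('a, 'b) smat"
 show "(a + b) * c = a * c + b * c"
  by transfer (simp add: matrix_matrix_mult_def vec_eq_iff distrib_right sum.distrib)
qed (transfer; simp add: matrix_mul_assoc matrix_add_ldistrib)+
end

lift_definition ent :: "('a, 'n::finite) smat \<Rightarrow> 'n \<Rightarrow> 'n \<Rightarrow> 'a" is "\<lambda>X i j. X $ i $ j" .
lift_definition sc :: "'a::comm_ring_1 \<Rightarrow> ('a, 'n::finite) smat" is mat .
text \<open>Base change along the ring map from the integers. Matrices that must have the same
  meaning over the complex numbers and over R are integral matrices under \<open>oi\<close>.\<close>

lift_definition oi :: "(int, 'n::finite) smat \<Rightarrow> ('a::comm_ring_1, 'n) smat" is "map_matrix of_int" .
lift_definition sdet :: "('a::comm_ring_1, 'n::finite) smat \<Rightarrow> 'a" is det .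

lemma smat_eqI: "(\<And>i j. ent X i j = ent Y i j) ==> X = Y" by transfer (simp add: vec_eq_iff)

lemma ent_0 [simp]: "ent 0 i j = 0" by transfer simp
lemma ent_1: "ent 1 i j = (if i = j then 1 else 0)" by transfer (simp add: mat_def)
lemma ent_add [simp]: "ent (X + Y) i j = ent X i j + ent Y i j" by transfer simp
lemma ent_diff [simp]: "ent (X - Y) i j = ent X i j - ent Y i j" by transfer simp
lemma ent_minus [simp]: "ent (- X) i j = - ent X i j" by transfer simp
lemma ent_mult: "ent (X * Y) i j = (\<Sum>k\<in>UNIV. ent X i k * ent Y k j)"
 by transfer (simp add: matrix_matrix_mult_def)
lemma ent_sc: "ent (sc a) i j = (if i = j then a else 0)" by transfer (simp add: mat_def)
lemma ent_oi [simp]: "ent (oi X) i j = of_int (ent X i j)" by transfer (simp add: map_matrix_def)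
lemma ent_sum: "ent (\<Sum>x\<in>A. f x) i j = (\<Sum>x\<in>A. ent (f x) i j)"
 by (induction A rule: infinite_finite_induct) auto

lemma ent_sc_mult [simp]: "ent (sc a * X) i j = a * ent X i j"
proof -
 have "(\<Sum>k\<in>UNIV. (if i = k then a else 0) * ent X k j) =
    (\<Sum>k\<in>UNIV. if i = k then a * ent X k j else 0)" by (intro sum.cong) auto
 thus ?thesis by (simp add: ent_mult ent_sc)
qed

definition smul :: "'a::comm_ring_1 \<Rightarrow> ('a, 'n::finite) smat \<Rightarrow> ('a, 'n) smat" (infixr \<open>\<cdot>\<close> 75)
 where "a \<cdot> X = sc a * X"

lemma ent_smul [simp]: "ent (a \<cdot> X) i j = a * ent X i j" by (simp add: smul_def)
lemma smul_mult_left [simp]: "a \<cdot> X * Y = a \<cdot> (X * Y)" by (simp add: smul_def mult.assoc)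
lemma smul_mult_right [simp]: "X * a \<cdot> Y = a \<cdot> (X * Y)"
 by (rule smat_eqI) (simp add: ent_mult sum_distrib_left mult.left_commute)
lemma smul_smul [simp]: "a \<cdot> b \<cdot> X = (a * b) \<cdot> X" by (rule smat_eqI) (simp add: mult.assoc)
lemma smul_0_left [simp]: "0 \<cdot> X = 0" by (rule smat_eqI) simp
lemma smul_0_right [simp]: "a \<cdot> 0 = 0" by (rule smat_eqI) simp
lemma smul_1 [simp]: "1 \<cdot> X = X" by (rule smat_eqI) simp
lemma smul_minus_left [simp]: "(- a) \<cdot> X = - (a \<cdot> X)" by (rule smat_eqI) simp
lemma smul_minus_right [simp]: "a \<cdot> (- X) = - (a \<cdot> X)" by (rule smat_eqI) simp
lemma smul_add_right: "a \<cdot> (X + Y) = a \<cdot> X + a \<cdot> Y" by (rule smat_eqI) (simp add: distrib_left)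
lemma smul_diff_right: "a \<cdot> (X - Y) = a \<cdot> X - a \<cdot> Y" by (rule smat_eqI) (simp add: right_diff_distrib)
lemma smul_add_left: "(a + b) \<cdot> X = a \<cdot> X + b \<cdot> X" by (rule smat_eqI) (simp add: distrib_right)
lemma smul_diff_left: "(a - b) \<cdot> X = a \<cdot> X - b \<cdot> X" by (rule smat_eqI) (simp add: left_diff_distrib)
lemma smul_sum_right: "a \<cdot> (\<Sum>x\<in>A. f x) = (\<Sum>x\<in>A. a \<cdot> f x)"
 by (rule smat_eqI) (simp add: ent_sum sum_distrib_left)
lemma smul_sum_left: "(\<Sum>x\<in>A. f x) \<cdot> X = (\<Sum>x\<in>A. f x \<cdot> X)"
 by (rule smat_eqI) (simp add: ent_sum sum_distrib_right)
lemma smul_of_nat: "of_nat k \<cdot> X = of_nat k * X"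
 by (rule smat_eqI, induction k) (simp_all add: algebra_simps)
lemma smul_of_int: "of_int k \<cdot> X = of_int k * X"
proof (cases k)
 case (neg n)
 hence "of_int k \<cdot> X = - (of_nat (Suc n) \<cdot> X)"
  by (simp only: of_int_minus of_int_of_nat_eq smul_minus_left)
 thus ?thesis unfolding smul_of_nat neg by (simp add: algebra_simps)
qed (simp add: smul_of_nat)
lemma smul_numeral: "numeral k \<cdot> X = numeral k * X" using smul_of_int[of "numeral k"] by simp
lemma smul_cancel [simp]: "a \<noteq> 0 ==> a \<cdot> X = a \<cdot> Y \<longleftrightarrow> X = Y" for a :: "'a::field"
proof
 assume "a \<noteq> 0" "a \<cdot> X = a \<cdot> Y"
 hence "inverse a \<cdot> a \<cdot> X = inverse a \<cdot> a \<cdot> Y" by metis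
 thus "X = Y" using \<open>a \<noteq> 0\<close> by simp
qed simp
lemma smul_eq_0 [simp]: "a \<cdot> X = 0 \<longleftrightarrow> a = 0 \<or> X = 0" for a :: "'a::field"
 using smul_cancel[of a X 0] by auto
lemma sc_conv_smul: "sc a = a \<cdot> 1" by (simp add: smul_def)

lemmas smul_algebra = smul_add_left smul_add_right smul_diff_left smul_diff_right

lemma sc_1 [simp]: "sc 1 = 1" by (rule smat_eqI) (simp add: ent_sc ent_1)

lemma oi_0 [simp]: "oi 0 = 0" by (rule smat_eqI) simp
lemma oi_1 [simp]: "oi 1 = 1" by (rule smat_eqI) (simp add: ent_1)
lemma oi_add: "oi (X + Y) = oi X + oi Y" by (rule smat_eqI) simp
lemma oi_diff: "oi (X - Y) = oi X - oi Y" by (rule smat_eqI) simp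
lemma oi_minus: "oi (- X) = - oi X" by (rule smat_eqI) simp
lemma oi_mult: "oi (X * Y) = oi X * oi Y" by (rule smat_eqI) (simp add: ent_mult)
lemma oi_sum: "oi (\<Sum>x\<in>A. f x) = (\<Sum>x\<in>A. oi (f x))"
 by (induction A rule: infinite_finite_induct) (simp_all add: oi_add)
lemma oi_of_nat: "oi (of_nat k) = of_nat k" by (induction k) (simp_all add: oi_add)
lemma oi_inj: "(oi X :: ('a::{comm_ring_1,ring_char_0}, 'n::finite) smat) = oi Y ==> X = Y"
 by (rule smat_eqI) (metis ent_oi of_int_eq_iff)

text \<open>Only meaningful for matrices with integer entries.\<close>

definition int_smat :: "(complex, 'n::finite) smat \<Rightarrow> (int, 'n) smat" where
 "int_smat X = smat (\<chi> i j. \<lfloor>Re (ent X i j)\<rfloor>)"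

lemma oi_int_smat: "(\<And>i j. ent X i j \<in> \<int>) ==> oi (int_smat X) = X"
proof (rule smat_eqI)
 fix i j assume "\<And>i j. ent X i j \<in> \<int>"
 then obtain k where k: "ent X i j = of_int k" by (metis Ints_cases)
 have "ent (int_smat X) i j = \<lfloor>Re (ent X i j)\<rfloor>"
  by (simp add: int_smat_def ent.rep_eq smat_inverse)
 thus "ent (oi (int_smat X)) i j = ent X i j" by (simp add: k)
qed

subsection \<open>Inverses\<close>

text \<open>The adjugate: entry (k, i) is the determinant after row i is replaced by the k-th unit
  vector. Its entries are integral polynomials in those of the matrix, so inversion in SL transfers
  between rings.\<close>

lift_definition sadj :: "('a::comm_ring_1, 'n::finite) smat \<Rightarrow> ('a, 'n) smat" is
 "\<lambda>A. \<chi> k i. det (\<chi> r. if r = i then axis k 1 else A $ r)" .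

lemma mult_sadj: "A * sadj A = sc (sdet A)"
proof (rule smat_eqI)
 fix j i
 \<comment> \<open>By linearity this is the determinant with row i replaced by row j; for i \<noteq>
   j two rows agree.\<close>
 have *: "(\<Sum>k\<in>UNIV. B $ j $ k * det (\<chi> r. if r = i then axis k 1 else B $ r)) =
   (if i = j then det B else 0)" for B :: "'a^'b^'b"
 proof -
  have "(\<Sum>k\<in>UNIV. B $ j $ k * det (\<chi> r. if r = i then axis k 1 else B $ r)) =
    (\<Sum>k\<in>UNIV. det (\<chi> r. if r = i then B $ j $ k *s axis k 1 else B $ r))"
   by (simp add: det_row_mul)
  also have "\<dots> = det (\<chi> r. if r = i then (\<Sum>k\<in>UNIV. B $ j $ k *s axis k 1) else B $ r)"
   by (rule det_linear_row_sum[symmetric]) simp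
  also have "(\<Sum>k\<in>UNIV. B $ j $ k *s axis k 1) = B $ j"
   by (simp add: vec_eq_iff axis_def if_distrib[of "(*) _"] cong: if_cong)
  also have "det (\<chi> r. if r = i then B $ j else B $ r) = (if i = j then det B else 0)"
  proof (cases "i = j")
   case True
   hence "(\<chi> r. if r = i then B $ j else B $ r) = B" by (simp add: vec_eq_iff)
   thus ?thesis using True by simp
  next
   case False
   thus ?thesis by (auto intro!: det_identical_rows[of i j] simp: row_def)
  qed
  finally show ?thesis .
 qed
 show "ent (A * sadj A) j i = ent (sc (sdet A)) j i" using *[of "of_smat A"] unfolding ent_mult
  by (simp add: ent.rep_eq sadj.rep_eq sdet.rep_eq sc.rep_eq mat_def eq_commute[of j])
qed

lemma sdet_mult: "sdet (A * B) = sdet A * sdet B" by transfer (rule det_mul)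
lemma sdet_1 [simp]: "sdet 1 = 1" by transfer simp

text \<open>A one-sided inverse makes the determinant a unit, and then the scaled adjugate is an
  inverse. Over a commutative ring this replaces the dimension argument.\<close>

lemma smat_inverse_comm:
 assumes "X * Y = (1 :: ('a::comm_ring_1, 'n::finite) smat)"
 shows "Y * X = 1"
proof -
 have r: "\<exists>B. A * B = 1 \<and> sdet B * sdet A = 1" if "sdet A * e = 1"
  for A :: "('a, 'n) smat" and e
 proof (intro exI conjI)
  show *: "A * e \<cdot> sadj A = 1" using that by (simp add: mult_sadj sc_conv_smul mult.commute)
  show "sdet (e \<cdot> sadj A) * sdet A = 1"
   using arg_cong[OF *, of sdet] unfolding sdet_mult by (simp add: mult.commute)
 qed
 have "sdet X * sdet Y = 1" using arg_cong[OF assms, of sdet] by (simp add: sdet_mult)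
 then obtain B where B: "X * B = 1" "sdet B * sdet X = 1" using r by blast
 then obtain C where C: "B * C = 1" using r by blast
 have "C = X" by (metis B(1) C mult.assoc mult.left_neutral mult.right_neutral)
 hence "B * X = 1" using C by simp
 hence "Y = B" by (metis assms mult.assoc mult.left_neutral mult.right_neutral)
 thus ?thesis using \<open>B * X = 1\<close> by simp
qed

lemma sadj_inverse: "sdet A = 1 ==> A * sadj A = 1" "sdet A = 1 ==> sadj A * A = 1"
 using mult_sadj[of A] smat_inverse_comm[of A "sadj A"] by simp_all

lemma sdet_sadj: "sdet A = 1 ==> sdet (sadj A) = 1"
 using arg_cong[OF sadj_inverse(1), of A sdet] by (simp add: sdet_mult)

section \<open>Transfer of integral polynomial identities\<close>

definition ev :: "'n::finite matrix_poly \<Rightarrow> ('a::comm_ring_1, 'n) smat \<Rightarrow> 'a" where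
 "ev p A = eval_matrix_poly p (of_smat A)"

lemma eval_superset:
 assumes "finite K" "Poly_Mapping.keys p \<subseteq> K"
 shows "eval_matrix_poly p A = (\<Sum>m\<in>K. of_int (Poly_Mapping.lookup p m) *
    (\<Prod>(i, j)\<in>UNIV. (A $ i $ j) ^ Poly_Mapping.lookup m (i, j)))"
 unfolding eval_matrix_poly_def using assms
 by (intro sum.mono_neutral_left) (auto simp: in_keys_iff)

lemma ev_add [simp]: "ev (p + q) A = ev p A + ev q A"
proof -
 let ?K = "Poly_Mapping.keys p \<union> Poly_Mapping.keys q"
 have "Poly_Mapping.keys (p + q) \<subseteq> ?K" by (rule keys_add)
 thus ?thesis by (simp add: ev_def eval_superset[of ?K] lookup_add distrib_right sum.distrib)
qed

lemma ev_0 [simp]: "ev 0 A = 0" by (simp add: ev_def eval_matrix_poly_def)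

lemma ev_single: "ev (Poly_Mapping.single m c) A =
  of_int c * (\<Prod>(i, j)\<in>UNIV. (ent A i j) ^ Poly_Mapping.lookup m (i, j))"
 by (simp add: ev_def eval_superset[of "{m}"] ent.rep_eq)

lemma ev_sum: "ev (\<Sum>x\<in>S. f x) A = (\<Sum>x\<in>S. ev (f x) A)"
 by (induction S rule: infinite_finite_induct) auto

lemma poly_mapping_single_expand:
 "p = (\<Sum>m\<in>Poly_Mapping.keys p. Poly_Mapping.single m (Poly_Mapping.lookup p m))"
proof (rule poly_mapping_eqI)
 fix k
 have "(\<Sum>m\<in>Poly_Mapping.keys p. Poly_Mapping.lookup p m when m = k) = Poly_Mapping.lookup p k"
  by (cases "k \<in> Poly_Mapping.keys p") (auto simp: when_def in_keys_iff)
 thus "Poly_Mapping.lookup p k = Poly_Mapping.lookup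
   (\<Sum>m\<in>Poly_Mapping.keys p. Poly_Mapping.single m (Poly_Mapping.lookup p m)) k"
  by (simp add: lookup_sum lookup_single)
qed

lemma ev_mult [simp]: "ev (p * q) A = ev p A * ev q A"
proof -
 have s: "ev (Poly_Mapping.single m c * Poly_Mapping.single m' c') A =
   ev (Poly_Mapping.single m c) A * ev (Poly_Mapping.single m' c') A" for m m' c c'
  unfolding mult_single ev_single
  by (simp add: lookup_add power_add prod.distrib case_prod_unfold mult_ac)
 have "ev (p * q) A = ev ((\<Sum>m\<in>Poly_Mapping.keys p. Poly_Mapping.single m (Poly_Mapping.lookup p m))
   * (\<Sum>m\<in>Poly_Mapping.keys q. Poly_Mapping.single m (Poly_Mapping.lookup q m))) A"
  using poly_mapping_single_expand[of p] poly_mapping_single_expand[of q] by metis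
 also have "\<dots> = ev (\<Sum>m\<in>Poly_Mapping.keys p. Poly_Mapping.single m (Poly_Mapping.lookup p m)) A
   * ev (\<Sum>m\<in>Poly_Mapping.keys q. Poly_Mapping.single m (Poly_Mapping.lookup q m)) A"
  unfolding sum_product ev_sum by (simp add: s)
 also have "\<dots> = ev p A * ev q A"
  using poly_mapping_single_expand[of p] poly_mapping_single_expand[of q] by metis
 finally show ?thesis .
qed

lemma ev_const [simp]: "ev (Poly_Mapping.single 0 c) A = of_int c" by (simp add: ev_single)

lemma ev_1 [simp]: "ev 1 A = 1" using ev_const[of 1 A] by (simp add: single_one del: ev_const)

lemma ev_power [simp]: "ev (p ^ k) A = ev p A ^ k" by (induction k) simp_all

lemma ev_var: "ev (Poly_Mapping.single (Poly_Mapping.single (i, j) 1) 1) A = ent A i j"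
proof -
 have "(\<Prod>z\<in>UNIV. (case z of (i', j') \<Rightarrow> ent A i' j') ^ (1 when (i, j) = z)) =
   (\<Prod>z\<in>UNIV. if z = (i, j) then ent A i j else 1)"
  by (intro prod.cong) (auto simp: when_def)
 hence "(\<Prod>z\<in>UNIV. (case z of (i', j') \<Rightarrow> ent A i' j') ^ (1 when (i, j) = z)) = ent A i j"
  by simp
 thus ?thesis unfolding ev_single lookup_single
  by (simp only: case_prod_unfold prod.collapse of_int_1 mult_1_left)
qed

section \<open>Functions over the complex numbers and over R given by one integral
  expression\<close>

named_theorems pair_intro

text \<open>\<open>Q F F'\<close> is meant to say that \<open>F\<close> over the complex numbers and
  \<open>F'\<close> over R come from the same integral formula. Closure under ring operations makes
  this provable by introduction rules that follow the syntax. The instances are polynomials in the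
  entries (\<open>ipair\<close>), polynomials in the entries and a parameter (\<open>tpair\<close>),
  and fractions with a fixed denominator (\<open>regpair\<close>).\<close>

locale function_pairs =
 fixes Q :: "('x \<Rightarrow> complex) \<Rightarrow> ('y \<Rightarrow> 'r::comm_ring_1) \<Rightarrow> bool"
 assumes const [pair_intro]: "Q (\<lambda>_. of_int c) (\<lambda>_. of_int c)"
  and add [pair_intro]: "Q F F' ==> Q G G' ==> Q (\<lambda>a. F a + G a) (\<lambda>b. F' b + G' b)"
  and mult [pair_intro]: "Q F F' ==> Q G G' ==> Q (\<lambda>a. F a * G a) (\<lambda>b. F' b * G' b)"
begin

lemma zero [pair_intro]: "Q (\<lambda>_. 0) (\<lambda>_. 0)" using const[of 0] by simp
lemma one [pair_intro]: "Q (\<lambda>_. 1) (\<lambda>_. 1)" using const[of 1] by simp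
lemma minus [pair_intro]: "Q F F' ==> Q (\<lambda>a. - F a) (\<lambda>b. - F' b)"
 using mult[OF const[of "-1"], of F F'] by simp
lemma diff [pair_intro]: "Q F F' ==> Q G G' ==> Q (\<lambda>a. F a - G a) (\<lambda>b. F' b - G' b)"
 using add[OF _ minus, of F F' G G'] by simp
lemma sum [pair_intro]: "(\<And>x. x \<in> S ==> Q (F x) (F' x)) ==>
  Q (\<lambda>a. \<Sum>x\<in>S. F x a) (\<lambda>b. \<Sum>x\<in>S. F' x b)"
 by (induction S rule: infinite_finite_induct) (auto intro: pair_intro)
lemma prod [pair_intro]: "(\<And>x. x \<in> S ==> Q (F x) (F' x)) ==>
  Q (\<lambda>a. \<Prod>x\<in>S. F x a) (\<lambda>b. \<Prod>x\<in>S. F' x b)"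
 by (induction S rule: infinite_finite_induct) (auto intro: pair_intro)
lemma prod_list [pair_intro]: "(\<And>x. x \<in> set xs ==> Q (F x) (F' x)) ==>
  Q (\<lambda>a. prod_list (map (\<lambda>x. F x a) xs)) (\<lambda>b. prod_list (map (\<lambda>x. F' x b) xs))"
 by (induction xs) (auto intro: pair_intro)
lemma power [pair_intro]: "Q F F' ==> Q (\<lambda>a. F a ^ k) (\<lambda>b. F' b ^ k)"
 by (induction k) (auto intro: pair_intro)

definition mat_pair :: "('x \<Rightarrow> (complex, 'n::finite) smat) \<Rightarrow> ('y \<Rightarrow> ('r, 'n) smat) \<Rightarrow> bool" where
 "mat_pair F F' \<longleftrightarrow> (\<forall>i j. Q (\<lambda>a. ent (F a) i j) (\<lambda>b. ent (F' b) i j))"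

lemma ent [pair_intro]: "mat_pair F F' ==> Q (\<lambda>a. ent (F a) i j) (\<lambda>b. ent (F' b) i j)"
 by (simp add: mat_pair_def)
lemma mat_const [pair_intro]: "mat_pair (\<lambda>_. oi X) (\<lambda>_. oi X)"
 by (auto simp: mat_pair_def intro: pair_intro)
lemma mat_add [pair_intro]:
 "mat_pair F F' ==> mat_pair G G' ==> mat_pair (\<lambda>a. F a + G a) (\<lambda>b. F' b + G' b)"
 by (auto simp: mat_pair_def intro: pair_intro)
lemma mat_diff [pair_intro]:
 "mat_pair F F' ==> mat_pair G G' ==> mat_pair (\<lambda>a. F a - G a) (\<lambda>b. F' b - G' b)"
 by (auto simp: mat_pair_def intro: pair_intro)
lemma mat_mult [pair_intro]:
 "mat_pair F F' ==> mat_pair G G' ==> mat_pair (\<lambda>a. F a * G a) (\<lambda>b. F' b * G' b)"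
 unfolding mat_pair_def ent_mult by (intro allI sum mult) auto
lemma mat_smul [pair_intro]: "Q f f' ==> mat_pair F F' ==> mat_pair (\<lambda>a. f a \<cdot> F a) (\<lambda>b. f' b \<cdot> F' b)"
 by (auto simp: mat_pair_def intro: pair_intro)
lemma mat_0 [pair_intro]: "mat_pair (\<lambda>_. 0) (\<lambda>_. 0)" using mat_const[of 0] by simp
lemma mat_1 [pair_intro]: "mat_pair (\<lambda>_. 1) (\<lambda>_. 1)" using mat_const[of 1] by simp
lemma mat_sum [pair_intro]: "(\<And>x. x \<in> S ==> mat_pair (F x) (F' x)) ==>
  mat_pair (\<lambda>a. \<Sum>x\<in>S. F x a) (\<lambda>b. \<Sum>x\<in>S. F' x b)"
 by (induction S rule: infinite_finite_induct) (auto intro: pair_intro)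
lemma mat_prod_list [pair_intro]: "(\<And>x. x \<in> set xs ==> mat_pair (F x) (F' x)) ==>
  mat_pair (\<lambda>a. prod_list (map (\<lambda>x. F x a) xs)) (\<lambda>b. prod_list (map (\<lambda>x. F' x b) xs))"
 by (induction xs) (auto intro: pair_intro)

lemma det: "(\<And>i j. Q (\<lambda>a. M a $ i $ j) (\<lambda>b. M' b $ i $ j)) ==>
  Q (\<lambda>a. det (M a)) (\<lambda>b. det (M' b))" unfolding det_def by (intro pair_intro) auto

lemma sdet [pair_intro]: "mat_pair F F' ==> Q (\<lambda>a. sdet (F a)) (\<lambda>b. sdet (F' b))"
 unfolding sdet.rep_eq by (rule det) (auto simp: mat_pair_def ent.rep_eq)

lemma mat_sadj [pair_intro]:
 assumes "mat_pair F F'" shows "mat_pair (\<lambda>a. sadj (F a)) (\<lambda>b. sadj (F' b))"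
proof -
 have "Q (\<lambda>a. Determinants.det (\<chi> r. if r = i then axis k 1 else of_smat (F a) $ r))
   (\<lambda>b. Determinants.det (\<chi> r. if r = i then axis k 1 else of_smat (F' b) $ r))" for i k
 proof (rule det)
  fix r c
  show "Q (\<lambda>a. (\<chi> r. if r = i then axis k 1 else of_smat (F a) $ r) $ r $ c)
   (\<lambda>b. (\<chi> r. if r = i then axis k 1 else of_smat (F' b) $ r) $ r $ c)"
   using assms by (cases "r = i"; cases "k = c")
    (auto simp: axis_def mat_pair_def ent.rep_eq intro: pair_intro)
 qed
 thus ?thesis by (simp add: mat_pair_def ent.rep_eq sadj.rep_eq)
qed

end

definition ipair :: "((complex, 'n::finite) smat \<Rightarrow> complex) \<Rightarrow>
  (('r::comm_ring_1, 'n) smat \<Rightarrow> 'r) \<Rightarrow> bool" where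
 "ipair F F' \<longleftrightarrow> (\<exists>p. F = ev p \<and> F' = ev p)"

interpretation ipair: function_pairs "ipair :: ((complex, 'n::finite) smat \<Rightarrow> complex) \<Rightarrow>
  (('r::comm_ring_1, 'n) smat \<Rightarrow> 'r) \<Rightarrow> bool"
proof
 show "ipair (\<lambda>_. of_int c) (\<lambda>_. of_int c)" for c
  unfolding ipair_def by (intro exI[of _ "Poly_Mapping.single 0 c"]) auto
 fix F G :: "(complex, 'n) smat \<Rightarrow> complex" and F' G' :: "('r, 'n) smat \<Rightarrow> 'r"
 assume "ipair F F'" "ipair G G'"
 then obtain p q where pq: "F = ev p" "F' = ev p" "G = ev q" "G' = ev q" unfolding ipair_def by auto
 show "ipair (\<lambda>a. F a + G a) (\<lambda>b. F' b + G' b)"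
  unfolding ipair_def pq by (intro exI[of _ "p + q"]) auto
 show "ipair (\<lambda>a. F a * G a) (\<lambda>b. F' b * G' b)"
  unfolding ipair_def pq by (intro exI[of _ "p * q"]) auto
qed

lemma ipair_mat_id [pair_intro]: "ipair.mat_pair (\<lambda>A. A) (\<lambda>A. A)"
 unfolding ipair.mat_pair_def ipair_def
proof (intro allI)
 fix i j
 show "\<exists>p. (\<lambda>A. ent A i j) = ev p \<and> (\<lambda>A. ent A i j) = ev p"
  by (intro exI[of _ "Poly_Mapping.single (Poly_Mapping.single (i, j) 1) 1"])
   (simp add: ev_var fun_eq_iff del: One_nat_def)
qed

text \<open>The list holds the terms of a polynomial in \<open>t\<close> as pairs of exponent and
  coefficient. Repeated exponents are allowed, which keeps sums and products of such lists
  simple.\<close>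

definition tpair :: "((complex, 'n::finite) smat \<times> complex \<Rightarrow> complex) \<Rightarrow>
  (('r::comm_ring_1, 'n) smat \<times> 'r \<Rightarrow> 'r) \<Rightarrow> bool" where
 "tpair F F' \<longleftrightarrow> (\<exists>L. F = (\<lambda>(A, t). \<Sum>(k, q)\<leftarrow>L. t ^ k * ev q A) \<and>
            F' = (\<lambda>(A, t). \<Sum>(k, q)\<leftarrow>L. t ^ k * ev q A))"

lemma tpair_mult_aux:
 "(\<Sum>(k, q)\<leftarrow>L. t ^ k * ev q A) * (\<Sum>(k, q)\<leftarrow>M. t ^ k * ev q A) =
  (\<Sum>(k, q)\<leftarrow>concat (map (\<lambda>(k, q). map (\<lambda>(k', q'). (k + k', q * q')) M) L). t ^ k * ev q A)"
proof (induction L)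
 case (Cons a L)
 have "(t ^ fst a * ev (snd a) A) * (\<Sum>(k, q)\<leftarrow>M. t ^ k * ev q A) =
  (\<Sum>(k, q)\<leftarrow>map (\<lambda>(k', q'). (fst a + k', snd a * q')) M. t ^ k * ev q A)"
  by (induction M) (auto simp: algebra_simps power_add)
 with Cons show ?case by (simp add: distrib_right case_prod_unfold)
qed simp

interpretation tpair: function_pairs "tpair :: ((complex, 'n::finite) smat \<times> complex \<Rightarrow> complex) \<Rightarrow>
  (('r::comm_ring_1, 'n) smat \<times> 'r \<Rightarrow> 'r) \<Rightarrow> bool"
proof
 show "tpair (\<lambda>_. of_int c) (\<lambda>_. of_int c)" for c
  unfolding tpair_def by (intro exI[of _ "[(0, Poly_Mapping.single 0 c)]"]) auto
 fix F G :: "(complex, 'n) smat \<times> complex \<Rightarrow> complex" and F' G' :: "('r, 'n) smat \<times> 'r \<Rightarrow> 'r"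
 assume "tpair F F'" "tpair G G'"
 then obtain L M where
  LM: "F = (\<lambda>(A, t). \<Sum>(k, q)\<leftarrow>L. t ^ k * ev q A)" "F' = (\<lambda>(A, t). \<Sum>(k, q)\<leftarrow>L. t ^ k * ev q A)"
   "G = (\<lambda>(A, t). \<Sum>(k, q)\<leftarrow>M. t ^ k * ev q A)" "G' = (\<lambda>(A, t). \<Sum>(k, q)\<leftarrow>M. t ^ k * ev q A)"
  unfolding tpair_def by blast
 show "tpair (\<lambda>a. F a + G a) (\<lambda>b. F' b + G' b)"
  unfolding tpair_def LM by (intro exI[of _ "L @ M"]) auto
 show "tpair (\<lambda>a. F a * G a) (\<lambda>b. F' b * G' b)" unfolding tpair_def LM
  by (intro exI[of _ "concat (map (\<lambda>(k, q). map (\<lambda>(k', q'). (k + k', q * q')) M) L)"])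
   (auto simp: tpair_mult_aux)
qed

lemma tpair_ipair: "ipair F F' ==> tpair (\<lambda>z. F (fst z)) (\<lambda>z. F' (fst z))"
 unfolding ipair_def tpair_def
proof (elim exE conjE)
 fix p assume "F = ev p" "F' = ev p"
 thus "\<exists>L. (\<lambda>z. F (fst z)) = (\<lambda>(A, t). \<Sum>(k, q)\<leftarrow>L. t ^ k * ev q A) \<and>
   (\<lambda>z. F' (fst z)) = (\<lambda>(A, t). \<Sum>(k, q)\<leftarrow>L. t ^ k * ev q A)"
  by (intro exI[of _ "[(0, p)]"]) auto
qed

lemma tpair_var [pair_intro]: "tpair snd snd"
 unfolding tpair_def by (intro exI[of _ "[(1, 1)]"]) auto

lemma tpair_mat_fst [pair_intro]: "tpair.mat_pair fst fst"
 using tpair_ipair[OF ipair.ent[OF ipair_mat_id]] by (auto simp: tpair.mat_pair_def)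

lemma tpair_ev:
 assumes "tpair.mat_pair F F'"
 shows "tpair (\<lambda>z. ev p (F z)) (\<lambda>z. ev p (F' z))"
proof -
 have "tpair (\<lambda>z. \<Prod>(i, j)\<in>UNIV. ent (F z) i j ^ Poly_Mapping.lookup m (i, j))
   (\<lambda>z. \<Prod>(i, j)\<in>UNIV. ent (F' z) i j ^ Poly_Mapping.lookup m (i, j))" for m
  unfolding case_prod_unfold by (intro tpair.prod tpair.power tpair.ent assms)
 thus ?thesis unfolding ev_def eval_matrix_poly_def
  by (intro tpair.sum tpair.mult tpair.const) (simp add: ent.rep_eq)
qed

lemma sum_list_powers_zero:
 fixes L :: "(nat \<times> 'b) list" and e :: "'b \<Rightarrow> complex"
 assumes "\<And>t. (\<Sum>(k, q)\<leftarrow>L. t ^ k * e q) = 0"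
 shows "(\<Sum>(k', q)\<leftarrow>L. if k' = k then e q else 0) = 0"
proof -
 obtain N where N: "\<forall>(k, q)\<in>set L. k \<le> N"
  using finite_nat_set_iff_bounded_le[of "fst ` set L"] by fastforce
 define c where "c k = (\<Sum>(k', q)\<leftarrow>L. if k' = k then e q else 0)" for k
 have "(\<Sum>i\<le>N. c i * t ^ i) = (\<Sum>(k, q)\<leftarrow>L. t ^ k * e q)" for t
  unfolding c_def using N
 proof (induction L)
  case (Cons a L)
  have "(\<Sum>i\<le>N. (if fst a = i then e (snd a) else 0) * t ^ i) = t ^ fst a * e (snd a)"
  proof -
   have "(\<Sum>i\<le>N. (if fst a = i then e (snd a) else 0) * t ^ i) =
     (\<Sum>i\<le>N. if fst a = i then t ^ fst a * e (snd a) else 0)" by (intro sum.cong) auto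
   thus ?thesis using Cons.prems by auto
  qed
  with Cons show ?case by (simp add: case_prod_unfold distrib_right sum.distrib)
 qed simp
 hence "\<forall>t. (\<Sum>i\<le>N. c i * t ^ i) = 0" using assms by simp
 hence "\<forall>i\<le>N. c i = 0" using polyfun_eq_0 by blast
 moreover have "c k = 0" if "k > N"
 proof -
  have "map (\<lambda>(k', q). if k' = k then e q else 0) L = map (\<lambda>_. 0) L"
   using N that by auto
  thus ?thesis unfolding c_def by (simp only: sum_list_0)
 qed
 ultimately show ?thesis unfolding c_def by (metis not_le)
qed

lemma sum_list_group:
 fixes L :: "(nat \<times> 'b) list" and e :: "'b \<Rightarrow> 'a::comm_ring_1"
 assumes "\<forall>(k, q)\<in>set L. k \<le> N"
 shows "(\<Sum>(k, q)\<leftarrow>L. t ^ k * e q) =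
     (\<Sum>i\<le>N. t ^ i * (\<Sum>(k, q)\<leftarrow>L. if k = i then e q else 0))" using assms
proof (induction L)
 case (Cons a L)
 have "(\<Sum>i\<le>N. t ^ i * (if fst a = i then e (snd a) else 0)) = t ^ fst a * e (snd a)"
  using Cons.prems by (auto simp: if_distrib[of "\<lambda>x. _ * x"] cong: if_cong)
 with Cons show ?case by (simp add: case_prod_unfold distrib_left sum.distrib)
qed simp


lemma ev_oi: "ev p (oi B) = of_int (ev p B)"
 by (simp add: ev_def eval_matrix_poly_def case_prod_unfold oi.rep_eq map_matrix_def)

text \<open>Over R the parameter cannot be varied to isolate coefficients. Over the complex numbers
  vanishing for all \<open>t\<close> makes each coefficient vanish on \<open>S\<close>; the
  coefficients are polynomials in the entries and transfer one by one.\<close>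

lemma tpair_vanish:
 fixes A' :: "('r::comm_ring_1, 'n::finite) smat"
 assumes tp: "tpair F F'"
  and S: "\<And>p. (\<And>A. A \<in> S ==> ev p A = 0) ==> ev p A' = 0"
  and 0: "\<And>A t. A \<in> S ==> F (A, t) = 0"
 shows "F' (A', t) = 0"
proof -
 obtain L where L: "F = (\<lambda>(A, t). \<Sum>(k, q)\<leftarrow>L. t ^ k * ev q A)"
  "F' = (\<lambda>(A, t). \<Sum>(k, q)\<leftarrow>L. t ^ k * ev q A)"
  using tp unfolding tpair_def by blast
 obtain N where N: "\<forall>(k, q)\<in>set L. k \<le> N"
  using finite_nat_set_iff_bounded_le[of "fst ` set L"] by fastforce
 define Q where "Q i = (\<Sum>(k, q)\<leftarrow>L. if k = i then q else 0)" for i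
 have ev: "ev (Q i) A = (\<Sum>(k, q)\<leftarrow>L. if k = i then ev q A else 0)" for i
  and A :: "('b::comm_ring_1, 'n) smat" unfolding Q_def by (induction L) auto
 have "ev (Q i) A = 0" if "A \<in> S" for i A
  unfolding ev using sum_list_powers_zero[where L = L and e = "\<lambda>q. ev q A" and k = i] 0[OF that] L(1) by auto
 hence "ev (Q i) A' = 0" for i using S by blast
 thus ?thesis unfolding L(2) using sum_list_group[OF N, where t = t and e = "\<lambda>q. ev q A'"]
  by (simp add: ev)
qed

section \<open>Divided powers and one-parameter subgroups\<close>

text \<open>The formal properties of \<open>X^k / k!\<close> for a nilpotent \<open>X\<close>,
  stated for integral matrices so that they survive the passage to a ring in which k! is
  zero.\<close>

definition dps :: "(nat \<Rightarrow> (int, 'n::finite) smat) \<Rightarrow> bool" where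
 "dps D \<longleftrightarrow> D 0 = 1 \<and> (\<forall>i j. D i * D j = of_nat (i + j choose i) * D (i + j)) \<and>
   (\<forall>k\<ge>CARD('n). D k = 0)"

definition rx :: "(nat \<Rightarrow> (int, 'n::finite) smat) \<Rightarrow> 'r::comm_ring_1 \<Rightarrow> ('r, 'n) smat" where
 "rx D t = (\<Sum>k<CARD('n). t ^ k \<cdot> oi (D k))"

text \<open>The diagonals i + j = k with k < 2n cover the square i, j < n, and \<open>f\<close> is
  zero outside the square.\<close>

lemma cauchy_fin:
 fixes f :: "nat \<Rightarrow> nat \<Rightarrow> 'a::comm_monoid_add"
 assumes "\<And>i j. i \<ge> n \<or> j \<ge> n ==> f i j = 0"
 shows "(\<Sum>i<n. \<Sum>j<n. f i j) = (\<Sum>k<2*n. \<Sum>i\<le>k. f i (k - i))"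
proof -
 have nz: "a < n" "b < n" if "f a b \<noteq> 0" for a b using that assms[of a b] by (meson not_le)+
 have "(\<Sum>k<2*n. \<Sum>i\<le>k. f i (k - i)) = (\<Sum>(i, j)\<in>{(i, j). i + j < 2*n}. f i j)"
  by (rule sum.triangle_reindex[symmetric])
 also have "\<dots> = (\<Sum>(i, j)\<in>{..<n} \<times> {..<n}. f i j)"
 proof (rule sum.mono_neutral_right)
  show "finite {(i, j). i + j < 2*n}" by (rule finite_subset[of _ "{..2*n} \<times> {..2*n}"]) auto
  show "\<forall>z\<in>{(i, j). i + j < 2*n} - {..<n} \<times> {..<n}. (case z of (i, j) \<Rightarrow> f i j) = 0"
   by (auto dest: nz)
 qed auto
 finally show ?thesis by (simp add: sum.cartesian_product)
qed

lemma rx_0: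
 fixes D :: "nat \<Rightarrow> (int, 'n::finite) smat"
 assumes "dps D" shows "rx D 0 = 1"
proof -
 have "(\<Sum>k<CARD('n). 0 ^ k \<cdot> oi (D k)) = (\<Sum>k<CARD('n). if k = 0 then oi (D 0) else 0)"
  by (intro sum.cong) (auto simp: power_0_left)
 thus ?thesis using \<open>dps D\<close> by (simp add: rx_def dps_def)
qed

lemma rx_add:
 fixes D :: "nat \<Rightarrow> (int, 'n::finite) smat" and s t :: "'r::comm_ring_1"
 assumes "dps D" shows "rx D (s + t) = rx D s * rx D t"
proof -
 let ?n = "CARD('n)"
 let ?f = "\<lambda>i j. s ^ i \<cdot> oi (D i) * t ^ j \<cdot> oi (D j)"
 have D: "\<And>i j. D i * D j = of_nat (i + j choose i) * D (i + j)" "\<And>k. k \<ge> ?n ==> D k = 0"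
  using assms by (auto simp: dps_def)
 have f: "?f i j = (of_nat (i + j choose i) * s ^ i * t ^ j) \<cdot> oi (D (i + j))" for i j
 proof -
  have "?f i j = (s ^ i * t ^ j) \<cdot> oi (D i * D j)" by (simp add: oi_mult mult.commute)
  also have "oi (D i * D j) = (of_nat (i + j choose i) \<cdot> oi (D (i + j)) :: ('r, 'n) smat)"
   by (simp only: D(1) oi_mult oi_of_nat smul_of_nat)
  finally show ?thesis by (simp only: smul_smul mult_ac)
 qed
 have "rx D s * rx D t = (\<Sum>i<?n. \<Sum>j<?n. ?f i j)" by (simp add: rx_def sum_product)
 also have "\<dots> = (\<Sum>k<2 * ?n. \<Sum>i\<le>k. ?f i (k - i))"
  by (rule cauchy_fin) (auto simp: D)
 also have "\<dots> = (\<Sum>k<2 * ?n. (s + t) ^ k \<cdot> oi (D k))"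
 proof (intro sum.cong refl)
  fix k
  have "(\<Sum>i\<le>k. ?f i (k - i)) = (\<Sum>i\<le>k. (of_nat (k choose i) * s ^ i * t ^ (k - i)) \<cdot> oi (D k))"
   by (intro sum.cong refl) (simp only: f, simp)
  thus "(\<Sum>i\<le>k. ?f i (k - i)) = (s + t) ^ k \<cdot> oi (D k)"
   by (simp add: binomial_ring smul_sum_left)
 qed
 also have "\<dots> = rx D (s + t)" unfolding rx_def by (rule sum.mono_neutral_right) (auto simp: D)
 finally show ?thesis by simp
qed

lemma rx_inverse: "dps D ==> rx D t * rx D (- t) = 1" "dps D ==> rx D (- t) * rx D t = 1"
 using rx_add[of D t "- t"] rx_add[of D "- t" t] by (simp_all add: rx_0)

lemma tpair_rx [pair_intro]: "tpair f f' ==> tpair.mat_pair (\<lambda>z. rx D (f z)) (\<lambda>z. rx D (f' z))"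
 unfolding rx_def by (intro tpair.mat_sum tpair.mat_smul tpair.power tpair.mat_const)

text \<open>Over the complex numbers the determinant is a polynomial \<open>P\<close> in
  \<open>t\<close> with \<open>P(t) P(-t) = 1\<close>, hence a constant, and
  \<open>P(0) = 1\<close>. The identity is then transferred coefficient by coefficient.\<close>

lemma sdet_rx:
 fixes D :: "nat \<Rightarrow> (int, 'n::finite) smat" and t :: "'r::comm_ring_1"
 assumes "dps D" shows "sdet (rx D t) = 1"
proof -
 have tp: "tpair (\<lambda>z. sdet (rx D (snd z)) - 1 :: complex) (\<lambda>z. sdet (rx D (snd z)) - 1 :: 'b::comm_ring_1)"
  by (intro tpair.diff tpair.one tpair.sdet tpair_rx tpair_var)
 obtain L :: "(nat \<times> 'n matrix_poly) list"
  where L: "(\<lambda>z. sdet (rx D (snd z)) - 1) = (\<lambda>(A, t). \<Sum>(k, q)\<leftarrow>L. t ^ k * (ev q A :: complex))"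
  using tp unfolding tpair_def by metis
 obtain N where N: "\<forall>(k, q)\<in>set L. k \<le> N"
  using finite_nat_set_iff_bounded_le[of "fst ` set L"] by fastforce
 \<comment> \<open>\<open>L\<close> represents the determinant minus 1, which accounts for the
   leading 1; the matrix variable is set to 0.\<close>
 define P where "P = 1 + (\<Sum>i\<le>N. monom (\<Sum>(k, q)\<leftarrow>L. if k = i then ev q 0 else 0) i :: complex poly)"
 have P: "sdet (rx D z) = poly P z" for z
  using sum_list_group[OF N, where t = z and e = "\<lambda>q. ev q 0"] fun_cong[OF L, of "(0, z)"]
  by (simp add: P_def poly_sum poly_monom mult.commute algebra_simps)
 have "poly (P * pcompose P [:0, -1:]) z = poly 1 z" for z
  using arg_cong[OF rx_inverse(1)[OF assms, of z], of sdet] by (simp add: sdet_mult P poly_pcompose)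
 hence "P * pcompose P [:0, -1:] = 1" by (metis poly_eq_poly_eq_iff ext)
 hence "P dvd 1" by (metis dvd_triv_left)
 then obtain c where "P = [:c:]" by (auto simp: is_unit_poly_iff)
 hence "poly P z = poly P 0" for z by simp
 hence *: "sdet (rx D z) = 1" for z :: complex using P[of z] P[of 0] by (simp add: rx_0 assms)
 \<comment> \<open>The zero matrix is integral, so a polynomial that vanishes at it over the complex
   numbers vanishes at it over R.\<close>
 have "sdet (rx D (snd (oi 0 :: ('r, 'n) smat, t))) - 1 = 0"
 proof (rule tpair_vanish[OF tp, of "{oi 0}"])
  fix p :: "'n matrix_poly"
  assume "\<And>A :: (complex, 'n) smat. A \<in> {oi 0} ==> ev p A = 0"
  hence "ev p (oi 0 :: (complex, 'n) smat) = 0" by blast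
  thus "ev p (oi 0 :: ('r, 'n) smat) = 0" unfolding ev_oi by (simp only: of_int_eq_0_iff of_int_0)
 qed (auto simp: *)
 thus ?thesis by simp
qed

definition dp :: "(complex, 'n::finite) smat \<Rightarrow> nat \<Rightarrow> (complex, 'n) smat" where
 "dp X k = (1 / fact k) \<cdot> X ^ k"

lemma dp_0 [simp]: "dp X 0 = 1" by (simp add: dp_def)
lemma dp_1 [simp]: "dp X (Suc 0) = X" by (simp add: dp_def)
lemma dp_Suc: "of_nat (Suc k) * dp X (Suc k) = X * dp X k"
proof -
 have "of_nat (Suc k) * (1 / fact (Suc k)) = (1 / fact k :: complex)"
  by (simp add: field_simps del: of_nat_Suc)
 thus ?thesis unfolding smul_of_nat[symmetric] dp_def smul_smul power_Suc by simp
qed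

lemma dp_commute: "dp X k * X = X * dp X k" by (simp add: dp_def power_commutes)

lemma dp_Suc': "of_nat (Suc k) * dp X (Suc k) = dp X k * X" by (simp only: dp_Suc dp_commute)

lemma dp_mult: "dp X i * dp X j = of_nat (i + j choose i) * dp X (i + j)"
proof -
 have "(1 / fact i) * (1 / fact j) = (of_nat (i + j choose i) * (1 / fact (i + j)) :: complex)"
  by (simp add: binomial_fact)
 thus ?thesis
  unfolding smul_of_nat[symmetric] dp_def smul_smul smul_mult_left smul_mult_right power_add
  by (simp add: mult.commute)
qed

text \<open>The coefficients of \<open>exp (t X) Z exp (-t X)\<close>.\<close>

definition Ac :: "(complex, 'n::finite) smat \<Rightarrow> (complex, 'n) smat \<Rightarrow> nat \<Rightarrow> (complex, 'n) smat" where
 "Ac X Z k = (\<Sum>i\<le>k. dp X i * Z * dp (- X) (k - i))"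

lemma Ac_0 [simp]: "Ac X Z 0 = Z" by (simp add: Ac_def)

text \<open>Hence \<open>Ac X Z k\<close> is \<open>ad(X)^k Z / k!\<close>. The factor k + 1 is
  split as i + (k + 1 - i), one part for each of the two exponentials.\<close>

lemma Ac_Suc: "of_nat (Suc k) * Ac X Z (Suc k) = X * Ac X Z k - Ac X Z k * X"
proof -
 have "of_nat (Suc k) * Ac X Z (Suc k) =
   (\<Sum>i\<le>Suc k. of_nat i * (dp X i * Z * dp (- X) (Suc k - i)) +
        of_nat (Suc k - i) * (dp X i * Z * dp (- X) (Suc k - i)))" unfolding Ac_def sum_distrib_left
  by (intro sum.cong refl) (simp only: distrib_right[symmetric] of_nat_add[symmetric], simp)
 also have "\<dots> = (\<Sum>i\<le>Suc k. of_nat i * dp X i * Z * dp (- X) (Suc k - i)) +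
   (\<Sum>i\<le>Suc k. dp X i * Z * (of_nat (Suc k - i) * dp (- X) (Suc k - i)))"
  unfolding sum.distrib by (intro arg_cong2[of _ _ _ _ "(+)"] sum.cong refl)
    (simp_all only: smul_of_nat[symmetric] smul_mult_left smul_mult_right)
 also have "(\<Sum>i\<le>Suc k. of_nat i * dp X i * Z * dp (- X) (Suc k - i)) = X * Ac X Z k"
  unfolding sum.atMost_Suc_shift Ac_def sum_distrib_left
  by (simp add: dp_Suc mult.assoc del: of_nat_Suc)
 also have "(\<Sum>i\<le>Suc k. dp X i * Z * (of_nat (Suc k - i) * dp (- X) (Suc k - i))) = - (Ac X Z k * X)"
 proof -
  have "(\<Sum>i\<le>Suc k. dp X i * Z * (of_nat (Suc k - i) * dp (- X) (Suc k - i))) =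
    (\<Sum>i\<le>k. dp X i * Z * (dp (- X) (k - i) * (- X)))"
  proof -
   have "of_nat (Suc k - i) * dp (- X) (Suc k - i) = dp (- X) (k - i) * (- X)" if "i \<le> k" for i
    using dp_Suc'[of "k - i" "- X"] that by (simp only: Suc_diff_le)
   thus ?thesis by simp
  qed
  thus ?thesis by (simp add: Ac_def sum_distrib_right sum_negf mult.assoc)
 qed
 finally show ?thesis by simp
qed

lemma of_nat_Suc_cancel: "of_nat (Suc k) * X = of_nat (Suc k) * Y \<longleftrightarrow> X = (Y :: (complex, 'n::finite) smat)"
 using smul_cancel[of "of_nat (Suc k)" X Y] of_nat_neq_0[of k, where 'a = complex]
 unfolding smul_of_nat by blast

lemma Ac_zero: "Ac X Z m = 0 ==> k \<ge> m ==> Ac X Z k = 0"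
proof (induction k)
 case (Suc k)
 thus ?case using Ac_Suc[of k X Z] of_nat_Suc_cancel[of k "Ac X Z (Suc k)" 0]
  by (cases "m = Suc k") auto
qed simp

section \<open>Nilpotency from integral divided powers\<close>

definition divisible :: "(complex, 'n::finite) smat \<Rightarrow> bool" where
 "divisible X \<longleftrightarrow> (\<forall>k i j. ent (dp X k) i j \<in> \<int>)"

text \<open>If \<open>X^n v\<close> were nonzero, then v, X v, ..., \<open>X^n v\<close> would be n
  + 1 independent vectors in dimension n.\<close>

lemma nilpotent_dim:
 fixes X :: "(complex, 'n::finite) smat"
 assumes "X ^ N = 0" shows "X ^ CARD('n) = 0"
proof (rule ccontr)
 let ?n = "CARD('n)"
 assume nz: "X ^ ?n \<noteq> 0"
 define A where "A k = of_smat (X ^ k)" for k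
 have A0: "A 0 = mat 1" by (simp add: A_def one_smat.rep_eq)
 have Aadd: "A (i + j) = A i ** A j" for i j by (simp add: A_def power_add times_smat.rep_eq)
 have AN: "A k = 0" if "k \<ge> N" for k
 proof -
  have "X ^ k = X ^ N * X ^ (k - N)" using that by (simp add: power_add[symmetric])
  thus ?thesis by (simp add: A_def assms zero_smat.rep_eq)
 qed
 have "A ?n \<noteq> 0" unfolding A_def using nz by (metis of_smat_inverse zero_smat_def)
 then obtain v where v: "A ?n *v v \<noteq> 0" using matrix_eq[of "A ?n" 0] by auto
 define V where "V i = A i *v v" for i
 have V: "A i *v V j = V (i + j)" for i j by (simp add: V_def Aadd matrix_vector_mul_assoc)
 have V0: "V k = 0" if "k \<ge> N" for k by (simp add: V_def AN[OF that])
 have indep: "c i = 0" if "(\<Sum>i\<le>?n. c i *s V i) = 0" "i \<le> ?n" for c i using that(2)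
 proof (induction i rule: less_induct)
  case (less i)
  show ?case
  proof (rule ccontr)
   assume ci: "c i \<noteq> 0"
   have "\<exists>k. V k = 0" using V0 by blast
   \<comment> \<open>Applying \<open>A (m - 1 - i)\<close> to the relation kills the terms beyond
     \<open>i\<close>, and those before \<open>i\<close> have zero coefficients already; what is
     left is \<open>c i\<close> times the last nonzero vector \<open>V (m - 1)\<close>.\<close>
   define m where "m = (LEAST k. V k = 0)"
   have m: "V m = 0" "\<And>k. k < m ==> V k \<noteq> 0"
    using LeastI_ex[OF \<open>\<exists>k. V k = 0\<close>] not_less_Least unfolding m_def by auto
   have mz: "V k = 0" if "k \<ge> m" for k using V[of "k - m" m] that m(1) by simp
   have mn: "m > ?n" using mz[of ?n] v by (force simp: V_def)
   have "A (m - 1 - i) *v (\<Sum>j\<le>?n. c j *s V j) = 0" by (simp add: that(1))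
   hence "(\<Sum>j\<le>?n. c j *s V (m - 1 - i + j)) = 0"
    by (simp add: vec.linear_sum[OF matrix_vector_mul_linear_gen] matrix_vector_mult_scaleR
      vector_scalar_commute V)
   also have "(\<Sum>j\<le>?n. c j *s V (m - 1 - i + j)) = (\<Sum>j\<le>?n. if j = i then c i *s V (m - 1) else 0)"
   proof (intro sum.cong refl)
    fix j assume "j \<in> {..?n}"
    consider "j < i" | "j = i" | "j > i" by linarith
    thus "c j *s V (m - 1 - i + j) = (if j = i then c i *s V (m - 1) else 0)"
    proof cases
     case 1 thus ?thesis using less by simp
    next
     case 2 thus ?thesis using mn less.prems by simp
    next
     case 3 thus ?thesis using mz[of "m - 1 - i + j"] mn less.prems by simp
    qed
   qed
   finally have "c i *s V (m - 1) = 0" using less.prems by simp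
   thus False using ci m(2)[of "m - 1"] mn by (simp add: vector_mul_eq_0)
  qed
 qed
 have inj: "inj_on V {..?n}"
 proof (rule inj_onI, rule ccontr)
  fix a b assume ab: "a \<in> {..?n}" "b \<in> {..?n}" "V a = V b" "a \<noteq> b"
  define c :: "nat \<Rightarrow> complex" where "c i = (if i = a then 1 else if i = b then -1 else 0)" for i
  have "(\<Sum>i\<le>?n. c i *s V i) = (\<Sum>i\<in>{a, b}. c i *s V i)"
   by (rule sum.mono_neutral_right) (use ab in \<open>auto simp: c_def\<close>)
  also have "\<dots> = 0" using ab by (simp add: c_def)
  finally show False using indep[of c a] ab by (simp add: c_def)
 qed
 have "vec.independent (V ` {..?n})"
 proof (subst vec.independent_explicit_finite_subsets, intro allI impI ballI)
  fix S u w assume S: "S \<subseteq> V ` {..?n}" "finite S" "(\<Sum>v\<in>S. u v *s v) = 0" "w \<in> S"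
  then obtain T where T: "T \<subseteq> {..?n}" "S = V ` T" by (meson subset_imageE)
  then obtain i where i: "i \<in> T" "w = V i" using S(4) by blast
  have "(\<Sum>i\<le>?n. (if i \<in> T then u (V i) else 0) *s V i) = (\<Sum>i\<in>T. u (V i) *s V i)"
   using T(1) by (intro sum.mono_neutral_cong_right) auto
  also have "\<dots> = 0" using S(3) inj_on_subset[OF inj T(1)] by (simp add: T(2) sum.reindex)
  finally show "u w = 0" using indep[of "\<lambda>i. if i \<in> T then u (V i) else 0" i] i T(1) by auto
 qed
 hence "card (V ` {..?n}) \<le> vec.dim (UNIV :: (complex^'n) set)"
  by (intro vec.independent_card_le_dim) auto
 thus False using inj unfolding vec_dim_card by (simp add: card_image)
qed

text \<open>The entries of \<open>X^k / k!\<close> are integers bounded by \<open>C^k / k!\<close>,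
  which tends to 0, so they vanish for some k. This derives nilpotency of the root matrices from
  admissibility of the basis.\<close>

lemma divisible_nilpotent:
 fixes X :: "(complex, 'n::finite) smat"
 assumes "divisible X" shows "X ^ CARD('n) = 0"
proof -
 define M where "M = (\<Sum>i\<in>UNIV. \<Sum>j\<in>UNIV. norm (ent X i j))"
 let ?C = "real CARD('n) * M"
 have M: "norm (ent X i j) \<le> M" for i j
 proof -
  have "norm (ent X i j) \<le> (\<Sum>j\<in>UNIV. norm (ent X i j))" by (rule member_le_sum) auto
  also have "\<dots> \<le> M" unfolding M_def by (rule member_le_sum) (auto intro: sum_nonneg)
  finally show ?thesis .
 qed
 have M0: "M \<ge> 0" unfolding M_def by (intro sum_nonneg) auto
 have b: "norm (ent (X ^ k) i j) \<le> ?C ^ k" for k i j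
 proof (induction k arbitrary: i j)
  case 0 thus ?case by (simp add: ent_1)
 next
  case (Suc k)
  have "norm (ent (X ^ Suc k) i j) \<le> (\<Sum>l\<in>UNIV. norm (ent X i l * ent (X ^ k) l j))"
   by (simp add: ent_mult norm_sum)
  also have "\<dots> \<le> (\<Sum>l\<in>(UNIV :: 'n set). M * ?C ^ k)"
   by (intro sum_mono) (auto simp: norm_mult intro!: mult_mono M Suc M0)
  finally show ?case by (simp add: mult_ac)
 qed
 have "(\<lambda>k. ?C ^ k / fact k) \<longlonglongrightarrow> 0"
  using summable_LIMSEQ_zero[OF summable_exp[of ?C]] by (simp add: divide_inverse mult.commute)
 from order_tendstoD(2)[OF this zero_less_one] obtain k where k: "?C ^ k / fact k < 1"
  unfolding eventually_sequentially by blast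
 have "ent (dp X k) i j = 0" for i j
 proof -
  have "norm (ent (dp X k) i j) = norm (ent (X ^ k) i j) / fact k"
   by (simp add: dp_def norm_divide norm_mult)
  also have "\<dots> \<le> ?C ^ k / fact k" using b by (intro divide_right_mono) auto
  also note k
  finally have "norm (ent (dp X k) i j) < 1" .
  moreover obtain z where "ent (dp X k) i j = of_int z"
   using assms unfolding divisible_def by (metis Ints_cases)
  ultimately show ?thesis by (simp add: norm_of_int)
 qed
 hence "dp X k = 0" by (intro smat_eqI) simp
 hence "X ^ k = 0" by (simp add: dp_def)
 thus ?thesis by (rule nilpotent_dim)
qed

definition idp :: "(complex, 'n::finite) smat \<Rightarrow> nat \<Rightarrow> (int, 'n) smat" where
 "idp X k = int_smat (dp X k)"

lemma oi_idp: "divisible X ==> oi (idp X k) = dp X k"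
 unfolding idp_def divisible_def by (rule oi_int_smat) auto

lemma dp_ge_CARD: "divisible X ==> k \<ge> CARD('n) ==> dp (X :: (complex, 'n::finite) smat) k = 0"
 using divisible_nilpotent[of X] power_add[of X "CARD('n)" "k - CARD('n)"] by (simp add: dp_def)

lemma dps_idp: "divisible X ==> dps (idp X)" unfolding dps_def
proof (intro conjI allI impI)
 assume X: "divisible X"
 show "idp X 0 = 1" by (rule oi_inj[where 'a=complex]) (simp add: oi_idp X)
 show "idp X i * idp X j = of_nat (i + j choose i) * idp X (i + j)" for i j
  by (rule oi_inj[where 'a=complex]) (simp add: oi_mult oi_of_nat oi_idp X dp_mult)
 show "idp X k = 0" if "k \<ge> CARD('a)" for k
  by (rule oi_inj[where 'a=complex]) (simp add: oi_idp X dp_ge_CARD that)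
qed

lemma dp_uminus: "dp (- X) k = (-1) ^ k \<cdot> dp X k"
proof -
 have "(- X) ^ k = (-1) ^ k \<cdot> X ^ k" by (induction k) auto
 thus ?thesis by (simp add: dp_def mult.commute)
qed

lemma rx_conj:
 fixes X :: "(complex, 'n::finite) smat"
 assumes X: "divisible X" and m: "Ac X Z m = 0"
 shows "rx (idp X) t * Z * rx (idp X) (- t) = (\<Sum>k<m. t ^ k \<cdot> Ac X Z k)"
proof -
 let ?n = "CARD('n)"
 let ?f = "\<lambda>i j. t ^ i \<cdot> dp X i * Z * (- t) ^ j \<cdot> dp X j"
 have f: "?f i j = t ^ (i + j) \<cdot> (dp X i * Z * dp (- X) j)" for i j
 proof -
  have "(- t) ^ j = t ^ j * (-1) ^ j" by (subst power_minus) (rule mult.commute)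
  thus ?thesis by (simp add: dp_uminus power_add mult_ac)
 qed
 have "rx (idp X) t * Z * rx (idp X) (- t) = (\<Sum>i<?n. \<Sum>j<?n. ?f i j)"
  by (simp only: rx_def oi_idp[OF X] sum_distrib_right[of _ _ Z] sum_product)
 also have "\<dots> = (\<Sum>k<2 * ?n. \<Sum>i\<le>k. ?f i (k - i))"
  by (rule cauchy_fin) (auto simp: dp_ge_CARD X)
 also have "\<dots> = (\<Sum>k<2 * ?n. t ^ k \<cdot> Ac X Z k)"
  unfolding Ac_def smul_sum_right by (intro sum.cong refl) (simp only: f, simp)
 also have "\<dots> = (\<Sum>k<m. t ^ k \<cdot> Ac X Z k)"
 proof -
  have "Ac X Z k = 0" if "k \<ge> 2 * ?n" for k unfolding Ac_def
  proof (intro sum.neutral ballI)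
   fix i
   have "i \<ge> ?n \<or> k - i \<ge> ?n" using that by linarith
   thus "dp X i * Z * dp (- X) (k - i) = 0" by (auto simp: dp_uminus dp_ge_CARD X)
  qed
  hence "(\<Sum>k<2 * ?n. t ^ k \<cdot> Ac X Z k) = (\<Sum>k<max m (2 * ?n). t ^ k \<cdot> Ac X Z k)"
   by (intro sum.mono_neutral_left) auto
  also have "\<dots> = (\<Sum>k<m. t ^ k \<cdot> Ac X Z k)"
   using Ac_zero[OF m] by (intro sum.mono_neutral_right) auto
  finally show ?thesis .
 qed
 finally show ?thesis .
qed

lemma Ac_nilpotent:
 fixes X :: "(complex, 'n::finite) smat"
 assumes "divisible X" shows "Ac X Z (2 * CARD('n)) = 0" unfolding Ac_def
proof (intro sum.neutral ballI)
 fix i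
 have "i \<ge> CARD('n) \<or> 2 * CARD('n) - i \<ge> CARD('n)" by linarith
 thus "dp X i * Z * dp (- X) (2 * CARD('n) - i) = 0" by (auto simp: dp_uminus dp_ge_CARD assms)
qed


section \<open>Weight projectors of an \<open>sl\<^sub>2\<close>-triple\<close>

lemma fact_prime_decomp:
 assumes "prime (p :: nat)"
 shows "\<exists>m. fact k = p ^ (k div p) * fact (k div p) * m \<and> \<not> p dvd m"
proof (induction k)
 case 0
 thus ?case using assms by (auto intro!: exI[of _ 1] dest: not_prime_unit)
next
 case (Suc k)
 then obtain m where m: "fact k = p ^ (k div p) * fact (k div p) * m" "\<not> p dvd m" by blast
 have p: "p > 1" using assms prime_gt_1_nat by blast
 show ?case
 proof (cases "p dvd Suc k")
  case True
  hence d: "Suc k div p = Suc (k div p)" by (simp add: div_Suc dvd_eq_mod_eq_0)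
  have "Suc k = p * Suc (k div p)" using True d by (metis dvd_mult_div_cancel)
  hence "fact (Suc k) = p * Suc (k div p) * (p ^ (k div p) * fact (k div p) * m)"
   using m(1) by (metis fact_Suc of_nat_id)
  hence "fact (Suc k) = p ^ (Suc k div p) * fact (Suc k div p) * m"
   unfolding d by (simp only: power_Suc fact_Suc of_nat_id mult_ac)
  thus ?thesis using m(2) by blast
 next
  case False
  hence d: "Suc k div p = k div p" by (simp add: div_Suc dvd_eq_mod_eq_0)
  have "fact (Suc k) = p ^ (Suc k div p) * fact (Suc k div p) * (Suc k * m)"
   using m(1) unfolding d by (simp only: fact_Suc of_nat_id mult_ac)
  moreover have "\<not> p dvd Suc k * m" using False m(2) assms by (simp add: prime_dvd_mult_iff del: mult_Suc)
  ultimately show ?thesis by blast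
 qed
qed

text \<open>The valuation of k! at p is below k: with q = k div p, divisibility of k! by
  \<open>p^k\<close> would make \<open>p^(k - q)\<close> divide q!, and k - q \<ge> q because p
  \<ge> 2, against the induction hypothesis.\<close>

lemma prime_power_not_dvd_fact:
 assumes "prime (p :: nat)"
 shows "k \<ge> 1 ==> \<not> p ^ k dvd fact k"
proof (induction k rule: less_induct)
 case (less k)
 obtain m where m: "fact k = p ^ (k div p) * fact (k div p) * m" "\<not> p dvd m"
  using fact_prime_decomp[OF assms] by blast
 have p: "p \<ge> 2" using assms prime_ge_2_nat by blast
 define q where "q = k div p"
 have "p * q \<le> k" by (simp add: q_def)
 moreover have "2 * q \<le> p * q" using p by simp
 ultimately have q: "2 * q \<le> k" by linarith
 show ?case
 proof
  assume "p ^ k dvd fact k"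
  moreover have "p ^ k = p ^ q * p ^ (k - q)" using q by (simp add: power_add[symmetric])
  ultimately have "p ^ (k - q) dvd fact q * m" using m(1) p by (simp add: q_def mult.assoc)
  moreover have "coprime (p ^ (k - q)) m" using m(2) assms by (simp add: prime_imp_coprime)
  ultimately have *: "p ^ (k - q) dvd fact q" using coprime_dvd_mult_left_iff by blast
  show False
  proof (cases "q = 0")
   case True
   thus False using * less.prems p by simp
  next
   case False
   have "p ^ q dvd p ^ (k - q)" using q by (intro le_imp_power_dvd) simp
   hence "p ^ q dvd fact q" using * dvd_trans by blast
   thus False using less.IH[of q] False q less.prems by simp
  qed
 qed
qed

lemma Ac_SucI: "X * Ac X Z k - Ac X Z k * X = of_nat (Suc k) * Y ==> Ac X Z (Suc k) = Y"
 using Ac_Suc[of k X Z] of_nat_Suc_cancel[of k] by metis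

lemma rx_conj':
 fixes t :: complex
 assumes "divisible X" "Ac X Z m = 0"
 shows "rx (idp X) t * Z = (\<Sum>k<m. t ^ k \<cdot> Ac X Z k) * rx (idp X) t"
proof -
 have "rx (idp X) t * Z = rx (idp X) t * Z * (rx (idp X) (- t) * rx (idp X) t)"
  by (simp add: rx_inverse(2)[OF dps_idp[OF assms(1)]])
 thus ?thesis using rx_conj[OF assms] by (metis mult.assoc)
qed

lemma eigenvectors_independent:
 fixes H :: "(complex, 'n::finite) smat" and c :: "'i \<Rightarrow> complex"
 assumes "finite M"
 shows "inj_on c M ==> (\<And>m. m \<in> M ==> H * X m - X m * H = c m \<cdot> X m) ==>
  (\<Sum>m\<in>M. X m) = 0 ==> \<forall>m\<in>M. X m = 0" using assms
proof (induction M arbitrary: X rule: finite_induct)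
 case (insert a M)
 \<comment> \<open>The image of the relation under \<open>[H, .] - c a\<close>, which removes the
   term of \<open>a\<close>.\<close>
 define Y where "Y m = (c m - c a) \<cdot> X m" for m
 have "(\<Sum>m\<in>insert a M. Y m) = (\<Sum>m\<in>insert a M. H * X m - X m * H - c a \<cdot> X m)"
  by (intro sum.cong refl) (simp add: Y_def insert.prems smul_diff_left)
 also have "\<dots> = H * (\<Sum>m\<in>insert a M. X m) - (\<Sum>m\<in>insert a M. X m) * H - c a \<cdot> (\<Sum>m\<in>insert a M. X m)"
  by (simp only: sum_subtractf sum_distrib_left sum_distrib_right smul_sum_right)
 finally have "(\<Sum>m\<in>insert a M. Y m) = 0" using insert.prems(3) by simp
 hence "(\<Sum>m\<in>M. Y m) = 0" using insert.hyps by (simp add: Y_def)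
 moreover have "H * Y m - Y m * H = c m \<cdot> Y m" if "m \<in> M" for m
  using insert.prems(2)[of m] that by (simp add: Y_def smul_diff_right[symmetric] mult.commute)
 ultimately have "\<forall>m\<in>M. Y m = 0" using insert.IH[of Y] insert.prems(1) by simp
 moreover have "c m \<noteq> c a" if "m \<in> M" for m
  using insert.prems(1) insert.hyps that by (metis inj_onD insertCI)
 ultimately have *: "\<forall>m\<in>M. X m = 0" by (auto simp: Y_def)
 hence "(\<Sum>m\<in>M. X m) = 0" by simp
 hence "X a = 0" using insert.prems(3) insert.hyps by simp
 thus ?case using * by simp
qed simp

text \<open>In SL2 this product of elementary matrices represents the nontrivial Weyl group element;
  conjugation by it changes the sign of \<open>H\<close>.\<close>

definition weyl_elt :: "(nat \<Rightarrow> (int, 'n::finite) smat) \<Rightarrow> (nat \<Rightarrow> (int, 'n) smat) \<Rightarrow> (int, 'n) smat" where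
 "weyl_elt D D' = rx D 1 * rx D' (-1) * rx D 1"

definition weyl_inv :: "(nat \<Rightarrow> (int, 'n::finite) smat) \<Rightarrow> (nat \<Rightarrow> (int, 'n) smat) \<Rightarrow> (int, 'n) smat" where
 "weyl_inv D D' = rx D (-1) * rx D' 1 * rx D (-1)"

text \<open>The terms of the expanded Weyl element that raise the eigenvalue of \<open>H\<close> by
  2m. The Weyl element sends eigenvalue -m to m, so these terms make up its restriction to the
  eigenspace of -m.\<close>

definition weyl_part ::
 "(nat \<Rightarrow> (int, 'n::finite) smat) \<Rightarrow> (nat \<Rightarrow> (int, 'n) smat) \<Rightarrow> int \<Rightarrow> (int, 'n) smat" where
 "weyl_part D D' m = (\<Sum>(i, j, k)\<in>{..<CARD('n)} \<times> {..<CARD('n)} \<times> {..<CARD('n)}.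
   if int i - int j + int k = m then (-1) ^ j \<cdot> (D i * D' j * D k) else 0)"

text \<open>Undoing the Weyl element turns that restriction into the projector onto eigenvalue m.
  All factors are integral, whereas an interpolation polynomial in \<open>H\<close> would have
  denominators.\<close>

definition wproj ::
 "(nat \<Rightarrow> (int, 'n::finite) smat) \<Rightarrow> (nat \<Rightarrow> (int, 'n) smat) \<Rightarrow> int \<Rightarrow> (int, 'n) smat" where
 "wproj D D' m = weyl_part D D' m * weyl_inv D D'"

text \<open>The range contains every i - j + k with exponents i, j, k below n, hence every index at
  which \<open>weyl_part\<close> can be nonzero.\<close>

definition weight_range :: "('a, 'n::finite) smat \<Rightarrow> int set" where
 "weight_range E = {- (2 * int CARD('n)) .. 2 * int CARD('n)}"

lemma finite_weight_range [simp]: "finite (weight_range E)" by (simp add: weight_range_def)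

lemma oi_smul: "oi (a \<cdot> X) = of_int a \<cdot> oi X" by (rule smat_eqI) simp

lemma oi_int [simp]: "oi X = X" for X :: "(int, 'n::finite) smat" by (rule smat_eqI) simp

lemma oi_rx: "oi (rx D t) = rx D (of_int t)" by (rule smat_eqI) (simp add: rx_def ent_sum oi_sum)

lemma wproj_commute:
 assumes "\<And>k. c * oi (D k) = oi (D k) * c" "\<And>k. c * oi (D' k) = oi (D' k) * c"
 shows "c * oi (wproj D D' m) = oi (wproj D D' m) * c"
proof -
 have m: "c * X = X * c ==> c * Y = Y * c ==> c * (X * Y) = X * Y * c" for X Y by (metis mult.assoc)
 have s: "(\<And>x. x \<in> S ==> c * f x = f x * c) ==> c * sum f S = sum f S * c" for S and f :: "'z \<Rightarrow> _"
  by (simp add: sum_distrib_left sum_distrib_right)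
 have r: "(\<And>k. c * oi (D k) = oi (D k) * c) ==> c * oi (rx D t) = oi (rx D t) * c" for D t
  unfolding rx_def oi_sum by (intro s) (simp add: oi_smul)
 show ?thesis unfolding wproj_def weyl_part_def weyl_inv_def oi_mult oi_sum
 proof (intro m r assms s)
  fix z assume "z \<in> {..<CARD('b)} \<times> {..<CARD('b)} \<times> {..<CARD('b)}"
  obtain i j k where "z = (i, j, k)" by (metis surj_pair)
  moreover have "c * (oi (D i) * oi (D' j) * oi (D k)) = oi (D i) * oi (D' j) * oi (D k) * c"
   by (intro m assms)
  ultimately show "c * oi (case z of (i, j, k) \<Rightarrow> if int i - int j + int k = m then (-1) ^ j \<cdot> (D i * D' j * D k) else 0)
   = oi (case z of (i, j, k) \<Rightarrow> if int i - int j + int k = m then (-1) ^ j \<cdot> (D i * D' j * D k) else 0) * c"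
   by (simp add: oi_smul oi_mult)
 qed
qed

lemma smul_2: "2 \<cdot> X = X + X" by (rule smat_eqI) simp

text \<open>\<open>Q\<close> equals all its powers and is therefore divisible by every power of
  p.\<close>

lemma idempotent_dvd:
 fixes Q :: "(int, 'n::finite) smat"
 assumes p: "prime (p :: nat)" and Q: "Q * Q = Q" and dvd: "\<And>i j. int p dvd ent Q i j"
 shows "Q = 0"
proof -
 have "\<forall>i j. int p ^ k dvd ent Q i j" for k
 proof (induction k)
  case (Suc k)
  have "int p ^ Suc k dvd ent (Q * Q) i j" for i j
   unfolding ent_mult power_Suc using Suc dvd by (intro dvd_sum mult_dvd_mono) auto
  thus ?case by (simp add: Q)
 qed simp
 hence "ent Q i j = 0" for i j
 proof -
  have p2: "p \<ge> 2" using p prime_ge_2_nat by blast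
  define k where "k = nat \<bar>ent Q i j\<bar>"
  have "k < 2 ^ k" by (rule less_exp)
  also have "(2::nat) ^ k \<le> p ^ k" using p2 by (intro power_mono) auto
  finally have "\<bar>ent Q i j\<bar> < int p ^ k" unfolding k_def
   by (metis abs_ge_zero nat_less_iff of_nat_power zero_less_nat_eq linorder_not_less nat_eq_iff2 zle_int int_nat_eq)
  moreover have "int p ^ k dvd ent Q i j"
   using \<open>\<And>k. \<forall>i j. int p ^ k dvd ent Q i j\<close> by blast
  ultimately show ?thesis by (metis dvd_imp_le_int not_less abs_of_nat of_nat_power)
 qed
 thus ?thesis by (intro smat_eqI) simp
qed

text \<open>The gcd of the entries is 1, so Bezout coefficients give an integral linear form with
  value 1. Over any ring this form recovers a from the multiple a X.\<close>

lemma bezout_smat: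
 fixes X :: "(int, 'n::finite) smat"
 assumes no_prime: "\<And>p :: nat. prime p ==> \<not> (\<forall>i j. int p dvd ent X i j)"
 shows "\<exists>a :: 'n \<Rightarrow> 'n \<Rightarrow> int. (\<Sum>i\<in>UNIV. \<Sum>j\<in>UNIV. a i j * ent X i j) = 1"
proof -
 define S where "S = range (\<lambda>(i, j). ent X i j)"
 have "finite S" unfolding S_def by simp
 have "Gcd S = 1"
 proof (rule ccontr)
  assume "Gcd S \<noteq> 1"
  hence "nat (Gcd S) \<noteq> 1" by (metis Gcd_int_greater_eq_0 int_nat_eq of_nat_1)
  then obtain p where p: "prime p" "p dvd nat (Gcd S)" using prime_factor_nat by blast
  hence "int p dvd Gcd S" by (metis Gcd_int_greater_eq_0 int_dvd_int_iff int_nat_eq)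
  hence "int p dvd ent X i j" for i j by (rule dvd_trans) (auto simp: S_def intro!: Gcd_dvd)
  thus False using no_prime[OF p(1)] by blast
 qed
 have "\<exists>a :: int \<Rightarrow> int. (\<Sum>s\<in>T. a s * s) = Gcd T" if "finite T" for T :: "int set"
  using that
 proof (induction T rule: finite_induct)
  case (insert t T)
  then obtain a where a: "(\<Sum>s\<in>T. a s * s) = Gcd T" by blast
  obtain u v where uv: "u * t + v * Gcd T = gcd t (Gcd T)" using bezout_int by blast
  define b where "b s = (if s = t then u else v * a s)" for s
  have "(\<Sum>s\<in>T. b s * s) = (\<Sum>s\<in>T. v * (a s * s))"
   by (intro sum.cong refl) (use insert.hyps in \<open>auto simp: b_def\<close>)
  also have "\<dots> = v * Gcd T" using a by (simp add: sum_distrib_left[symmetric])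
  finally have "(\<Sum>s\<in>insert t T. b s * s) = Gcd (insert t T)"
   using insert.hyps uv by (simp add: b_def)
  thus ?case by blast
 qed simp
 then obtain a where a: "(\<Sum>s\<in>S. a s * s) = 1" using \<open>finite S\<close> \<open>Gcd S = 1\<close> by metis
 define e where "e z = ent X (fst z) (snd z)" for z
 define r where "r s = (SOME z. e z = s)" for s
 have r: "e (r s) = s" if "s \<in> S" for s
 proof -
  have "\<exists>z. e z = s" using that by (auto simp: S_def e_def)
  thus ?thesis unfolding r_def by (rule someI_ex)
 qed
 have "(\<Sum>z\<in>UNIV. (\<Sum>s\<in>S. if r s = z then a s else 0) * e z) =
   (\<Sum>z\<in>UNIV. \<Sum>s\<in>S. if r s = z then a s * s else 0)" unfolding sum_distrib_right
 proof (intro sum.cong refl)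
  fix z s assume "s \<in> S"
  thus "(if r s = z then a s else 0) * e z = (if r s = z then a s * s else 0)"
   using r[of s] by (cases "r s = z") simp_all
 qed
 also have "\<dots> = (\<Sum>s\<in>S. a s * s)" by (subst sum.swap) simp
 finally have "(\<Sum>z\<in>UNIV. (\<Sum>s\<in>S. if r s = z then a s else 0) * e z) = 1"
  using a by simp
 hence "(\<Sum>i\<in>UNIV. \<Sum>j\<in>UNIV. (\<Sum>s\<in>S. if r s = (i, j) then a s else 0) * ent X i j) = 1"
  unfolding e_def sum.cartesian_product by (simp add: case_prod_unfold)
 thus ?thesis by (intro exI)
qed

section \<open>Projectors and primitivity for an \<open>sl\<^sub>2\<close>-triple\<close>

locale sl2_triple =
 fixes E F H :: "(complex, 'n::finite) smat"
 assumes EF: "E * F - F * E = H" and HE: "H * E - E * H = 2 * E" and HF: "H * F - F * H = - (2 * F)"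
  and divE: "divisible E" and divF: "divisible F"
begin

abbreviation "D \<equiv> idp E"
abbreviation "D' \<equiv> idp F"

abbreviation "x \<equiv> rx D (1 :: complex)"
abbreviation "y \<equiv> rx D' (-1 :: complex)"
definition "w = x * y * x"
definition "w' = rx D (-1) * rx D' 1 * (rx D (-1) :: (complex, 'n) smat)"

lemma w: "oi (weyl_elt D D') = w" and w': "oi (weyl_inv D D') = w'"
 by (simp_all add: weyl_elt_def weyl_inv_def w_def w'_def oi_mult oi_rx)

lemma ww': "w * w' = 1" "w' * w = 1"
proof -
 note i = rx_inverse[OF dps_idp[OF divE], of "1 :: complex"] rx_inverse[OF dps_idp[OF divF], of "-1 :: complex"]
 have "w * w' = x * (y * (x * rx D (-1)) * rx D' 1) * rx D (-1)"
  by (simp only: w_def w'_def mult.assoc)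
 also have "\<dots> = 1" using i by simp
 finally show "w * w' = 1" .
 thus "w' * w = 1" by (rule smat_inverse_comm)
qed

lemma xH: "x * H = (H - 2 * E) * x"
proof -
 have 1: "Ac E H (Suc 0) = - (2 * E)" by (rule Ac_SucI) (use HE in \<open>simp add: algebra_simps\<close>)
 have 2: "Ac E H (Suc (Suc 0)) = 0" by (rule Ac_SucI) (simp add: 1 mult_2 mult_2_right algebra_simps)
 show ?thesis using rx_conj'[OF divE 2, of 1] by (simp add: 1 eval_nat_numeral)
qed

lemma xF: "x * F = (F + H - E) * x"
proof -
 have 1: "Ac E F (Suc 0) = H" by (rule Ac_SucI) (use EF in simp)
 have 2: "Ac E F (Suc (Suc 0)) = - E" by (rule Ac_SucI) (use HE in \<open>simp add: 1 algebra_simps mult_2\<close>)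
 have 3: "Ac E F (Suc (Suc (Suc 0))) = 0" by (rule Ac_SucI) (simp add: 2)
 show ?thesis using rx_conj'[OF divE 3, of 1] by (simp add: 1 2 eval_nat_numeral algebra_simps)
qed

lemma yH: "y * H = (H - 2 * F) * y"
proof -
 have 1: "Ac F H (Suc 0) = 2 * F" by (rule Ac_SucI) (use HF in \<open>simp add: algebra_simps\<close>)
 have 2: "Ac F H (Suc (Suc 0)) = 0" by (rule Ac_SucI) (simp add: 1 mult_2 algebra_simps)
 show ?thesis using rx_conj'[OF divF 2, of "-1"] by (simp add: 1 eval_nat_numeral)
qed

lemma yE: "y * E = (E + H - F) * y"
proof -
 have 1: "Ac F E (Suc 0) = - H" by (rule Ac_SucI) (simp add: EF[symmetric])
 have 2: "Ac F E (Suc (Suc 0)) = - F" by (rule Ac_SucI) (use HF in \<open>simp add: 1 algebra_simps mult_2\<close>)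
 have 3: "Ac F E (Suc (Suc (Suc 0))) = 0" by (rule Ac_SucI) (simp add: 2)
 show ?thesis using rx_conj'[OF divF 3, of "-1"] by (simp add: 1 2 eval_nat_numeral algebra_simps)
qed

lemma xE: "x * E = E * x"
proof -
 have 1: "Ac E E (Suc 0) = 0" by (rule Ac_SucI) simp
 show ?thesis using rx_conj'[OF divE 1, of 1] by simp
qed

lemma wH: "w * H = - (H * w)"
proof -
 have "w * H = x * y * (x * H)" by (simp add: w_def mult.assoc)
 also have "\<dots> = x * (y * H - 2 * (y * E)) * x" by (simp add: xH algebra_simps mult_2)
 also have "\<dots> = x * ((- H - 2 * E) * y) * x"
  by (simp only: yH yE) (simp add: algebra_simps mult_2)
 also have "\<dots> = (- (x * H) - 2 * (x * E)) * y * x" by (simp add: algebra_simps mult_2)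
 also have "\<dots> = - (H * w)" by (simp only: xH xE) (simp add: w_def algebra_simps mult_2)
 finally show ?thesis .
qed

lemma wE: "w * E = - (F * w)"
proof -
 have "w * E = x * (y * E) * x" by (simp add: w_def mult.assoc xE)
 also have "\<dots> = (x * E + x * H - x * F) * y * x" by (simp only: yE) (simp add: algebra_simps)
 also have "\<dots> = - (F * w)" by (simp only: xE xH xF) (simp add: w_def algebra_simps mult_2)
 finally show ?thesis .
qed

lemma w'H: "w' * H = - (H * w')"
proof -
 have "w' * (w * H) * w' = - (w' * (H * w) * w')" by (simp add: wH)
 thus ?thesis using ww' by (simp add: mult.assoc) (simp add: mult.assoc[symmetric] ww')
qed

lemma H_dpE: "H * dp E k = dp E k * H + of_nat (2 * k) \<cdot> dp E k"
proof -
 have HE': "H * E = E * H + 2 \<cdot> E" using HE by (simp add: algebra_simps smul_numeral)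
 have "H * E ^ k = E ^ k * H + of_nat (2 * k) \<cdot> E ^ k"
 proof (induction k)
  case (Suc k)
  have "H * E ^ Suc k = (E * H + 2 \<cdot> E) * E ^ k" by (simp add: mult.assoc[symmetric] HE')
  also have "\<dots> = E * (H * E ^ k) + 2 \<cdot> E ^ Suc k" by (simp add: algebra_simps)
  finally show ?case unfolding Suc by (simp add: algebra_simps smul_add_left)
 qed simp
 thus ?thesis by (simp add: dp_def smul_add_right mult.commute)
qed

lemma H_dpF: "H * dp F k = dp F k * H - of_nat (2 * k) \<cdot> dp F k"
proof -
 have HF': "H * F = F * H - 2 \<cdot> F" using HF by (simp add: algebra_simps smul_numeral)
 have "H * F ^ k = F ^ k * H - of_nat (2 * k) \<cdot> F ^ k"
 proof (induction k)
  case (Suc k)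
  have "H * F ^ Suc k = (F * H - 2 \<cdot> F) * F ^ k" by (simp add: mult.assoc[symmetric] HF')
  also have "\<dots> = F * (H * F ^ k) - 2 \<cdot> F ^ Suc k" by (simp add: algebra_simps)
  finally show ?case unfolding Suc by (simp add: algebra_simps smul_add_left)
 qed simp
 thus ?thesis by (simp add: dp_def smul_diff_right mult.commute)
qed

definition "Wp m = (oi (weyl_part D D' m) :: (complex, 'n) smat)"

lemma Wp: "Wp m = (\<Sum>(i, j, k)\<in>{..<CARD('n)} \<times> {..<CARD('n)} \<times> {..<CARD('n)}.
   if int i - int j + int k = m then (-1) ^ j \<cdot> (dp E i * dp F j * dp E k) else 0)"
proof -
 show ?thesis unfolding Wp_def weyl_part_def oi_sum
  by (intro sum.cong refl) (auto simp: oi_smul oi_mult oi_idp divE divF)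
qed

lemma H_Wp: "H * Wp m = Wp m * H + of_int (2 * m) \<cdot> Wp m"
 unfolding Wp sum_distrib_left sum_distrib_right smul_sum_right sum.distrib[symmetric]
proof (intro sum.cong refl)
 fix z assume "z \<in> {..<CARD('n)} \<times> {..<CARD('n)} \<times> {..<CARD('n)}"
 obtain i j k where z: "z = (i, j, k)" by (metis surj_pair)
 let ?X = "dp E i * dp F j * dp E k"
 have "H * ?X = dp E i * (H * dp F j) * dp E k + of_nat (2 * i) \<cdot> ?X"
  by (simp add: mult.assoc[symmetric] H_dpE distrib_right)
 also have "dp E i * (H * dp F j) * dp E k = dp E i * dp F j * (H * dp E k) - of_nat (2 * j) \<cdot> ?X"
  by (simp add: H_dpF algebra_simps)
 also have "dp E i * dp F j * (H * dp E k) = ?X * H + of_nat (2 * k) \<cdot> ?X"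
  by (simp add: H_dpE algebra_simps)
 finally have "H * ?X = ?X * H + of_int (2 * (int i - int j + int k)) \<cdot> ?X"
  by (simp add: smul_algebra algebra_simps)
 thus "H * (case z of (i, j, k) \<Rightarrow>
    if int i - int j + int k = m then (-1) ^ j \<cdot> (dp E i * dp F j * dp E k) else 0) =
   (case z of (i, j, k) \<Rightarrow>
    if int i - int j + int k = m then (-1) ^ j \<cdot> (dp E i * dp F j * dp E k) else 0) * H +
   of_int (2 * m) \<cdot> (case z of (i, j, k) \<Rightarrow>
    if int i - int j + int k = m then (-1) ^ j \<cdot> (dp E i * dp F j * dp E k) else 0)"
  by (auto simp: z smul_add_right mult.commute)
qed

abbreviation "M \<equiv> weight_range E"

lemma sum_Wp: "(\<Sum>m\<in>M. Wp m) = w"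
proof -
 let ?n = "CARD('n)" let ?T = "{..<CARD('n)} \<times> {..<CARD('n)} \<times> {..<CARD('n)}"
 have "(\<Sum>m\<in>M. Wp m) = (\<Sum>z\<in>?T. \<Sum>m\<in>M. case z of (i, j, k) \<Rightarrow>
   if int i - int j + int k = m then (-1) ^ j \<cdot> (dp E i * dp F j * dp E k) else 0)"
  unfolding Wp by (rule sum.swap)
 also have "\<dots> = (\<Sum>(i, j, k)\<in>?T. (-1) ^ j \<cdot> (dp E i * dp F j * dp E k))"
  by (intro sum.cong refl) (auto split: prod.splits simp: weight_range_def)
 also have "\<dots> = (\<Sum>i<?n. \<Sum>j<?n. \<Sum>k<?n. (-1) ^ j \<cdot> (dp E i * dp F j * dp E k))"
  by (simp add: sum.cartesian_product)
 also have "\<dots> = w"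
 proof -
  have x: "x = (\<Sum>i<?n. dp E i)" and y: "y = (\<Sum>j<?n. (-1) ^ j \<cdot> dp F j)"
   by (simp_all add: rx_def oi_idp divE divF)
  have "w = (\<Sum>i<?n. \<Sum>j<?n. dp E i * (-1) ^ j \<cdot> dp F j) * x"
   unfolding w_def by (subst (1) x, subst y, subst sum_product) (rule refl)
  also have "\<dots> = (\<Sum>i<?n. \<Sum>j<?n. \<Sum>k<?n. (dp E i * (-1) ^ j \<cdot> dp F j) * dp E k)"
   by (simp only: sum_distrib_right) (simp only: x sum_distrib_left)
  finally show ?thesis by simp
 qed
 finally show ?thesis .
qed

text \<open>\<open>Wp m\<close> is the part of \<open>w\<close> of eigenvalue 2m under ad H.
  Splitting \<open>w * H + H * w = 0\<close> into these parts gives one relation for each m.\<close>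

lemma Wp_H: "Wp m * H = - (of_int m \<cdot> Wp m)"
proof (cases "m \<in> M")
 case True
 define X where "X m = Wp m * H + of_int m \<cdot> Wp m" for m
 have ad: "H * X m - X m * H = of_int (2 * m) \<cdot> X m" for m
  by (simp add: X_def distrib_left distrib_right mult.assoc[symmetric] H_Wp)
   (simp add: algebra_simps smul_add_right H_Wp)
 have s: "(\<Sum>m\<in>M. X m) = 0"
 proof -
  have "(2 :: complex) \<cdot> (\<Sum>m\<in>M. X m) = (\<Sum>m\<in>M. Wp m * H + H * Wp m)"
   unfolding smul_sum_right
   by (intro sum.cong refl) (simp only: H_Wp X_def smul_2 mult_2 of_int_add smul_add_left smul_add_right add_ac)
  also have "\<dots> = w * H + H * w"
   by (simp add: sum.distrib sum_distrib_left[symmetric] sum_distrib_right[symmetric] sum_Wp)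
  finally show ?thesis by (simp add: wH)
 qed
 have inj: "inj_on (\<lambda>m. complex_of_int (2 * m)) M" by (auto simp: inj_on_def)
 have "\<forall>m\<in>M. X m = 0" by (rule eigenvectors_independent[OF finite_weight_range inj ad s])
 hence "X m = 0" using True by blast
 thus ?thesis unfolding X_def by (simp add: eq_neg_iff_add_eq_0)
next
 case False
 hence "Wp m = 0" unfolding Wp by (intro sum.neutral) (auto simp: weight_range_def)
 thus ?thesis by simp
qed

abbreviation "P \<equiv> wproj D D'"

lemma oi_P: "oi (P m) = Wp m * w'" by (simp add: wproj_def oi_mult w' Wp_def)

lemma H_P: "H * oi (P m) = of_int m \<cdot> oi (P m)"
proof -
 have "H * Wp m = of_int m \<cdot> Wp m"
  unfolding H_Wp Wp_H by (simp add: smul_diff_left[symmetric] flip: smul_minus_left smul_add_left)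
 thus ?thesis unfolding oi_P by (metis mult.assoc smul_mult_left)
qed

lemma P_H: "oi (P m) * H = of_int m \<cdot> oi (P m)"
 unfolding oi_P by (simp add: mult.assoc w'H) (simp add: mult.assoc[symmetric] Wp_H)

lemma P_out: "m \<notin> M ==> P m = 0"
proof -
 assume "m \<notin> M"
 hence "weyl_part D D' m = 0" unfolding weyl_part_def
  by (intro sum.neutral) (auto simp: weight_range_def)
 thus ?thesis by (simp add: wproj_def)
qed

lemma P_sum: "(\<Sum>m\<in>M. P m) = 1" by (rule oi_inj[where 'a = complex])
  (simp add: oi_sum oi_P sum_distrib_right[symmetric] sum_Wp ww')

lemma P_ortho: "m \<noteq> k ==> P m * P k = 0"
proof (rule oi_inj[where 'a = complex])
 assume "m \<noteq> k"
 have "of_int m \<cdot> (oi (P m) * oi (P k)) = (of_int k :: complex) \<cdot> (oi (P m) * oi (P k))"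
  using mult.assoc[of "oi (P m)" H "oi (P k)"] unfolding P_H H_P by simp
 hence "(of_int (m - k) :: complex) \<cdot> (oi (P m) * oi (P k)) = 0" by (simp add: smul_diff_left)
 thus "oi (P m * P k) = (oi 0 :: (complex, 'n) smat)" using \<open>m \<noteq> k\<close> by (simp add: oi_mult)
qed

lemma P_idem: "P m * P k = (if m = k then P m else 0)"
proof (cases "m = k")
 case True
 have "P k = (\<Sum>m\<in>M. P m * P k)" by (simp add: sum_distrib_right[symmetric] P_sum)
 also have "\<dots> = (\<Sum>m\<in>M. if m = k then P k * P k else 0)"
  by (intro sum.cong refl) (auto simp: P_ortho)
 also have "\<dots> = P k * P k" using P_out by (cases "k \<in> M") auto
 finally show ?thesis using True by simp
qed (simp add: P_ortho)

text \<open>Suppose a prime p divides all entries of \<open>E\<close>. Then k! times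
  \<open>D k\<close> is divisible by \<open>p^k\<close>, and the valuation of k! is below k, so p
  divides \<open>D k\<close> for k \<ge> 1. As \<open>F\<close> is conjugate to \<open>- E\<close>
  by the Weyl element, p also divides the divided powers of \<open>F\<close>. So p divides the
  idempotents \<open>P m\<close> with m \<noteq> 0, which therefore vanish; hence
  \<open>P 0 = 1\<close> and \<open>H = 0\<close>.\<close>

lemma primitive:
 assumes "H \<noteq> 0"
 obtains a :: "'n \<Rightarrow> 'n \<Rightarrow> int" where "(\<Sum>i\<in>UNIV. \<Sum>j\<in>UNIV. a i j * ent (D 1) i j) = 1"
proof -
 have no_prime: "\<not> (\<forall>i j. int p dvd ent (D 1) i j)" if p: "prime p" for p :: nat
 proof
  assume dv: "\<forall>i j. int p dvd ent (D 1) i j"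
  define I where "I X \<longleftrightarrow> (\<forall>i j. int p dvd ent X i j)" for X :: "(int, 'n) smat"
  have I_mult: "I X ==> I (X * Y)" "I Y ==> I (X * Y)" for X Y
   unfolding I_def ent_mult by (auto intro!: dvd_sum)
  have key: "I (idp Z k)" if Z: "divisible Z" "I (idp Z 1)" and k: "k \<ge> 1" for Z k
  proof -
   define Y where "Y = smat (\<chi> i j. ent (idp Z 1) i j div int p)"
   have "ent Y i j = ent (idp Z 1) i j div int p" for i j
    by (simp add: Y_def ent.rep_eq smat_inverse)
   hence Y: "idp Z 1 = of_nat p * Y"
    using Z(2) unfolding smul_of_nat[symmetric] by (intro smat_eqI) (simp add: I_def)
   have "of_nat (fact k) * idp Z k = idp Z 1 ^ k"
   proof (rule oi_inj[where 'a = complex])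
    have "oi (idp Z 1 ^ k) = (Z ^ k :: (complex, 'n) smat)"
     by (induction k) (simp_all add: oi_mult oi_idp Z)
    moreover have "oi (of_nat (fact k) * idp Z k) = Z ^ k"
     unfolding smul_of_nat[symmetric] oi_smul oi_idp[OF Z(1)] dp_def by simp
    ultimately show "oi (of_nat (fact k) * idp Z k) = (oi (idp Z 1 ^ k) :: (complex, 'n) smat)" by simp
   qed
   also have "\<dots> = of_nat (p ^ k) * Y ^ k"
    unfolding Y smul_of_nat[symmetric] by (induction k) (simp_all add: mult.commute)
   finally have e: "int (fact k) * ent (idp Z k) i j = int (p ^ k) * ent (Y ^ k) i j" for i j
    unfolding smul_of_nat[symmetric] by (metis ent_smul)
   have "int p dvd ent (idp Z k) i j" for i j
   proof (rule ccontr)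
    assume "\<not> int p dvd ent (idp Z k) i j"
    hence "coprime (int p ^ k) (ent (idp Z k) i j)" using p by (simp add: prime_imp_coprime)
    moreover have "int p ^ k dvd int (fact k) * ent (idp Z k) i j" unfolding e by simp
    ultimately have "int p ^ k dvd int (fact k)" by (simp only: coprime_dvd_mult_left_iff)
    hence "p ^ k dvd fact k" by (metis of_nat_dvd_iff of_nat_power)
    thus False using prime_power_not_dvd_fact[OF p k] by simp
   qed
   thus ?thesis by (simp add: I_def)
  qed
  have I1: "I (D 1)" using dv by (simp add: I_def)
  have "w * E * w' = - F" by (simp add: wE mult.assoc ww')
  hence "D' 1 = - (weyl_elt D D' * D 1 * weyl_inv D D')"
   by (intro oi_inj[where 'a = complex]) (simp add: oi_minus oi_mult w w' oi_idp divE divF)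
  hence I2: "I (D' 1)" using I_mult[OF I_mult(2), OF I1] by (simp add: I_def)
  have z: "P m = 0" if "m \<noteq> 0" for m
  proof -
   have "I (weyl_part D D' m)" unfolding I_def weyl_part_def ent_sum
   proof (intro allI dvd_sum)
    fix a b and z :: "nat \<times> nat \<times> nat"
    obtain i j k where z: "z = (i, j, k)" by (metis surj_pair)
    show "int p dvd ent (case z of (i, j, k) \<Rightarrow>
      if int i - int j + int k = m then (-1) ^ j \<cdot> (D i * D' j * D k) else 0) a b"
    proof (cases "int i - int j + int k = m")
     case True
     hence "i \<ge> 1 \<or> j \<ge> 1 \<or> k \<ge> 1" using that by linarith
     hence "I (D i * D' j * D k)" using I_mult key[OF divE I1] key[OF divF I2] by blast
     thus ?thesis by (simp add: z I_def)
    qed (simp add: z)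
   qed
   hence I: "I (P m)" unfolding wproj_def by (rule I_mult)
   show ?thesis by (rule idempotent_dvd[OF p P_idem[of m m, simplified]]) (use I in \<open>simp add: I_def\<close>)
  qed
  have "(\<Sum>m\<in>M. P m) = (\<Sum>m\<in>M. if m = 0 then P 0 else 0)"
   by (intro sum.cong) (auto simp: z)
  hence "P 0 = 1" using P_sum by (simp split: if_splits)
  hence "H = 0" using H_P[of 0] by simp
  thus False using assms by simp
 qed
 show ?thesis using bezout_smat[OF no_prime] that by blast
qed

end


section \<open>Root systems\<close>

locale irreducible_roots =
 fixes \<Phi> :: "'e::euclidean_space set"
 assumes irreducible: "irreducible_root_system \<Phi>" and rank: "DIM('e) > 1"
begin

abbreviation ci :: "'e \<Rightarrow> 'e \<Rightarrow> real" where "ci \<equiv> cartan_number"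

lemma root_system: "root_system \<Phi>" and roots_nonempty: "\<Phi> \<noteq> {}"
 using irreducible by (auto simp: irreducible_root_system_def)

lemma finite_roots [simp]: "finite \<Phi>" and zero_not_root: "0 \<notin> \<Phi>" and span_roots: "span \<Phi> = UNIV"
 using root_system by (auto simp: root_system_def)

lemma root_nonzero [simp]: "\<alpha> \<in> \<Phi> ==> \<alpha> \<noteq> 0" using zero_not_root by blast

lemma reflect: "\<alpha> \<in> \<Phi> ==> \<beta> \<in> \<Phi> ==> \<beta> - ci \<beta> \<alpha> *\<^sub>R \<alpha> \<in> \<Phi>"
 and ci_Ints: "\<alpha> \<in> \<Phi> ==> \<beta> \<in> \<Phi> ==> ci \<beta> \<alpha> \<in> \<int>"
 and reduced: "\<alpha> \<in> \<Phi> ==> c *\<^sub>R \<alpha> \<in> \<Phi> ==> c = 1 \<or> c = -1"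
 using root_system by (auto simp: root_system_def)

lemma ci_self [simp]: "\<alpha> \<noteq> 0 ==> ci \<alpha> \<alpha> = 2" by (simp add: cartan_number_def)
lemma ci_add: "ci (\<beta> + \<gamma>) \<alpha> = ci \<beta> \<alpha> + ci \<gamma> \<alpha>"
 by (simp add: cartan_number_def inner_add_left add_divide_distrib distrib_left)
lemma ci_diff: "ci (\<beta> - \<gamma>) \<alpha> = ci \<beta> \<alpha> - ci \<gamma> \<alpha>"
 by (simp add: cartan_number_def inner_diff_left diff_divide_distrib right_diff_distrib)
lemma ci_minus [simp]: "ci (- \<beta>) \<alpha> = - ci \<beta> \<alpha>" by (simp add: cartan_number_def)
lemma ci_minus_right [simp]: "ci \<beta> (- \<alpha>) = - ci \<beta> \<alpha>" by (simp add: cartan_number_def)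
lemma ci_scale: "ci (c *\<^sub>R \<beta>) \<alpha> = c * ci \<beta> \<alpha>" by (simp add: cartan_number_def)
lemma ci_zero [simp]: "ci 0 \<alpha> = 0" by (simp add: cartan_number_def)
lemma ci_coroot: "ci \<mu> \<alpha> = \<mu> \<bullet> coroot \<alpha>"
 by (simp add: cartan_number_def coroot_def)
lemma ci_inner: "\<alpha> \<noteq> 0 ==> ci \<beta> \<alpha> * (\<alpha> \<bullet> \<alpha>) = 2 * (\<beta> \<bullet> \<alpha>)" by (simp add: cartan_number_def)
lemma inner_self_not_neg [simp]: "\<not> x \<bullet> x < 0" for x :: "'a::real_inner"
 by (simp add: not_less)
lemma ci_pos: "\<alpha> \<noteq> 0 ==> ci \<beta> \<alpha> > 0 \<longleftrightarrow> \<beta> \<bullet> \<alpha> > 0"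
 and ci_neg: "\<alpha> \<noteq> 0 ==> ci \<beta> \<alpha> < 0 \<longleftrightarrow> \<beta> \<bullet> \<alpha> < 0"
 and ci_eq_0: "\<alpha> \<noteq> 0 ==> ci \<beta> \<alpha> = 0 \<longleftrightarrow> \<beta> \<bullet> \<alpha> = 0"
 using inner_gt_zero_iff[of \<alpha>]
 by (auto simp: cartan_number_def zero_less_divide_iff divide_less_0_iff)

lemma ci_separates: "(\<And>\<alpha>. \<alpha> \<in> S ==> ci \<mu> \<alpha> = ci \<nu> \<alpha>) ==> S \<subseteq> \<Phi> ==> span S = UNIV ==> \<mu> = \<nu>"
proof -
 assume h: "\<And>\<alpha>. \<alpha> \<in> S ==> ci \<mu> \<alpha> = ci \<nu> \<alpha>" and S: "S \<subseteq> \<Phi>" "span S = UNIV"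
 have "ci (\<mu> - \<nu>) \<alpha> = 0" if "\<alpha> \<in> S" for \<alpha> using h[OF that] by (simp add: ci_diff)
 hence o: "\<And>\<alpha>. \<alpha> \<in> S ==> orthogonal (\<mu> - \<nu>) \<alpha>"
  using S(1) by (auto simp: orthogonal_def ci_eq_0 subset_eq)
 have "orthogonal (\<mu> - \<nu>) (\<mu> - \<nu>)"
  using orthogonal_to_span[of "\<mu> - \<nu>" S "\<mu> - \<nu>"] o S(2) by blast
 thus ?thesis by (simp add: orthogonal_self)
qed

lemma neg_root [simp]: "\<alpha> \<in> \<Phi> ==> - \<alpha> \<in> \<Phi>"
 using reflect[of \<alpha> \<alpha>] by (simp add: scaleR_2)

lemma neg_root_iff [simp]: "- \<alpha> \<in> \<Phi> \<longleftrightarrow> \<alpha> \<in> \<Phi>" using neg_root[of "- \<alpha>"] by auto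

text \<open>Equality in Cauchy-Schwarz would make the roots proportional, which a reduced system
  allows for a root and its negative only.\<close>

lemma inner_bound:
 assumes "\<alpha> \<in> \<Phi>" "\<beta> \<in> \<Phi>" "\<beta> \<noteq> \<alpha>" "\<beta> \<noteq> - \<alpha>"
 shows "\<bar>\<beta> \<bullet> \<alpha>\<bar> < norm \<beta> * norm \<alpha>"
proof (rule ccontr)
 assume "\<not> ?thesis"
 hence "\<bar>\<beta> \<bullet> \<alpha>\<bar> = norm \<beta> * norm \<alpha>" using Cauchy_Schwarz_ineq2[of \<beta> \<alpha>] by linarith
 hence "norm \<alpha> *\<^sub>R \<beta> = norm \<beta> *\<^sub>R \<alpha> \<or> norm \<alpha> *\<^sub>R \<beta> = - norm \<beta> *\<^sub>R \<alpha>"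
  using norm_cauchy_schwarz_abs_eq[of \<beta> \<alpha>] by auto
 moreover have "\<beta> = inverse (norm \<alpha>) *\<^sub>R norm \<alpha> *\<^sub>R \<beta>" using assms(1) by simp
 ultimately have "\<beta> = inverse (norm \<alpha>) *\<^sub>R norm \<beta> *\<^sub>R \<alpha> \<or>
   \<beta> = inverse (norm \<alpha>) *\<^sub>R (- norm \<beta>) *\<^sub>R \<alpha>" by metis
 hence "\<beta> = (inverse (norm \<alpha>) * norm \<beta>) *\<^sub>R \<alpha> \<or>
   \<beta> = (inverse (norm \<alpha>) * (- norm \<beta>)) *\<^sub>R \<alpha>" by (simp only: scaleR_scaleR)
 then obtain c where "\<beta> = c *\<^sub>R \<alpha>" by blast
 thus False using reduced[of \<alpha> c] assms by auto
qed

lemma ci_prod_less: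
 assumes "\<alpha> \<in> \<Phi>" "\<beta> \<in> \<Phi>" "\<beta> \<noteq> \<alpha>" "\<beta> \<noteq> - \<alpha>"
 shows "ci \<alpha> \<beta> * ci \<beta> \<alpha> < 4"
proof -
 have "(\<beta> \<bullet> \<alpha>)\<^sup>2 < (norm \<beta> * norm \<alpha>)\<^sup>2"
  using inner_bound[OF assms] by (metis abs_ge_zero power2_abs power_strict_mono zero_less_numeral)
 hence "(\<beta> \<bullet> \<alpha>) * (\<beta> \<bullet> \<alpha>) < (\<alpha> \<bullet> \<alpha>) * (\<beta> \<bullet> \<beta>)"
  by (simp add: power_mult_distrib power2_norm_eq_inner) (simp add: power2_eq_square mult.commute)
 thus ?thesis using assms
  by (simp add: cartan_number_def inner_commute divide_less_eq inner_gt_zero_iff mult_ac)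
qed

text \<open>Both Cartan numbers are negative integers and their product is below 4, so one of them
  is -1, and the corresponding reflection is the sum.\<close>

lemma add_root:
 assumes "\<alpha> \<in> \<Phi>" "\<beta> \<in> \<Phi>" "\<alpha> \<bullet> \<beta> < 0" "\<alpha> + \<beta> \<noteq> 0"
 shows "\<alpha> + \<beta> \<in> \<Phi>"
proof -
 have "\<beta> \<noteq> \<alpha>" "\<beta> \<noteq> - \<alpha>" using assms by (auto simp: not_less)
 hence p: "ci \<alpha> \<beta> * ci \<beta> \<alpha> < 4" using ci_prod_less assms by blast
 obtain a b where ab: "ci \<alpha> \<beta> = of_int a" "ci \<beta> \<alpha> = of_int b"
  using ci_Ints assms by (meson Ints_cases)
 have "ci \<alpha> \<beta> < 0" "ci \<beta> \<alpha> < 0" using assms ci_neg by (auto simp: inner_commute)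
 hence n: "a < 0" "b < 0" using ab by auto
 have "a * b < 4" using p unfolding ab by (metis of_int_less_iff of_int_mult of_int_numeral)
 have "a = -1 \<or> b = -1"
 proof (rule ccontr)
  assume "\<not> ?thesis"
  hence "- a \<ge> 2" "- b \<ge> 2" using n by auto
  hence "(- a) * (- b) \<ge> 2 * 2" by (intro mult_mono) auto
  thus False using \<open>a * b < 4\<close> by simp
 qed
 thus ?thesis using reflect[OF assms(1,2)] reflect[OF assms(2,1)] by (auto simp: ab add.commute)
qed

lemma diff_root:
 assumes "\<alpha> \<in> \<Phi>" "\<beta> \<in> \<Phi>" "\<alpha> \<bullet> \<beta> > 0" "\<alpha> \<noteq> \<beta>"
 shows "\<alpha> - \<beta> \<in> \<Phi>" using add_root[of \<alpha> "- \<beta>"] assms by simp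

text \<open>If all roots have the same length, all are long; so among the roots this is the
  complement of \<open>short_root\<close>.\<close>

definition long :: "'e \<Rightarrow> bool" where
 "long \<theta> \<longleftrightarrow> \<theta> \<in> \<Phi> \<and> (\<forall>\<beta>\<in>\<Phi>. norm \<beta> \<le> norm \<theta>)"

lemma long_root: "long \<theta> ==> \<theta> \<in> \<Phi>" by (simp add: long_def)
lemma long_minus [simp]: "long (- \<theta>) \<longleftrightarrow> long \<theta>" by (simp add: long_def)
lemma long_norm: "long \<theta> ==> long \<theta>' ==> norm \<theta> = norm \<theta>'"
 unfolding long_def by (meson antisym)
lemma long_norm_le: "long \<theta> ==> \<beta> \<in> \<Phi> ==> norm \<beta> \<le> norm \<theta>" by (simp add: long_def)
lemma long_inner_le: "long \<theta> ==> \<beta> \<in> \<Phi> ==> \<beta> \<bullet> \<beta> \<le> \<theta> \<bullet> \<theta>"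
 using long_norm_le by (metis norm_ge_zero power2_norm_eq_inner power_mono)

lemma ci_long:
 assumes "long \<theta>" "\<delta> \<in> \<Phi>" "\<delta> \<noteq> \<theta>" "\<delta> \<noteq> - \<theta>"
 shows "ci \<delta> \<theta> = -1 \<or> ci \<delta> \<theta> = 0 \<or> ci \<delta> \<theta> = 1"
proof -
 have t: "\<theta> \<in> \<Phi>" "\<theta> \<noteq> 0" using assms long_root by auto
 have "\<bar>\<delta> \<bullet> \<theta>\<bar> < norm \<delta> * norm \<theta>" using inner_bound[OF t(1) assms(2-4)] .
 also have "\<dots> \<le> norm \<theta> * norm \<theta>"
  by (intro mult_right_mono long_norm_le[OF assms(1,2)]) auto
 also have "\<dots> = \<theta> \<bullet> \<theta>" by (simp add: dot_square_norm power2_eq_square)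
 finally have "\<bar>ci \<delta> \<theta>\<bar> < 2" using t
  by (simp add: cartan_number_def abs_mult divide_less_eq inner_gt_zero_iff)
 moreover obtain k where k: "ci \<delta> \<theta> = of_int k" using ci_Ints[OF t(1) assms(2)] Ints_cases by blast
 ultimately have "\<bar>k\<bar> < 2" by linarith
 thus ?thesis unfolding k by auto
qed

text \<open>The second part says that the string through \<open>\<delta>\<close> starts at
  \<open>\<delta>\<close>, since \<open>\<delta> - k \<theta>\<close> would be longer than
  \<open>\<theta>\<close>. So r = 0 in the bracket formula and the structure constant is a
  sign.\<close>

lemma long_add_root:
 assumes "long \<theta>" "\<delta> \<in> \<Phi>" "ci \<delta> \<theta> = -1"
 shows "\<theta> + \<delta> \<in> \<Phi>" "\<And>k::nat. \<delta> - real k *\<^sub>R \<theta> \<in> \<Phi> \<longleftrightarrow> k = 0"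
proof -
 have t: "\<theta> \<in> \<Phi>" "\<theta> \<noteq> 0" "\<theta> \<bullet> \<theta> > 0" using assms long_root by (auto simp: inner_gt_zero_iff)
 show "\<theta> + \<delta> \<in> \<Phi>" using reflect[OF t(1) assms(2)] assms(3) by (simp add: add.commute)
 fix k :: nat
 have i: "2 * (\<delta> \<bullet> \<theta>) = - (\<theta> \<bullet> \<theta>)" using ci_inner[OF t(2), of \<delta>] assms(3) by simp
 show "\<delta> - real k *\<^sub>R \<theta> \<in> \<Phi> \<longleftrightarrow> k = 0"
 proof (cases "k = 0")
  case False
  have "(\<delta> - real k *\<^sub>R \<theta>) \<bullet> (\<delta> - real k *\<^sub>R \<theta>) =
    \<delta> \<bullet> \<delta> - real k * (2 * (\<delta> \<bullet> \<theta>)) + (real k)\<^sup>2 * (\<theta> \<bullet> \<theta>)"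
   by (simp add: inner_diff_left inner_diff_right inner_commute power2_eq_square algebra_simps)
  also have "\<dots> = \<delta> \<bullet> \<delta> + real k * (\<theta> \<bullet> \<theta>) + (real k)\<^sup>2 * (\<theta> \<bullet> \<theta>)" unfolding i by simp
  also have "\<dots> > \<theta> \<bullet> \<theta>"
  proof -
   have "real k * (\<theta> \<bullet> \<theta>) \<ge> 1 * (\<theta> \<bullet> \<theta>)" using False t by (intro mult_right_mono) auto
   moreover have "\<delta> \<bullet> \<delta> > 0" using assms(2) by (simp add: inner_gt_zero_iff)
   moreover have "(real k)\<^sup>2 * (\<theta> \<bullet> \<theta>) \<ge> 0" by simp
   ultimately show ?thesis by linarith
  qed
  finally have "\<delta> - real k *\<^sub>R \<theta> \<notin> \<Phi>" using long_inner_le[OF assms(1)] by force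
  thus ?thesis using False by simp
 qed (use assms in simp)
qed

text \<open>A longest root plus a root at a nonobtuse angle is longer than every root.\<close>

lemma long_add_not_root:
 assumes "long \<theta>" "\<delta> \<in> \<Phi>" "ci \<delta> \<theta> \<ge> 0"
 shows "\<theta> + \<delta> \<notin> \<Phi>" "\<theta> + \<delta> \<noteq> 0"
proof -
 have t: "\<theta> \<in> \<Phi>" "\<theta> \<noteq> 0" using assms long_root by auto
 have i: "\<delta> \<bullet> \<theta> \<ge> 0" using assms(3) ci_neg[OF t(2), of \<delta>] by linarith
 have "(\<theta> + \<delta>) \<bullet> (\<theta> + \<delta>) > \<theta> \<bullet> \<theta>"
 proof -
  have "(\<theta> + \<delta>) \<bullet> (\<theta> + \<delta>) = \<theta> \<bullet> \<theta> + 2 * (\<delta> \<bullet> \<theta>) + \<delta> \<bullet> \<delta>"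
   by (simp add: inner_add_left inner_add_right inner_commute)
  moreover have "\<delta> \<bullet> \<delta> > 0" using assms(2) by (simp add: inner_gt_zero_iff)
  ultimately show ?thesis using i by linarith
 qed
 thus "\<theta> + \<delta> \<notin> \<Phi>" "\<theta> + \<delta> \<noteq> 0" using long_inner_le[OF assms(1), of "\<theta> + \<delta>"] t by (auto simp: not_le)
qed

text \<open>Rank above 1 leaves roots other than \<open>\<theta>\<close> and
  \<open>- \<theta>\<close>; irreducibility forbids that all of them are orthogonal to
  \<open>\<theta>\<close>.\<close>

lemma ex_nonorthogonal:
 assumes "\<theta> \<in> \<Phi>"
 obtains \<gamma> where "\<gamma> \<in> \<Phi>" "\<gamma> \<noteq> \<theta>" "\<gamma> \<noteq> - \<theta>" "\<gamma> \<bullet> \<theta> > 0"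
proof -
 let ?B = "\<Phi> - {\<theta>, - \<theta>}"
 have "?B \<noteq> {}"
 proof
  assume "?B = {}"
  hence "\<Phi> \<subseteq> span {\<theta>}" using span_base[of \<theta> "{\<theta>}"] span_neg[of \<theta> "{\<theta>}"] by blast
  hence "span {\<theta>} = UNIV" using span_roots by (metis span_minimal subspace_span top.extremum_unique)
  hence "DIM('e) \<le> 1" using dim_le_card'[of "{\<theta>}"] by (metis card.empty card.insert_remove card_insert_disjoint dim_UNIV dim_span empty_iff finite.emptyI finite_insert One_nat_def)
  thus False using rank by simp
 qed
 moreover have "{\<theta>, - \<theta>} \<union> ?B = \<Phi>" using assms by auto
 ultimately obtain \<alpha> \<gamma> where "\<alpha> \<in> {\<theta>, - \<theta>}" "\<gamma> \<in> ?B" "\<alpha> \<bullet> \<gamma> \<noteq> 0"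
  using irreducible unfolding irreducible_root_system_def by (metis Diff_disjoint insert_not_empty)
 hence g: "\<gamma> \<in> \<Phi>" "\<gamma> \<noteq> \<theta>" "\<gamma> \<noteq> - \<theta>" "\<gamma> \<bullet> \<theta> \<noteq> 0" by (auto simp: inner_commute)
 show ?thesis
 proof (cases "\<gamma> \<bullet> \<theta> > 0")
  case False
  moreover have "- \<gamma> \<noteq> \<theta>" using g by auto
  ultimately show ?thesis using g that[of "- \<gamma>"] by auto
 qed (use g that in blast)
qed

lemma ex_degree_one:
 assumes "long \<theta>"
 obtains \<gamma> where "\<gamma> \<in> \<Phi>" "ci \<gamma> \<theta> = 1"
proof -
 obtain \<gamma> where g: "\<gamma> \<in> \<Phi>" "\<gamma> \<noteq> \<theta>" "\<gamma> \<noteq> - \<theta>" "\<gamma> \<bullet> \<theta> > 0"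
  using ex_nonorthogonal long_root[OF assms] by blast
 hence "ci \<gamma> \<theta> > 0" using ci_pos long_root[OF assms] by simp
 thus ?thesis using ci_long[OF assms g(1-3)] that[OF g(1)] by linarith
qed

end


section \<open>Root matrices and weights\<close>

lemma intertwine_mult:
 "a * b = b' * a ==> a * c = c' * a ==> a * (b * c) = b' * c' * (a :: 'a::semigroup_mult)"
 by (metis mult.assoc)

text \<open>The matrices of a Chevalley basis, with the Lie algebra itself forgotten.
  \<open>H_lin\<close> keeps the fact that \<open>H\<close> depends linearly on the coroot.\<close>

locale chevalley_rep = irreducible_roots \<Phi> for \<Phi> :: "'e::euclidean_space set" +
 fixes \<Delta> :: "'e set" and E :: "'e \<Rightarrow> (complex, 'n::finite) smat" and H :: "'e \<Rightarrow> (complex, 'n) smat"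
 assumes base: "root_base \<Phi> \<Delta>"
  and H_def: "\<alpha> \<in> \<Phi> ==> H \<alpha> = E \<alpha> * E (- \<alpha>) - E (- \<alpha>) * E \<alpha>"
  and HE: "\<alpha> \<in> \<Phi> ==> \<beta> \<in> \<Phi> ==> H \<alpha> * E \<beta> - E \<beta> * H \<alpha> = of_real (cartan_number \<beta> \<alpha>) \<cdot> E \<beta>"
  and HH: "\<alpha> \<in> \<Phi> ==> \<beta> \<in> \<Phi> ==> H \<alpha> * H \<beta> = H \<beta> * H \<alpha>"
  and H_lin: "\<alpha> \<in> \<Phi> ==> \<exists>c :: 'e \<Rightarrow> int. coroot \<alpha> = (\<Sum>\<delta>\<in>\<Delta>. of_int (c \<delta>) *\<^sub>R coroot \<delta>) \<and>
    H \<alpha> = (\<Sum>\<delta>\<in>\<Delta>. of_int (c \<delta>) \<cdot> H \<delta>)"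
  and EE: "\<alpha> \<in> \<Phi> ==> \<beta> \<in> \<Phi> ==> \<alpha> + \<beta> \<in> \<Phi> ==>
    (let r = Max {k :: nat. \<beta> - real k *\<^sub>R \<alpha> \<in> \<Phi>} in
     E \<alpha> * E \<beta> - E \<beta> * E \<alpha> = of_nat (r + 1) \<cdot> E (\<alpha> + \<beta>) \<or>
     E \<alpha> * E \<beta> - E \<beta> * E \<alpha> = (- of_nat (r + 1)) \<cdot> E (\<alpha> + \<beta>))"
  and EE_commute: "\<alpha> \<in> \<Phi> ==> \<beta> \<in> \<Phi> ==> \<alpha> + \<beta> \<notin> \<Phi> ==> \<alpha> + \<beta> \<noteq> 0 ==> E \<alpha> * E \<beta> = E \<beta> * E \<alpha>"
  and E_nonzero: "\<alpha> \<in> \<Phi> ==> E \<alpha> \<noteq> 0"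
  and E_divisible: "\<alpha> \<in> \<Phi> ==> divisible (E \<alpha>)"
begin

lemma base_subset: "\<Delta> \<subseteq> \<Phi>" and base_independent: "independent \<Delta>" and span_base_eq: "span \<Delta> = UNIV"
 using base by (auto simp: root_base_def)
lemma finite_base [simp]: "finite \<Delta>" by (rule finite_subset[OF base_subset finite_roots])

definition D :: "'e \<Rightarrow> nat \<Rightarrow> (int, 'n) smat" where "D \<alpha> = idp (E \<alpha>)"
abbreviation D1 :: "'e \<Rightarrow> ('r::comm_ring_1, 'n) smat" where "D1 \<alpha> \<equiv> oi (D \<alpha> (Suc 0))"

lemma oi_D: "\<alpha> \<in> \<Phi> ==> oi (D \<alpha> k) = dp (E \<alpha>) k" unfolding D_def by (rule oi_idp[OF E_divisible])
lemma oi_D1 [simp]: "\<alpha> \<in> \<Phi> ==> D1 \<alpha> = E \<alpha>" by (simp add: oi_D)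
lemma dps_D: "\<alpha> \<in> \<Phi> ==> dps (D \<alpha>)" unfolding D_def by (rule dps_idp[OF E_divisible])
lemma D_0 [simp]: "\<alpha> \<in> \<Phi> ==> D \<alpha> 0 = 1" using dps_D by (simp add: dps_def)

lemma sl2: "\<alpha> \<in> \<Phi> ==> sl2_triple (E \<alpha>) (E (- \<alpha>)) (H \<alpha>)"
proof
 assume a: "\<alpha> \<in> \<Phi>"
 thus "E \<alpha> * E (- \<alpha>) - E (- \<alpha>) * E \<alpha> = H \<alpha>" by (simp add: H_def)
 show "H \<alpha> * E \<alpha> - E \<alpha> * H \<alpha> = 2 * E \<alpha>" using HE[OF a a] a by (simp add: smul_numeral)
 show "H \<alpha> * E (- \<alpha>) - E (- \<alpha>) * H \<alpha> = - (2 * E (- \<alpha>))"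
  using HE[OF a, of "- \<alpha>"] a by (simp add: smul_numeral)
qed (simp_all add: E_divisible)

definition P :: "'e \<Rightarrow> int \<Rightarrow> (int, 'n) smat" where "P \<alpha> = wproj (D \<alpha>) (D (- \<alpha>))"
abbreviation Ps :: "('e \<Rightarrow> int) \<Rightarrow> 'e list \<Rightarrow> (int, 'n) smat" where
 "Ps k xs \<equiv> prod_list (map (\<lambda>\<alpha>. P \<alpha> (k \<alpha>)) xs)"

context
 fixes \<alpha> assumes a: "\<alpha> \<in> \<Phi>"
begin
lemma H_P: "H \<alpha> * oi (P \<alpha> m) = of_int m \<cdot> oi (P \<alpha> m)" unfolding P_def D_def by (rule sl2_triple.H_P[OF sl2[OF a]])
lemma P_H: "oi (P \<alpha> m) * H \<alpha> = of_int m \<cdot> oi (P \<alpha> m)" unfolding P_def D_def by (rule sl2_triple.P_H[OF sl2[OF a]])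
lemma P_idem: "P \<alpha> m * P \<alpha> k = (if m = k then P \<alpha> m else 0)" unfolding P_def D_def by (rule sl2_triple.P_idem[OF sl2[OF a]])
lemma P_sum: "(\<Sum>m\<in>weight_range (E \<alpha>). P \<alpha> m) = 1" unfolding P_def D_def by (rule sl2_triple.P_sum[OF sl2[OF a]])
lemma P_out: "m \<notin> weight_range (E \<alpha>) ==> P \<alpha> m = 0" unfolding P_def D_def by (rule sl2_triple.P_out[OF sl2[OF a]])
lemma H_nonzero: "H \<alpha> \<noteq> 0"
proof
 assume "H \<alpha> = 0"
 thus False using HE[OF a a] a E_nonzero[OF a] by simp
qed
lemma D_primitive: "\<exists>c :: 'n \<Rightarrow> 'n \<Rightarrow> int. (\<Sum>i\<in>UNIV. \<Sum>j\<in>UNIV. c i j * ent (D \<alpha> 1) i j) = 1"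
 unfolding D_def by (rule sl2_triple.primitive[OF sl2[OF a] H_nonzero]) blast
end

text \<open>\<open>P \<alpha> k * X * P \<alpha> m\<close> is an eigenvector for multiplication by
  \<open>H \<alpha>\<close> from either side; comparing eigenvalues leaves only k = m + c.\<close>

lemma shift_P:
 assumes a: "\<alpha> \<in> \<Phi>" and X: "H \<alpha> * X - X * H \<alpha> = of_int c \<cdot> X"
 shows "X * oi (P \<alpha> m) = oi (P \<alpha> (m + c)) * X"
proof -
 let ?p = "\<lambda>m. oi (P \<alpha> m) :: (complex, 'n) smat" and ?M = "weight_range (E \<alpha>)"
 have z: "?p k * X * ?p m = 0" if "k \<noteq> m + c" for k m
 proof -
  have "?p k * (H \<alpha> * X - X * H \<alpha>) * ?p m = (?p k * H \<alpha>) * X * ?p m - ?p k * X * (H \<alpha> * ?p m)"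
   by (simp add: algebra_simps)
  also have "\<dots> = of_int (k - m) \<cdot> (?p k * X * ?p m)"
   by (simp add: P_H[OF a] H_P[OF a] smul_diff_left)
  finally have "of_int c \<cdot> (?p k * X * ?p m) = (of_int (k - m) :: complex) \<cdot> (?p k * X * ?p m)"
   unfolding X by simp
  hence "of_int (k - m - c) \<cdot> (?p k * X * ?p m) = (0 :: (complex, 'n) smat)"
   by (simp add: smul_diff_left)
  moreover have "complex_of_int (k - m - c) \<noteq> 0" using that by (simp only: of_int_eq_0_iff)
  ultimately show ?thesis by (simp only: smul_eq_0) blast
 qed
 have s: "(\<Sum>k\<in>?M. ?p k) = 1" using P_sum[OF a] by (metis oi_sum oi_1)
 have out: "?p k = 0" if "k \<notin> ?M" for k using P_out[OF a that] by simp
 have "X * ?p m = (\<Sum>k\<in>?M. ?p k * X * ?p m)" by (simp add: sum_distrib_right[symmetric] s)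
 also have "\<dots> = (\<Sum>k\<in>?M. if k = m + c then ?p (m + c) * X * ?p m else 0)"
  by (intro sum.cong refl) (auto simp: z)
 also have "\<dots> = ?p (m + c) * X * ?p m" using out by auto
 finally have 1: "X * ?p m = ?p (m + c) * X * ?p m" .
 have "?p (m + c) * X = (\<Sum>k\<in>?M. ?p (m + c) * X * ?p k)"
  by (simp add: sum_distrib_left[symmetric] s)
 also have "\<dots> = (\<Sum>k\<in>?M. if k = m then ?p (m + c) * X * ?p m else 0)"
  by (intro sum.cong refl) (auto simp: z)
 also have "\<dots> = ?p (m + c) * X * ?p m" using out by auto
 finally show ?thesis using 1 by simp
qed

lemma H_P_commute: "\<alpha> \<in> \<Phi> ==> \<beta> \<in> \<Phi> ==> H \<beta> * oi (P \<alpha> m) = oi (P \<alpha> m) * H \<beta>"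
 using shift_P[of \<alpha> "H \<beta>" 0 m] HH[of \<alpha> \<beta>] by simp

lemma P_commute: "\<alpha> \<in> \<Phi> ==> \<beta> \<in> \<Phi> ==> P \<alpha> m * P \<beta> k = P \<beta> k * P \<alpha> m"
 using shift_P[of \<beta> "oi (P \<alpha> m)" 0 k] H_P_commute[of \<alpha> \<beta> m]
 by (intro oi_inj[where 'a = complex]) (simp add: oi_mult)

section \<open>Weights and the projectors onto their spaces\<close>

definition cint :: "'e \<Rightarrow> 'e \<Rightarrow> int" where "cint \<mu> \<alpha> = \<lfloor>ci \<mu> \<alpha>\<rfloor>"

definition integral_weight :: "'e \<Rightarrow> bool" where
 "integral_weight \<mu> \<longleftrightarrow> (\<forall>\<alpha>\<in>\<Phi>. ci \<mu> \<alpha> \<in> \<int>)"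

lemma cint: "integral_weight \<mu> ==> \<alpha> \<in> \<Phi> ==> of_int (cint \<mu> \<alpha>) = ci \<mu> \<alpha>"
 unfolding integral_weight_def cint_def by (metis Ints_cases floor_of_int)
lemma root_integral: "\<alpha> \<in> \<Phi> ==> integral_weight \<alpha>"
 unfolding integral_weight_def using ci_Ints by blast
lemma integral_weight_add: "integral_weight \<mu> ==> integral_weight \<nu> ==> integral_weight (\<mu> + \<nu>)"
 unfolding integral_weight_def by (auto simp: ci_add)
lemma integral_weight_minus: "integral_weight \<mu> ==> integral_weight (- \<mu>)"
 unfolding integral_weight_def by auto
lemma integral_weight_add_iff: "integral_weight \<nu> ==> integral_weight (\<mu> + \<nu>) \<longleftrightarrow> integral_weight \<mu>"
 using integral_weight_add[of \<mu> \<nu>] integral_weight_add[of "\<mu> + \<nu>" "- \<nu>"] integral_weight_minus by auto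
lemma cint_add: "integral_weight \<mu> ==> integral_weight \<nu> ==> \<alpha> \<in> \<Phi> ==>
  cint (\<mu> + \<nu>) \<alpha> = cint \<mu> \<alpha> + cint \<nu> \<alpha>"
 by (metis cint integral_weight_add ci_add of_int_add of_int_eq_iff)

definition roots_list :: "'e list" where "roots_list = (SOME xs. set xs = \<Phi>)"
lemma set_roots_list: "set roots_list = \<Phi>"
 unfolding roots_list_def by (rule someI_ex) (rule finite_list, simp)

text \<open>The projector onto the weight space of weight \<open>\<mu>\<close>.\<close>

definition pr :: "'e \<Rightarrow> (int, 'n) smat" where
 "pr \<mu> = (if integral_weight \<mu> then Ps (cint \<mu>) roots_list else 0)"
abbreviation opr :: "'e \<Rightarrow> ('r::comm_ring_1, 'n) smat" where "opr \<mu> \<equiv> oi (pr \<mu>)"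

definition Wt :: "'e set" where "Wt = {\<mu>. pr \<mu> \<noteq> 0}"

lemma pr_zero: "\<mu> \<notin> Wt ==> pr \<mu> = 0" by (simp add: Wt_def)

lemma Wt_integral: "\<mu> \<in> Wt ==> integral_weight \<mu>" by (auto simp: Wt_def pr_def split: if_splits)

lemma P_prod_commute: "\<alpha> \<in> \<Phi> ==> set xs \<subseteq> \<Phi> ==>
 P \<alpha> m * Ps k xs = Ps k xs * P \<alpha> m"
proof (induction xs)
 case (Cons b xs)
 hence "P \<alpha> m * P b (k b) = P b (k b) * P \<alpha> m" using P_commute by simp
 thus ?case using Cons by (simp add: intertwine_mult)
qed simp

lemma P_prod: "\<alpha> \<in> set xs ==> set xs \<subseteq> \<Phi> ==>
 P \<alpha> m * Ps k xs =
 (if m = k \<alpha> then Ps k xs else 0)"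
proof (induction xs)
 case (Cons b xs)
 show ?case
 proof (cases "b = \<alpha>")
  case True
  thus ?thesis using Cons.prems by (simp add: mult.assoc[symmetric] P_idem)
 next
  case False
  hence "P \<alpha> m * (P b (k b) * Ps k xs) =
    P b (k b) * (P \<alpha> m * Ps k xs)"
   using Cons.prems P_commute[of \<alpha> b m "k b"] by (auto simp: mult.assoc[symmetric])
  thus ?thesis using Cons False by auto
 qed
qed simp

lemma P_pr: "\<alpha> \<in> \<Phi> ==> P \<alpha> m * pr \<mu> = (if m = cint \<mu> \<alpha> then pr \<mu> else 0)"
 unfolding pr_def using P_prod[of \<alpha> roots_list m "cint \<mu>"] by (auto simp: set_roots_list)

lemma pr_P: "\<alpha> \<in> \<Phi> ==> pr \<mu> * P \<alpha> m = (if m = cint \<mu> \<alpha> then pr \<mu> else 0)"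
proof -
 assume a: "\<alpha> \<in> \<Phi>"
 have "pr \<mu> * P \<alpha> m = P \<alpha> m * pr \<mu>"
  using P_prod_commute[OF a, of roots_list m "cint \<mu>"] by (simp add: pr_def set_roots_list)
 thus ?thesis by (simp add: P_pr[OF a])
qed

lemma H_pr:
 assumes "\<alpha> \<in> \<Phi>" shows "H \<alpha> * opr \<mu> = of_real (ci \<mu> \<alpha>) \<cdot> opr \<mu>"
proof (cases "integral_weight \<mu>")
 case True
 have "opr \<mu> = oi (P \<alpha> (cint \<mu> \<alpha>)) * (opr \<mu> :: (complex, 'n) smat)"
  using P_pr[OF assms, of "cint \<mu> \<alpha>" \<mu>] by (metis oi_mult)
 hence "H \<alpha> * opr \<mu> = of_int (cint \<mu> \<alpha>) \<cdot> opr \<mu>"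
  using H_P[OF assms, of "cint \<mu> \<alpha>"] by (metis mult.assoc smul_mult_left)
 thus ?thesis using cint[OF True assms] by (metis of_real_of_int_eq)
qed (simp add: pr_def)

lemma pr_H:
 assumes "\<alpha> \<in> \<Phi>" shows "opr \<mu> * H \<alpha> = of_real (ci \<mu> \<alpha>) \<cdot> opr \<mu>"
proof (cases "integral_weight \<mu>")
 case True
 have "opr \<mu> = opr \<mu> * (oi (P \<alpha> (cint \<mu> \<alpha>)) :: (complex, 'n) smat)"
  using pr_P[OF assms, of \<mu> "cint \<mu> \<alpha>"] by (metis oi_mult)
 hence "opr \<mu> * H \<alpha> = of_int (cint \<mu> \<alpha>) \<cdot> opr \<mu>"
  using P_H[OF assms, of "cint \<mu> \<alpha>"] by (metis mult.assoc smul_mult_right)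
 thus ?thesis using cint[OF True assms] by (metis of_real_of_int_eq)
qed (simp add: pr_def)

lemma pr_idem: "pr \<mu> * pr \<nu> = (if \<mu> = \<nu> then pr \<mu> else 0)"
proof (cases "integral_weight \<mu> \<and> integral_weight \<nu>")
 case True
 show ?thesis
 proof (cases "\<mu> = \<nu>")
  case True
  have "Ps (cint \<nu>) xs * pr \<nu> = pr \<nu>" if "set xs \<subseteq> \<Phi>" for xs
   using that by (induction xs) (simp_all add: mult.assoc P_pr)
  moreover have "Ps (cint \<nu>) roots_list = pr \<nu>"
   using \<open>integral_weight \<mu> \<and> integral_weight \<nu>\<close> by (simp add: pr_def)
  ultimately have "pr \<nu> * pr \<nu> = pr \<nu>" using set_roots_list by (metis order_refl)
  thus ?thesis using True by simp
 next
  case False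
  then obtain \<alpha> where a: "\<alpha> \<in> \<Phi>" "ci \<mu> \<alpha> \<noteq> ci \<nu> \<alpha>" using ci_separates[of \<Phi> \<mu> \<nu>] span_roots by blast
  hence "cint \<mu> \<alpha> \<noteq> cint \<nu> \<alpha>" using True cint by metis
  hence "pr \<mu> * P \<alpha> (cint \<mu> \<alpha>) * pr \<nu> = 0" using a by (simp add: mult.assoc P_pr)
  thus ?thesis using False a by (simp add: pr_P)
 qed
qed (auto simp: pr_def)

lemma finite_Wt [simp]: "finite Wt"
proof (rule finite_imageD)
 let ?f = "\<lambda>\<mu>. restrict (cint \<mu>) \<Phi>"
 show "inj_on ?f Wt"
 proof (rule inj_onI)
  fix \<mu> \<nu> assume m: "\<mu> \<in> Wt" "\<nu> \<in> Wt" "?f \<mu> = ?f \<nu>"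
  have "ci \<mu> \<alpha> = ci \<nu> \<alpha>" if "\<alpha> \<in> \<Phi>" for \<alpha>
   using fun_cong[OF m(3), of \<alpha>] that cint Wt_integral m by (metis restrict_apply)
  thus "\<mu> = \<nu>" using ci_separates[of \<Phi>] span_roots by blast
 qed
 have "?f ` Wt \<subseteq> (\<Pi>\<^sub>E \<alpha>\<in>\<Phi>. weight_range (E \<alpha>))"
 proof (rule image_subsetI, rule PiE_I)
  fix \<mu> \<alpha> assume m: "\<mu> \<in> Wt" "\<alpha> \<in> \<Phi>"
  hence "P \<alpha> (cint \<mu> \<alpha>) \<noteq> 0" using P_pr[of \<alpha> "cint \<mu> \<alpha>" \<mu>] by (auto simp: Wt_def)
  thus "?f \<mu> \<alpha> \<in> weight_range (E \<alpha>)" using P_out m by (metis restrict_apply')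
 qed auto
 thus "finite (?f ` Wt)" by (rule finite_subset) (auto intro: finite_PiE)
qed

text \<open>The vector \<open>\<mu>\<close> is determined by the eigenvalues on the base, and it
  fits the other roots because \<open>coroot \<alpha>\<close> and \<open>H \<alpha>\<close> have the
  same integral expansion over the base.\<close>

lemma weight_exists:
 fixes k :: "'e \<Rightarrow> complex" and Y :: "(complex, 'n) smat"
 assumes Y: "Y \<noteq> 0" and k: "\<And>\<alpha>. \<alpha> \<in> \<Phi> ==> H \<alpha> * Y = of_int (m \<alpha>) \<cdot> Y"
 obtains \<mu> where "\<And>\<alpha>. \<alpha> \<in> \<Phi> ==> ci \<mu> \<alpha> = of_int (m \<alpha>)"
proof -
 \<comment> \<open>The values are scaled so that the vector representing \<open>g\<close> pairs with
   the coroot of \<open>\<delta>\<close> to \<open>m \<delta>\<close>.\<close>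
 obtain g :: "'e \<Rightarrow> real" where g: "linear g" "\<And>\<delta>. \<delta> \<in> \<Delta> ==> g \<delta> = of_int (m \<delta>) * (\<delta> \<bullet> \<delta>) / 2"
  using linear_independent_extend[OF base_independent, of "\<lambda>\<delta>. of_int (m \<delta>) * (\<delta> \<bullet> \<delta>) / 2"] by blast
 define \<mu> where "\<mu> = (\<Sum>b\<in>Basis. g b *\<^sub>R b)"
 have gm: "\<mu> \<bullet> v = g v" for v
 proof -
  have "g v = g (\<Sum>b\<in>Basis. (v \<bullet> b) *\<^sub>R b)" by (simp add: euclidean_representation)
  also have "\<dots> = (\<Sum>b\<in>Basis. (v \<bullet> b) * g b)"
   using g(1) by (simp add: linear_sum linear_cmul)
  also have "\<dots> = \<mu> \<bullet> v" unfolding \<mu>_def inner_sum_left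
   by (intro sum.cong refl) (simp add: inner_commute mult.commute)
  finally show ?thesis by simp
 qed
 have d: "\<mu> \<bullet> coroot \<delta> = of_int (m \<delta>)" if "\<delta> \<in> \<Delta>" for \<delta>
 proof -
  have "\<delta> \<in> \<Phi>" using that base_subset by blast
  hence "\<delta> \<bullet> \<delta> \<noteq> 0" by simp
  thus ?thesis unfolding coroot_def gm linear_cmul[OF g(1)] g(2)[OF that] by simp
 qed
 show ?thesis
 proof (rule that[of \<mu>])
  fix \<alpha> assume a: "\<alpha> \<in> \<Phi>"
  obtain c :: "'e \<Rightarrow> int" where c: "coroot \<alpha> = (\<Sum>\<delta>\<in>\<Delta>. of_int (c \<delta>) *\<^sub>R coroot \<delta>)"
    "H \<alpha> = (\<Sum>\<delta>\<in>\<Delta>. of_int (c \<delta>) \<cdot> H \<delta>)" using H_lin[OF a] by blast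
  have "H \<alpha> * Y = (\<Sum>\<delta>\<in>\<Delta>. of_int (c \<delta> * m \<delta>) \<cdot> Y)"
   unfolding c(2) sum_distrib_right using base_subset k by (intro sum.cong refl) auto
  also have "\<dots> = of_int (\<Sum>\<delta>\<in>\<Delta>. c \<delta> * m \<delta>) \<cdot> Y" by (simp add: smul_sum_left)
  finally have "of_int (m \<alpha> - (\<Sum>\<delta>\<in>\<Delta>. c \<delta> * m \<delta>)) \<cdot> Y = (0 :: (complex, 'n) smat)"
   using k[OF a] by (simp add: smul_diff_left)
  hence "m \<alpha> = (\<Sum>\<delta>\<in>\<Delta>. c \<delta> * m \<delta>)" using Y by (metis smul_eq_0 of_int_eq_0_iff eq_iff_diff_eq_0)
  thus "ci \<mu> \<alpha> = of_int (m \<alpha>)"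
   unfolding ci_coroot c(1) inner_sum_right using d by simp
 qed
qed

text \<open>If something were left over, a nonzero part of it would lie in a joint eigenspace of all
  \<open>H \<alpha>\<close>. Its eigenvalues come from a weight, and the projector of that weight
  kills the leftover.\<close>

lemma sum_pr: "(\<Sum>\<mu>\<in>Wt. pr \<mu>) = 1"
proof (rule ccontr)
 assume ne: "(\<Sum>\<mu>\<in>Wt. pr \<mu>) \<noteq> 1"
 define X where "X = 1 - (\<Sum>\<mu>\<in>Wt. pr \<mu>)"
 have prX: "pr \<mu> * X = 0" for \<mu>
 proof -
  have "pr \<mu> * (\<Sum>\<mu>\<in>Wt. pr \<mu>) = (\<Sum>\<nu>\<in>Wt. if \<mu> = \<nu> then pr \<mu> else 0)"
   by (simp add: sum_distrib_left pr_idem)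
  also have "\<dots> = pr \<mu>" using pr_zero by auto
  finally show ?thesis by (simp add: X_def right_diff_distrib)
 qed
 \<comment> \<open>Eigenvalues are chosen root by root so that the product of projectors does not
   kill \<open>X\<close>.\<close>
 have "\<exists>k. Ps k xs * X \<noteq> 0" if "set xs \<subseteq> \<Phi>" "distinct xs" for xs
  using that
 proof (induction xs)
  case Nil thus ?case using ne by (simp add: X_def)
 next
  case (Cons a xs)
  then obtain k where k: "Ps k xs * X \<noteq> 0" by auto
  let ?Y = "Ps k xs * X"
  have "\<exists>m. P a m * ?Y \<noteq> 0"
  proof (rule ccontr)
   assume "\<not> ?thesis"
   hence "(\<Sum>m\<in>weight_range (E a). P a m) * ?Y = 0" by (simp add: sum_distrib_right)
   thus False using k P_sum[of a] Cons.prems by simp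
  qed
  then obtain m where m: "P a m * ?Y \<noteq> 0" by blast
  have "map (\<lambda>\<alpha>. P \<alpha> ((k(a := m)) \<alpha>)) xs = map (\<lambda>\<alpha>. P \<alpha> (k \<alpha>)) xs"
   using Cons.prems by auto
  thus ?case using m by (intro exI[of _ "k(a := m)"]) (simp add: mult.assoc del: fun_upd_apply map_eq_conv, simp)
 qed
 moreover obtain xs where xs: "set xs = \<Phi>" "distinct xs" using finite_distinct_list[of \<Phi>] by auto
 ultimately obtain k where k: "Ps k xs * X \<noteq> 0" by (metis order_refl)
 define Q where "Q = Ps k xs"
 have PQ: "P \<alpha> (k \<alpha>) * Q = Q" if "\<alpha> \<in> \<Phi>" for \<alpha>
  using P_prod[of \<alpha> xs "k \<alpha>" k] that xs by (simp add: Q_def)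
 have "H \<alpha> * oi (Q * X) = of_int (k \<alpha>) \<cdot> oi (Q * X)" if "\<alpha> \<in> \<Phi>" for \<alpha>
 proof -
  have "oi (P \<alpha> (k \<alpha>)) * oi (Q * X) = (oi (Q * X) :: (complex, 'n) smat)"
   by (simp only: oi_mult[symmetric] mult.assoc[symmetric] PQ[OF that])
  thus ?thesis
   using mult.assoc[of "H \<alpha>" "oi (P \<alpha> (k \<alpha>))" "oi (Q * X)"] H_P[OF that, of "k \<alpha>"] by simp
 qed
 moreover have "oi (Q * X) \<noteq> (0 :: (complex, 'n) smat)" using k oi_inj[where 'a = complex] unfolding Q_def by (metis oi_0)
 ultimately obtain \<mu> where \<mu>: "\<And>\<alpha>. \<alpha> \<in> \<Phi> ==> ci \<mu> \<alpha> = of_int (k \<alpha>)" using weight_exists by metis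
 have i: "integral_weight \<mu>" using \<mu> by (simp add: integral_weight_def)
 have c: "cint \<mu> \<alpha> = k \<alpha>" if "\<alpha> \<in> \<Phi>" for \<alpha> using \<mu>[OF that] by (simp add: cint_def)
 have "pr \<mu> * Q = Q"
 proof -
  have "Ps (cint \<mu>) ys * Q = Q" if "set ys \<subseteq> \<Phi>" for ys
   using that by (induction ys) (simp_all add: mult.assoc PQ c)
  moreover have "Ps (cint \<mu>) roots_list = pr \<mu>" using i by (simp add: pr_def)
  ultimately show ?thesis using set_roots_list by (metis order_refl)
 qed
 moreover have "Q * pr \<mu> = pr \<mu> * Q"
 proof -
  have "Ps k ys * pr \<mu> = pr \<mu> * Ps k ys" if "set ys \<subseteq> \<Phi>" for ys using that
  proof (induction ys)
   case (Cons y ys)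
   hence "P y (k y) * pr \<mu> = pr \<mu> * P y (k y)" by (auto simp: P_pr pr_P)
   moreover have "Ps k ys * pr \<mu> =
     pr \<mu> * Ps k ys" using Cons by simp
   ultimately show ?case
    using intertwine_mult[OF sym sym, of "P y (k y)" "pr \<mu>" "P y (k y)"] by simp
  qed simp
  thus ?thesis using xs by (simp add: Q_def)
 qed
 ultimately have "Q * X = Q * (pr \<mu> * X)" by (metis mult.assoc)
 thus False using k prX by (simp add: Q_def)
qed

lemma E_pr: "\<gamma> \<in> \<Phi> ==> E \<gamma> * opr \<mu> = opr (\<mu> + \<gamma>) * E \<gamma>"
proof (cases "integral_weight \<mu>")
 case True
 assume g: "\<gamma> \<in> \<Phi>"
 have i: "integral_weight (\<mu> + \<gamma>)" using True g integral_weight_add root_integral by blast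
 have "E \<gamma> * oi (Ps (cint \<mu>) xs) =
   oi (Ps (cint (\<mu> + \<gamma>)) xs) * E \<gamma>" if "set xs \<subseteq> \<Phi>" for xs
  using that
 proof (induction xs)
  case (Cons a xs)
  hence a: "a \<in> \<Phi>" by simp
  have "H a * E \<gamma> - E \<gamma> * H a = of_int (cint \<gamma> a) \<cdot> E \<gamma>"
   using HE[OF a g] cint[OF root_integral[OF g] a] by (metis of_real_of_int_eq)
  hence "E \<gamma> * oi (P a (cint \<mu> a)) = oi (P a (cint (\<mu> + \<gamma>) a)) * E \<gamma>"
   using shift_P[OF a] cint_add[OF True root_integral[OF g] a] by simp
  with Cons show ?case by (simp add: oi_mult intertwine_mult)
 qed simp
 thus ?thesis using True i set_roots_list by (simp add: pr_def)
next
 case False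
 assume g: "\<gamma> \<in> \<Phi>"
 thus ?thesis using False integral_weight_add_iff[OF root_integral[OF g], of \<mu>] by (simp add: pr_def)
qed

lemma D_pr:
 assumes "\<gamma> \<in> \<Phi>" shows "D \<gamma> k * pr \<mu> = pr (\<mu> + real k *\<^sub>R \<gamma>) * D \<gamma> k"
proof (rule oi_inj[where 'a = complex])
 have "E \<gamma> ^ k * opr \<mu> = opr (\<mu> + real k *\<^sub>R \<gamma>) * E \<gamma> ^ k" for \<mu>
 proof (induction k)
  case (Suc k)
  have "E \<gamma> ^ Suc k * opr \<mu> = E \<gamma> * opr (\<mu> + real k *\<^sub>R \<gamma>) * E \<gamma> ^ k"
   by (simp add: mult.assoc Suc)
  also have "\<dots> = opr (\<mu> + real k *\<^sub>R \<gamma> + \<gamma>) * E \<gamma> ^ Suc k"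
   by (simp add: E_pr[OF assms] mult.assoc)
  also have "\<mu> + real k *\<^sub>R \<gamma> + \<gamma> = \<mu> + real (Suc k) *\<^sub>R \<gamma>" by (simp add: scaleR_left_distrib)
  finally show ?case .
 qed simp
 thus "oi (D \<gamma> k * pr \<mu>) = (oi (pr (\<mu> + real k *\<^sub>R \<gamma>) * D \<gamma> k) :: (complex, 'n) smat)"
  by (simp add: oi_mult oi_D[OF assms] dp_def)
qed

end


section \<open>Gradings by projectors\<close>

text \<open>One calculus of homogeneous components for two gradings: by weights, with the projectors
  \<open>pr\<close>, and by integers, with the projectors \<open>P \<theta>\<close>.\<close>

locale grading =
 fixes p :: "'i::ab_group_add \<Rightarrow> (int, 'n::finite) smat" and I :: "'i set"
 assumes finite_index [simp]: "finite I"
  and p_idem: "p i * p j = (if i = j then p i else 0)"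
  and p_sum: "(\<Sum>i\<in>I. p i) = 1"
  and p_zero: "i \<notin> I ==> p i = 0"
begin

abbreviation q :: "'i \<Rightarrow> ('r::comm_ring_1, 'n) smat" where "q i \<equiv> oi (p i)"

lemma q_idem: "q i * q j = (if i = j then q i else 0)"
 using p_idem[of i j] by (simp add: oi_mult[symmetric])
lemma q_idem_left: "q i * (q j * X) = (if i = j then q i * X else 0)"
 by (simp add: mult.assoc[symmetric] q_idem)
lemma q_sum: "(\<Sum>i\<in>I. q i) = 1" using p_sum by (metis oi_sum oi_1)
lemma q_zero: "i \<notin> I ==> q i = 0" using p_zero by simp

definition hom :: "'i \<Rightarrow> ('r::comm_ring_1, 'n) smat \<Rightarrow> bool" where
 "hom v X \<longleftrightarrow> (\<forall>i. X * q i = q (i + v) * X)"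

definition cmp :: "'i \<Rightarrow> ('r::comm_ring_1, 'n) smat \<Rightarrow> ('r, 'n) smat" where
 "cmp v X = (\<Sum>i\<in>I. q (i + v) * X * q i)"

lemma homD: "hom v X ==> X * q i = q (i + v) * X" by (simp add: hom_def)

lemma hom_0 [simp]: "hom v 0" by (simp add: hom_def)
lemma hom_1 [simp]: "hom 0 1" by (simp add: hom_def)
lemma hom_add: "hom v X ==> hom v Y ==> hom v (X + Y)" by (simp add: hom_def algebra_simps)
lemma hom_diff: "hom v X ==> hom v Y ==> hom v (X - Y)" by (simp add: hom_def algebra_simps)
lemma hom_smul: "hom v X ==> hom v (a \<cdot> X)" by (simp add: hom_def)
lemma hom_sum: "(\<And>x. x \<in> S ==> hom v (f x)) ==> hom v (\<Sum>x\<in>S. f x)"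
 by (induction S rule: infinite_finite_induct) (auto intro: hom_add)
lemma hom_mult: "hom v X ==> hom w Y ==> hom (v + w) (X * Y)" unfolding hom_def
proof (intro allI)
 fix i assume h: "\<forall>i. X * q i = q (i + v) * X" "\<forall>i. Y * q i = q (i + w) * Y"
 have "X * Y * q i = X * q (i + w) * Y" using h(2) by (simp add: mult.assoc)
 also have "\<dots> = q (i + w + v) * (X * Y)" using h(1) by (simp add: mult.assoc)
 finally show "X * Y * q i = q (i + (v + w)) * (X * Y)" by (simp add: ac_simps)
qed

lemma cmp_0 [simp]: "cmp v 0 = 0" by (simp add: cmp_def)
lemma cmp_add: "cmp v (X + Y) = cmp v X + cmp v Y" by (simp add: cmp_def algebra_simps sum.distrib)
lemma cmp_diff: "cmp v (X - Y) = cmp v X - cmp v Y"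
 by (simp add: cmp_def algebra_simps sum_subtractf)
lemma cmp_minus: "cmp v (- X) = - cmp v X" by (simp add: cmp_def sum_negf)
lemma cmp_smul: "cmp v (a \<cdot> X) = a \<cdot> cmp v X" by (simp add: cmp_def smul_sum_right)
lemma cmp_sum: "cmp v (\<Sum>x\<in>S. f x) = (\<Sum>x\<in>S. cmp v (f x))"
 by (induction S rule: infinite_finite_induct) (auto simp: cmp_add)

lemma cmp_hom: assumes "hom v X" shows "cmp w X = (if w = v then X else 0)"
proof -
 have "q (i + w) * X * q i = (if w = v then X * q i else 0)" for i
 proof -
  have "q (i + w) * X * q i = q (i + w) * (q (i + v) * X)"
   using homD[OF assms] by (simp add: mult.assoc)
  thus ?thesis by (simp add: q_idem_left homD[OF assms])
 qed
 hence "cmp w X = (\<Sum>i\<in>I. if w = v then X * q i else 0)" by (simp add: cmp_def)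
 thus ?thesis by (simp add: sum_distrib_left[symmetric] q_sum)
qed

lemma hom_cmp: "hom v (cmp v X)" unfolding hom_def cmp_def
proof
 fix j
 have 1: "(\<Sum>i\<in>I. q (i + v) * X * q i) * q j = (\<Sum>i\<in>I. if i = j then q (j + v) * X * q j else 0)"
  unfolding sum_distrib_right by (intro sum.cong refl) (auto simp: mult.assoc q_idem)
 have 2: "q (j + v) * (\<Sum>i\<in>I. q (i + v) * X * q i) = (\<Sum>i\<in>I. if i = j then q (j + v) * X * q j else 0)"
  unfolding sum_distrib_left by (intro sum.cong refl) (auto simp: mult.assoc q_idem_left)
 show "(\<Sum>i\<in>I. q (i + v) * X * q i) * q j = q (j + v) * (\<Sum>i\<in>I. q (i + v) * X * q i)"
  unfolding 1 2 ..
qed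

lemma cmp_mult_left: assumes "hom v X" shows "cmp w (X * Y) = X * cmp (w - v) Y"
proof -
 have "q (i + w) * (X * Y) * q i = X * (q (i + (w - v)) * Y * q i)" for i
 proof -
  have "X * q (i + (w - v)) = q (i + w) * X" using homD[OF assms, of "i + (w - v)"] by simp
  thus ?thesis by (metis mult.assoc)
 qed
 thus ?thesis by (simp add: cmp_def sum_distrib_left)
qed

text \<open>The sum is reindexed by a shift that does not preserve the finite index set; the
  projectors vanish outside it, so the excess terms are zero.\<close>

lemma cmp_mult_right: assumes "hom v Y" shows "cmp w (X * Y) = cmp (w - v) X * Y"
proof -
 let ?f = "\<lambda>i. q (i + w) * (X * Y) * q i"
 let ?S = "I \<union> (\<lambda>i. i - v) ` I"
 have f: "?f i = q (i + w) * X * q (i + v) * Y" for i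
  using homD[OF assms, of i] by (simp add: mult.assoc)
 have "cmp w (X * Y) = (\<Sum>i\<in>?S. ?f i)"
  unfolding cmp_def by (rule sum.mono_neutral_left) (auto simp: q_zero)
 also have "\<dots> = (\<Sum>i\<in>(\<lambda>i. i - v) ` I. ?f i)"
 proof (rule sum.mono_neutral_right)
  show "\<forall>i\<in>?S - (\<lambda>i. i - v) ` I. ?f i = 0"
  proof
   fix i assume "i \<in> ?S - (\<lambda>i. i - v) ` I"
   hence "i + v \<notin> I" by (metis DiffD2 add_diff_cancel_right' image_eqI)
   thus "?f i = 0" unfolding f by (simp add: q_zero)
  qed
 qed auto
 also have "\<dots> = (\<Sum>i\<in>I. ?f (i - v))" by (rule sum.reindex_cong[of "\<lambda>i. i - v"]) (auto simp: inj_on_def)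
 also have "\<dots> = (\<Sum>i\<in>I. q (i + (w - v)) * X * q i * Y)"
  unfolding f by (intro sum.cong refl) (simp add: algebra_simps)
 finally show ?thesis by (simp add: cmp_def sum_distrib_right)
qed

lemma cmp_expand: "X = (\<Sum>v\<in>(\<lambda>(i, j). i - j) ` (I \<times> I). cmp v X)"
proof -
 let ?D = "(\<lambda>(i, j). i - j) ` (I \<times> I)"
 have "(\<Sum>v\<in>?D. cmp v X) = (\<Sum>j\<in>I. \<Sum>v\<in>?D. q (j + v) * X * q j)"
  unfolding cmp_def by (rule sum.swap)
 also have "\<dots> = (\<Sum>j\<in>I. (\<Sum>i\<in>I. q i) * X * q j)"
 proof (intro sum.cong refl)
  fix j assume j: "j \<in> I"
  have "(\<Sum>i\<in>I. q i * X * q j) = (\<Sum>v\<in>(\<lambda>i. i - j) ` I. q (j + v) * X * q j)"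
   by (subst sum.reindex) (auto simp: inj_on_def)
  also have "\<dots> = (\<Sum>v\<in>?D. q (j + v) * X * q j)"
  proof (rule sum.mono_neutral_left)
   show "\<forall>v\<in>?D - (\<lambda>i. i - j) ` I. q (j + v) * X * q j = 0"
   proof
    fix v assume "v \<in> ?D - (\<lambda>i. i - j) ` I"
    hence "j + v \<notin> I" by (metis DiffD2 add_diff_cancel_left' image_eqI)
    thus "q (j + v) * X * q j = 0" by (simp add: q_zero)
   qed
  qed (use j in auto)
  finally show "(\<Sum>v\<in>?D. q (j + v) * X * q j) = (\<Sum>i\<in>I. q i) * X * q j"
   by (simp add: sum_distrib_right)
 qed
 also have "\<dots> = X" by (simp add: q_sum sum_distrib_left[symmetric])
 finally show ?thesis by simp
qed

lemma eq_by_cmp: "(\<And>v. cmp v X = cmp v Y) ==> X = Y"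
 using cmp_expand[of X] cmp_expand[of Y] by simp

end

section \<open>The Lie algebra inside the matrix algebra\<close>

context chevalley_rep begin

sublocale wt: grading pr Wt by unfold_locales (auto simp: pr_idem sum_pr pr_zero)

lemma hom_D: "\<gamma> \<in> \<Phi> ==> wt.hom (real k *\<^sub>R \<gamma>) (oi (D \<gamma> k))"
 unfolding wt.hom_def using D_pr[of \<gamma> k] by (metis oi_mult)
lemma hom_D1: "\<gamma> \<in> \<Phi> ==> wt.hom \<gamma> (D1 \<gamma>)" using hom_D[of \<gamma> "Suc 0"] by simp
lemma hom_E: "\<gamma> \<in> \<Phi> ==> wt.hom \<gamma> (E \<gamma>)" using hom_D1[of \<gamma>] by (metis oi_D1)
lemma hom_H: "\<gamma> \<in> \<Phi> ==> wt.hom 0 (H \<gamma>)"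
 unfolding wt.hom_def by (simp add: H_pr pr_H)

text \<open>Such coefficients exist because the root matrix is primitive,
  \<open>D_primitive\<close>.\<close>

definition phi_coeff :: "'e \<Rightarrow> 'n \<Rightarrow> 'n \<Rightarrow> int" where
 "phi_coeff \<gamma> = (SOME c. (\<Sum>i\<in>UNIV. \<Sum>j\<in>UNIV. c i j * ent (D \<gamma> 1) i j) = 1)"

text \<open>An integral linear functional reading off the coefficient of the root matrix of \<open>\<gamma>\<close>.\<close>

definition \<phi> :: "'e \<Rightarrow> ('r::comm_ring_1, 'n) smat \<Rightarrow> 'r" where
 "\<phi> \<gamma> X = (\<Sum>i\<in>UNIV. \<Sum>j\<in>UNIV. of_int (phi_coeff \<gamma> i j) * ent (wt.cmp \<gamma> X) i j)"

lemma phi_add: "\<phi> \<gamma> (X + Y) = \<phi> \<gamma> X + \<phi> \<gamma> Y"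
 by (simp add: \<phi>_def wt.cmp_add distrib_left sum.distrib)
lemma phi_minus: "\<phi> \<gamma> (- X) = - \<phi> \<gamma> X"
 by (simp add: \<phi>_def wt.cmp_minus sum_negf)
lemma phi_smul: "\<phi> \<gamma> (a \<cdot> X) = a * \<phi> \<gamma> X"
 by (simp add: \<phi>_def wt.cmp_smul sum_distrib_left mult.left_commute)
lemma phi_0 [simp]: "\<phi> \<gamma> 0 = 0" by (simp add: \<phi>_def)
lemma phi_sum: "\<phi> \<gamma> (\<Sum>x\<in>S. f x) = (\<Sum>x\<in>S. \<phi> \<gamma> (f x))"
 by (induction S rule: infinite_finite_induct) (auto simp: phi_add)
lemma phi_hom: "wt.hom v X ==> v \<noteq> \<gamma> ==> \<phi> \<gamma> X = 0"
 by (simp add: \<phi>_def wt.cmp_hom)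
lemma phi_D1: assumes "\<gamma> \<in> \<Phi>" shows "\<phi> \<gamma> (D1 \<gamma>) = 1"
proof -
 have "\<phi> \<gamma> (D1 \<gamma>) = of_int (\<Sum>i\<in>UNIV. \<Sum>j\<in>UNIV. phi_coeff \<gamma> i j * ent (D \<gamma> 1) i j)"
  by (simp add: \<phi>_def wt.cmp_hom[OF hom_D1[OF assms]])
 also have "(\<Sum>i\<in>UNIV. \<Sum>j\<in>UNIV. phi_coeff \<gamma> i j * ent (D \<gamma> 1) i j) = 1"
  unfolding phi_coeff_def by (rule someI_ex[OF D_primitive[OF assms]])
 finally show ?thesis by simp
qed
lemma phi_E: "\<gamma> \<in> \<Phi> ==> \<phi> \<gamma> (E \<gamma>) = 1" using phi_D1[of \<gamma>] by (metis oi_D1)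

lemma phi_pair:
 assumes "function_pairs Q" "function_pairs.mat_pair Q F F'"
 shows "Q (\<lambda>a. \<phi> \<gamma> (F a)) (\<lambda>b. \<phi> \<gamma> (F' b))"
proof -
 interpret function_pairs Q by fact
 show ?thesis unfolding \<phi>_def wt.cmp_def
  by (intro sum mult const ent mat_sum mat_mult mat_const assms(2))
qed

text \<open>The complex Lie algebra as a span of matrices, given by generators so that linear
  statements are proved by induction.\<close>

inductive_set Ls :: "(complex, 'n) smat set" where
 Ls_E: "\<gamma> \<in> \<Phi> ==> E \<gamma> \<in> Ls"
| Ls_H: "\<gamma> \<in> \<Phi> ==> H \<gamma> \<in> Ls"
| Ls_add: "X \<in> Ls ==> Y \<in> Ls ==> X + Y \<in> Ls"
| Ls_smul: "X \<in> Ls ==> a \<cdot> X \<in> Ls"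

lemma Ls_0: "0 \<in> Ls" using roots_nonempty Ls_smul[OF Ls_E, of _ 0] by auto
lemma Ls_sum: "(\<And>x. x \<in> S ==> f x \<in> Ls) ==> (\<Sum>x\<in>S. f x) \<in> Ls"
 by (induction S rule: infinite_finite_induct) (auto intro: Ls_0 Ls_add)

abbreviation br :: "('r::comm_ring_1, 'n) smat \<Rightarrow> ('r, 'n) smat \<Rightarrow> ('r, 'n) smat" where
 "br X Y \<equiv> X * Y - Y * X"

lemma br_root_cases:
 assumes "\<alpha> \<in> \<Phi>" "\<beta> \<in> \<Phi>"
 shows "\<exists>N :: int. br (E \<alpha>) (E \<beta>) =
  (if \<alpha> + \<beta> \<in> \<Phi> then of_int N \<cdot> E (\<alpha> + \<beta>) else if \<alpha> + \<beta> = 0 then H \<alpha> else 0)"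
proof (cases "\<alpha> + \<beta> \<in> \<Phi>")
 case True
 define r where "r = Max {k :: nat. \<beta> - real k *\<^sub>R \<alpha> \<in> \<Phi>}"
 have "br (E \<alpha>) (E \<beta>) = of_int (int (r + 1)) \<cdot> E (\<alpha> + \<beta>) \<or> br (E \<alpha>) (E \<beta>) = of_int (- int (r + 1)) \<cdot> E (\<alpha> + \<beta>)"
  using EE[OF assms True] by (simp add: r_def Let_def)
 hence "\<exists>N :: int. br (E \<alpha>) (E \<beta>) = of_int N \<cdot> E (\<alpha> + \<beta>)" by blast
 thus ?thesis using True by simp
next
 case False
 thus ?thesis
 proof (cases "\<alpha> + \<beta> = 0")
  case True
  hence "\<beta> = - \<alpha>" by (simp add: eq_neg_iff_add_eq_0 add.commute)
  thus ?thesis using False H_def[OF assms(1)] by simp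
 qed (use False EE_commute[OF assms] in simp)
qed

lemma Ls_bracket: "X \<in> Ls ==> Y \<in> Ls ==> br X Y \<in> Ls"
proof (induction X arbitrary: Y rule: Ls.induct)
 case (Ls_E \<gamma>)
 from Ls_E(2) show ?case
 proof (induction Y rule: Ls.induct)
  case (Ls_E \<delta>)
  obtain N :: int where N: "br (E \<gamma>) (E \<delta>) = (if \<gamma> + \<delta> \<in> \<Phi> then of_int N \<cdot> E (\<gamma> + \<delta>)
    else if \<gamma> + \<delta> = 0 then H \<gamma> else 0)"
   using br_root_cases[OF \<open>\<gamma> \<in> \<Phi>\<close> Ls_E] by blast
  show ?case unfolding N using Ls.Ls_smul[OF Ls.Ls_E] Ls.Ls_H[OF \<open>\<gamma> \<in> \<Phi>\<close>] Ls_0 by simp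
 next
  case (Ls_H \<delta>)
  have "br (E \<gamma>) (H \<delta>) = (- of_real (ci \<gamma> \<delta>)) \<cdot> E \<gamma>" using HE[OF Ls_H \<open>\<gamma> \<in> \<Phi>\<close>]
   by (simp add: minus_diff_eq[symmetric, of "E \<gamma> * H \<delta>"])
  thus ?case using Ls.Ls_smul[OF Ls.Ls_E] \<open>\<gamma> \<in> \<Phi>\<close> by metis
 next
  case (Ls_add X Y)
  have "br (E \<gamma>) (X + Y) = br (E \<gamma>) X + br (E \<gamma>) Y" by (simp add: algebra_simps)
  thus ?case using Ls_add Ls.Ls_add by metis
 next
  case (Ls_smul X a)
  have "br (E \<gamma>) (a \<cdot> X) = a \<cdot> br (E \<gamma>) X" by (simp add: smul_diff_right)
  thus ?case using Ls_smul Ls.Ls_smul by metis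
 qed
next
 case (Ls_H \<gamma>)
 from Ls_H(2) show ?case
 proof (induction Y rule: Ls.induct)
  case (Ls_E \<delta>)
  thus ?case using HE[OF \<open>\<gamma> \<in> \<Phi>\<close> Ls_E] Ls.Ls_smul[OF Ls.Ls_E] by metis
 next
  case (Ls_H \<delta>)
  thus ?case using HH[OF \<open>\<gamma> \<in> \<Phi>\<close> Ls_H] Ls_0 by simp
 next
  case (Ls_add X Y)
  have "br (H \<gamma>) (X + Y) = br (H \<gamma>) X + br (H \<gamma>) Y" by (simp add: algebra_simps)
  thus ?case using Ls_add Ls.Ls_add by metis
 next
  case (Ls_smul X a)
  have "br (H \<gamma>) (a \<cdot> X) = a \<cdot> br (H \<gamma>) X" by (simp add: smul_diff_right)
  thus ?case using Ls_smul Ls.Ls_smul by metis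
 qed
next
 case (Ls_add X Z)
 have "br (X + Z) Y = br X Y + br Z Y" by (simp add: algebra_simps)
 thus ?case using Ls_add Ls.Ls_add by metis
next
 case (Ls_smul X a)
 have "br (a \<cdot> X) Y = a \<cdot> br X Y" by (simp add: smul_diff_right)
 thus ?case using Ls_smul Ls.Ls_smul by metis
qed

lemma cmp_E: "\<delta> \<in> \<Phi> ==> wt.cmp v (E \<delta>) = (if v = \<delta> then E \<delta> else 0)"
 by (rule wt.cmp_hom[OF hom_E])
lemma cmp_H: "\<delta> \<in> \<Phi> ==> wt.cmp v (H \<delta>) = (if v = 0 then H \<delta> else 0)"
 by (rule wt.cmp_hom[OF hom_H])
lemma phi_E_if: "\<delta> \<in> \<Phi> ==> \<phi> \<gamma> (E \<delta>) = (if \<gamma> = \<delta> then 1 else 0)"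
 using phi_E phi_hom[OF hom_E, of \<delta> \<gamma>] by auto
lemma phi_H: "\<delta> \<in> \<Phi> ==> \<gamma> \<in> \<Phi> ==> \<phi> \<gamma> (H \<delta>) = 0"
 using phi_hom[OF hom_H, of \<delta> \<gamma>] zero_not_root by metis

text \<open>For fixed \<open>\<gamma>\<close> this is a linear equation with integral coefficients,
  and in this form membership in the Lie algebra passes to conjugates over R.\<close>

lemma Ls_cmp_root: "Z \<in> Ls ==> \<gamma> \<in> \<Phi> ==> wt.cmp \<gamma> Z = \<phi> \<gamma> Z \<cdot> E \<gamma>"
proof (induction Z rule: Ls.induct)
 case (Ls_H \<delta>)
 thus ?case using zero_not_root by (auto simp: cmp_H phi_H)
qed (auto simp: cmp_E phi_E_if wt.cmp_add wt.cmp_smul phi_add phi_smul smul_add_left)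

lemma Ls_cmp_other: "Z \<in> Ls ==> v \<notin> \<Phi> ==> v \<noteq> 0 ==> wt.cmp v Z = 0"
 by (induction Z rule: Ls.induct) (auto simp: cmp_E cmp_H wt.cmp_add wt.cmp_smul)

lemma Ls_cmp_0: "Z \<in> Ls ==> wt.cmp 0 Z \<in> Ls"
proof (induction Z rule: Ls.induct)
 case (Ls_E \<delta>)
 hence "wt.cmp 0 (E \<delta>) = 0" using zero_not_root by (auto simp: cmp_E)
 thus ?case by (simp only: Ls_0)
qed (auto simp: cmp_H wt.cmp_add wt.cmp_smul intro: Ls.intros)

lemma Ls_cmp_0_H: "Z \<in> Ls ==> \<gamma> \<in> \<Phi> ==> wt.cmp 0 Z * H \<gamma> = H \<gamma> * wt.cmp 0 Z"
proof (induction Z rule: Ls.induct)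
 case (Ls_E \<delta>)
 hence "wt.cmp 0 (E \<delta>) = 0" using zero_not_root by (auto simp: cmp_E)
 thus ?case by simp
qed (auto simp: cmp_H HH wt.cmp_add wt.cmp_smul algebra_simps)

lemma Ls_expand: "Z \<in> Ls ==> Z = wt.cmp 0 Z + (\<Sum>\<gamma>\<in>\<Phi>. \<phi> \<gamma> Z \<cdot> E \<gamma>)"
proof (rule wt.eq_by_cmp)
 fix v assume Z: "Z \<in> Ls"
 have c0: "wt.cmp v (wt.cmp 0 Z) = (if v = 0 then wt.cmp 0 Z else 0)"
  by (rule wt.cmp_hom[OF wt.hom_cmp])
 have "wt.cmp v (\<Sum>\<gamma>\<in>\<Phi>. \<phi> \<gamma> Z \<cdot> E \<gamma>) = (\<Sum>\<gamma>\<in>\<Phi>. if v = \<gamma> then \<phi> v Z \<cdot> E v else 0)"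
  unfolding wt.cmp_sum by (intro sum.cong refl) (auto simp: wt.cmp_smul cmp_E)
 also have "\<dots> = (if v \<in> \<Phi> then \<phi> v Z \<cdot> E v else 0)" by simp
 finally show "wt.cmp v Z = wt.cmp v (wt.cmp 0 Z + (\<Sum>\<gamma>\<in>\<Phi>. \<phi> \<gamma> Z \<cdot> E \<gamma>))"
  using Ls_cmp_root[OF Z, of v] Ls_cmp_other[OF Z, of v] zero_not_root by (auto simp: wt.cmp_add c0)
qed

lemma long_bracket:
 assumes "long \<theta>" "\<delta> \<in> \<Phi>" "ci \<delta> \<theta> = -1"
 shows "\<exists>\<epsilon>\<in>{1, -1 :: int}. D \<theta> 1 * D \<delta> 1 - D \<delta> 1 * D \<theta> 1 = \<epsilon> \<cdot> D (\<theta> + \<delta>) 1"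
proof -
 note t = long_root[OF assms(1)]
 note r = long_add_root[OF assms]
 have "{k :: nat. \<delta> - real k *\<^sub>R \<theta> \<in> \<Phi>} = {0}" using r(2) by auto
 hence "br (E \<theta>) (E \<delta>) = of_int 1 \<cdot> E (\<theta> + \<delta>) \<or> br (E \<theta>) (E \<delta>) = of_int (-1) \<cdot> E (\<theta> + \<delta>)"
  using EE[OF t assms(2) r(1)] by (simp add: Let_def)
 then obtain \<epsilon> :: int where e: "\<epsilon> \<in> {1, -1}" "br (E \<theta>) (E \<delta>) = of_int \<epsilon> \<cdot> E (\<theta> + \<delta>)" by blast
 have "oi (D \<theta> 1 * D \<delta> 1 - D \<delta> 1 * D \<theta> 1) = (oi (\<epsilon> \<cdot> D (\<theta> + \<delta>) 1) :: (complex, 'n) smat)"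
  using e(2) t assms(2) r(1) by (simp add: oi_diff oi_mult oi_smul)
 thus ?thesis using e(1) oi_inj[where 'a = complex] by blast
qed

definition eps :: "'e \<Rightarrow> 'e \<Rightarrow> int" where
 "eps \<theta> \<delta> = (SOME \<epsilon>. \<epsilon> \<in> {1, -1} \<and> D \<theta> 1 * D \<delta> 1 - D \<delta> 1 * D \<theta> 1 = \<epsilon> \<cdot> D (\<theta> + \<delta>) 1)"

lemma eps:
 assumes "long \<theta>" "\<delta> \<in> \<Phi>" "ci \<delta> \<theta> = -1"
 shows "eps \<theta> \<delta> = 1 \<or> eps \<theta> \<delta> = -1"
  and "br (oi (D \<theta> 1)) (oi (D \<delta> 1)) = (of_int (eps \<theta> \<delta>) :: 'r::comm_ring_1) \<cdot> oi (D (\<theta> + \<delta>) 1)"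
proof -
 have "\<exists>\<epsilon>. \<epsilon> \<in> {1, -1} \<and> D \<theta> 1 * D \<delta> 1 - D \<delta> 1 * D \<theta> 1 = \<epsilon> \<cdot> D (\<theta> + \<delta>) 1"
  using long_bracket[OF assms] by metis
 from someI_ex[OF this] have "eps \<theta> \<delta> \<in> {1, -1} \<and>
   D \<theta> 1 * D \<delta> 1 - D \<delta> 1 * D \<theta> 1 = eps \<theta> \<delta> \<cdot> D (\<theta> + \<delta>) 1"
  unfolding eps_def[symmetric] .
 hence e: "eps \<theta> \<delta> \<in> {1, -1}"
  "D \<theta> 1 * D \<delta> 1 - D \<delta> 1 * D \<theta> 1 = eps \<theta> \<delta> \<cdot> D (\<theta> + \<delta>) 1" by simp_all
 thus "eps \<theta> \<delta> = 1 \<or> eps \<theta> \<delta> = -1" by simp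
 have "br (oi (D \<theta> 1)) (oi (D \<delta> 1)) = (oi (D \<theta> 1 * D \<delta> 1 - D \<delta> 1 * D \<theta> 1) :: ('r, 'n) smat)"
  by (simp only: oi_diff oi_mult)
 thus "br (oi (D \<theta> 1)) (oi (D \<delta> 1)) = (of_int (eps \<theta> \<delta>) :: 'r) \<cdot> oi (D (\<theta> + \<delta>) 1)"
  by (simp only: e oi_smul)
qed

end


section \<open>The group and its integral equations\<close>

context chevalley_rep begin

lemma root_neq_neg [simp]:
 assumes "\<beta> \<in> \<Phi>" shows "\<beta> \<noteq> - \<beta>" "- \<beta> \<noteq> \<beta>"
proof -
 have "\<beta> + \<beta> \<noteq> 0" using assms by (metis root_nonzero scaleR_2 scaleR_eq_0_iff zero_neq_numeral)
 thus "\<beta> \<noteq> - \<beta>" "- \<beta> \<noteq> \<beta>" by (metis add.right_inverse)+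
qed

definition X :: "'e \<Rightarrow> 'r::comm_ring_1 \<Rightarrow> ('r, 'n) smat" where "X \<alpha> t = rx (D \<alpha>) t"
abbreviation Xs :: "('e \<Rightarrow> 'r::comm_ring_1) \<Rightarrow> 'e list \<Rightarrow> ('r, 'n) smat" where
 "Xs s ds \<equiv> prod_list (map (\<lambda>\<delta>. X \<delta> (s \<delta>)) ds)"

lemma X_0 [simp]: "\<alpha> \<in> \<Phi> ==> X \<alpha> 0 = 1" unfolding X_def by (rule rx_0[OF dps_D])
lemma X_inverse: "\<alpha> \<in> \<Phi> ==> X \<alpha> t * X \<alpha> (- t) = 1" "\<alpha> \<in> \<Phi> ==> X \<alpha> (- t) * X \<alpha> t = 1"
 unfolding X_def by (rule rx_inverse[OF dps_D]; assumption)+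
lemma sdet_X [simp]: "\<alpha> \<in> \<Phi> ==> sdet (X \<alpha> t) = 1" unfolding X_def by (rule sdet_rx[OF dps_D])

text \<open>Left multiplication by generators suffices, since the inverse of a root element is a
  root element.\<close>

inductive_set GC :: "(complex, 'n) smat set" where
 GC_1: "1 \<in> GC"
| GC_X: "\<alpha> \<in> \<Phi> ==> A \<in> GC ==> X \<alpha> t * A \<in> GC"

text \<open>\<open>chevalley_group\<close> in the language of \<open>smat\<close>.\<close>

definition GR :: "('r::comm_ring_1, 'n) smat set" where
 "GR = {A. sdet A = 1 \<and> (\<forall>p. (\<forall>B\<in>GC. ev p B = 0) \<longrightarrow> ev p A = 0)}"

lemma GC_mult: "A \<in> GC ==> B \<in> GC ==> A * B \<in> GC"
 by (induction A rule: GC.induct) (auto simp: mult.assoc intro: GC.intros)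
lemma GC_X1: "\<alpha> \<in> \<Phi> ==> X \<alpha> t \<in> GC" using GC_X[OF _ GC_1, of \<alpha> t] by simp
lemma GC_det: "A \<in> GC ==> sdet A = 1" by (induction A rule: GC.induct) (auto simp: sdet_mult)

lemma sadj_unique: "sdet A = 1 ==> A * B = 1 ==> sadj A = B"
 using sadj_inverse(2)[of A] by (metis mult.assoc mult.left_neutral mult.right_neutral)

lemma GC_sadj: "A \<in> GC ==> sadj A \<in> GC"
proof (induction A rule: GC.induct)
 case GC_1
 have "sadj 1 = (1 :: (complex, 'n) smat)" by (rule sadj_unique) auto
 thus ?case by (simp add: GC.GC_1)
next
 case (GC_X \<alpha> A t)
 have "sadj (X \<alpha> t * A) = sadj A * X \<alpha> (- t)"
 proof (rule sadj_unique)
  have "X \<alpha> t * A * (sadj A * X \<alpha> (- t)) = X \<alpha> t * (A * sadj A) * X \<alpha> (- t)"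
   by (simp add: mult.assoc)
  thus "X \<alpha> t * A * (sadj A * X \<alpha> (- t)) = 1"
   using GC_X by (simp add: sadj_inverse GC_det X_inverse)
 qed (use GC_X in \<open>simp add: sdet_mult GC_det\<close>)
 thus ?case using GC_X GC_mult GC_X1 by simp
qed

definition cj :: "('r::comm_ring_1, 'n) smat \<Rightarrow> ('r, 'n) smat \<Rightarrow> ('r, 'n) smat" where
 "cj A Z = A * Z * sadj A"

lemma cj_mult: "sdet A = 1 ==> cj A (Y * Z) = cj A Y * cj A Z"
proof -
 assume "sdet A = 1"
 hence "A * Y * (sadj A * A) * Z * sadj A = A * Y * Z * sadj A" by (simp add: sadj_inverse)
 thus ?thesis by (simp add: cj_def mult.assoc)
qed
lemma cj_add: "cj A (Y + Z) = cj A Y + cj A Z" by (simp add: cj_def algebra_simps)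
lemma cj_diff: "cj A (Y - Z) = cj A Y - cj A Z" by (simp add: cj_def algebra_simps)
lemma cj_smul: "cj A (a \<cdot> Y) = a \<cdot> cj A Y" by (simp add: cj_def)
lemma cj_eq_iff: "sdet A = 1 ==> cj A Z = Y \<longleftrightarrow> A * Z = Y * A"
proof
 assume "sdet A = 1" "cj A Z = Y"
 thus "A * Z = Y * A" unfolding cj_def by (metis mult.assoc mult.right_neutral sadj_inverse(2))
next
 assume "sdet A = 1" "A * Z = Y * A"
 thus "cj A Z = Y" by (simp add: cj_def mult.assoc sadj_inverse)
qed

lemma Ls_Ac: "\<beta> \<in> \<Phi> ==> Z \<in> Ls ==> Ac (E \<beta>) Z k \<in> Ls"
proof (induction k)
 case (Suc k)
 have "Ac (E \<beta>) Z (Suc k) = (1 / of_nat (Suc k)) \<cdot> br (E \<beta>) (Ac (E \<beta>) Z k)"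
 proof (rule Ac_SucI)
  have "of_nat (Suc k) \<cdot> (1 / of_nat (Suc k)) \<cdot> br (E \<beta>) (Ac (E \<beta>) Z k) = br (E \<beta>) (Ac (E \<beta>) Z k)"
   by (simp del: of_nat_Suc)
  thus "br (E \<beta>) (Ac (E \<beta>) Z k) = of_nat (Suc k) * (1 / of_nat (Suc k)) \<cdot> br (E \<beta>) (Ac (E \<beta>) Z k)"
   unfolding smul_of_nat by simp
 qed
 thus ?case using Ls_smul[OF Ls_bracket[OF Ls_E]] Suc by simp
qed simp

lemma Ls_conj_X: "\<beta> \<in> \<Phi> ==> Z \<in> Ls ==> X \<beta> t * Z * X \<beta> (- t) \<in> Ls"
 unfolding X_def D_def rx_conj[OF E_divisible Ac_nilpotent[OF E_divisible]]
 by (intro Ls_sum Ls_smul Ls_Ac)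

text \<open>A root element acts on the Lie algebra by the terminating series of
  \<open>ad(E \<beta>)^k / k!\<close>, and the Lie algebra is closed under brackets.\<close>

lemma Ls_cj: "A \<in> GC ==> Z \<in> Ls ==> cj A Z \<in> Ls"
proof (induction A rule: GC.induct)
 case GC_1
 have "sadj 1 = (1 :: (complex, 'n) smat)" by (rule sadj_unique) auto
 thus ?case using GC_1 by (simp add: cj_def)
next
 case (GC_X \<alpha> A t)
 have "sadj (X \<alpha> t * A) = sadj A * X \<alpha> (- t)"
 proof (rule sadj_unique)
  have "X \<alpha> t * A * (sadj A * X \<alpha> (- t)) = X \<alpha> t * (A * sadj A) * X \<alpha> (- t)"
   by (simp add: mult.assoc)
  thus "X \<alpha> t * A * (sadj A * X \<alpha> (- t)) = 1"
   using GC_X by (simp add: sadj_inverse GC_det X_inverse)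
 qed (use GC_X in \<open>simp add: sdet_mult GC_det\<close>)
 hence "cj (X \<alpha> t * A) Z = X \<alpha> t * cj A Z * X \<alpha> (- t)" by (simp add: cj_def mult.assoc)
 thus ?case using Ls_conj_X GC_X by simp
qed

lemma GR_det: "A \<in> GR ==> sdet A = 1" by (simp add: GR_def)

lemma GR_scalar:
 assumes "ipair F F'" "\<And>A. A \<in> GC ==> F A = 0" "A' \<in> GR" shows "F' A' = 0"
 using assms unfolding ipair_def GR_def by auto

lemma GR_eq:
 assumes F: "ipair.mat_pair F F'" and G: "ipair.mat_pair G G'"
  and eq: "\<And>A. A \<in> GC ==> F A = G A" and A': "A' \<in> GR"
 shows "F' A' = G' A'"
proof (rule smat_eqI)
 fix i j
 have "ent (F' A' - G' A') i j = 0"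
  by (rule GR_scalar[OF ipair.ent[OF ipair.mat_diff[OF F G]] _ A']) (simp add: eq)
 thus "ent (F' A') i j = ent (G' A') i j" by simp
qed

lemma mat_pair_cj [pair_intro]: "ipair.mat_pair F F' ==> ipair.mat_pair G G' ==>
  ipair.mat_pair (\<lambda>A. cj (F A) (G A)) (\<lambda>A. cj (F' A) (G' A))"
 unfolding cj_def by (intro ipair.mat_mult ipair.mat_sadj)

lemma mat_pair_cmp: "ipair.mat_pair F F' ==>
  ipair.mat_pair (\<lambda>A. wt.cmp v (F A)) (\<lambda>A. wt.cmp v (F' A))"
 unfolding wt.cmp_def by (intro ipair.mat_sum ipair.mat_mult ipair.mat_const)

lemma ipair_phi: "ipair.mat_pair F F' ==> ipair (\<lambda>A. \<phi> v (F A)) (\<lambda>A. \<phi> v (F' A))"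
 by (rule phi_pair[OF ipair.function_pairs_axioms])

lemma X_of_int: "X \<alpha> (of_int t) = oi (X \<alpha> t)" by (simp add: X_def oi_rx)
lemma mat_pair_X_int: "ipair.mat_pair (\<lambda>A. X \<alpha> (of_int t)) (\<lambda>A. X \<alpha> (of_int t))"
 unfolding X_of_int by (rule ipair.mat_const)
lemma mat_pair_X1:
 "ipair.mat_pair (\<lambda>A. X \<alpha> 1) (\<lambda>A. X \<alpha> 1)" "ipair.mat_pair (\<lambda>A. X \<alpha> (-1)) (\<lambda>A. X \<alpha> (-1))"
 using mat_pair_X_int[of \<alpha> 1] mat_pair_X_int[of \<alpha> "-1"] by simp_all

lemma mat_pair_E [pair_intro]: "\<gamma> \<in> \<Phi> ==> ipair.mat_pair (\<lambda>A. E \<gamma>) (\<lambda>A. D1 \<gamma>)"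
 using ipair.mat_const[of "D \<gamma> (Suc 0)"] by (simp only: oi_D1)

text \<open>The identity is an integral point, and evaluating integral polynomials at integral
  points commutes with ring maps.\<close>

lemma GR_1: "1 \<in> (GR :: ('r::comm_ring_1, 'n) smat set)"
proof -
 have "ev p (1 :: ('r, 'n) smat) = 0" if "\<forall>B\<in>GC. ev p B = 0" for p
 proof -
  have "ev p (oi 1 :: (complex, 'n) smat) = 0" using that GC_1 by simp
  hence "ev p (1 :: (int, 'n) smat) = 0" unfolding ev_oi by (simp only: of_int_eq_0_iff)
  hence "ev p (oi 1 :: ('r, 'n) smat) = 0" unfolding ev_oi by simp
  thus ?thesis by simp
 qed
 thus ?thesis by (simp add: GR_def)
qed

lemma tpair_X: "tpair.mat_pair (\<lambda>z. X \<alpha> (snd z)) (\<lambda>z. X \<alpha> (snd z))"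
 unfolding X_def by (rule tpair_rx[OF tpair_var])

text \<open>The parameter \<open>t\<close> lies in R, so the translation is not given by integral
  polynomials in the entries; it is treated as a polynomial in a further variable.\<close>

lemma GR_X_left:
 fixes A :: "('r::comm_ring_1, 'n) smat"
 assumes A: "A \<in> GR" and a: "\<alpha> \<in> \<Phi>" shows "X \<alpha> t * A \<in> GR"
proof -
 have "ev p (X \<alpha> t * A) = 0" if p: "\<forall>B\<in>GC. ev p B = 0" for p
 proof -
  have tp: "tpair (\<lambda>z. ev p (X \<alpha> (snd z) * fst z)) (\<lambda>z. ev p (X \<alpha> (snd z) * fst z) :: 'r)"
   by (intro tpair_ev tpair.mat_mult tpair_X tpair_mat_fst)
  have "ev p (X \<alpha> (snd (A, t)) * fst (A, t)) = 0"
   by (rule tpair_vanish[OF tp, of GC]) (use A p a in \<open>auto simp: GR_def intro: GC_X\<close>)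
  thus ?thesis by simp
 qed
 thus ?thesis using A a by (simp add: GR_def sdet_mult)
qed

lemma GR_X_right:
 fixes A :: "('r::comm_ring_1, 'n) smat"
 assumes A: "A \<in> GR" and a: "\<alpha> \<in> \<Phi>" shows "A * X \<alpha> t \<in> GR"
proof -
 have "ev p (A * X \<alpha> t) = 0" if p: "\<forall>B\<in>GC. ev p B = 0" for p
 proof -
  have tp: "tpair (\<lambda>z. ev p (fst z * X \<alpha> (snd z))) (\<lambda>z. ev p (fst z * X \<alpha> (snd z)) :: 'r)"
   by (intro tpair_ev tpair.mat_mult tpair_X tpair_mat_fst)
  have "ev p (fst (A, t) * X \<alpha> (snd (A, t))) = 0"
   by (rule tpair_vanish[OF tp, of GC]) (use A p a in \<open>auto simp: GR_def intro: GC_mult GC_X1\<close>)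
  thus ?thesis by simp
 qed
 thus ?thesis using A a by (simp add: GR_def sdet_mult)
qed

text \<open>Elements conjugate to a root matrix satisfy the integral linear equations of the Lie algebra.\<close>

context
 fixes g :: "('r::comm_ring_1, 'n) smat" and B :: "(int, 'n) smat"
 assumes g: "g \<in> GR" and B: "oi B \<in> Ls"
begin

lemma cj_cmp_root: "\<gamma> \<in> \<Phi> ==> wt.cmp \<gamma> (cj g (oi B)) = \<phi> \<gamma> (cj g (oi B)) \<cdot> oi (D \<gamma> 1)"
 by (rule GR_eq[OF _ _ _ g, where F = "\<lambda>A. wt.cmp \<gamma> (cj A (oi B))"
    and G = "\<lambda>A. \<phi> \<gamma> (cj A (oi B)) \<cdot> oi (D \<gamma> 1)"])
  (auto intro!: mat_pair_cmp pair_intro ipair_phi ipair_mat_id simp: Ls_cmp_root[OF Ls_cj[OF _ B]])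

lemma cj_cmp_other: "v \<notin> \<Phi> ==> v \<noteq> 0 ==> wt.cmp v (cj g (oi B)) = 0"
 by (rule GR_eq[OF _ _ _ g, where F = "\<lambda>A. wt.cmp v (cj A (oi B))" and G = "\<lambda>A. 0"])
  (auto intro!: mat_pair_cmp pair_intro ipair_mat_id simp: Ls_cmp_other[OF Ls_cj[OF _ B]])

end

text \<open>\<open>ad(E \<beta>)\<close> raises the degree by 2 and all degrees lie between -2 and
  2, so the square is nonzero only on degree -2, the line of \<open>E (- \<beta>)\<close>. The
  factor -2 comes from \<open>[e, [e, f]] = [e, h] = -2 e\<close>.\<close>

lemma ad_long_sq:
 assumes b: "long \<beta>" and Z: "Z \<in> Ls"
 shows "br (E \<beta>) (br (E \<beta>) Z) = - (2 * \<phi> (- \<beta>) Z) \<cdot> E \<beta>"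
proof -
 have b': "\<beta> \<in> \<Phi>" using b by (rule long_root)
 show ?thesis using Z
 proof (induction Z rule: Ls.induct)
  case (Ls_E \<delta>)
  show ?case
  proof (cases "\<delta> = - \<beta>")
   case True
   have "br (E \<beta>) (H \<beta>) = - (br (H \<beta>) (E \<beta>))" by simp
   thus ?thesis using True b' HE[OF b' b'] by (simp add: H_def[symmetric] phi_E)
  next
   case False
   hence p: "\<phi> (- \<beta>) (E \<delta>) = 0" using Ls_E by (auto simp: phi_E_if)
   show ?thesis
   proof (cases "\<beta> + \<delta> \<in> \<Phi>")
    case True
    have "\<delta> \<noteq> \<beta>"
    proof
     assume "\<delta> = \<beta>"
     hence "2 *\<^sub>R \<beta> \<in> \<Phi>" using True by (simp add: scaleR_2)
     thus False using reduced[OF b', of 2] by simp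
    qed
    hence "ci \<delta> \<beta> = -1"
     using ci_long[OF b Ls_E _ False] long_add_not_root(1)[OF b Ls_E] True by auto
    hence "ci (\<beta> + \<delta>) \<beta> = 1" using b' by (simp add: ci_add)
    hence "E \<beta> * E (\<beta> + \<delta>) = E (\<beta> + \<delta>) * E \<beta>"
     using long_add_not_root[OF b True] EE_commute[OF b' True] by simp
    moreover obtain N :: int where "br (E \<beta>) (E \<delta>) = of_int N \<cdot> E (\<beta> + \<delta>)"
     using br_root_cases[OF b' Ls_E] True by auto
    ultimately show ?thesis by (simp add: p)
   next
    case False
    hence "E \<beta> * E \<delta> = E \<delta> * E \<beta>"
     using EE_commute[OF b' Ls_E] \<open>\<delta> \<noteq> - \<beta>\<close> by (metis eq_neg_iff_add_eq_0 add.commute)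
    thus ?thesis by (simp add: p)
   qed
  qed
 next
  case (Ls_H \<delta>)
  have "br (E \<beta>) (H \<delta>) = - (br (H \<delta>) (E \<beta>))" by simp
  hence "br (E \<beta>) (H \<delta>) = (- of_real (ci \<beta> \<delta>)) \<cdot> E \<beta>" using HE[OF Ls_H b'] by simp
  thus ?case using b' Ls_H by (simp add: phi_H)
 next
  case (Ls_add X Y)
  have "br (E \<beta>) (br (E \<beta>) (X + Y)) = br (E \<beta>) (br (E \<beta>) X) + br (E \<beta>) (br (E \<beta>) Y)"
   by (simp add: algebra_simps)
  thus ?case using Ls_add by (simp add: phi_add distrib_left smul_add_left smul_diff_left)
 next
  case (Ls_smul X a)
  have "br (E \<beta>) (br (E \<beta>) (a \<cdot> X)) = a \<cdot> br (E \<beta>) (br (E \<beta>) X)"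
   by (simp add: smul_diff_right[symmetric])
  thus ?case using Ls_smul by (simp add: phi_smul mult_ac)
 qed
qed

text \<open>The factor 2 of \<open>ad_long_sq\<close> cancels against 2!, which makes the formula
  integral.\<close>

lemma X_conj_long:
 assumes b: "long \<beta>" and Z: "Z \<in> Ls"
 shows "X \<beta> t * Z * X \<beta> (- t) = Z + t \<cdot> br (E \<beta>) Z - (t\<^sup>2 * \<phi> (- \<beta>) Z) \<cdot> E \<beta>"
proof -
 have b': "\<beta> \<in> \<Phi>" using b by (rule long_root)
 have "br (E \<beta>) (br (E \<beta>) Z) = - (2 * \<phi> (- \<beta>) Z) \<cdot> E \<beta>" by (rule ad_long_sq[OF b Z])
 hence 2: "br (E \<beta>) (br (E \<beta>) Z) = of_nat (Suc (Suc 0)) * ((- \<phi> (- \<beta>) Z) \<cdot> E \<beta>)"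
  unfolding smul_of_nat[symmetric] by simp
 have 1: "Ac (E \<beta>) Z (Suc 0) = br (E \<beta>) Z" by (rule Ac_SucI) simp
 have 2: "Ac (E \<beta>) Z (Suc (Suc 0)) = (- \<phi> (- \<beta>) Z) \<cdot> E \<beta>" by (rule Ac_SucI) (simp only: 1 2)
 have 3: "Ac (E \<beta>) Z (Suc (Suc (Suc 0))) = 0" by (rule Ac_SucI) (simp add: 2)
 show ?thesis unfolding X_def D_def rx_conj[OF E_divisible[OF b'] 3]
  by (simp add: 1 2 eval_nat_numeral)
qed

section \<open>Centralizers of long root elements\<close>

text \<open>Let \<open>x = X \<beta> 1\<close>, \<open>e = D1 \<beta>\<close> and
  \<open>y = g e g^(-1)\<close>. The formula \<open>x z x^(-1) = z + [e, z] - \<phi>(z) e\<close>,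
  where \<open>\<phi>\<close> is the coordinate at \<open>- \<beta>\<close>, is used directly and
  after conjugation by \<open>g\<close>, which fixes \<open>x\<close> and takes \<open>e\<close> to
  \<open>y\<close>. Comparing weights then forces \<open>y = e\<close>; this replaces a logarithm of
  \<open>x\<close>.\<close>

lemma centralizer_long:
 fixes g :: "('r::comm_ring_1, 'n) smat"
 assumes b: "long \<beta>" and g: "g \<in> GR" and comm: "g * X \<beta> 1 = X \<beta> 1 * g"
 shows "g * oi (D \<beta> 1) = oi (D \<beta> 1) * g"
proof -
 have b': "\<beta> \<in> \<Phi>" "- \<beta> \<in> \<Phi>" using long_root[OF b] by auto
 define e f h where "e = (oi (D \<beta> 1) :: ('r, 'n) smat)" and "f = (oi (D (- \<beta>) 1) :: ('r, 'n) smat)"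
  and "h = br e f"
 define y where "y = cj g e"
 define x where "x = (X \<beta> 1 :: ('r, 'n) smat)"
 have det: "sdet g = 1" by (rule GR_det[OF g])
 note inv = sadj_inverse[OF det]
 have x: "x * X \<beta> (-1) = 1" "X \<beta> (-1) * x = 1" using X_inverse[OF b'(1)] by (simp_all add: x_def)
 have gx: "g * x = x * g" using comm by (simp add: x_def)
 have g'x: "sadj g * x = x * sadj g"
 proof -
  have "sadj g * (g * x) * sadj g = sadj g * (x * g) * sadj g" by (simp add: gx)
  thus ?thesis using inv by (simp add: mult.assoc) (simp add: mult.assoc[symmetric] inv)
 qed
 have D1_Ls: "\<gamma> \<in> \<Phi> ==> oi (D \<gamma> 1) \<in> Ls" for \<gamma> by (simp add: Ls_E)
 have xz: "x * z = (z + br e z - \<phi> (- \<beta>) z \<cdot> e) * x"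
  if "z = oi B" "oi B \<in> Ls" for z B
 proof -
  have "x * (oi B) * X \<beta> (-1) = oi B + br e (oi B) - \<phi> (- \<beta>) (oi B) \<cdot> e"
   unfolding e_def x_def
  proof (rule GR_eq[OF _ _ _ g, where F = "\<lambda>A. X \<beta> 1 * oi B * X \<beta> (-1)"
     and G = "\<lambda>A. oi B + br (oi (D \<beta> 1)) (oi B) - \<phi> (- \<beta>) (oi B) \<cdot> oi (D \<beta> 1)"])
   show "ipair.mat_pair (\<lambda>A. X \<beta> 1 * oi B * X \<beta> (-1)) (\<lambda>A. X \<beta> 1 * oi B * X \<beta> (-1))"
    by (intro pair_intro mat_pair_X1)
  qed (use X_conj_long[OF b that(2), of 1] b' in \<open>auto intro!: pair_intro ipair_phi simp: x_def e_def\<close>)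
  hence "x * z * X \<beta> (-1) * x = (z + br e z - \<phi> (- \<beta>) z \<cdot> e) * x" using that by simp
  thus ?thesis using x by (simp add: mult.assoc)
 qed
 have xcj: "x * cj A' (oi B) = (cj A' (oi B) + br e (cj A' (oi B)) - \<phi> (- \<beta>) (cj A' (oi B)) \<cdot> e) * x"
  if "A' = g \<or> A' = sadj g" "oi B \<in> Ls" for A' B
 proof -
  have "x * cj A' (oi B) * X \<beta> (-1) = cj A' (oi B) + br e (cj A' (oi B)) - \<phi> (- \<beta>) (cj A' (oi B)) \<cdot> e"
   using that(1)
  proof
   assume A': "A' = g"
   show ?thesis unfolding A' x_def e_def
    by (rule GR_eq[OF _ _ _ g, where F = "\<lambda>A. X \<beta> 1 * cj A (oi B) * X \<beta> (-1)"
     and G = "\<lambda>A. cj A (oi B) + br (oi (D \<beta> 1)) (cj A (oi B)) - \<phi> (- \<beta>) (cj A (oi B)) \<cdot> oi (D \<beta> 1)"])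
     (use X_conj_long[OF b Ls_cj[OF _ that(2)], of _ 1] b' in
      \<open>auto intro!: pair_intro ipair_phi mat_pair_X1 ipair_mat_id\<close>)
  next
   assume A': "A' = sadj g"
   show ?thesis unfolding A' x_def e_def
    by (rule GR_eq[OF _ _ _ g, where F = "\<lambda>A. X \<beta> 1 * cj (sadj A) (oi B) * X \<beta> (-1)"
     and G = "\<lambda>A. cj (sadj A) (oi B) + br (oi (D \<beta> 1)) (cj (sadj A) (oi B))
       - \<phi> (- \<beta>) (cj (sadj A) (oi B)) \<cdot> oi (D \<beta> 1)"])
     (use X_conj_long[OF b Ls_cj[OF GC_sadj that(2)], of _ 1] b' in
      \<open>auto intro!: pair_intro ipair_phi mat_pair_X1 ipair_mat_id\<close>)
  qed
  hence "x * cj A' (oi B) * (X \<beta> (-1) * x) =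
    (cj A' (oi B) + br e (cj A' (oi B)) - \<phi> (- \<beta>) (cj A' (oi B)) \<cdot> e) * x"
   by (simp add: mult.assoc[symmetric])
  thus ?thesis using x by simp
 qed
 have cancel: "A * x = B * x ==> A = B" for A B using x by (metis mult.assoc mult.right_neutral)
 have ex: "x * e = e * x"
 proof -
  have "br e e = 0" "\<phi> (- \<beta>) e = 0"
   using phi_hom[OF hom_D1[OF b'(1)], of "- \<beta>"] b' by (auto simp: e_def)
  thus ?thesis using xz[of e "D \<beta> 1"] D1_Ls[OF b'(1)] by (simp add: e_def)
 qed
 have bry: "br e y = \<phi> (- \<beta>) y \<cdot> e"
 proof -
  have "x * y = y * x" unfolding y_def cj_def by (intro intertwine_mult) (simp_all add: ex gx g'x)
  hence "y * x = (y + br e y - \<phi> (- \<beta>) y \<cdot> e) * x"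
   using xcj[of g "D \<beta> 1"] D1_Ls[OF b'(1)] by (simp add: y_def e_def)
  from cancel[OF this] show ?thesis by (simp add: algebra_simps)
 qed
 \<comment> \<open>The formula for \<open>g^(-1) z g\<close>, conjugated by \<open>g\<close>, gives
   a second expression for \<open>x z x^(-1)\<close>, with \<open>y\<close> in place of
   \<open>e\<close>. The scalar \<open>c\<close> is minus the coordinate of
   \<open>g^(-1) z g\<close> at \<open>- \<beta>\<close>.\<close>
 have bryz: "\<exists>c. br y z + c \<cdot> y = br e z - \<phi> (- \<beta>) z \<cdot> e" if z: "z = oi B" "oi B \<in> Ls" for z B
 proof -
  define z' where "z' = cj (sadj g) z"
  have ss: "sadj (sadj g) = g" using inv by (intro sadj_unique) (auto simp: sdet_sadj det)
  have cz: "cj g z' = z"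
  proof -
   have "cj g z' = (g * sadj g) * z * (g * sadj g)" by (simp only: z'_def cj_def ss mult.assoc)
   thus ?thesis by (simp add: inv)
  qed
  have cx: "cj g x = x" using gx by (simp add: cj_eq_iff det)
  have "x * z' = (z' + br e z' - \<phi> (- \<beta>) z' \<cdot> e) * x"
   using xcj[of "sadj g" B] z by (simp add: z'_def)
  hence "cj g (x * z') = cj g ((z' + br e z' - \<phi> (- \<beta>) z' \<cdot> e) * x)" by simp
  hence "x * z = (z + br y z - \<phi> (- \<beta>) z' \<cdot> y) * x"
   by (simp add: cj_mult[OF det] cj_add cj_diff cj_smul cz cx y_def)
  hence "(z + br y z - \<phi> (- \<beta>) z' \<cdot> y) * x = (z + br e z - \<phi> (- \<beta>) z \<cdot> e) * x"
   using xz[OF z] by simp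
  from cancel[OF this] show ?thesis
   by (intro exI[of _ "- \<phi> (- \<beta>) z'"]) (simp add: algebra_simps)
 qed
 have cy: "wt.cmp \<gamma> y = \<phi> \<gamma> y \<cdot> oi (D \<gamma> 1)" if "\<gamma> \<in> \<Phi>" for \<gamma>
  using cj_cmp_root[OF g D1_Ls[OF b'(1)] that] by (simp add: y_def e_def)
 have cy0: "wt.cmp v y = 0" if "v \<notin> \<Phi>" "v \<noteq> 0" for v
  using cj_cmp_other[OF g D1_Ls[OF b'(1)] that] by (simp add: y_def e_def)
 have he: "wt.hom \<beta> e" "wt.hom (- \<beta>) f" using b' by (simp_all add: e_def f_def hom_D1)
 have hz: "wt.hom \<gamma> (oi (D \<gamma> 1))" if "\<gamma> \<in> \<Phi>" for \<gamma> using hom_D1[OF that] by simp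
 have cmp_br_l: "wt.cmp w (br A B) = br A (wt.cmp (w - v) B)" if "wt.hom v A" for w v and A B :: "('r, 'n) smat"
  by (simp add: wt.cmp_diff wt.cmp_mult_left[OF that] wt.cmp_mult_right[OF that])
 have cmp_br_r: "wt.cmp w (br B A) = br (wt.cmp (w - v) B) A" if "wt.hom v A" for w v and A B :: "('r, 'n) smat"
  by (simp add: wt.cmp_diff wt.cmp_mult_left[OF that] wt.cmp_mult_right[OF that])
 have hh: "br h (oi (D \<gamma> 1)) = of_int (cint \<gamma> \<beta>) \<cdot> oi (D \<gamma> 1)" if "\<gamma> \<in> \<Phi>" for \<gamma>
 proof -
  let ?h = "D \<beta> 1 * D (- \<beta>) 1 - D (- \<beta>) 1 * D \<beta> 1"
  have "?h * D \<gamma> 1 - D \<gamma> 1 * ?h = cint \<gamma> \<beta> \<cdot> D \<gamma> 1"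
  proof (rule oi_inj[where 'a = complex])
   have "oi ?h = H \<beta>" using b' by (simp add: oi_diff oi_mult H_def)
   moreover have "complex_of_int (cint \<gamma> \<beta>) = of_real (ci \<gamma> \<beta>)"
    using cint[OF root_integral[OF that] b'(1)] by (metis of_real_of_int_eq)
   ultimately show "oi (?h * D \<gamma> 1 - D \<gamma> 1 * ?h) = (oi (cint \<gamma> \<beta> \<cdot> D \<gamma> 1) :: (complex, 'n) smat)"
    using HE[OF b'(1) that] that by (simp add: oi_smul oi_diff oi_mult)
  qed
  hence "oi (?h * D \<gamma> 1 - D \<gamma> 1 * ?h) = (oi (cint \<gamma> \<beta> \<cdot> D \<gamma> 1) :: ('r, 'n) smat)" by simp
  thus ?thesis unfolding h_def e_def f_def by (simp only: oi_diff oi_mult oi_smul)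
 qed
 have phiD: "\<phi> \<gamma> (oi (D \<gamma> 1) :: ('r, 'n) smat) = 1" if "\<gamma> \<in> \<Phi>" for \<gamma>
  by (simp add: phi_D1 that)
 have epsR: "br (oi (D a 1)) (oi (D \<delta> 1)) = (of_int (eps a \<delta>) :: 'r) \<cdot> oi (D (a + \<delta>) 1)"
  if "long a" "\<delta> \<in> \<Phi>" "ci \<delta> a = -1" for a \<delta> by (rule eps(2)[OF that])
 have D_cancel: "a \<cdot> oi (D \<gamma> 1) = (0 :: ('r, 'n) smat) ==> a = 0" if "\<gamma> \<in> \<Phi>" for a \<gamma>
  using phi_smul[of \<gamma> a "oi (D \<gamma> 1)"] phiD[OF that] by simp
 obtain \<gamma>' where "\<gamma>' \<in> \<Phi>" "ci \<gamma>' \<beta> = 1" using ex_degree_one[OF b] by blast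
 then obtain \<gamma> where ga: "\<gamma> \<in> \<Phi>" "ci \<gamma> \<beta> = -1" using neg_root ci_minus by metis
 \<comment> \<open>The bracket of \<open>h\<close> with a root matrix of degree -1 is minus that
   matrix, and the latter can be cancelled.\<close>
 have h0: "a = 0" if "a \<cdot> h = 0" for a
 proof -
  have "cint \<gamma> \<beta> = -1" using ga by (simp add: cint_def floor_eq_iff)
  hence "a \<cdot> oi (D \<gamma> 1) = - (br (a \<cdot> h) (oi (D \<gamma> 1)))"
   using hh[OF ga(1)] by (simp add: smul_diff_right[symmetric])
  thus ?thesis using that D_cancel[OF ga(1)] by simp
 qed
 have hom_h: "wt.hom 0 h"
  using wt.hom_diff[OF wt.hom_mult[OF he(1,2)]] wt.hom_mult[OF he(2,1)] by (simp add: h_def)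
 have y1: "\<phi> (- \<beta>) y = 0"
 proof (rule h0)
  have "wt.cmp 0 (br e y) = \<phi> (- \<beta>) y \<cdot> h"
   using cmp_br_l[OF he(1), of 0 y] cy[OF b'(2)] by (simp add: h_def f_def smul_diff_right)
  moreover have "wt.cmp 0 (\<phi> (- \<beta>) y \<cdot> e) = 0" using wt.cmp_hom[OF he(1), of 0] b' by (simp add: wt.cmp_smul)
  ultimately show "\<phi> (- \<beta>) y \<cdot> h = 0" using bry by simp
 qed
 hence ey: "br e y = 0" using bry by simp
 have ym1: "\<phi> \<delta> y = 0" if d: "\<delta> \<in> \<Phi>" "ci \<delta> \<beta> = -1" for \<delta>
 proof -
  have "wt.cmp (\<beta> + \<delta>) (br e y) = br e (wt.cmp \<delta> y)"
   using cmp_br_l[OF he(1), of "\<beta> + \<delta>" y] by simp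
  also have "\<dots> = (\<phi> \<delta> y * of_int (eps \<beta> \<delta>)) \<cdot> oi (D (\<beta> + \<delta>) 1)"
   using epsR[OF b d] cy[OF d(1)] by (simp add: e_def smul_diff_right[symmetric])
  finally have "\<phi> \<delta> y * of_int (eps \<beta> \<delta>) = 0"
   using ey D_cancel[OF long_add_root(1)[OF b d]] by simp
  thus ?thesis using eps(1)[OF b d] by auto
 qed
 \<comment> \<open>The relation for z = f, whose coordinate at \<open>- \<beta>\<close> is 1; this
   produces the term \<open>- e\<close>.\<close>
 obtain c where c: "br y f + c \<cdot> y = h - e"
 proof -
  have "\<phi> (- \<beta>) f = 1" using phi_D1[OF b'(2)] by (simp add: f_def)
  thus ?thesis using bryz[of f "D (- \<beta>) 1"] D1_Ls[OF b'(2)] that by (auto simp: f_def h_def)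
 qed
 have cmpc: "br (wt.cmp (v + \<beta>) y) f + c \<cdot> wt.cmp v y = wt.cmp v (h - e)" for v
  using arg_cong[OF c, of "wt.cmp v"] cmp_br_r[OF he(2), of v y]
  by (simp add: wt.cmp_add wt.cmp_smul)
 have cmphe: "wt.cmp v (h - e) = (if v = 0 then h else if v = \<beta> then - e else 0)" for v
  using b' by (auto simp: wt.cmp_diff wt.cmp_hom[OF hom_h] wt.cmp_hom[OF he(1)])
 \<comment> \<open>\<open>2 \<beta>\<close> is no root, so in weight \<open>\<beta>\<close> only
   \<open>c y\<close> and \<open>- e\<close> remain.\<close>
 have "c * \<phi> \<beta> y = -1"
 proof -
  have "2 *\<^sub>R \<beta> \<notin> \<Phi>" using reduced[OF b'(1), of 2] by auto
  hence "wt.cmp (\<beta> + \<beta>) y = 0" using cy0[of "\<beta> + \<beta>"] root_neq_neg(1)[OF b'(1)]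
   by (simp add: scaleR_2 eq_neg_iff_add_eq_0)
  hence "(c * \<phi> \<beta> y + 1) \<cdot> oi (D \<beta> 1) = (0 :: ('r, 'n) smat)"
   using cmpc[of \<beta>] cmphe[of \<beta>] cy[OF b'(1)] b' by (simp add: smul_add_left e_def)
  thus ?thesis using D_cancel[OF b'(1)] by (metis eq_neg_iff_add_eq_0)
 qed
 have y1': "\<phi> \<epsilon> y = 0" if d: "\<epsilon> \<in> \<Phi>" "ci \<epsilon> \<beta> = 1" for \<epsilon>
 proof -
  have d': "ci \<epsilon> (- \<beta>) = -1" using d by simp
  have r: "- \<beta> + \<epsilon> \<in> \<Phi>" using long_add_root(1)[OF _ d(1) d'] b by simp
  have "ci (- \<beta> + \<epsilon>) \<beta> = -1" using d b' by (simp add: ci_diff)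
  hence "wt.cmp (- \<beta> + \<epsilon>) y = 0" using ym1[OF r] cy[OF r] by simp
  moreover have "- \<beta> + \<epsilon> \<noteq> 0" "- \<beta> + \<epsilon> \<noteq> \<beta>"
   using r zero_not_root \<open>ci (- \<beta> + \<epsilon>) \<beta> = -1\<close> b' by auto
  ultimately have "br (wt.cmp \<epsilon> y) f = 0"
   using cmpc[of "- \<beta> + \<epsilon>"] cmphe[of "- \<beta> + \<epsilon>"] by simp
  hence "\<phi> \<epsilon> y \<cdot> br f (oi (D \<epsilon> 1)) = 0"
   using cy[OF d(1)] by (simp add: smul_diff_right)
  hence "(\<phi> \<epsilon> y * of_int (eps (- \<beta>) \<epsilon>)) \<cdot> oi (D (- \<beta> + \<epsilon>) 1) = (0 :: ('r, 'n) smat)"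
   using epsR[OF _ d(1) d'] b by (simp add: f_def)
  hence "\<phi> \<epsilon> y * of_int (eps (- \<beta>) \<epsilon>) = 0" using D_cancel[OF r] by blast
  thus ?thesis using eps(1)[OF _ d(1) d'] b by auto
 qed
 \<comment> \<open>The root matrix of \<open>\<gamma>\<close>, of degree -1, has coordinate 0 at
   \<open>- \<beta>\<close>. In weight \<open>\<beta> + \<gamma>\<close> its relation compares
   \<open>\<phi> \<beta> y\<close> with 1, up to an invertible sign.\<close>
 have yb: "\<phi> \<beta> y = 1"
 proof -
  have r: "\<beta> + \<gamma> \<in> \<Phi>" by (rule long_add_root(1)[OF b ga])
  have "ci (\<beta> + \<gamma>) \<beta> = 1" using ga b' by (simp add: ci_add)
  hence z: "wt.cmp (\<beta> + \<gamma>) y = 0" using y1'[OF r] cy[OF r] by simp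
  have "\<gamma> \<noteq> - \<beta>" "\<gamma> \<noteq> 0" using ga b' by auto
  hence "\<phi> (- \<beta>) (oi (D \<gamma> 1)) = (0 :: 'r)" using phi_hom[OF hom_D1[OF ga(1)], of "- \<beta>"] by simp
  then obtain c' where "br y (oi (D \<gamma> 1)) + c' \<cdot> y = br e (oi (D \<gamma> 1))"
   using bryz[of "oi (D \<gamma> 1)" "D \<gamma> 1"] D1_Ls[OF ga(1)] by auto
  from arg_cong[OF this, of "wt.cmp (\<beta> + \<gamma>)"]
  have "br (wt.cmp \<beta> y) (oi (D \<gamma> 1)) = br e (oi (D \<gamma> 1))"
   using z cmp_br_r[OF hz[OF ga(1)], of "\<beta> + \<gamma>" y] cmp_br_r[OF hz[OF ga(1)], of "\<beta> + \<gamma>" e] wt.cmp_hom[OF he(1), of \<beta>]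
   by (simp add: wt.cmp_add wt.cmp_smul)
  hence "\<phi> \<beta> y \<cdot> br e (oi (D \<gamma> 1)) = br e (oi (D \<gamma> 1))"
   using cy[OF b'(1)] by (simp add: e_def smul_diff_right)
  hence "(\<phi> \<beta> y - 1) \<cdot> br e (oi (D \<gamma> 1)) = 0"
   by (simp only: smul_diff_left) simp
  hence "((\<phi> \<beta> y - 1) * of_int (eps \<beta> \<gamma>)) \<cdot> oi (D (\<beta> + \<gamma>) 1) = (0 :: ('r, 'n) smat)"
   using epsR[OF b ga] by (simp add: e_def)
  hence "(\<phi> \<beta> y - 1) * of_int (eps \<beta> \<gamma>) = 0" using D_cancel[OF r] by blast
  thus ?thesis using eps(1)[OF b ga] by auto
 qed
 hence c1: "c = -1" using \<open>c * \<phi> \<beta> y = -1\<close> by simp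
 have y0: "wt.cmp 0 y = 0"
  using cmpc[of 0] cmphe[of 0] cy[OF b'(1)] yb c1 by (simp add: h_def e_def)
 have yd0: "\<phi> \<delta> y = 0" if d: "\<delta> \<in> \<Phi>" "ci \<delta> \<beta> = 0" for \<delta>
 proof -
  have "wt.cmp (\<beta> + \<delta>) y = 0" using long_add_not_root[OF b d(1)] d(2) cy0 by simp
  moreover have "\<delta> \<noteq> 0" "\<delta> \<noteq> \<beta>" using d b' by auto
  ultimately have "wt.cmp \<delta> y = 0"
   using cmpc[of \<delta>] cmphe[of \<delta>] c1 by (simp add: add.commute)
  thus ?thesis using cy[OF d(1)] D_cancel[OF d(1)] by simp
 qed
 have "y = e"
 proof (rule wt.eq_by_cmp)
  fix v
  have ce: "wt.cmp v e = (if v = \<beta> then e else 0)" by (rule wt.cmp_hom[OF he(1)])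
  consider "v = 0" | "v \<noteq> 0" "v \<notin> \<Phi>" | "v = \<beta>" | "v = - \<beta>" | "v \<in> \<Phi>" "v \<noteq> \<beta>" "v \<noteq> - \<beta>" by blast
  thus "wt.cmp v y = wt.cmp v e"
  proof cases
   case 5
   hence "\<phi> v y = 0" using ci_long[OF b 5] ym1 y1' yd0 by auto
   thus ?thesis using 5 cy ce by simp
  next
   case 4
   thus ?thesis using cy[OF b'(2)] y1 ce b' by (auto simp: neg_equal_zero)
  qed (use y0 cy0 ce b' cy[OF b'(1)] yb in \<open>auto simp: e_def\<close>)
 qed
 thus ?thesis using cj_eq_iff[OF det, of e e] by (simp add: y_def e_def)
qed

end


text \<open>Identities between rational functions whose denominator is a power of \<open>d\<close>; on the
 other ring they are only used where \<open>d\<close> takes the value \<open>1\<close>.\<close>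

definition regpair :: "((complex, 'n::finite) smat \<Rightarrow> complex) \<Rightarrow> (('r::comm_ring_1, 'n) smat \<Rightarrow> 'r) \<Rightarrow>
  ((complex, 'n) smat \<Rightarrow> complex) \<Rightarrow> (('r, 'n) smat \<Rightarrow> 'r) \<Rightarrow> bool" where
 "regpair d d' F F' \<longleftrightarrow> (\<exists>p N. (\<forall>A. d A \<noteq> 0 \<longrightarrow> F A * d A ^ N = ev p A) \<and> (\<forall>A. d' A = 1 \<longrightarrow> F' A = ev p A))"

lemma regpair_function_pairs:
 assumes "ipair d d'" shows "function_pairs (regpair d d')"
proof
 obtain q where q: "d = ev q" "d' = ev q" using assms by (auto simp: ipair_def)
 show "regpair d d' (\<lambda>_. of_int c) (\<lambda>_. of_int c)" for c
  unfolding regpair_def by (intro exI[of _ "Poly_Mapping.single 0 c"] exI[of _ 0]) auto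
 fix F F' G G' assume "regpair d d' F F'" "regpair d d' G G'"
 then obtain p N r M where
  p: "\<And>A. d A \<noteq> 0 ==> F A * d A ^ N = ev p A" "\<And>A. d' A = 1 ==> F' A = ev p A" and
  r: "\<And>A. d A \<noteq> 0 ==> G A * d A ^ M = ev r A" "\<And>A. d' A = 1 ==> G' A = ev r A"
  unfolding regpair_def by blast
 show "regpair d d' (\<lambda>a. F a + G a) (\<lambda>b. F' b + G' b)" unfolding regpair_def
 proof (intro exI[of _ "p * q ^ M + r * q ^ N"] exI[of _ "N + M"] conjI allI impI)
  fix A assume "d A \<noteq> 0"
  thus "(F A + G A) * d A ^ (N + M) = ev (p * q ^ M + r * q ^ N) A"
   by (simp add: p(1)[symmetric] r(1)[symmetric] q(1)[symmetric] power_add algebra_simps)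
 next
  fix A assume "d' A = 1"
  thus "F' A + G' A = ev (p * q ^ M + r * q ^ N) A" by (simp add: p(2) r(2) q(2)[symmetric])
 qed
 show "regpair d d' (\<lambda>a. F a * G a) (\<lambda>b. F' b * G' b)" unfolding regpair_def
 proof (intro exI[of _ "p * r"] exI[of _ "N + M"] conjI allI impI)
  fix A assume "d A \<noteq> 0"
  thus "F A * G A * d A ^ (N + M) = ev (p * r) A"
   by (simp add: p(1)[symmetric] r(1)[symmetric] power_add algebra_simps)
 next
  fix A assume "d' A = 1"
  thus "F' A * G' A = ev (p * r) A" by (simp add: p(2) r(2))
 qed
qed

lemma regpair_ipair: "ipair F F' ==> regpair d d' F F'"
 unfolding ipair_def regpair_def by (metis mult.right_neutral power_0)

lemma regpair_inverse: "regpair d d' (\<lambda>A. 1 / d A) (\<lambda>A. 1)"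
 unfolding regpair_def by (intro exI[of _ 1]) auto

lemma (in function_pairs) mat_rx: "Q f f' ==> mat_pair (\<lambda>a. rx D (f a)) (\<lambda>b. rx D (f' b))"
 unfolding rx_def by (intro mat_sum mat_smul power mat_const)

lemma (in grading) cmp_mult:
 fixes X Y :: "('r::comm_ring_1, 'n) smat"
 assumes "finite T" "\<And>i. i \<notin> T ==> cmp i X * cmp (j - i) Y = 0"
 shows "cmp j (X * Y) = (\<Sum>i\<in>T. cmp i X * cmp (j - i) Y)"
proof -
 let ?S = "(\<lambda>(i, j). i - j) ` (I \<times> I)"
 have "X * Y = (\<Sum>i\<in>?S. cmp i X * Y)" using cmp_expand[of X] by (metis sum_distrib_right)
 hence "cmp j (X * Y) = (\<Sum>i\<in>?S. cmp i X * cmp (j - i) Y)"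
  by (simp add: cmp_sum cmp_mult_left[OF hom_cmp])
 also have "\<dots> = (\<Sum>i\<in>?S \<union> T. cmp i X * cmp (j - i) Y)"
 proof (rule sum.mono_neutral_left)
  have "cmp i X = 0" if "i \<notin> ?S" for i
  proof -
   have "cmp i X = cmp i (\<Sum>v\<in>?S. cmp v X)" using cmp_expand[of X] by simp
   also have "\<dots> = (\<Sum>v\<in>?S. if i = v then cmp v X else 0)"
    by (simp add: cmp_sum cmp_hom[OF hom_cmp])
   also have "\<dots> = 0" using that by (intro sum.neutral) auto
   finally show ?thesis .
  qed
  thus "\<forall>i\<in>?S \<union> T - ?S. cmp i X * cmp (j - i) Y = 0" by auto
 qed (use assms in auto)
 also have "\<dots> = (\<Sum>i\<in>T. cmp i X * cmp (j - i) Y)"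
  by (rule sum.mono_neutral_right) (use assms in auto)
 finally show ?thesis .
qed

lemma (in grading) hom_bracket: "hom u X ==> hom v Y ==> u + v = w ==> hom w (X * Y - Y * X)"
 using hom_diff[OF hom_mult[of u X v Y]] hom_mult[of v Y u X] by (simp add: add.commute)

section \<open>Orbits of long root matrices\<close>

context chevalley_rep begin

lemma grading_P: "\<theta> \<in> \<Phi> ==> grading (P \<theta>) (weight_range (E \<theta>))"
 by unfold_locales (auto simp: P_idem P_sum P_out)

lemma GC_prod_X: "set ds \<subseteq> \<Phi> ==> Xs s ds \<in> GC"
 by (induction ds) (auto intro: GC.intros)

lemma GR_prod_X: "set ds \<subseteq> \<Phi> ==> A \<in> GR ==> Xs s ds * A \<in> GR"
 by (induction ds) (auto simp: mult.assoc intro: GR_X_left)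

lemma prod_X_inverse: "set ds \<subseteq> \<Phi> ==>
 Xs (\<lambda>\<delta>. - s \<delta>) (rev ds) * Xs s ds = 1"
proof (induction ds)
 case (Cons a ds)
 thus ?case
  using X_inverse(2)[of a "s a"] by (simp add: mult.assoc) (simp add: mult.assoc[symmetric])
qed simp

lemma prod_X_inverse': "set ds \<subseteq> \<Phi> ==>
 Xs s ds * Xs (\<lambda>\<delta>. - s \<delta>) (rev ds) = 1"
 by (rule smat_inverse_comm[OF prod_X_inverse])

definition lower_roots :: "'e \<Rightarrow> 'e list" where
 "lower_roots \<theta> = (SOME xs. set xs = {\<delta>\<in>\<Phi>. ci \<delta> \<theta> = -1} \<and> distinct xs)"

lemma lower_roots: "set (lower_roots \<theta>) = {\<delta>\<in>\<Phi>. ci \<delta> \<theta> = -1}" "distinct (lower_roots \<theta>)"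
proof -
 have "\<exists>xs. set xs = {\<delta>\<in>\<Phi>. ci \<delta> \<theta> = -1} \<and> distinct xs" by (rule finite_distinct_list) simp
 from someI_ex[OF this] show "set (lower_roots \<theta>) = {\<delta>\<in>\<Phi>. ci \<delta> \<theta> = -1}" "distinct (lower_roots \<theta>)"
  unfolding lower_roots_def by auto
qed

lemma X_expand: "X \<delta> t = (\<Sum>k<CARD('n). t ^ k \<cdot> oi (D \<delta> k))"
 by (simp add: X_def rx_def)

end

text \<open>A long \<open>\<theta>\<close> grades everything by the eigenvalues of
  \<open>H \<theta>\<close>. On the Lie algebra the degrees are -2, ..., 2, and the extreme ones
  occur at \<open>\<theta>\<close> and \<open>- \<theta>\<close> only.\<close>

locale chevalley_long = chevalley_rep \<Phi> \<Delta> E H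
 for \<Phi> :: "'e::euclidean_space set" and \<Delta> and E :: "'e \<Rightarrow> (complex, 'n::finite) smat" and H +
 fixes \<theta> :: 'e
 assumes long_theta: "long \<theta>"
begin

lemma theta [simp]: "\<theta> \<in> \<Phi>" by (rule long_root[OF long_theta])

sublocale dg: grading "P \<theta>" "weight_range (E \<theta>)" by (rule grading_P[OF theta])

abbreviation dgr :: "'e \<Rightarrow> int" where "dgr \<delta> \<equiv> cint \<delta> \<theta>"

lemma dgr: "\<delta> \<in> \<Phi> ==> of_int (dgr \<delta>) = ci \<delta> \<theta>" by (simp add: cint root_integral)
lemma dgr_eq: "\<delta> \<in> \<Phi> ==> dgr \<delta> = m \<longleftrightarrow> ci \<delta> \<theta> = of_int m" using dgr[of \<delta>] by (metis of_int_eq_iff)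
lemma dgr_theta [simp]: "dgr \<theta> = 2" "dgr (- \<theta>) = -2" by (simp_all add: cint_def)

lemma dgr_bound: "\<delta> \<in> \<Phi> ==> \<delta> = \<theta> \<or> \<delta> = - \<theta> \<or> dgr \<delta> \<in> {-1, 0, 1}"
 using ci_long[OF long_theta, of \<delta>] by (auto simp: dgr_eq)

lemma dg_hom_E: "\<delta> \<in> \<Phi> ==> dg.hom (dgr \<delta>) (E \<delta>)"
 unfolding dg.hom_def using shift_P[OF theta, of "E \<delta>" "dgr \<delta>"] HE[OF theta, of \<delta>] dgr[of \<delta>]
 by (metis of_real_of_int_eq)

lemma dg_hom_D: assumes "\<delta> \<in> \<Phi>" shows "dg.hom (int k * dgr \<delta>) (oi (D \<delta> k))"
proof -
 have "dg.hom (int k * dgr \<delta>) (E \<delta> ^ k)"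
  by (induction k) (use dg.hom_mult[OF dg_hom_E[OF assms]] in \<open>auto simp: distrib_right\<close>)
 hence "dg.hom (int k * dgr \<delta>) (oi (D \<delta> k) :: (complex, 'n) smat)"
  by (simp add: oi_D[OF assms] dp_def dg.hom_smul)
 hence "oi (D \<delta> k * P \<theta> i) = (oi (P \<theta> (i + int k * dgr \<delta>) * D \<delta> k) :: (complex, 'n) smat)" for i
  unfolding dg.hom_def by (simp add: oi_mult)
 hence "D \<delta> k * P \<theta> i = P \<theta> (i + int k * dgr \<delta>) * D \<delta> k" for i by (rule oi_inj)
 thus ?thesis unfolding dg.hom_def by (metis oi_mult)
qed

lemma dg_hom_D1: "\<delta> \<in> \<Phi> ==> dg.hom (dgr \<delta>) (D1 \<delta>)" using dg_hom_D[of \<delta> "Suc 0"] by simp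

lemma dg_hom_cmp0: "Z \<in> Ls ==> dg.hom 0 (wt.cmp 0 Z)"
 unfolding dg.hom_def using shift_P[OF theta, of "wt.cmp 0 Z" 0] Ls_cmp_0_H[of Z \<theta>] by simp

lemma dg_cmp_Ls:
 assumes Z: "Z \<in> Ls"
 shows "dg.cmp j Z = (if j = 0 then wt.cmp 0 Z else 0) + (\<Sum>\<gamma>\<in>{\<gamma>\<in>\<Phi>. dgr \<gamma> = j}. \<phi> \<gamma> Z \<cdot> E \<gamma>)"
proof -
 have "dg.cmp j Z = dg.cmp j (wt.cmp 0 Z) + (\<Sum>\<gamma>\<in>\<Phi>. \<phi> \<gamma> Z \<cdot> dg.cmp j (E \<gamma>))"
  by (subst Ls_expand[OF Z]) (simp only: dg.cmp_add dg.cmp_sum dg.cmp_smul)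
 also have "dg.cmp j (wt.cmp 0 Z) = (if j = 0 then wt.cmp 0 Z else 0)"
  by (rule dg.cmp_hom[OF dg_hom_cmp0[OF Z]])
 also have "(\<Sum>\<gamma>\<in>\<Phi>. \<phi> \<gamma> Z \<cdot> dg.cmp j (E \<gamma>)) = (\<Sum>\<gamma>\<in>\<Phi>. if dgr \<gamma> = j then \<phi> \<gamma> Z \<cdot> E \<gamma> else 0)"
  by (intro sum.cong refl) (auto simp: dg.cmp_hom[OF dg_hom_E])
 also have "\<dots> = (\<Sum>\<gamma>\<in>{\<gamma>\<in>\<Phi>. dgr \<gamma> = j}. \<phi> \<gamma> Z \<cdot> E \<gamma>)"
  by (rule sum.inter_filter[symmetric]) simp
 finally show ?thesis .
qed

lemma roots_dgr_2: "{\<gamma>\<in>\<Phi>. dgr \<gamma> = 2} = {\<theta>}" "{\<gamma>\<in>\<Phi>. dgr \<gamma> = -2} = {- \<theta>}"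
 using dgr_bound by force+

lemma dg_cmp_Ls_2: "Z \<in> Ls ==> dg.cmp 2 Z = \<phi> \<theta> Z \<cdot> E \<theta>"
 and dg_cmp_Ls_m2: "Z \<in> Ls ==> dg.cmp (-2) Z = \<phi> (- \<theta>) Z \<cdot> E (- \<theta>)"
 by (simp_all add: dg_cmp_Ls roots_dgr_2)

lemma dg_cmp_Ls_big: "Z \<in> Ls ==> \<bar>j\<bar> > 2 ==> dg.cmp j Z = 0"
proof -
 assume "Z \<in> Ls" "\<bar>j\<bar> > 2"
 moreover have "{\<gamma>\<in>\<Phi>. dgr \<gamma> = j} = {}" using \<open>\<bar>j\<bar> > 2\<close> dgr_bound by fastforce
 moreover have "j \<noteq> 0" using \<open>\<bar>j\<bar> > 2\<close> by auto
 ultimately show ?thesis unfolding dg_cmp_Ls[OF \<open>Z \<in> Ls\<close>] by (simp only: sum.empty) simp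
qed

lemma phi_dg_cmp: "Z \<in> Ls ==> \<gamma> \<in> \<Phi> ==> dgr \<gamma> = j ==> \<phi> \<gamma> (dg.cmp j Z) = \<phi> \<gamma> Z"
proof -
 assume h: "Z \<in> Ls" "\<gamma> \<in> \<Phi>" "dgr \<gamma> = j"
 have "\<phi> \<gamma> (wt.cmp 0 Z) = 0" using phi_hom[OF wt.hom_cmp, of 0 \<gamma> Z] h(2) zero_not_root by metis
 hence "\<phi> \<gamma> (dg.cmp j Z) = (\<Sum>\<delta>\<in>{\<delta>\<in>\<Phi>. dgr \<delta> = j}. \<phi> \<gamma> (\<phi> \<delta> Z \<cdot> E \<delta>))"
  by (simp add: dg_cmp_Ls h(1) phi_add phi_sum)
 also have "\<dots> = (\<Sum>\<delta>\<in>{\<delta>\<in>\<Phi>. dgr \<delta> = j}. if \<delta> = \<gamma> then \<phi> \<gamma> Z else 0)"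
  by (intro sum.cong refl) (auto simp: phi_smul phi_E_if)
 also have "\<dots> = \<phi> \<gamma> Z" using h by simp
 finally show ?thesis .
qed

text \<open>The equation \<open>ad(w)\<^sup>2 f = \<kappa> w\<close> cuts out the cone over the orbit of the long root matrices.\<close>

lemma orbit_unique:
 assumes w: "w \<in> Ls" and w2: "\<phi> \<theta> w = 1" and w1: "\<And>\<epsilon>. \<epsilon> \<in> \<Phi> ==> ci \<epsilon> \<theta> = 1 ==> \<phi> \<epsilon> w = 0"
  and g: "\<gamma> \<in> \<Phi>" "ci \<gamma> \<theta> = 1" and wg: "\<phi> \<gamma> (br w (E \<gamma>)) = 0"
  and orb: "br w (br w (E (- \<theta>))) = \<kappa> \<cdot> w"
 shows "w = E \<theta>"
proof -
 define e f where "e = E \<theta>" and "f = E (- \<theta>)"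
 define w0 wm wl where "w0 = dg.cmp 0 w" and "wm = dg.cmp (-1) w" and "wl = dg.cmp (-2) w"
 have LsE: "e \<in> Ls" "f \<in> Ls" by (simp_all add: e_def f_def Ls_E)
 have he: "dg.hom 2 e" "dg.hom (-2) f" "dg.hom 0 w0" "dg.hom (-1) wm" "dg.hom (-2) wl"
  using dg_hom_E[of \<theta>] dg_hom_E[of "- \<theta>"] dg.hom_cmp by (simp_all add: e_def f_def w0_def wm_def wl_def)
 have h: "br e f = H \<theta>" by (simp add: e_def f_def H_def)
 have hH: "dg.hom 0 (H \<theta>)" using dg.hom_bracket[OF he(1,2), of 0] by (simp add: h)
 have c2: "dg.cmp 2 w = e" using dg_cmp_Ls_2[OF w] w2 by (simp add: e_def)
 have c1: "dg.cmp 1 w = 0"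
  unfolding dg_cmp_Ls[OF w] using w1 by (auto simp: dgr_eq intro!: sum.neutral)
 have wsum: "w = e + w0 + wm + wl"
 proof (rule dg.eq_by_cmp)
  fix i :: int
  have ce: "dg.cmp j (e + w0 + wm + wl) = (if j = 2 then e else 0) + (if j = 0 then w0 else 0)
    + (if j = -1 then wm else 0) + (if j = -2 then wl else 0)" for j
   by (simp add: dg.cmp_add dg.cmp_hom[OF he(1)] dg.cmp_hom[OF he(3)] dg.cmp_hom[OF he(4)] dg.cmp_hom[OF he(5)])
  consider "i = 2" | "i = 1" | "i = 0" | "i = -1" | "i = -2" | "\<bar>i\<bar> > 2" by linarith
  thus "dg.cmp i w = dg.cmp i (e + w0 + wm + wl)"
  proof cases
   case 6
   hence "i \<noteq> 2" "i \<noteq> 0" "i \<noteq> -1" "i \<noteq> -2" by auto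
   thus ?thesis using dg_cmp_Ls_big[OF w 6] ce by simp
  qed (simp_all add: ce c2 c1 w0_def[symmetric] wm_def[symmetric] wl_def[symmetric])
 qed
 have LsZ: "Z \<in> Ls" if "Z = w0 \<or> Z = wm \<or> Z = wl" for Z
  using that unfolding w0_def wm_def wl_def dg_cmp_Ls[OF w]
  by (auto intro!: Ls_sum Ls_smul Ls_E Ls_add Ls_cmp_0[OF w] Ls_0)
 \<comment> \<open>Degree -2 is the line of \<open>f\<close>, so the bracket with the degree 0 part
   multiplies \<open>f\<close> by a scalar.\<close>
 define \<eta> where "\<eta> = \<phi> (- \<theta>) (br w0 f)"
 have b0: "br w0 f = \<eta> \<cdot> f"
 proof -
  have "dg.hom (-2) (br w0 f)" by (rule dg.hom_bracket[OF he(3,2)]) simp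
  hence "br w0 f = dg.cmp (-2) (br w0 f)" by (simp add: dg.cmp_hom)
  also have "\<dots> = \<eta> \<cdot> f" using dg_cmp_Ls_m2[OF Ls_bracket[OF LsZ LsE(2)], of w0] by (simp add: \<eta>_def f_def)
  finally show ?thesis .
 qed
 have bm: "br wm f = 0"
 proof -
  have "dg.hom (-3) (br wm f)" by (rule dg.hom_bracket[OF he(4,2)]) simp
  hence "br wm f = dg.cmp (-3) (br wm f)" by (simp add: dg.cmp_hom)
  also have "\<dots> = 0" using dg_cmp_Ls_big[OF Ls_bracket[OF LsZ LsE(2)], of wm "-3"] by simp
  finally show ?thesis .
 qed
 define l where "l = \<phi> (- \<theta>) w"
 have wl: "wl = l \<cdot> f" using dg_cmp_Ls_m2[OF w] by (simp add: wl_def f_def l_def)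
 have bl: "br wl f = 0" by (simp add: wl)
 have bw: "br w f = H \<theta> + \<eta> \<cdot> f"
 proof -
  have "br w f = br e f + br w0 f + br wm f + br wl f" by (simp add: wsum algebra_simps)
  thus ?thesis by (simp add: h b0 bm bl)
 qed
 have H0: "br w0 (H \<theta>) = 0"
 proof -
  have "br (wt.cmp 0 w) (H \<theta>) = 0" using Ls_cmp_0_H[OF w theta] by simp
  moreover have "E \<gamma> * H \<theta> = H \<theta> * E \<gamma>" if "\<gamma> \<in> \<Phi>" "dgr \<gamma> = 0" for \<gamma>
   using HE[OF theta that(1)] that by (simp add: dgr_eq)
  ultimately show ?thesis
   unfolding w0_def dg_cmp_Ls[OF w] by (simp add: algebra_simps sum_distrib_left sum_distrib_right)
 qed
 have Hm: "br wm (H \<theta>) = wm"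
 proof -
  have "E \<gamma> * H \<theta> = H \<theta> * E \<gamma> + E \<gamma>" if "\<gamma> \<in> \<Phi>" "dgr \<gamma> = -1" for \<gamma>
   using HE[OF theta that(1)] that by (simp add: dgr_eq algebra_simps)
  thus ?thesis unfolding wm_def dg_cmp_Ls[OF w]
   by (simp add: sum_distrib_left sum_distrib_right smul_add_right sum.distrib)
 qed
 have Hf: "br f (H \<theta>) = 2 \<cdot> f" using HE[OF theta, of "- \<theta>"] by (simp add: f_def algebra_simps)
 have He: "br e (H \<theta>) = (-2) \<cdot> e" using HE[OF theta theta] by (simp add: e_def algebra_simps)
 have brl: "br Z (Y + a \<cdot> V) = br Z Y + a \<cdot> br Z V" for Z Y V :: "(complex, 'n) smat" and a
  by (simp add: algebra_simps smul_algebra)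
 have bww: "br w (br w f) = br w (H \<theta>) + \<eta> \<cdot> (H \<theta> + \<eta> \<cdot> f)"
  using brl[of w "H \<theta>" \<eta> f] by (simp only: bw)
 have "br w (H \<theta>) = br e (H \<theta>) + br w0 (H \<theta>) + br wm (H \<theta>) + l \<cdot> br f (H \<theta>)"
  unfolding wsum wl by (simp add: algebra_simps smul_algebra)
 also have "\<dots> = (-2) \<cdot> e + wm + (2 * l) \<cdot> f"
  unfolding He H0 Hm Hf by (simp add: mult.commute)
 finally have main: "(-2) \<cdot> e + wm + (2 * l) \<cdot> f + \<eta> \<cdot> (H \<theta> + \<eta> \<cdot> f) = \<kappa> \<cdot> w"
  using orb bww by (simp add: f_def)
 have e0: "e \<noteq> 0" "f \<noteq> 0" using E_nonzero by (simp_all add: e_def f_def)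
 note cs = dg.cmp_add dg.cmp_diff dg.cmp_smul dg.cmp_hom[OF he(1)] dg.cmp_hom[OF he(2)] dg.cmp_hom[OF he(3)]
  dg.cmp_hom[OF he(4)] dg.cmp_hom[OF he(5)] dg.cmp_hom[OF hH] dg.cmp_minus
 \<comment> \<open>Degree 2 gives \<open>\<kappa> = -2\<close>, degree 0 makes \<open>w0\<close> a
   multiple of \<open>H \<theta>\<close>, degree -1 gives \<open>3 wm = 0\<close>, and degree -2
   finally \<open>4 l = 0\<close>. For these divisions the argument is carried out over the complex
   numbers.\<close>
 have "(-2) \<cdot> e = \<kappa> \<cdot> e" using arg_cong[OF main, of "dg.cmp 2"] unfolding wsum by (simp add: cs)
 hence "(\<kappa> + 2) \<cdot> e = 0" by (simp add: smul_add_left neg_eq_iff_add_eq_0 add.commute)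
 hence k: "\<kappa> = -2" using e0 by (simp add: eq_neg_iff_add_eq_0)
 have "\<eta> \<cdot> H \<theta> = \<kappa> \<cdot> w0" using arg_cong[OF main, of "dg.cmp 0"] unfolding wsum by (simp add: cs)
 hence w0: "w0 = (- \<eta> / 2) \<cdot> H \<theta>"
 proof -
  have "w0 = (- 1 / 2) \<cdot> \<kappa> \<cdot> w0" by (simp add: k)
  also have "\<dots> = (- 1 / 2) \<cdot> \<eta> \<cdot> H \<theta>" by (simp only: \<open>\<eta> \<cdot> H \<theta> = \<kappa> \<cdot> w0\<close>)
  finally show ?thesis by simp
 qed
 have "wm = \<kappa> \<cdot> wm" using arg_cong[OF main, of "dg.cmp (-1)"] unfolding wsum by (simp add: cs)
 hence "(1 - \<kappa>) \<cdot> wm = 0" by (simp add: smul_diff_left)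
 hence wm0: "wm = 0" using k by simp
 \<comment> \<open>\<open>\<gamma>\<close> has degree 1, so this coordinate detects the remaining
   multiple \<open>- \<eta> / 2\<close> of \<open>H \<theta>\<close>.\<close>
 have "\<phi> \<gamma> (br w (E \<gamma>)) = \<phi> \<gamma> (dg.cmp 1 (br w (E \<gamma>)))"
  using phi_dg_cmp[OF Ls_bracket[OF w Ls_E[OF g(1)]] g(1), of 1] g by (simp add: dgr_eq)
 also have "dg.cmp 1 (br w (E \<gamma>)) = br w0 (E \<gamma>)"
 proof -
  have "dgr \<gamma> = 1" using g by (simp add: dgr_eq)
  hence "dg.hom 1 (E \<gamma>)" using dg_hom_E[OF g(1)] by simp
  thus ?thesis by (simp add: dg.cmp_diff dg.cmp_mult_left dg.cmp_mult_right w0_def)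
 qed
 also have "br w0 (E \<gamma>) = (- \<eta> / 2) \<cdot> E \<gamma>"
 proof -
  have "br (a \<cdot> H \<theta>) (E \<gamma>) = a \<cdot> br (H \<theta>) (E \<gamma>)" for a by (simp add: smul_diff_right)
  moreover have "br (H \<theta>) (E \<gamma>) = E \<gamma>" using HE[OF theta g(1)] g(2) by simp
  ultimately show ?thesis unfolding w0 by presburger
 qed
 finally have "\<eta> = 0" using wg phi_E[OF g(1)] by (simp add: phi_smul phi_minus)
 moreover have "(2 * l) \<cdot> f = \<kappa> \<cdot> wl"
  using arg_cong[OF main, of "dg.cmp (-2)"] \<open>\<eta> = 0\<close> unfolding wsum by (simp add: cs)
 hence "(4 * l) \<cdot> f = 0" by (simp add: wl k smul_add_left[symmetric] eq_neg_iff_add_eq_0)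
 hence "wl = 0" using e0 by (simp add: wl)
 ultimately show ?thesis using wsum wm0 w0 by (simp add: e_def)
qed

end


context chevalley_long begin

text \<open>Unipotent elements going up (s = 1) or down (s = -1) in the grading, with first-order
  part \<open>S\<close>. Products add these parts, whatever happens further away from degree
  0.\<close>

definition tri :: "int \<Rightarrow> ('r::comm_ring_1, 'n) smat \<Rightarrow> ('r, 'n) smat \<Rightarrow> bool" where
 "tri s S v \<longleftrightarrow> (s = 1 \<or> s = -1) \<and> (\<forall>i. i * s < 0 \<longrightarrow> dg.cmp i v = 0) \<and> dg.cmp 0 v = 1 \<and> dg.cmp s v = S"

lemma tri_1: "s = 1 \<or> s = -1 ==> tri s 0 1" by (auto simp: tri_def dg.cmp_hom[OF dg.hom_1])

lemma tri_mult: assumes "tri s S v" "tri s T w" shows "tri s (S + T) (v * w)"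
proof -
 have s: "s = 1 \<or> s = -1" using assms by (simp add: tri_def)
 have z: "i * s < 0 ==> dg.cmp i v = 0" "i * s < 0 ==> dg.cmp i w = 0" for i
  using assms by (auto simp: tri_def)
 have "dg.cmp j (v * w) = (\<Sum>i\<in>{}. dg.cmp i v * dg.cmp (j - i) w)" if "j * s < 0" for j
 proof (rule dg.cmp_mult)
  fix i
  have "i * s < 0 \<or> (j - i) * s < 0" using that s by auto
  thus "dg.cmp i v * dg.cmp (j - i) w = 0" using z by auto
 qed simp
 moreover have "dg.cmp 0 (v * w) = (\<Sum>i\<in>{0}. dg.cmp i v * dg.cmp (0 - i) w)"
 proof (rule dg.cmp_mult)
  fix i :: int assume "i \<notin> {0}"
  hence "i * s < 0 \<or> (0 - i) * s < 0" using s by auto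
  thus "dg.cmp i v * dg.cmp (0 - i) w = 0" using z by auto
 qed simp
 moreover have "dg.cmp s (v * w) = (\<Sum>i\<in>{0, s}. dg.cmp i v * dg.cmp (s - i) w)"
 proof (rule dg.cmp_mult)
  fix i :: int assume "i \<notin> {0, s}"
  hence "i * s < 0 \<or> (s - i) * s < 0" using s by auto
  thus "dg.cmp i v * dg.cmp (s - i) w = 0" using z by auto
 qed simp
 ultimately show ?thesis using assms s by (auto simp: tri_def add.commute)
qed

lemma cmp_X:
 assumes d: "\<delta> \<in> \<Phi>"
 shows "dg.cmp i (X \<delta> t) = (\<Sum>k<CARD('n). if i = int k * dgr \<delta> then t ^ k \<cdot> oi (D \<delta> k) else 0)"
 unfolding X_expand dg.cmp_sum by (intro sum.cong refl) (simp add: dg.cmp_smul dg.cmp_hom[OF dg_hom_D[OF d]])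

lemma D_vanish: "\<delta> \<in> \<Phi> ==> k \<ge> CARD('n) ==> D \<delta> k = 0"
 using dps_D by (auto simp: dps_def)

lemma cmp_X_mult:
 assumes d: "\<delta> \<in> \<Phi>" and "dgr \<delta> \<noteq> 0"
 shows "dg.cmp (int k * dgr \<delta>) (X \<delta> t) = t ^ k \<cdot> oi (D \<delta> k)"
 using D_vanish[OF d, of k] assms by (auto simp: cmp_X)

lemma tri_X:
 assumes d: "\<delta> \<in> \<Phi>" and s: "dgr \<delta> = s" "s = 1 \<or> s = -1"
 shows "tri s (t \<cdot> D1 \<delta>) (X \<delta> t)"
proof -
 have "dg.cmp i (X \<delta> t) = 0" if "i * s < 0" for i
  unfolding cmp_X[OF d] using that s by (intro sum.neutral) auto
 thus ?thesis
  using cmp_X_mult[OF d, of 0 t] cmp_X_mult[OF d, of "Suc 0" t] d s by (auto simp: tri_def)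
qed

lemma tri_X2:
 assumes d: "\<delta> \<in> \<Phi>" and s: "dgr \<delta> = 2 * s" "s = 1 \<or> s = -1"
 shows "tri s 0 (X \<delta> t)"
proof -
 have "dg.cmp i (X \<delta> t) = 0" if "i * s < 0 \<or> i = s" for i
 proof -
  have "i \<noteq> int k * dgr \<delta>" for k using that s by (auto; presburger)
  thus ?thesis unfolding cmp_X[OF d] by (intro sum.neutral) simp
 qed
 thus ?thesis using cmp_X_mult[OF d, of 0 t] d s by (auto simp: tri_def)
qed

lemma tri_prod_X:
 assumes "\<And>\<delta>. \<delta> \<in> set ds ==> \<delta> \<in> \<Phi> \<and> dgr \<delta> = s" "s = 1 \<or> s = -1"
 shows "tri s (\<Sum>\<delta>\<leftarrow>ds. t \<delta> \<cdot> D1 \<delta>) (Xs t ds)"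
 using assms(1)
proof (induction ds)
 case (Cons a ds)
 thus ?case using tri_mult[OF tri_X[of a s "t a"]] assms(2) by simp
qed (simp add: tri_1[OF assms(2)])

lemma lower: "\<delta> \<in> set (lower_roots \<theta>) ==> \<delta> \<in> \<Phi> \<and> dgr \<delta> = -1"
 by (auto simp: lower_roots dgr_eq)

lemma lower_subset: "set (lower_roots \<theta>) \<subseteq> \<Phi>" "set (rev (lower_roots \<theta>)) \<subseteq> \<Phi>" using lower by auto

text \<open>A fixed root of degree 1, at which a multiple of \<open>H \<theta>\<close> becomes
  visible.\<close>

definition gam :: 'e where "gam = (SOME \<gamma>. \<gamma> \<in> \<Phi> \<and> ci \<gamma> \<theta> = 1)"

lemma gam: "gam \<in> \<Phi>" "ci gam \<theta> = 1"
proof -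
 have "\<exists>\<gamma>. \<gamma> \<in> \<Phi> \<and> ci \<gamma> \<theta> = 1" using ex_degree_one[OF long_theta] by metis
 from someI_ex[OF this] show "gam \<in> \<Phi>" "ci gam \<theta> = 1" by (simp_all add: gam_def)
qed

text \<open>For \<open>w\<close> in the orbit of the root matrix of \<open>\<theta>\<close> whose \<open>\<theta>\<close>-coordinate is \<open>1\<close>, conjugation by
 \<open>vv w\<close> takes that root matrix to \<open>w\<close>: the factors successively remove the components of \<open>w\<close> of
 degrees \<open>1\<close> and \<open>0\<close>, and the orbit equation determines the rest.\<close>

definition cf :: "'e \<Rightarrow> ('r::comm_ring_1, 'n) smat \<Rightarrow> 'r" where
 "cf \<delta> w = - of_int (eps \<theta> \<delta>) * \<phi> (\<theta> + \<delta>) w"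
definition v1 :: "('r::comm_ring_1, 'n) smat \<Rightarrow> ('r, 'n) smat" where
 "v1 w = Xs (\<lambda>\<delta>. cf \<delta> w) (lower_roots \<theta>)"
definition v1' :: "('r::comm_ring_1, 'n) smat \<Rightarrow> ('r, 'n) smat" where
 "v1' w = Xs (\<lambda>\<delta>. - cf \<delta> w) (rev (lower_roots \<theta>))"
text \<open>The factor along \<open>- \<theta>\<close> with parameter s adds
  \<open>s H \<theta>\<close> in degree 0. Since \<open>gam\<close> has degree 1, the coordinate
  changes by s, and this choice of s makes it zero.\<close>

definition cf' :: "('r::comm_ring_1, 'n) smat \<Rightarrow> 'r" where
 "cf' w = - \<phi> gam (br (v1' w * w * v1 w) (D1 gam))"
definition vv :: "('r::comm_ring_1, 'n) smat \<Rightarrow> ('r, 'n) smat" where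
 "vv w = v1 w * X (- \<theta>) (cf' w)"
definition vv' :: "('r::comm_ring_1, 'n) smat \<Rightarrow> ('r, 'n) smat" where
 "vv' w = X (- \<theta>) (- cf' w) * v1' w"

lemma v1_inverse: "v1' w * v1 w = 1" "v1 w * v1' w = 1"
 unfolding v1_def v1'_def by (rule prod_X_inverse prod_X_inverse', rule lower_subset)+

lemma vv_inverse: "vv' w * vv w = 1" "vv w * vv' w = 1"
proof -
 have "vv' w * vv w = X (- \<theta>) (- cf' w) * (v1' w * v1 w) * X (- \<theta>) (cf' w)"
  by (simp add: vv_def vv'_def mult.assoc)
 thus "vv' w * vv w = 1" by (simp add: v1_inverse X_inverse)
 thus "vv w * vv' w = 1" by (rule smat_inverse_comm)
qed

text \<open>\<open>ad_long_sq\<close> carried along by conjugation; the equation is homogeneous, so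
  scaling by \<open>c\<close> is allowed.\<close>

lemma orbit_equation:
 assumes A: "A \<in> GC" and Z: "Z \<in> Ls"
 shows "\<exists>\<kappa>. br (c \<cdot> cj A (E \<theta>)) (br (c \<cdot> cj A (E \<theta>)) Z) = \<kappa> \<cdot> c \<cdot> cj A (E \<theta>)"
proof -
 have d: "sdet A = 1" by (rule GC_det[OF A])
 define Y where "Y = cj (sadj A) Z"
 have sa: "sadj (sadj A) = A" by (rule sadj_unique) (use d in \<open>simp_all add: sdet_sadj sadj_inverse\<close>)
 have "A * Y = Z * A" using d by (simp add: Y_def cj_def sa mult.assoc[symmetric] sadj_inverse)
 hence Zc: "Z = cj A Y" using cj_eq_iff[OF d] by metis
 have Y: "Y \<in> Ls" unfolding Y_def by (rule Ls_cj[OF GC_sadj[OF A] Z])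
 have "br (c \<cdot> cj A (E \<theta>)) (br (c \<cdot> cj A (E \<theta>)) Z) = (c * c) \<cdot> cj A (br (E \<theta>) (br (E \<theta>) Y))"
 proof -
  have cb: "br (cj A U) (cj A V) = cj A (br U V)" for U V by (simp add: cj_diff cj_mult[OF d])
  have bs: "br (c \<cdot> U) V = c \<cdot> br U V" "br U (c \<cdot> V) = c \<cdot> br U V" for U V :: "(complex, 'n) smat"
   by (simp_all add: smul_diff_right)
  show ?thesis unfolding Zc bs cb smul_smul ..
 qed
 also have "\<dots> = (c * - (2 * \<phi> (- \<theta>) Y)) \<cdot> c \<cdot> cj A (E \<theta>)"
  unfolding ad_long_sq[OF long_theta Y] cj_smul smul_smul by (simp add: mult_ac)
 finally show ?thesis by blast
qed

lemma orbit_normal: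
 assumes A: "A \<in> GC" and w: "w = c \<cdot> cj A (E \<theta>)" "\<phi> \<theta> w = 1"
 shows "vv' w * w * vv w = E \<theta>"
proof -
 have Lw: "w \<in> Ls" unfolding w(1) by (rule Ls_smul[OF Ls_cj[OF A Ls_E[OF theta]]])
 define w1 where "w1 = v1' w * w * v1 w"
 define s where "s = cf' w"
 define w2 where "w2 = vv' w * w * vv w"
 have GC1: "v1' w \<in> GC" "vv' w \<in> GC"
  unfolding vv'_def v1'_def by (auto intro!: GC_X GC_prod_X simp: lower)
 have "sadj (vv' w) = vv w" "sadj (v1' w) = v1 w"
  using sadj_unique[OF GC_det] GC1 vv_inverse v1_inverse by blast+
 hence w2: "w2 = cj (vv' w) w" and w1: "w1 = cj (v1' w) w" by (simp_all add: w2_def w1_def cj_def)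
 have L1: "w1 \<in> Ls" unfolding w1 by (rule Ls_cj[OF GC1(1) Lw])
 have L2: "w2 \<in> Ls" unfolding w2 by (rule Ls_cj[OF GC1(2) Lw])
 define S where "S = (\<Sum>\<delta>\<leftarrow>lower_roots \<theta>. cf \<delta> w \<cdot> D1 \<delta> :: (complex, 'n) smat)"
 have t1: "tri (-1) S (v1 w)" unfolding v1_def S_def by (rule tri_prod_X) (auto simp: lower)
 have "(\<Sum>\<delta>\<leftarrow>rev (lower_roots \<theta>). - cf \<delta> w \<cdot> D1 \<delta>) = (- S :: (complex, 'n) smat)"
  unfolding S_def by (simp add: rev_map[symmetric] sum_list_rev uminus_sum_list_map o_def)
 hence t1': "tri (-1) (- S) (v1' w)"
  unfolding v1'_def using tri_prod_X[of "rev (lower_roots \<theta>)" "-1" "\<lambda>\<delta>. - cf \<delta> w"] by (simp add: lower)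
 note z = t1[unfolded tri_def] t1'[unfolded tri_def]
 have big: "dg.cmp j w = 0" if "j > 2" for j using dg_cmp_Ls_big[OF Lw] that by simp
 have we: "dg.cmp 2 w = E \<theta>" using dg_cmp_Ls_2[OF Lw] w(2) by simp
 have wv: "dg.cmp j (w * v1 w) = (\<Sum>i\<in>{j..2}. dg.cmp i w * dg.cmp (j - i) (v1 w))" for j
 proof (rule dg.cmp_mult)
  fix i assume "i \<notin> {j..2}"
  thus "dg.cmp i w * dg.cmp (j - i) (v1 w) = 0" using big[of i] z by auto
 qed simp
 have vwv: "dg.cmp j w1 = (\<Sum>i\<in>{j-2..0}. dg.cmp i (v1' w) * dg.cmp (j - i) (w * v1 w))" for j
  unfolding w1_def mult.assoc
 proof (rule dg.cmp_mult)
  fix i assume "i \<notin> {j-2..0}"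
  thus "dg.cmp i (v1' w) * dg.cmp (j - i) (w * v1 w) = 0" using z wv[of "j - i"] by auto
 qed simp
 have wv2: "dg.cmp 2 (w * v1 w) = E \<theta>" using wv[of 2] z we by simp
 have i12: "{1..2} = {1, 2::int}" "{-1..0} = {-1, 0::int}" by auto
 have wv1: "dg.cmp 1 (w * v1 w) = dg.cmp 1 w + E \<theta> * S" using wv[of 1] z we by (simp add: i12)
 have c2: "dg.cmp 2 w1 = E \<theta>" using vwv[of 2] z wv2 by simp
 \<comment> \<open>Conjugation by a lower unipotent with linear part \<open>S\<close> changes degree
   1 by \<open>[E \<theta>, S]\<close>, since the degree 2 part of \<open>w\<close> is
   \<open>E \<theta>\<close> and nothing lies above.\<close>
 have c1: "dg.cmp 1 w1 = dg.cmp 1 w + br (E \<theta>) S"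
  using vwv[of 1] z wv2 wv1 by (simp add: i12)
 have c1': "\<phi> \<epsilon> w1 = 0" if e: "\<epsilon> \<in> \<Phi>" "ci \<epsilon> \<theta> = 1" for \<epsilon>
 proof -
  define \<delta> where "\<delta> = \<epsilon> - \<theta>"
  have d1: "dgr \<epsilon> = 1" using e by (simp add: dgr_eq)
  have "\<theta> - \<epsilon> \<in> \<Phi>" using long_add_root(1)[OF long_theta, of "- \<epsilon>"] e by simp
  hence d: "\<delta> \<in> \<Phi>" using neg_root[of "\<theta> - \<epsilon>"] by (simp add: \<delta>_def)
  have cd: "ci \<delta> \<theta> = -1" using e by (simp add: \<delta>_def ci_diff)
  have "br (E \<theta>) S = (\<Sum>\<delta>\<leftarrow>lower_roots \<theta>. cf \<delta> w \<cdot> br (E \<theta>) (D1 \<delta>))"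
   unfolding S_def by (simp add: sum_list_const_mult[symmetric] sum_list_mult_const[symmetric]
     sum_list_subtractf[symmetric] smul_diff_right)
  also have "\<dots> = (\<Sum>\<delta>\<in>set (lower_roots \<theta>). cf \<delta> w \<cdot> br (E \<theta>) (D1 \<delta>))"
   by (rule sum_list_distinct_conv_sum_set[OF lower_roots(2)])
  also have "\<dots> = (\<Sum>\<delta>\<in>set (lower_roots \<theta>). (cf \<delta> w * of_int (eps \<theta> \<delta>)) \<cdot> E (\<theta> + \<delta>))"
  proof (intro sum.cong refl)
   fix \<delta> assume "\<delta> \<in> set (lower_roots \<theta>)"
   hence dd: "\<delta> \<in> \<Phi>" "ci \<delta> \<theta> = -1" by (auto simp: lower_roots)
   thus "cf \<delta> w \<cdot> br (E \<theta>) (D1 \<delta>) = (cf \<delta> w * of_int (eps \<theta> \<delta>)) \<cdot> E (\<theta> + \<delta>)"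
    using eps(2)[OF long_theta dd, where 'r = complex] long_add_root(1)[OF long_theta dd] by simp
  qed
  finally have bS: "br (E \<theta>) S = (\<Sum>\<delta>\<in>set (lower_roots \<theta>). (cf \<delta> w * of_int (eps \<theta> \<delta>)) \<cdot> E (\<theta> + \<delta>))" .
  have "\<phi> \<epsilon> (br (E \<theta>) S) = (\<Sum>\<delta>'\<in>set (lower_roots \<theta>). if \<delta>' = \<delta> then cf \<delta> w * of_int (eps \<theta> \<delta>) else 0)"
   unfolding bS phi_sum
  proof (intro sum.cong refl)
   fix \<delta>' assume "\<delta>' \<in> set (lower_roots \<theta>)"
   hence "\<theta> + \<delta>' \<in> \<Phi>" using long_add_root(1)[OF long_theta] by (simp add: lower_roots)
   moreover have "\<epsilon> = \<theta> + \<delta>' \<longleftrightarrow> \<delta>' = \<delta>" by (auto simp: \<delta>_def)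
   ultimately show "\<phi> \<epsilon> ((cf \<delta>' w * of_int (eps \<theta> \<delta>')) \<cdot> E (\<theta> + \<delta>')) =
     (if \<delta>' = \<delta> then cf \<delta> w * of_int (eps \<theta> \<delta>) else 0)"
    by (simp add: phi_smul phi_E_if)
  qed
  also have "\<dots> = cf \<delta> w * of_int (eps \<theta> \<delta>)" using d cd by (simp add: lower_roots)
  also have "\<dots> = - (of_int (eps \<theta> \<delta>) * of_int (eps \<theta> \<delta>)) * \<phi> \<epsilon> w" by (simp add: cf_def \<delta>_def mult_ac)
  \<comment> \<open>The structure constant is a sign and its own inverse; this is the reason for the
    factor in \<open>cf\<close>.\<close>
  also have "\<dots> = - \<phi> \<epsilon> w" using eps(1)[OF long_theta d cd] by auto
  finally show ?thesis
   using phi_dg_cmp[OF L1 e(1) d1] phi_dg_cmp[OF Lw e(1) d1] by (simp add: c1 phi_add)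
 qed
 have c10: "dg.cmp 1 w1 = 0"
  unfolding dg_cmp_Ls[OF L1] using c1' by (auto simp: dgr_eq intro!: sum.neutral)
 define f where "f = E (- \<theta>)"
 have hf: "dg.hom (-2) f" using dg_hom_E[of "- \<theta>"] by (simp add: f_def)
 have he: "dg.hom 2 (E \<theta>)" using dg_hom_E[of \<theta>] by simp
 have "w2 = X (- \<theta>) (- s) * w1 * X (- \<theta>) (- (- s))"
  by (simp add: w2_def w1_def vv_def vv'_def s_def mult.assoc)
 also have "\<dots> = w1 + (- s) \<cdot> br f w1 - ((- s)\<^sup>2 * \<phi> (- (- \<theta>)) w1) \<cdot> f"
  unfolding f_def by (rule X_conj_long) (use long_theta L1 in simp_all)
 finally have w2e: "w2 = w1 - s \<cdot> br f w1 - (s\<^sup>2 * \<phi> \<theta> w1) \<cdot> f" by simp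
 have c: "dg.cmp j w2 = dg.cmp j w1 - s \<cdot> br f (dg.cmp (j + 2) w1)" if "j \<noteq> -2" for j
  unfolding w2e using that
  by (simp add: dg.cmp_diff dg.cmp_smul dg.cmp_mult_left[OF hf] dg.cmp_mult_right[OF hf] dg.cmp_hom[OF hf])
 have big1: "dg.cmp j w1 = 0" if "j > 2" for j using dg_cmp_Ls_big[OF L1] that by simp
 have p2: "\<phi> \<theta> w2 = 1"
  using phi_dg_cmp[OF L2 theta, of 2] c[of 2] c2 big1[of 4] by (simp add: phi_E)
 have p1: "\<phi> \<epsilon> w2 = 0" if e: "\<epsilon> \<in> \<Phi>" "ci \<epsilon> \<theta> = 1" for \<epsilon>
 proof -
  have "dgr \<epsilon> = 1" using e by (simp add: dgr_eq)
  thus ?thesis using phi_dg_cmp[OF L2 e(1), of 1] c[of 1] c10 big1[of 3] by simp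
 qed
 have dg1: "dgr gam = 1" using gam by (simp add: dgr_eq)
 hence hg: "dg.hom 1 (E gam)" using dg_hom_E[OF gam(1)] by simp
 have bg: "\<phi> gam (br V (E gam)) = \<phi> gam (br (dg.cmp 0 V) (E gam))" if "V \<in> Ls" for V
  using phi_dg_cmp[OF Ls_bracket[OF that Ls_E[OF gam(1)]] gam(1) dg1]
  by (simp add: dg.cmp_diff dg.cmp_mult_left[OF hg] dg.cmp_mult_right[OF hg])
 \<comment> \<open>Degree 2 is \<open>E \<theta>\<close>, so degree 0 gains
   \<open>s [E \<theta>, f] = s H \<theta>\<close>.\<close>
 have "dg.cmp 0 w2 = dg.cmp 0 w1 + s \<cdot> H \<theta>"
  using c[of 0] c2 by (simp add: H_def f_def smul_diff_right)
 hence "br (dg.cmp 0 w2) (E gam) = br (dg.cmp 0 w1) (E gam) + s \<cdot> br (H \<theta>) (E gam)"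
  by (simp add: smul_algebra algebra_simps)
 also have "br (H \<theta>) (E gam) = E gam" using HE[OF theta gam(1)] gam(2) by simp
 finally have "\<phi> gam (br w2 (E gam)) = \<phi> gam (br w1 (E gam)) + s"
  by (simp add: bg[OF L1] bg[OF L2] phi_add phi_smul phi_E[OF gam(1)])
 also have "s = - \<phi> gam (br w1 (E gam))" by (simp add: s_def cf'_def w1_def gam(1))
 finally have pg: "\<phi> gam (br w2 (E gam)) = 0" by simp
 \<comment> \<open>\<open>w2\<close> is again a multiple of a conjugate of
   \<open>E \<theta>\<close>, so the orbit equation holds for it.\<close>
 have "w2 = c \<cdot> cj (vv' w * A) (E \<theta>)"
 proof -
  have "sadj (vv' w * A) = sadj A * vv w"
  proof (rule sadj_unique)
   have "vv' w * A * (sadj A * vv w) = vv' w * (A * sadj A) * vv w" by (simp add: mult.assoc)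
   thus "vv' w * A * (sadj A * vv w) = 1" by (simp add: sadj_inverse GC_det[OF A] vv_inverse)
  qed (simp add: sdet_mult GC_det[OF A] GC_det[OF GC1(2)])
  thus ?thesis by (simp add: w2_def w(1) cj_def mult.assoc)
 qed
 then obtain \<kappa> where "br w2 (br w2 (E (- \<theta>))) = \<kappa> \<cdot> w2"
  using orbit_equation[OF GC_mult[OF GC1(2) A], of "E (- \<theta>)" c] Ls_E by auto
 hence "w2 = E \<theta>" using orbit_unique[OF L2 p2 p1 gam pg] by blast
 thus ?thesis by (simp add: w2_def)
qed

text \<open>All divided powers are included because over R the matrices \<open>D \<theta> k\<close>
  are not determined by \<open>D \<theta> 1\<close>. The factor in front becomes 1 at the elements
  to which the identity is transferred.\<close>

lemma orbit_conj:
 assumes A: "A \<in> GC" and d: "\<phi> \<theta> (cj A (E \<theta>)) \<noteq> 0"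
 defines "w \<equiv> (1 / \<phi> \<theta> (cj A (E \<theta>))) \<cdot> cj A (E \<theta>)"
 shows "cj A (oi (D \<theta> k)) * vv w = \<phi> \<theta> (cj A (E \<theta>)) ^ k \<cdot> (vv w * oi (D \<theta> k))"
proof -
 define d where "d = \<phi> \<theta> (cj A (E \<theta>))"
 have d0: "d \<noteq> 0" using d by (simp add: d_def)
 have "\<phi> \<theta> w = 1" using d by (simp add: w_def phi_smul)
 hence "vv' w * w * vv w = E \<theta>" using orbit_normal[OF A] w_def by blast
 hence "vv w * (vv' w * w * vv w) = vv w * E \<theta>" by simp
 hence wv: "w * vv w = vv w * E \<theta>" by (simp add: mult.assoc[symmetric] vv_inverse)
 have y: "cj A (E \<theta>) = d \<cdot> w" using d0 by (simp add: w_def d_def)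
 have "cj A (E \<theta> ^ k) * vv w = d ^ k \<cdot> (vv w * E \<theta> ^ k)"
 proof (induction k)
  case 0
  show ?case by (simp add: cj_def sadj_inverse GC_det[OF A])
 next
  case (Suc k)
  have "cj A (E \<theta> ^ Suc k) = cj A (E \<theta>) * cj A (E \<theta> ^ k)" by (simp add: cj_mult[OF GC_det[OF A]])
  hence "cj A (E \<theta> ^ Suc k) * vv w = d \<cdot> (w * (cj A (E \<theta> ^ k) * vv w))" by (simp add: y mult.assoc)
  also have "\<dots> = d ^ Suc k \<cdot> (w * vv w * E \<theta> ^ k)" by (simp add: Suc mult.assoc)
  finally show ?case by (simp add: wv mult.assoc)
 qed
 thus ?thesis by (simp add: oi_D dp_def cj_smul d_def[symmetric])
qed

section \<open>Transfer of the normal form to R\<close>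

context
 fixes Q :: "('x \<Rightarrow> complex) \<Rightarrow> ('y \<Rightarrow> 'r::comm_ring_1) \<Rightarrow> bool"
 assumes Q: "function_pairs Q"
begin

interpretation function_pairs Q by (rule Q)

lemma pair_X: "Q f f' ==> mat_pair (\<lambda>a. X \<alpha> (f a)) (\<lambda>b. X \<alpha> (f' b))"
 unfolding X_def by (rule mat_rx)

lemma pair_cf: "mat_pair F F' ==> Q (\<lambda>a. cf \<delta> (F a)) (\<lambda>b. cf \<delta> (F' b))"
 unfolding cf_def by (intro mult minus const phi_pair[OF Q])

lemma pair_v1: "mat_pair F F' ==> mat_pair (\<lambda>a. v1 (F a)) (\<lambda>b. v1 (F' b))"
 "mat_pair F F' ==> mat_pair (\<lambda>a. v1' (F a)) (\<lambda>b. v1' (F' b))"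
 unfolding v1_def v1'_def by (intro mat_prod_list pair_X minus pair_cf; assumption)+

lemma pair_cf': "mat_pair F F' ==> Q (\<lambda>a. cf' (F a)) (\<lambda>b. cf' (F' b))"
 unfolding cf'_def by (intro minus phi_pair[OF Q] mat_diff mat_mult pair_v1 mat_const)

lemma pair_vv: "mat_pair F F' ==> mat_pair (\<lambda>a. vv (F a)) (\<lambda>b. vv (F' b))"
 unfolding vv_def by (intro mat_mult pair_v1 pair_X pair_cf')

end

theorem GR_orbit_conj:
 fixes g :: "('r::comm_ring_1, 'n) smat"
 assumes g: "g \<in> GR" and y: "y = cj g (D1 \<theta>)" "\<phi> \<theta> y = 1"
 shows "cj g (oi (D \<theta> k)) * vv y = vv y * oi (D \<theta> k)"
proof -
 define d where "d A = \<phi> \<theta> (cj A (E \<theta>))" for A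
 define d' where "d' A = \<phi> \<theta> (cj A (D1 \<theta>))" for A :: "('r, 'n) smat"
 have dd: "ipair d d'" unfolding d_def d'_def by (intro ipair_phi mat_pair_cj mat_pair_E ipair_mat_id theta)
 interpret rp: function_pairs "regpair d d'" by (rule regpair_function_pairs[OF dd])
 have up: "rp.mat_pair F F'" if "ipair.mat_pair F F'" for F F'
  using that unfolding rp.mat_pair_def ipair.mat_pair_def by (auto intro: regpair_ipair)
 have pw: "rp.mat_pair (\<lambda>A. (1 / d A) \<cdot> cj A (E \<theta>)) (\<lambda>A. 1 \<cdot> cj A (D1 \<theta>))"
  by (intro rp.mat_smul regpair_inverse up mat_pair_cj mat_pair_E ipair_mat_id theta)
 have pv: "rp.mat_pair (\<lambda>A. vv ((1 / d A) \<cdot> cj A (E \<theta>))) (\<lambda>A. vv (1 \<cdot> cj A (D1 \<theta>)))"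
  by (rule pair_vv[OF rp.function_pairs_axioms pw])
 have pc: "rp.mat_pair (\<lambda>A. cj A (oi (D \<theta> k))) (\<lambda>A. cj A (oi (D \<theta> k)))"
  by (intro up mat_pair_cj ipair.mat_const ipair_mat_id)
 define F where "F A = cj A (oi (D \<theta> k)) * vv ((1 / d A) \<cdot> cj A (E \<theta>)) -
  d A ^ k \<cdot> (vv ((1 / d A) \<cdot> cj A (E \<theta>)) * oi (D \<theta> k))" for A
 define F' where "F' A = cj A (oi (D \<theta> k)) * vv (1 \<cdot> cj A (D1 \<theta>)) -
  d' A ^ k \<cdot> (vv (1 \<cdot> cj A (D1 \<theta>)) * oi (D \<theta> k))" for A
 have pF: "rp.mat_pair F F'" unfolding F_def F'_def
  by (intro rp.mat_diff rp.mat_mult rp.mat_smul rp.power rp.mat_const pv pc regpair_ipair dd)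
 have F0: "F A = 0" if "A \<in> GC" "d A \<noteq> 0" for A
  unfolding F_def d_def using orbit_conj[OF that(1) that(2)[unfolded d_def], of k] by simp
 have dg1: "d' g = 1" using y by (simp add: d'_def)
 have "F' g = 0"
 proof (rule smat_eqI)
  fix i j
  obtain p N where p: "\<And>A. d A \<noteq> 0 ==> ent (F A) i j * d A ^ N = ev p A"
   "\<And>A. d' A = 1 ==> ent (F' A) i j = ev p A"
   using rp.ent[OF pF, of i j] unfolding regpair_def by blast
  \<comment> \<open>The identity is known where \<open>d\<close> is nonzero. The extra factor
    \<open>q\<close> makes the polynomial vanish on all of \<open>GC\<close>, and \<open>q\<close>
    has the value 1 at \<open>g\<close>.\<close>
  obtain q where q: "d = ev q" "d' = ev q" using dd by (auto simp: ipair_def)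
  have "ev (p * q) A = 0" if "A \<in> GC" for A
  proof (cases "d A = 0")
   case True thus ?thesis by (simp add: q)
  next
   case False thus ?thesis using p(1)[OF False] F0[OF that False] by simp
  qed
  hence "ev (p * q) g = 0" using g unfolding GR_def by blast
  thus "ent (F' g) i j = ent 0 i j" using p(2)[OF dg1] dg1 by (simp add: q(2)[symmetric])
 qed
 thus ?thesis using dg1 by (simp add: F'_def y(1))
qed

end


lemma prod_list_eq_1: "(\<And>x. x \<in> set xs ==> f x = (1 :: 'a::monoid_mult)) ==> prod_list (map f xs) = 1"
 by (induction xs) auto

section \<open>Elements commuting with a long root element\<close>

context chevalley_rep begin

lemma D_commute:
 assumes "\<alpha> \<in> \<Phi>" "\<beta> \<in> \<Phi>" "\<alpha> + \<beta> \<notin> \<Phi>" "\<alpha> + \<beta> \<noteq> 0"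
 shows "D \<alpha> i * D \<beta> j = D \<beta> j * D \<alpha> i"
proof (rule oi_inj[where 'a = complex])
 have "E \<alpha> * E \<beta> = E \<beta> * E \<alpha>" by (rule EE_commute[OF assms])
 hence "E \<alpha> * E \<beta> ^ j = E \<beta> ^ j * E \<alpha>" by (rule power_commuting_commutes[symmetric, OF sym])
 hence "E \<alpha> ^ i * E \<beta> ^ j = E \<beta> ^ j * E \<alpha> ^ i" by (rule power_commuting_commutes)
 thus "oi (D \<alpha> i * D \<beta> j) = (oi (D \<beta> j * D \<alpha> i) :: (complex, 'n) smat)"
  by (simp add: oi_mult oi_D assms dp_def mult.commute)
qed

lemma X_D_commute:
 assumes "\<alpha> \<in> \<Phi>" "\<beta> \<in> \<Phi>" "\<alpha> + \<beta> \<notin> \<Phi>" "\<alpha> + \<beta> \<noteq> 0"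
 shows "X \<alpha> t * oi (D \<beta> j) = oi (D \<beta> j) * X \<alpha> t"
 unfolding X_expand sum_distrib_left sum_distrib_right
 using D_commute[OF assms] by (intro sum.cong refl) (simp add: oi_mult[symmetric])

lemma commute_X:
 "(\<And>k. c * oi (D \<beta> k) = oi (D \<beta> k) * c) ==> c * X \<beta> t = X \<beta> t * c"
 unfolding X_expand sum_distrib_left sum_distrib_right by simp

lemma X_commute:
 assumes "\<alpha> \<in> \<Phi>" "\<beta> \<in> \<Phi>" "\<alpha> + \<beta> \<notin> \<Phi>" "\<alpha> + \<beta> \<noteq> 0"
 shows "X \<alpha> t * X \<beta> u = X \<beta> u * X \<alpha> t"
 by (rule commute_X[OF X_D_commute[OF assms]])

lemma commute_P:
 "(\<And>k. c * oi (D \<theta> k) = oi (D \<theta> k) * c) ==> (\<And>k. c * oi (D (- \<theta>) k) = oi (D (- \<theta>) k) * c) ==>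
  c * oi (P \<theta> m) = oi (P \<theta> m) * c" unfolding P_def by (rule wproj_commute)

lemma conj_cj_long:
 fixes g :: "('r::comm_ring_1, 'n) smat"
 assumes b: "long \<beta>" and g: "g \<in> GR" and B: "oi B \<in> Ls"
 shows "X \<beta> 1 * cj g (oi B) * X \<beta> (-1) =
  cj g (oi B) + br (oi (D \<beta> 1)) (cj g (oi B)) - \<phi> (- \<beta>) (cj g (oi B)) \<cdot> oi (D \<beta> 1)"
 by (rule GR_eq[OF _ _ _ g, where F = "\<lambda>A. X \<beta> 1 * cj A (oi B) * X \<beta> (-1)"
     and G = "\<lambda>A. cj A (oi B) + br (oi (D \<beta> 1)) (cj A (oi B)) - \<phi> (- \<beta>) (cj A (oi B)) \<cdot> oi (D \<beta> 1)"])
  (use X_conj_long[OF b Ls_cj[OF _ B], of _ 1] long_root[OF b] in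
   \<open>auto intro!: pair_intro ipair_phi mat_pair_X1 ipair_mat_id\<close>)

lemma GR_mult_inverse_X: "set ds \<subseteq> \<Phi> ==> - \<theta> \<in> \<Phi> ==> A \<in> GR ==>
  X (- \<theta>) a * Xs s ds * A \<in> GR" unfolding mult.assoc by (intro GR_X_left GR_prod_X)

text \<open>For \<open>y = D1 \<theta>\<close> all coefficients of the normal form vanish for weight
  reasons, so \<open>vv y = 1\<close>. Thus commutation spreads from k = 1 to all divided powers,
  although over R these need not be polynomials in \<open>D1 \<theta>\<close>.\<close>

lemma centralizer_long_all:
 fixes g :: "('r::comm_ring_1, 'n) smat"
 assumes th: "long \<theta>" and g: "g \<in> GR" and comm: "g * D1 \<theta> = D1 \<theta> * g"
 shows "g * oi (D \<theta> k) = oi (D \<theta> k) * g"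
proof -
 interpret cl: chevalley_long \<Phi> \<Delta> E H \<theta> by unfold_locales (rule th)
 define e where "e = (D1 \<theta> :: ('r, 'n) smat)"
 have t: "\<theta> \<in> \<Phi>" by (rule long_root[OF th])
 have he: "wt.hom \<theta> e" unfolding e_def by (rule hom_D1[OF t])
 have y: "cj g (D1 \<theta>) = e" using cj_eq_iff[OF GR_det[OF g]] comm by (simp add: e_def)
 have "cl.cf \<delta> e = 0" if "\<delta> \<in> \<Phi>" for \<delta>
  using that phi_hom[OF he, of "\<theta> + \<delta>"] by (simp add: cl.cf_def)
 hence v1: "cl.v1 e = 1" "cl.v1' e = 1"
  unfolding cl.v1_def cl.v1'_def using cl.lower by (auto intro!: prod_list_eq_1)
 have "wt.hom (\<theta> + gam) (br e (D1 gam))" if "gam \<in> \<Phi>" for gam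
  by (rule wt.hom_bracket[OF he hom_D1[OF that]]) simp
 from phi_hom[OF this[OF cl.gam(1)], of cl.gam] have "cl.cf' e = 0" using t by (simp add: cl.cf'_def v1)
 hence "cl.vv e = 1" using t by (simp add: cl.vv_def v1)
 hence "cj g (oi (D \<theta> k)) = oi (D \<theta> k)"
  using cl.GR_orbit_conj[OF g y[symmetric], of k] phi_D1[OF t] by (simp add: e_def)
 thus ?thesis using cj_eq_iff[OF GR_det[OF g]] by blast
qed

text \<open>The orbit theorem applies to \<open>- \<theta>\<close>: conjugating
  \<open>x f x^(-1) = f + [e, f] - e\<close> by \<open>g\<close> shows that
  \<open>y = g f g^(-1)\<close> has coordinate 1 at \<open>- \<theta>\<close>. The element
  \<open>u\<close> taking \<open>f\<close> to \<open>y\<close> is built from \<open>\<theta>\<close>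
  and roots of degree 1, so it commutes with all \<open>D \<theta> k\<close>; hence
  \<open>c = u^(-1) g\<close> commutes with the divided powers for both signs.\<close>

lemma centralizer_decomposition:
 fixes g :: "('r::comm_ring_1, 'n) smat"
 assumes th: "long \<theta>" and g: "g \<in> GR" and comm: "g * X \<theta> 1 = X \<theta> 1 * g"
 obtains r s c where "c \<in> GR"
  and "\<And>k. c * oi (D \<theta> k) = oi (D \<theta> k) * c" "\<And>k. c * oi (D (- \<theta>) k) = oi (D (- \<theta>) k) * c"
  and "g = Xs r (lower_roots (- \<theta>)) * X \<theta> s * c"
  and "\<And>\<delta>. r \<delta> = - of_int (eps (- \<theta>) \<delta>) * \<phi> (- \<theta> + \<delta>) (cj g (D1 (- \<theta>)))"
proof -
 have t: "\<theta> \<in> \<Phi>" "- \<theta> \<in> \<Phi>" using long_root[OF th] by simp_all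
 interpret cl: chevalley_long \<Phi> \<Delta> E H "- \<theta>" by unfold_locales (use th in simp)
 define e where "e = (D1 \<theta> :: ('r, 'n) smat)"
 define y where "y = cj g (D1 (- \<theta>))"
 define x where "x = (X \<theta> 1 :: ('r, 'n) smat)"
 have ge: "g * e = e * g" using centralizer_long[OF th g comm] by (simp add: e_def)
 have det: "sdet g = 1" by (rule GR_det[OF g])
 have x: "x * X \<theta> (-1) = 1" "X \<theta> (-1) * x = 1" using X_inverse[OF t(1)] by (simp_all add: x_def)
 have gx: "cj g x = x" "cj g e = e" using cj_eq_iff[OF det] comm ge by (simp_all add: x_def)
 have gx': "cj g (X \<theta> (-1)) = X \<theta> (-1)"
 proof -
  have "g * X \<theta> (-1) = X \<theta> (-1) * (x * g) * X \<theta> (-1)"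
   by (simp add: mult.assoc[symmetric] x)
  also have "x * g = g * x" using comm by (simp add: x_def)
  also have "X \<theta> (-1) * (g * x) * X \<theta> (-1) = X \<theta> (-1) * g" by (simp add: mult.assoc x)
  finally show ?thesis using cj_eq_iff[OF det] by blast
 qed
 have L: "D1 (- \<theta>) \<in> Ls" using t by (simp add: Ls_E)
 have c1: "cj 1 Z = Z" for Z :: "('r, 'n) smat"
 proof -
  have "sadj 1 = (1 :: ('r, 'n) smat)" by (rule sadj_unique) auto
  thus ?thesis by (simp add: cj_def)
 qed
 define f where "f = (D1 (- \<theta>) :: ('r, 'n) smat)"
 have pf: "\<phi> (- \<theta>) f = 1" "\<phi> \<theta> e = 1" unfolding f_def e_def by (rule phi_D1[OF t(2)] phi_D1[OF t(1)])+
 have "X \<theta> 1 * cj 1 f * X \<theta> (-1) = cj 1 f + br (oi (D \<theta> 1)) (cj 1 f) - \<phi> (- \<theta>) (cj 1 f) \<cdot> oi (D \<theta> 1)"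
  unfolding f_def by (rule conj_cj_long[OF th GR_1 L])
 hence "x * f * X \<theta> (-1) = f + br e f - e" by (simp add: c1 x_def e_def pf)
 hence "cj g (x * f * X \<theta> (-1)) = cj g (f + br e f - e)" by simp
 hence "x * y * X \<theta> (-1) = y + br e y - e"
  by (simp add: cj_mult[OF det] cj_add cj_diff gx gx' y_def f_def[symmetric])
 moreover have "x * y * X \<theta> (-1) = y + br e y - \<phi> (- \<theta>) y \<cdot> e"
  using conj_cj_long[OF th g L] by (simp add: x_def e_def y_def)
 ultimately have "\<phi> (- \<theta>) y \<cdot> e = e" by simp
 hence "\<phi> \<theta> (\<phi> (- \<theta>) y \<cdot> e) = \<phi> \<theta> e" by simp
 hence y1: "\<phi> (- \<theta>) y = 1" by (simp add: phi_smul pf)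
 have orb: "cj g (oi (D (- \<theta>) k)) * cl.vv y = cl.vv y * oi (D (- \<theta>) k)" for k
  by (rule cl.GR_orbit_conj[OF g y_def y1])
 define u u' where "u = cl.vv y" and "u' = cl.vv' y"
 have uu: "u * u' = 1" "u' * u = 1" by (simp_all add: u_def u'_def cl.vv_inverse)
 have u: "u = Xs (\<lambda>\<delta>. cl.cf \<delta> y) (lower_roots (- \<theta>)) * X \<theta> (cl.cf' y)"
  by (simp add: u_def cl.vv_def cl.v1_def)
 define c where "c = u' * g"
 have gc: "g = u * c" by (simp add: c_def mult.assoc[symmetric] uu)
 have c: "c \<in> GR" unfolding c_def u'_def cl.vv'_def cl.v1'_def
  by (rule GR_mult_inverse_X[OF cl.lower_subset(2) _ g]) (use t in simp)
 have cneg: "c * oi (D (- \<theta>) k) = oi (D (- \<theta>) k) * c" for k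
 proof -
  have "g * oi (D (- \<theta>) k) = cj g (oi (D (- \<theta>) k)) * g" using cj_eq_iff[OF det] by blast
  hence "u' * (g * oi (D (- \<theta>) k)) = u' * (cj g (oi (D (- \<theta>) k)) * (u * c))" by (simp add: gc[symmetric])
  also have "\<dots> = u' * (cj g (oi (D (- \<theta>) k)) * u) * c" by (simp add: mult.assoc)
  also have "\<dots> = u' * u * oi (D (- \<theta>) k) * c" using orb[of k] by (simp add: u_def mult.assoc)
  finally show ?thesis by (simp add: c_def uu mult.assoc)
 qed
 have ud: "u * oi (D \<theta> k) = oi (D \<theta> k) * u" for k
 proof -
  have com: "X \<delta> s * oi (D \<theta> k) = oi (D \<theta> k) * X \<delta> s" if "\<delta> \<in> \<Phi>" "ci \<delta> \<theta> \<ge> 0" for \<delta> and s :: 'r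
   by (rule X_D_commute[OF that(1) t(1)])
    (use long_add_not_root[OF th that] in \<open>simp_all add: add.commute\<close>)
  have "Xs (\<lambda>\<delta>. cl.cf \<delta> y) ds * oi (D \<theta> k) =
    oi (D \<theta> k) * Xs (\<lambda>\<delta>. cl.cf \<delta> y) ds"
   if "\<And>\<delta>. \<delta> \<in> set ds ==> \<delta> \<in> \<Phi> \<and> ci \<delta> \<theta> \<ge> 0" for ds
   using that
  proof (induction ds)
   case (Cons a ds)
   hence "X a (cl.cf a y) * oi (D \<theta> k) = oi (D \<theta> k) * X a (cl.cf a y)" using com by simp
   with Cons show ?case by (simp add: mult.assoc) (simp add: mult.assoc[symmetric])
  qed simp
  from this[of "lower_roots (- \<theta>)"]
  have "Xs (\<lambda>\<delta>. cl.cf \<delta> y) (lower_roots (- \<theta>)) * oi (D \<theta> k) =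
    oi (D \<theta> k) * Xs (\<lambda>\<delta>. cl.cf \<delta> y) (lower_roots (- \<theta>))"
   by (auto simp: lower_roots)
  thus ?thesis using com[OF t(1), of "cl.cf' y"] t unfolding u
   by (simp add: mult.assoc) (simp add: mult.assoc[symmetric])
 qed
 have cpos: "c * oi (D \<theta> k) = oi (D \<theta> k) * c" for k
 proof -
  have gk: "g * oi (D \<theta> k) = oi (D \<theta> k) * g"
   by (rule centralizer_long_all[OF th g]) (use ge in \<open>simp add: e_def\<close>)
  have "u' * (u * oi (D \<theta> k)) * u' = u' * (oi (D \<theta> k) * u) * u'" by (simp add: ud)
  hence "oi (D \<theta> k) * u' = u' * oi (D \<theta> k)" using uu
   by (simp add: mult.assoc) (simp add: mult.assoc[symmetric] uu)
  hence "oi (D \<theta> k) * (u' * g) = u' * (oi (D \<theta> k) * g)" by (simp add: mult.assoc[symmetric])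
  thus ?thesis by (simp add: c_def gk[symmetric] mult.assoc)
 qed
 show ?thesis
 proof (rule that[OF c cpos cneg])
  show "g = Xs (\<lambda>\<delta>. cl.cf \<delta> y) (lower_roots (- \<theta>)) * X \<theta> (cl.cf' y) * c"
   by (simp add: gc u)
 qed (simp add: cl.cf_def y_def)
qed

end


section \<open>The big cell\<close>

text \<open>The translates and derivatives taken in the argument have complex coefficients, hence
  this class besides the integral polynomials.\<close>

inductive pf :: "((complex, 'n::finite) smat \<Rightarrow> complex) \<Rightarrow> bool" where
 pf_const: "pf (\<lambda>_. c)"
| pf_ent: "pf (\<lambda>A. ent A i j)"
| pf_add: "pf F ==> pf G ==> pf (\<lambda>A. F A + G A)"
| pf_mult: "pf F ==> pf G ==> pf (\<lambda>A. F A * G A)"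

lemma pf_sum: "(\<And>x. x \<in> S ==> pf (F x)) ==> pf (\<lambda>A. \<Sum>x\<in>S. F x A)"
 by (induction S rule: infinite_finite_induct) (auto intro: pf.intros)
lemma pf_prod: "(\<And>x. x \<in> S ==> pf (F x)) ==> pf (\<lambda>A. \<Prod>x\<in>S. F x A)"
 by (induction S rule: infinite_finite_induct) (auto intro: pf.intros)
lemma pf_power: "pf F ==> pf (\<lambda>A. F A ^ k)" by (induction k) (auto intro: pf.intros)

lemma pf_ev: "pf (ev p)"
proof -
 have "pf (\<lambda>A. \<Prod>z\<in>UNIV. (ent A (fst z) (snd z)) ^ Poly_Mapping.lookup m z)" for m :: "'a \<times> 'a \<Rightarrow>\<^sub>0 nat"
  by (intro pf_prod pf_power pf_ent)
 hence "pf (\<lambda>A. \<Sum>m\<in>Poly_Mapping.keys p. of_int (Poly_Mapping.lookup p m) *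
   (\<Prod>z\<in>UNIV. (ent A (fst z) (snd z)) ^ Poly_Mapping.lookup m z))"
  by (intro pf_sum pf_mult pf_const)
 thus ?thesis by (simp add: ev_def[abs_def] eval_matrix_poly_def ent.rep_eq case_prod_unfold)
qed

lemma pf_left: "pf F ==> pf (\<lambda>A. F (B * A))"
 by (induction rule: pf.induct) (auto simp: ent_mult intro!: pf.intros pf_sum)

definition mder :: "(complex \<Rightarrow> (complex, 'n::finite) smat) \<Rightarrow> (complex, 'n) smat \<Rightarrow> complex \<Rightarrow> bool" where
 "mder c c' s \<longleftrightarrow> (\<forall>i j. ((\<lambda>s. ent (c s) i j) has_field_derivative ent c' i j) (at s))"

lemma mder_mult_const: "mder c c' s ==> mder (\<lambda>s. M * c s * N) (M * c' * N) s"
 unfolding mder_def ent_mult by (intro allI DERIV_sum DERIV_cmult DERIV_cmult_right) blast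

definition is_der :: "((complex, 'n::finite) smat \<Rightarrow> complex) \<Rightarrow> ((complex, 'n) smat \<Rightarrow> (complex, 'n) smat \<Rightarrow> complex) \<Rightarrow> bool"
 where "is_der F F' \<longleftrightarrow> (\<forall>A Z W. F' A (Z + W) = F' A Z + F' A W) \<and> (\<forall>A a Z. F' A (a \<cdot> Z) = a * F' A Z) \<and>
  (\<forall>c c' s. mder c c' s \<longrightarrow> ((\<lambda>s. F (c s)) has_field_derivative F' (c s) c') (at s))"

text \<open>The second part concerns the derivative along the vector field
  \<open>A \<mapsto> M * A\<close>, which is again polynomial; this allows iteration.\<close>

lemma pf_derivative: "pf F ==> \<exists>F'. is_der F F' \<and> (\<forall>M. pf (\<lambda>A. F' A (M * A)))"
proof (induction rule: pf.induct)
 case (pf_const c)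
 show ?case by (intro exI[of _ "\<lambda>_ _. 0"]) (auto simp: is_der_def intro: pf.pf_const)
next
 case (pf_ent i j)
 show ?case by (intro exI[of _ "\<lambda>_ Z. ent Z i j"])
   (auto simp: is_der_def mder_def ent_mult intro!: pf_sum pf.intros)
next
 case (pf_add F G)
 then obtain F' G' where "is_der F F'" "\<forall>M. pf (\<lambda>A. F' A (M * A))" "is_der G G'" "\<forall>M. pf (\<lambda>A. G' A (M * A))"
  by blast
 thus ?case by (intro exI[of _ "\<lambda>A Z. F' A Z + G' A Z"])
   (auto simp: is_der_def algebra_simps intro!: pf.intros DERIV_add)
next
 case (pf_mult F G)
 then obtain F' G' where h: "is_der F F'" "\<forall>M. pf (\<lambda>A. F' A (M * A))" "is_der G G'" "\<forall>M. pf (\<lambda>A. G' A (M * A))"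
  by blast
 have "((\<lambda>s. F (c s) * G (c s)) has_field_derivative F' (c s) c' * G (c s) + G' (c s) c' * F (c s)) (at s)"
  if "mder c c' s" for c c' s
  by (rule DERIV_mult) (use h that in \<open>auto simp: is_der_def\<close>)
 thus ?case using h pf_mult.hyps by (intro exI[of _ "\<lambda>A Z. F' A Z * G A + G' A Z * F A"])
   (auto simp: is_der_def algebra_simps intro!: pf.intros)
qed

text \<open>\<open>s \<mapsto> F (x s * A)\<close> is entire. Its derivative is the same expression
  for the polynomial \<open>A \<mapsto> F' A (M * A)\<close>, which again vanishes on
  \<open>S\<close>; so all derivatives at 0 vanish.\<close>

lemma vanish_translate:
 assumes x: "\<And>s. mder x (M * x s) s" "x 0 = 1"
  and tangent: "\<And>F F' A. pf F ==> is_der F F' ==> (\<And>A. A \<in> S ==> F A = 0) ==> A \<in> S ==> F' A (M * A) = 0"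
  and F: "pf F" "\<And>A. A \<in> S ==> F A = 0" and A: "A \<in> S"
 shows "F (x s * A) = 0"
proof -
 have dx: "mder (\<lambda>s. x s * A) (M * (x s * A)) s" for s
  using mder_mult_const[OF x(1), of 1 A s] by (simp add: mult.assoc)
 have "(deriv ^^ n) (\<lambda>s. F (x s * A)) 0 = 0" if "pf F" "\<And>A. A \<in> S ==> F A = 0" for n F
  using that
 proof (induction n arbitrary: F)
  case 0
  thus ?case using A x(2) by simp
 next
  case (Suc n)
  obtain F' where F': "is_der F F'" "pf (\<lambda>A. F' A (M * A))" using pf_derivative[OF Suc.prems(1)] by blast
  have "deriv (\<lambda>s. F (x s * A)) = (\<lambda>s. F' (x s * A) (M * (x s * A)))"
  proof
   fix s
   have "((\<lambda>s. F (x s * A)) has_field_derivative F' (x s * A) (M * (x s * A))) (at s)"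
    using F'(1) dx[of s] unfolding is_der_def by blast
   thus "deriv (\<lambda>s. F (x s * A)) s = F' (x s * A) (M * (x s * A))" by (rule DERIV_imp_deriv)
  qed
  hence "(deriv ^^ Suc n) (\<lambda>s. F (x s * A)) = (deriv ^^ n) (\<lambda>s. F' (x s * A) (M * (x s * A)))"
   by (simp add: funpow_Suc_right del: funpow.simps)
  thus ?case using Suc.IH[OF F'(2)] tangent[OF Suc.prems(1) F'(1)] Suc.prems(2) by simp
 qed
 moreover have "(\<lambda>s. F (x s * A)) holomorphic_on UNIV"
 proof -
  obtain F' where "is_der F F'" using pf_derivative[OF F(1)] by blast
  hence "((\<lambda>s. F (x s * A)) has_field_derivative F' (x s * A) (M * (x s * A))) (at s)" for s
   using dx[of s] unfolding is_der_def by blast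
  thus ?thesis unfolding holomorphic_on_def field_differentiable_def by auto
 qed
 ultimately show ?thesis
  using holomorphic_fun_eq_0_on_connected[of "\<lambda>s. F (x s * A)" UNIV 0 s] F by auto
qed

text \<open>In block form \<open>v\<close> is lower and \<open>u\<close> upper triangular, so the Schur complement of the block of
 \<open>v t u\<close> belonging to the idempotent \<open>P\<close> only sees the diagonal entry of \<open>t\<close>.\<close>

lemma schur_complement:
 fixes P p u v t u' v' t' :: "('r::comm_ring_1, 'n::finite) smat"
 assumes P: "P * P = P" "P * p = 0" "p * P = 0" "p * p = p"
  and t: "t * P = P * t" "t' * P = P * t'" "t * p = k \<cdot> p" "p * t = k \<cdot> p" "t * t' = 1"
  and u: "P * u * P = u * P" "P * u' * P = u' * P" "p * u * p = p" "u * u' = 1"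
  and v: "P * v * P = P * v" "P * v' * P = P * v'" "p * v * P = p * v - p" "v * v' = 1"
 defines "A \<equiv> v * t * u" and "B \<equiv> 1 - P + P * (v * t * u) * P"
 shows "sdet B \<cdot> (p * A * p) - p * A * P * sadj B * (P * A * p) = (sdet B * k) \<cdot> p"
proof -
 \<comment> \<open>Products are normalized by nesting to the right; these variants let a rule for a
   short product fire inside a longer one.\<close>
 have ext: "a * b = c ==> a * (b * z) = c * z" "a * b * a' = c ==> a * (b * (a' * z)) = c * z"
   "a * b * a' = c ==> a * (b * a') = c" "a * b * a' * b' = c ==> a * (b * (a' * (b' * z))) = c * z"
   for a b a' b' c z :: "('r, 'n) smat" by (simp_all add: mult.assoc[symmetric])
 have tt: "t' * t = 1" "u' * u = 1" "v' * v = 1" using t u v by (auto intro: smat_inverse_comm)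
 have Pt: "P * t = t * P" "P * t' = t' * P" using t by simp_all
 have "P * u' * t' * P = P * u' * P * t'" by (simp add: mult.assoc t)
 also have "\<dots> = u' * P * t'" by (simp only: u(2))
 finally have P4: "P * u' * t' * P = u' * t' * P" by (simp only: mult.assoc t(2))
 have "p * v * t * P = p * v * P * t" by (simp add: mult.assoc t)
 hence p4: "p * v * t * P = p * v * t - k \<cdot> p" by (simp add: v left_diff_distrib t)
 have v3: "p * v' * P = p * v' - p"
 proof -
  have "p * v * P * v' * P = p * v * P * v'" using v(2) by (simp add: mult.assoc)
  hence "(p * v - p) * v' * P = (p * v - p) * v'" by (simp only: v(3))
  hence "p * (v * v') * P - p * v' * P = p * (v * v') - p * v'"
   by (simp only: left_diff_distrib mult.assoc)
  thus ?thesis using P by (simp add: v(4)) (metis minus_diff_eq minus_minus)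
 qed
 note rules = v3 v3[THEN ext(2)] v3[THEN ext(3)] P P[THEN ext(1)] Pt Pt[THEN ext(1)] t(3-) t(3-)[THEN ext(1)] P4[THEN ext(4)] p4[THEN ext(4)] u(4) v(4) tt u(4)[THEN ext(1)] v(4)[THEN ext(1)] tt[THEN ext(1)]
  u(1-3)[THEN ext(2)] v(1-3)[THEN ext(2)] u(1-3)[THEN ext(3)] v(1-3)[THEN ext(3)]
 \<comment> \<open>The triangular factors preserve the block and are inverted there one at a time,
   which gives the inverse of the block of the product.\<close>
 define W where "W = 1 - P + u' * t' * P * v'"
 have BW: "B * W = 1" unfolding B_def W_def
  by (simp add: distrib_left distrib_right left_diff_distrib right_diff_distrib mult.assoc rules)
 have "sadj B = W * B * sadj B" using smat_inverse_comm[OF BW] by simp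
 also have "\<dots> = sdet B \<cdot> W" by (simp add: mult.assoc mult_sadj sc_conv_smul)
 finally have adj: "sadj B = sdet B \<cdot> W" .
 have "p * A * P * W * (P * A * p) = p * A * p - k \<cdot> p" unfolding A_def W_def
  by (simp add: distrib_left distrib_right left_diff_distrib right_diff_distrib mult.assoc rules)
 thus ?thesis by (simp add: adj smul_diff_right)
qed

section \<open>Unipotent subgroups, torus and the tangent directions of the big cell\<close>

context chevalley_rep begin

text \<open>The height with respect to the base, extended linearly so that it also orders the
  weights.\<close>

definition ht :: "'e \<Rightarrow> real" where "ht = (SOME g. linear g \<and> (\<forall>\<delta>\<in>\<Delta>. g \<delta> = 1))"

lemma ht: "linear ht" "\<And>\<delta>. \<delta> \<in> \<Delta> ==> ht \<delta> = 1"
proof -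
 have "independent \<Delta>" using base by (simp add: root_base_def)
 hence "\<exists>g. linear g \<and> (\<forall>\<delta>\<in>\<Delta>. g \<delta> = (1::real))"
  using linear_independent_extend[of \<Delta> "\<lambda>_. 1"] by simp
 from someI_ex[OF this] show "linear ht" "\<And>\<delta>. \<delta> \<in> \<Delta> ==> ht \<delta> = 1" by (simp_all add: ht_def)
qed

lemma ht_add: "ht (a + b) = ht a + ht b" by (rule linear_add[OF ht(1)])
lemma ht_scale: "ht (a *\<^sub>R b) = a * ht b" using linear_scale[OF ht(1)] by simp

lemma ht_root: assumes "\<beta> \<in> \<Phi>" shows "ht \<beta> < 0 \<or> ht \<beta> > 0"
proof -
 have fin: "finite \<Delta>" using base finite_subset[OF _ finite_roots] by (simp add: root_base_def)
 obtain c :: "'e \<Rightarrow> nat" where c: "\<beta> = (\<Sum>\<delta>\<in>\<Delta>. real (c \<delta>) *\<^sub>R \<delta>) \<or> \<beta> = - (\<Sum>\<delta>\<in>\<Delta>. real (c \<delta>) *\<^sub>R \<delta>)"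
  using base assms unfolding root_base_def by blast
 have h: "ht (\<Sum>\<delta>\<in>\<Delta>. real (c \<delta>) *\<^sub>R \<delta>) = real (\<Sum>\<delta>\<in>\<Delta>. c \<delta>)"
  using ht by (simp add: linear_sum[OF ht(1)] ht_scale)
 have "(\<Sum>\<delta>\<in>\<Delta>. c \<delta>) \<noteq> 0"
 proof
  assume "(\<Sum>\<delta>\<in>\<Delta>. c \<delta>) = 0"
  hence "\<beta> = 0" using c fin by auto
  thus False using assms by simp
 qed
 hence "ht (\<Sum>\<delta>\<in>\<Delta>. real (c \<delta>) *\<^sub>R \<delta>) > 0" unfolding h by (simp only: of_nat_0_less_iff neq0_conv)
 thus ?thesis using c linear_neg[OF ht(1)] by (elim disjE) simp_all
qed

inductive_set UG :: "'e set \<Rightarrow> (complex, 'n) smat set" for S where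
 UG_1: "1 \<in> UG S"
| UG_X: "\<beta> \<in> S ==> A \<in> UG S ==> X \<beta> s * A \<in> UG S"

lemma UG_mult: "A \<in> UG S ==> B \<in> UG S ==> A * B \<in> UG S"
 by (induction A rule: UG.induct) (auto simp: mult.assoc intro: UG.intros)
lemma UG_X1: "\<beta> \<in> S ==> X \<beta> s \<in> UG S" using UG_X[OF _ UG_1, of \<beta> S s] by simp
lemma UG_GC: "A \<in> UG S ==> S \<subseteq> \<Phi> ==> A \<in> GC"
 by (induction A rule: UG.induct) (auto intro: GC.intros)

lemma UG_inverse: "A \<in> UG S ==> S \<subseteq> \<Phi> ==> \<exists>B\<in>UG S. A * B = 1"
proof (induction A rule: UG.induct)
 case (UG_X \<beta> A s)
 then obtain B where B: "B \<in> UG S" "A * B = 1" by blast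
 have "X \<beta> s * A * (B * X \<beta> (- s)) = X \<beta> s * (A * B) * X \<beta> (- s)" by (simp add: mult.assoc)
 hence "X \<beta> s * A * (B * X \<beta> (- s)) = 1" using B UG_X X_inverse by auto
 moreover have "B * X \<beta> (- s) \<in> UG S" using B UG_X UG_mult UG_X1 by blast
 ultimately show ?case by blast
qed (auto intro: UG.intros)

abbreviation pos :: "'e set" where "pos \<equiv> {\<beta>\<in>\<Phi>. ht \<beta> > 0}"
abbreviation neg :: "'e set" where "neg \<equiv> {\<beta>\<in>\<Phi>. ht \<beta> < 0}"

text \<open>Torus elements are parametrized by logarithms of characters; adding \<open>s\<close>
  times a Cartan number then gives a curve in the torus that can be differentiated.\<close>

definition addf :: "('e \<Rightarrow> complex) \<Rightarrow> bool" where "addf la \<longleftrightarrow> (\<forall>a b. la (a + b) = la a + la b)"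
lemma addfD: "addf la ==> la (a + b) = la a + la b" by (simp add: addf_def)

definition Tor :: "('e \<Rightarrow> complex) \<Rightarrow> (complex, 'n) smat" where
 "Tor la = (\<Sum>\<mu>\<in>Wt. exp (la \<mu>) \<cdot> opr \<mu>)"

definition Om :: "(complex, 'n) smat set" where
 "Om = {v * Tor la * u | v la u. v \<in> UG neg \<and> addf la \<and> u \<in> UG pos}"

lemma OmI: "v \<in> UG neg ==> addf la ==> u \<in> UG pos ==> v * Tor la * u \<in> Om" by (auto simp: Om_def)

lemma Tor_pr: "Tor la * opr \<mu> = exp (la \<mu>) \<cdot> opr \<mu>" "opr \<mu> * Tor la = exp (la \<mu>) \<cdot> opr \<mu>"
proof -
 have "Tor la * opr \<mu> = (\<Sum>\<nu>\<in>Wt. if \<nu> = \<mu> then exp (la \<mu>) \<cdot> opr \<mu> else 0)"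
  unfolding Tor_def sum_distrib_right by (intro sum.cong refl) (simp add: wt.q_idem)
 thus "Tor la * opr \<mu> = exp (la \<mu>) \<cdot> opr \<mu>" using pr_zero[of \<mu>] by auto
 have "opr \<mu> * Tor la = (\<Sum>\<nu>\<in>Wt. if \<nu> = \<mu> then exp (la \<mu>) \<cdot> opr \<mu> else 0)"
  unfolding Tor_def sum_distrib_left by (intro sum.cong refl) (auto simp: wt.q_idem)
 thus "opr \<mu> * Tor la = exp (la \<mu>) \<cdot> opr \<mu>" using pr_zero[of \<mu>] by auto
qed

lemma eq_by_pr: "(\<And>\<mu>. Y * opr \<mu> = Z * opr \<mu>) ==> Y = (Z :: ('r::comm_ring_1, 'n) smat)"
proof -
 assume h: "\<And>\<mu>. Y * opr \<mu> = Z * opr \<mu>"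
 have "Y * (\<Sum>\<mu>\<in>Wt. opr \<mu>) = Z * (\<Sum>\<mu>\<in>Wt. opr \<mu>)" unfolding sum_distrib_left using h by simp
 thus ?thesis by (simp add: wt.q_sum)
qed

lemma Tor_E: "addf la ==> \<delta> \<in> \<Phi> ==> E \<delta> * Tor la = exp (- la \<delta>) \<cdot> (Tor la * E \<delta>)"
proof (rule eq_by_pr)
 fix \<mu> assume l: "addf la" and d: "\<delta> \<in> \<Phi>"
 have "exp (- la \<delta>) \<cdot> (Tor la * E \<delta>) * opr \<mu> = exp (- la \<delta>) \<cdot> (Tor la * opr (\<mu> + \<delta>) * E \<delta>)"
  by (simp add: mult.assoc E_pr[OF d])
 also have "\<dots> = exp (la \<mu>) \<cdot> (E \<delta> * opr \<mu>)"
  by (simp add: Tor_pr E_pr[OF d] addfD[OF l] exp_add[symmetric])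
 finally show "E \<delta> * Tor la * opr \<mu> = exp (- la \<delta>) \<cdot> (Tor la * E \<delta>) * opr \<mu>"
  by (simp add: mult.assoc Tor_pr)
qed

lemma Tor_inverse: "addf la ==> Tor la * Tor (\<lambda>\<mu>. - la \<mu>) = 1"
 by (rule eq_by_pr) (simp add: mult.assoc Tor_pr exp_add[symmetric])

lemma mder_X: assumes b: "\<beta> \<in> \<Phi>" shows "mder (X \<beta>) (E \<beta> * X \<beta> s) s"
 unfolding mder_def
proof (intro allI)
 fix i j
 let ?N = "CARD('n)"
 have x: "X \<beta> s = (\<Sum>k<?N. s ^ k \<cdot> dp (E \<beta>) k)" for s by (simp add: X_expand oi_D[OF b])
 have "E \<beta> * X \<beta> s = (\<Sum>k<?N. (of_nat (Suc k) * s ^ k) \<cdot> dp (E \<beta>) (Suc k))"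
  unfolding x sum_distrib_left
  by (intro sum.cong refl) (simp add: dp_Suc[symmetric] smul_of_nat[symmetric] mult.commute del: of_nat_Suc)
 also have "\<dots> = (\<Sum>k<Suc ?N. (of_nat k * s ^ (k - 1)) \<cdot> dp (E \<beta>) k)"
  by (subst sum.lessThan_Suc_shift) simp
 also have "\<dots> = (\<Sum>k<?N. (of_nat k * s ^ (k - 1)) \<cdot> dp (E \<beta>) k)"
  using dp_ge_CARD[OF E_divisible[OF b], of ?N] by simp
 finally have e: "ent (E \<beta> * X \<beta> s) i j = (\<Sum>k<?N. of_nat k * s ^ (k - 1) * ent (dp (E \<beta>) k) i j)"
  by (simp add: ent_sum)
 have fx: "(\<lambda>s. ent (X \<beta> s) i j) = (\<lambda>s. \<Sum>k<?N. s ^ k * ent (dp (E \<beta>) k) i j)"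
  by (simp add: x ent_sum)
 show "((\<lambda>s. ent (X \<beta> s) i j) has_field_derivative ent (E \<beta> * X \<beta> s) i j) (at s)"
  unfolding e fx by (intro DERIV_sum DERIV_cmult_right) (auto intro!: derivative_eq_intros)
qed

text \<open>At \<open>A = v t u\<close> the directions \<open>v Z t u\<close> with \<open>Z\<close>
  in the Lie algebra are tangent to the cell: negative roots move \<open>v\<close>, coroots move
  \<open>t\<close>, positive roots move \<open>u\<close>. Conjugation by \<open>v\<close> preserves
  the Lie algebra, so \<open>E \<gamma> * A\<close> is of this form.\<close>

lemma tangent:
 assumes F: "is_der F F'" "\<And>A. A \<in> Om ==> F A = 0" and A: "A \<in> Om" and g: "\<gamma> \<in> \<Phi>"
 shows "F' A (E \<gamma> * A) = 0"
proof -
 obtain v u la where vu: "v \<in> UG neg" "u \<in> UG pos" and l: "addf la" and Ae: "A = v * Tor la * u"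
  using A by (auto simp: Om_def)
 define t where "t = Tor la"
 have lin: "F' A (Z + W) = F' A Z + F' A W" "F' A (a \<cdot> Z) = a * F' A Z" for Z W a
  using F(1) by (auto simp: is_der_def)
 have curve: "F' (c 0) c' = 0" if "mder c c' 0" "\<And>s. c s \<in> Om" for c c'
 proof -
  have "((\<lambda>s. F (c s)) has_field_derivative F' (c 0) c') (at 0)" using F(1) that by (auto simp: is_der_def)
  hence "((\<lambda>s. 0) has_field_derivative F' (c 0) c') (at 0)" using F(2) that by simp
  thus ?thesis using DERIV_unique DERIV_const by blast
 qed
 have Z0: "F' A (v * Z * (t * u)) = 0" if "Z \<in> Ls" for Z using that
 proof (induction Z rule: Ls.induct)
  case (Ls_E \<delta>)
  have dX: "mder (\<lambda>s. M * X \<delta> s * N) (M * E \<delta> * N) 0" for M N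
   using mder_mult_const[OF mder_X[OF Ls_E], of M N 0] Ls_E by simp
  show ?case
  proof (cases "ht \<delta> < 0")
   case True
   have "v * X \<delta> s * (t * u) \<in> Om" for s
    using OmI[OF UG_mult[OF vu(1) UG_X1] l vu(2), of \<delta> s] True Ls_E by (simp add: t_def mult.assoc)
   from curve[OF dX this] show ?thesis using Ls_E by (simp add: Ae t_def mult.assoc)
  next
   case False
   hence p: "\<delta> \<in> pos" using ht_root Ls_E by auto
   have "v * t * X \<delta> s * u \<in> Om" for s
    using OmI[OF vu(1) l UG_mult[OF UG_X1[OF p] vu(2)], of s] by (simp add: t_def mult.assoc)
   from curve[OF dX this] have "F' A (v * t * E \<delta> * u) = 0" using Ls_E by (simp add: Ae t_def mult.assoc)
   moreover have "v * E \<delta> * (t * u) = exp (- la \<delta>) \<cdot> (v * t * E \<delta> * u)"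
   proof -
    have "v * E \<delta> * (t * u) = v * (E \<delta> * t) * u" by (simp add: mult.assoc)
    also have "\<dots> = exp (- la \<delta>) \<cdot> (v * t * E \<delta> * u)"
     by (simp add: t_def Tor_E[OF l Ls_E]) (simp add: mult.assoc)
    finally show ?thesis .
   qed
   ultimately show ?thesis by (simp add: lin)
  qed
 next
  case (Ls_H \<delta>)
  define L where "L s \<mu> = la \<mu> + s * of_real (ci \<mu> \<delta>)" for s \<mu>
  have L: "addf (L s)" for s by (simp add: addf_def L_def addfD[OF l] ci_add algebra_simps)
  have "mder (\<lambda>s. Tor (L s)) (H \<delta> * t) 0" unfolding mder_def
  proof (intro allI)
   fix i j
   have "H \<delta> * t = (\<Sum>\<mu>\<in>Wt. (exp (la \<mu>) * of_real (ci \<mu> \<delta>)) \<cdot> opr \<mu>)"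
    unfolding t_def Tor_def sum_distrib_left by (intro sum.cong refl) (simp add: H_pr[OF Ls_H])
   hence e: "ent (H \<delta> * t) i j = (\<Sum>\<mu>\<in>Wt. exp (la \<mu>) * of_real (ci \<mu> \<delta>) * ent (opr \<mu>) i j)"
    by (simp add: ent_sum)
   show "((\<lambda>s. ent (Tor (L s)) i j) has_field_derivative ent (H \<delta> * t) i j) (at 0)"
    unfolding e Tor_def ent_sum ent_smul L_def
    by (intro DERIV_sum DERIV_cmult_right) (auto intro!: derivative_eq_intros)
  qed
  from mder_mult_const[OF this, of v u]
  have "mder (\<lambda>s. v * Tor (L s) * u) (v * H \<delta> * (t * u)) 0" by (simp add: mult.assoc)
  moreover have "v * Tor (L s) * u \<in> Om" for s by (rule OmI[OF vu(1) L vu(2)])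
  ultimately have "F' (v * Tor (L 0) * u) (v * H \<delta> * (t * u)) = 0" by (rule curve)
  thus ?case by (simp add: L_def[abs_def] Ae)
 next
  case (Ls_add X Y)
  thus ?case by (simp add: distrib_left distrib_right lin)
 next
  case (Ls_smul X a)
  thus ?case by (simp add: lin)
 qed
 obtain v' where v': "v' \<in> UG neg" "v * v' = 1" using UG_inverse[OF vu(1)] by auto
 have vv: "v' * v = 1" by (rule smat_inverse_comm[OF v'(2)])
 have v'G: "v' \<in> GC" by (rule UG_GC[OF v'(1)]) auto
 have "sadj v' = v" by (rule sadj_unique[OF GC_det[OF v'G] vv])
 hence "v' * E \<gamma> * v \<in> Ls" using Ls_cj[OF v'G Ls_E[OF g]] by (simp add: cj_def)
 from Z0[OF this] have "F' A (v * v' * E \<gamma> * v * (t * u)) = 0" by (simp add: mult.assoc)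
 thus ?thesis by (simp add: v'(2) Ae t_def mult.assoc)
qed

lemma Om_1: "1 \<in> Om"
proof -
 have "addf (\<lambda>_ :: 'e. 0 :: complex)" by (simp add: addf_def)
 moreover have "Tor (\<lambda>_. 0) = 1" by (simp add: Tor_def wt.q_sum)
 ultimately show ?thesis using OmI[OF UG_1 _ UG_1, of "\<lambda>_. 0"] by simp
qed

text \<open>By \<open>tangent\<close> the polynomials vanishing on the cell still vanish after
  translation by each one-parameter root subgroup. This gives the density that is needed: what
  vanishes on the cell vanishes on the group.\<close>

lemma GC_Om: "B \<in> GC ==> pf F ==> (\<And>A. A \<in> Om ==> F A = 0) ==> A \<in> Om ==> F (B * A) = 0"
proof (induction B arbitrary: F rule: GC.induct)
 case (GC_X \<alpha> B t)
 have "F (X \<alpha> t * A) = 0" if "A \<in> Om" for A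
  by (rule vanish_translate[where x = "X \<alpha>" and M = "E \<alpha>" and S = Om])
   (use GC_X that mder_X tangent in auto)
 from GC_X.IH[OF pf_left[OF GC_X.prems(1)] this GC_X.prems(3)] have "F (X \<alpha> t * (B * A)) = 0" .
 thus ?case by (simp add: mult.assoc)
qed simp

lemma GR_Om:
 assumes F: "ipair F F'" "\<And>A. A \<in> Om ==> F A = 0" and A': "A' \<in> GR" shows "F' A' = 0"
proof (rule GR_scalar[OF F(1) _ A'])
 fix B assume B: "B \<in> GC"
 obtain p where "F = ev p" using F(1) by (auto simp: ipair_def)
 thus "F B = 0" using GC_Om[OF B _ F(2) Om_1] pf_ev[of p] by simp
qed

end


context chevalley_rep begin

section \<open>Diagonal elements\<close>

text \<open>Elements for positive roots map the space of \<open>\<mu>\<close> into itself plus this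
  block, because every positive root raises the height.\<close>

definition above :: "'e \<Rightarrow> (int, 'n) smat" where
 "above \<mu> = (\<Sum>\<nu>\<in>{\<nu>\<in>Wt. ht \<nu> > ht \<mu>}. pr \<nu>)"
abbreviation oab :: "'e \<Rightarrow> ('r::comm_ring_1, 'n) smat" where "oab \<mu> \<equiv> oi (above \<mu>)"

lemma above_pr: "above \<mu> * pr \<nu> = (if ht \<nu> > ht \<mu> then pr \<nu> else 0)"
 "pr \<nu> * above \<mu> = (if ht \<nu> > ht \<mu> then pr \<nu> else 0)"
proof -
 have "above \<mu> * pr \<nu> = (\<Sum>\<kappa>\<in>{\<kappa>\<in>Wt. ht \<kappa> > ht \<mu>}. if \<kappa> = \<nu> then pr \<nu> else 0)"
  unfolding above_def sum_distrib_right by (intro sum.cong refl) (simp add: pr_idem)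
 thus "above \<mu> * pr \<nu> = (if ht \<nu> > ht \<mu> then pr \<nu> else 0)" using pr_zero[of \<nu>] by auto
 have "pr \<nu> * above \<mu> = (\<Sum>\<kappa>\<in>{\<kappa>\<in>Wt. ht \<kappa> > ht \<mu>}. if \<kappa> = \<nu> then pr \<nu> else 0)"
  unfolding above_def sum_distrib_left by (intro sum.cong refl) (auto simp: pr_idem)
 thus "pr \<nu> * above \<mu> = (if ht \<nu> > ht \<mu> then pr \<nu> else 0)" using pr_zero[of \<nu>] by auto
qed

lemma above_idem: "above \<mu> * above \<mu> = above \<mu>"
proof -
 have "above \<mu> * above \<mu> = (\<Sum>\<nu>\<in>{\<nu>\<in>Wt. ht \<nu> > ht \<mu>}. above \<mu> * pr \<nu>)"
  by (subst (2) above_def) (simp add: sum_distrib_left)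
 also have "\<dots> = above \<mu>" unfolding above_def[of \<mu>, symmetric]
  by (subst (2) above_def) (intro sum.cong refl, simp add: above_pr)
 finally show ?thesis .
qed

lemma D_pr_above:
 assumes "\<beta> \<in> \<Phi>" "ht \<beta> > 0" "ht \<mu> < ht \<nu> \<or> (\<nu> = \<mu> \<and> k > 0)"
 shows "above \<mu> * (D \<beta> k * pr \<nu>) = D \<beta> k * pr \<nu>"
proof -
 have "real k * ht \<beta> > 0 \<or> (k = 0 \<and> ht \<mu> < ht \<nu>)" using assms(2,3) by (auto simp: zero_less_mult_iff)
 hence "ht (\<nu> + real k *\<^sub>R \<beta>) > ht \<mu>"
  using assms(3) by (auto simp: ht_add ht_scale)
 thus ?thesis unfolding D_pr[OF assms(1)] by (simp add: mult.assoc[symmetric] above_pr)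
qed

lemma pr_D: "\<beta> \<in> \<Phi> ==> pr \<nu> * D \<beta> k = D \<beta> k * pr (\<nu> - real k *\<^sub>R \<beta>)"
 using D_pr[of \<beta> k "\<nu> - real k *\<^sub>R \<beta>"] by simp

lemma pr_D_above:
 assumes "\<beta> \<in> \<Phi>" "ht \<beta> < 0" "ht \<mu> < ht \<nu> \<or> (\<nu> = \<mu> \<and> k > 0)"
 shows "pr \<nu> * D \<beta> k * above \<mu> = pr \<nu> * D \<beta> k"
proof -
 have "real k * ht \<beta> < 0 \<or> (k = 0 \<and> ht \<mu> < ht \<nu>)" using assms(2,3) by (auto simp: mult_less_0_iff)
 hence "ht (\<nu> - real k *\<^sub>R \<beta>) > ht \<mu>"
  using assms(3) ht_add[of "\<nu> - real k *\<^sub>R \<beta>" "real k *\<^sub>R \<beta>"] by (auto simp: ht_scale)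
 thus ?thesis unfolding pr_D[OF assms(1)] by (simp add: mult.assoc above_pr)
qed

lemma X_above:
 fixes s :: "'r::comm_ring_1"
 assumes b: "\<beta> \<in> \<Phi>" "ht \<beta> > 0"
 shows "oab \<mu> * (X \<beta> s * oab \<mu>) = X \<beta> s * oab \<mu>"
  and "X \<beta> s * opr \<mu> = opr \<mu> + oab \<mu> * X \<beta> s * opr \<mu>"
proof -
 have "above \<mu> * (D \<beta> k * above \<mu>) = D \<beta> k * above \<mu>" for k
  by (subst (2 3) above_def) (simp add: sum_distrib_left D_pr_above[OF b])
 hence 1: "oab \<mu> * (oi (D \<beta> k) * oab \<mu>) = oi (D \<beta> k) * oab \<mu>" for k
  by (simp add: oi_mult[symmetric])
 show "oab \<mu> * (X \<beta> s * oab \<mu>) = X \<beta> s * oab \<mu>"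
  unfolding X_expand sum_distrib_right sum_distrib_left by (simp add: 1)
 have 2: "oab \<mu> * (s ^ k \<cdot> oi (D \<beta> k)) * opr \<mu> = s ^ k \<cdot> oi (D \<beta> k) * opr \<mu> - (if k = 0 then opr \<mu> else 0)" for k
 proof (cases "k = 0")
  case True
  thus ?thesis using b(1) by (simp add: oi_mult[symmetric] above_pr)
 next
  case False
  hence "oi (above \<mu> * (D \<beta> k * pr \<mu>)) = (oi (D \<beta> k * pr \<mu>) :: ('r, 'n) smat)" using D_pr_above[OF b] by simp
  thus ?thesis using False by (simp add: oi_mult mult.assoc)
 qed
 have "oab \<mu> * X \<beta> s * opr \<mu> = X \<beta> s * opr \<mu> - opr \<mu>"
  unfolding X_expand sum_distrib_right sum_distrib_left 2 by (simp add: sum_subtractf)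
 thus "X \<beta> s * opr \<mu> = opr \<mu> + oab \<mu> * X \<beta> s * opr \<mu>" by simp
qed

lemma above_X:
 fixes s :: "'r::comm_ring_1"
 assumes b: "\<beta> \<in> \<Phi>" "ht \<beta> < 0"
 shows "oab \<mu> * X \<beta> s * oab \<mu> = oab \<mu> * X \<beta> s"
  and "opr \<mu> * X \<beta> s = opr \<mu> + opr \<mu> * X \<beta> s * oab \<mu>"
proof -
 have "above \<mu> * D \<beta> k * above \<mu> = above \<mu> * D \<beta> k" for k
  by (subst (1 3) above_def) (simp add: sum_distrib_right pr_D_above[OF b])
 hence 1: "oab \<mu> * oi (D \<beta> k) * oab \<mu> = oab \<mu> * oi (D \<beta> k)" for k
  by (simp add: oi_mult[symmetric])
 show "oab \<mu> * X \<beta> s * oab \<mu> = oab \<mu> * X \<beta> s"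
  unfolding X_expand sum_distrib_right sum_distrib_left by (simp add: 1)
 have 2: "opr \<mu> * (s ^ k \<cdot> oi (D \<beta> k)) * oab \<mu> = opr \<mu> * (s ^ k \<cdot> oi (D \<beta> k)) - (if k = 0 then opr \<mu> else 0)" for k
 proof (cases "k = 0")
  case True
  thus ?thesis using b(1) by (simp add: oi_mult[symmetric] above_pr)
 next
  case False
  hence "oi (pr \<mu> * D \<beta> k * above \<mu>) = (oi (pr \<mu> * D \<beta> k) :: ('r, 'n) smat)" using pr_D_above[OF b] by simp
  thus ?thesis using False by (simp add: oi_mult)
 qed
 have "opr \<mu> * X \<beta> s * oab \<mu> = opr \<mu> * X \<beta> s - opr \<mu>"
  unfolding X_expand sum_distrib_right sum_distrib_left 2 by (simp add: sum_subtractf)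
 thus "opr \<mu> * X \<beta> s = opr \<mu> + opr \<mu> * X \<beta> s * oab \<mu>" by simp
qed

text \<open>Block triangularity of the upper unipotent factor, in the form that
  \<open>schur_complement\<close> expects.\<close>

lemma UG_pos_above:
 assumes "u \<in> UG pos"
 shows "oab \<mu> * u * oab \<mu> = u * oab \<mu>"
  and "u * opr \<mu> = opr \<mu> + oab \<mu> * u * opr \<mu>"
proof -
 have "oab \<mu> * (u * oab \<mu>) = u * oab \<mu> \<and>
   u * opr \<mu> = opr \<mu> + oab \<mu> * u * opr \<mu>" using assms
 proof (induction rule: UG.induct)
  case UG_1
  show ?case by (simp add: oi_mult[symmetric] above_idem above_pr)
 next
  case (UG_X \<beta> A s)
  let ?P = "oab \<mu> :: (complex, 'n) smat" and ?p = "opr \<mu> :: (complex, 'n) smat"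
  have b: "\<beta> \<in> \<Phi>" "ht \<beta> > 0" using UG_X by auto
  note x = X_above[OF b, where \<mu> = \<mu> and s = s]
  have A: "?P * (A * ?P) = A * ?P" "A * ?p = ?p + ?P * A * ?p" using UG_X by auto
  have 1: "?P * (X \<beta> s * A * ?P) = X \<beta> s * A * ?P"
  proof -
   have "X \<beta> s * A * ?P = X \<beta> s * ?P * (A * ?P)" by (simp add: mult.assoc A(1))
   also have "\<dots> = ?P * (X \<beta> s * ?P) * (A * ?P)" by (simp only: x(1))
   finally show ?thesis by (simp add: mult.assoc A(1))
  qed
  have "X \<beta> s * A * ?p = X \<beta> s * ?p + X \<beta> s * ?P * (A * ?p)"
   using arg_cong[OF A(2), of "\<lambda>z. X \<beta> s * z"] by (simp add: distrib_left mult.assoc)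
  also have "X \<beta> s * ?P = ?P * (X \<beta> s * ?P)" by (simp only: x(1))
  also have "X \<beta> s * ?p = ?p + ?P * X \<beta> s * ?p" by (rule x(2))
  also have "?p + ?P * X \<beta> s * ?p + ?P * (X \<beta> s * ?P) * (A * ?p) =
    ?p + ?P * (X \<beta> s * (?p + ?P * A * ?p))" by (simp add: distrib_left mult.assoc)
  also have "?p + ?P * A * ?p = A * ?p" by (rule A(2)[symmetric])
  finally have "X \<beta> s * A * ?p = ?p + ?P * (X \<beta> s * A) * ?p" unfolding mult.assoc .
  with 1 show ?case by (rule conjI)
 qed
 thus "oab \<mu> * u * oab \<mu> = u * oab \<mu>"
  "u * opr \<mu> = opr \<mu> + oab \<mu> * u * opr \<mu>" unfolding mult.assoc by blast+
qed

lemma UG_neg_above: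
 assumes "v \<in> UG neg"
 shows "oab \<mu> * v * oab \<mu> = oab \<mu> * v"
  and "opr \<mu> * v = opr \<mu> + opr \<mu> * v * oab \<mu>"
proof -
 have "oab \<mu> * v * oab \<mu> = oab \<mu> * v \<and>
   opr \<mu> * v = opr \<mu> + opr \<mu> * v * oab \<mu>" using assms
 proof (induction rule: UG.induct)
  case UG_1
  show ?case by (simp add: oi_mult[symmetric] above_idem above_pr)
 next
  case (UG_X \<beta> A s)
  let ?P = "oab \<mu> :: (complex, 'n) smat" and ?p = "opr \<mu> :: (complex, 'n) smat"
  have b: "\<beta> \<in> \<Phi>" "ht \<beta> < 0" using UG_X by auto
  note x = above_X[OF b, where \<mu> = \<mu> and s = s]
  have A: "?P * A * ?P = ?P * A" "?p * A = ?p + ?p * A * ?P" using UG_X by auto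
  have 1: "?P * (X \<beta> s * A) * ?P = ?P * (X \<beta> s * A)"
  proof -
   have "?P * (X \<beta> s * A) = ?P * X \<beta> s * ?P * A" by (simp only: x(1) mult.assoc[symmetric])
   also have "\<dots> = ?P * X \<beta> s * (?P * A * ?P)" by (subst A(1)) (simp only: mult.assoc)
   also have "\<dots> = ?P * X \<beta> s * ?P * A * ?P" by (simp only: mult.assoc)
   also have "\<dots> = ?P * X \<beta> s * A * ?P" by (simp only: x(1))
   finally have "?P * (X \<beta> s * A) = ?P * (X \<beta> s * A) * ?P" unfolding mult.assoc .
   thus ?thesis by (rule sym)
  qed
  have "?p * (X \<beta> s * A) = (?p + ?p * X \<beta> s * ?P) * A" using x(2) by (simp only: mult.assoc[symmetric])
  also have "\<dots> = ?p * A + ?p * X \<beta> s * (?P * A)" by (simp only: distrib_right mult.assoc)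
  also have "?P * A = ?P * A * ?P" by (simp only: A(1))
  also have "?p * A = ?p + ?p * A * ?P" by (rule A(2))
  also have "?p + ?p * A * ?P + ?p * X \<beta> s * (?P * A * ?P) = ?p + (?p + ?p * X \<beta> s * ?P) * A * ?P"
   by (simp only: distrib_right mult.assoc add.assoc)
  also have "?p + ?p * X \<beta> s * ?P = ?p * X \<beta> s" by (rule x(2)[symmetric])
  finally have "?p * (X \<beta> s * A) = ?p + ?p * (X \<beta> s * A) * ?P" unfolding mult.assoc .
  with 1 show ?case by (rule conjI)
 qed
 thus "oab \<mu> * v * oab \<mu> = oab \<mu> * v"
  "opr \<mu> * v = opr \<mu> + opr \<mu> * v * oab \<mu>" by blast+
qed

text \<open>The block is completed by the identity so that its determinant is a minor of
  \<open>A\<close>.\<close>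

definition blk :: "'e \<Rightarrow> ('r::comm_ring_1, 'n) smat \<Rightarrow> ('r, 'n) smat" where
 "blk \<mu> A = 1 - oab \<mu> + oab \<mu> * A * oab \<mu>"
definition minor :: "'e \<Rightarrow> ('r::comm_ring_1, 'n) smat \<Rightarrow> 'r" where
 "minor \<mu> A = sdet (blk \<mu> A)"
text \<open>The Schur complement with the minor multiplied out, hence polynomial in the
  entries.\<close>

definition schur :: "'e \<Rightarrow> ('r::comm_ring_1, 'n) smat \<Rightarrow> ('r, 'n) smat" where
 "schur \<mu> A = minor \<mu> A \<cdot> (opr \<mu> * A * opr \<mu>) -
  opr \<mu> * A * oab \<mu> * sadj (blk \<mu> A) * (oab \<mu> * A * opr \<mu>)"

lemma schur_Om:
 assumes v: "v \<in> UG neg" and l: "addf la" and u: "u \<in> UG pos"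
 shows "schur \<mu> (v * Tor la * u) = (minor \<mu> (v * Tor la * u) * exp (la \<mu>)) \<cdot> opr \<mu>"
proof -
 obtain v' where v': "v' \<in> UG neg" "v * v' = 1" using UG_inverse[OF v] by auto
 obtain u' where u': "u' \<in> UG pos" "u * u' = 1" using UG_inverse[OF u] by auto
 let ?P = "oab \<mu> :: (complex, 'n) smat" and ?p = "opr \<mu> :: (complex, 'n) smat"
 have Tor_above: "Tor f * ?P = ?P * Tor f" for f
  unfolding above_def oi_sum sum_distrib_left sum_distrib_right by (simp add: Tor_pr)
 have P: "?P * ?P = ?P" "?P * ?p = 0" "?p * ?P = 0" "?p * ?p = ?p"
  by (simp_all add: oi_mult[symmetric] above_idem above_pr pr_idem)
 have pup: "?p * u * ?p = ?p"
  using arg_cong[OF UG_pos_above(2)[OF u, of \<mu>], of "\<lambda>z. ?p * z"] P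
  by (simp add: distrib_left mult.assoc[symmetric])
 have pvP: "?p * v * ?P = ?p * v - ?p" using UG_neg_above(2)[OF v, of \<mu>] by (metis add_diff_cancel_left')
 show ?thesis unfolding schur_def minor_def blk_def
  by (rule schur_complement[where P = ?P and p = ?p and u = u and v = v and t = "Tor la" and u' = u' and v' = v'
     and t' = "Tor (\<lambda>\<mu>. - la \<mu>)" and k = "exp (la \<mu>)", OF P Tor_above Tor_above Tor_pr Tor_inverse[OF l] UG_pos_above(1)[OF u]
     UG_pos_above(1)[OF u'(1)] pup u'(2) UG_neg_above(1)[OF v] UG_neg_above(1)[OF v'(1)] pvP v'(2)])
qed

text \<open>Not the trace, whose value on \<open>pr \<mu>\<close> is the multiplicity of the weight
  and may be zero in R; this integral form has the value 1 there.\<close>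

definition tr_coeff :: "'e \<Rightarrow> 'n \<Rightarrow> 'n \<Rightarrow> int" where
 "tr_coeff \<mu> = (SOME c. (\<Sum>i\<in>UNIV. \<Sum>j\<in>UNIV. c i j * ent (pr \<mu>) i j) = 1)"

definition tr :: "'e \<Rightarrow> ('r::comm_ring_1, 'n) smat \<Rightarrow> 'r" where
 "tr \<mu> Z = (\<Sum>i\<in>UNIV. \<Sum>j\<in>UNIV. of_int (tr_coeff \<mu> i j) * ent Z i j)"

lemma tr_smul: "tr \<mu> (a \<cdot> Z) = a * tr \<mu> Z"
 by (simp add: tr_def sum_distrib_left mult.left_commute)

lemma tr_pr: assumes "\<mu> \<in> Wt" shows "tr \<mu> (opr \<mu>) = 1"
proof -
 have "\<not> (\<forall>i j. int p dvd ent (pr \<mu>) i j)" if "prime p" for p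
  using idempotent_dvd[OF that, of "pr \<mu>"] assms by (auto simp: pr_idem Wt_def)
 from someI_ex[OF bezout_smat[OF this]]
 have 1: "(\<Sum>i\<in>UNIV. \<Sum>j\<in>UNIV. tr_coeff \<mu> i j * ent (pr \<mu>) i j) = 1" unfolding tr_coeff_def .
 have "tr \<mu> (opr \<mu>) = of_int (\<Sum>i\<in>UNIV. \<Sum>j\<in>UNIV. tr_coeff \<mu> i j * ent (pr \<mu>) i j)"
  by (simp add: tr_def)
 thus ?thesis by (simp only: 1) simp
qed

lemma ipair_minor: "ipair (minor \<mu>) (minor \<mu>)"
 unfolding minor_def[abs_def] blk_def[abs_def] by (intro pair_intro ipair_mat_id)
lemma mat_pair_schur: "ipair.mat_pair (schur \<mu>) (schur \<mu>)"
proof -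
 have "ipair.mat_pair (blk \<mu>) (blk \<mu>)" unfolding blk_def[abs_def] by (intro pair_intro ipair_mat_id)
 thus ?thesis unfolding schur_def[abs_def] by (intro pair_intro ipair_mat_id ipair_minor)
qed
lemma ipair_tr: "ipair.mat_pair F F' ==> ipair (\<lambda>A. tr \<mu> (F A)) (\<lambda>A. tr \<mu> (F' A))"
 unfolding tr_def by (intro pair_intro)

lemma tr_schur_Om:
 assumes "v \<in> UG neg" "addf la" "u \<in> UG pos" "\<mu> \<in> Wt"
 shows "tr \<mu> (schur \<mu> (v * Tor la * u)) = minor \<mu> (v * Tor la * u) * exp (la \<mu>)"
 by (simp add: schur_Om[OF assms(1-3)] tr_smul tr_pr assms(4))

lemma GR_schur:
 fixes c :: "('r::comm_ring_1, 'n) smat"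
 assumes c: "c \<in> GR" and m: "\<mu> \<in> Wt"
 shows "schur \<mu> c = tr \<mu> (schur \<mu> c) \<cdot> opr \<mu>"
proof (rule smat_eqI)
 fix i j
 have "ent (schur \<mu> c - tr \<mu> (schur \<mu> c) \<cdot> opr \<mu>) i j = 0"
 proof (rule GR_Om[OF _ _ c])
  show "ipair (\<lambda>A. ent (schur \<mu> A - tr \<mu> (schur \<mu> A) \<cdot> opr \<mu>) i j)
    (\<lambda>A. ent (schur \<mu> A - tr \<mu> (schur \<mu> A) \<cdot> opr \<mu>) i j)"
   by (intro pair_intro ipair_tr mat_pair_schur)
  fix A assume "A \<in> Om"
  thus "ent (schur \<mu> A - tr \<mu> (schur \<mu> A) \<cdot> opr \<mu>) i j = 0"
   using tr_schur_Om[OF _ _ _ m] schur_Om by (auto simp: Om_def)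
 qed
 thus "ent (schur \<mu> c) i j = ent (tr \<mu> (schur \<mu> c) \<cdot> opr \<mu>) i j" by simp
qed

text \<open>On the cell both sides are the product of all minors times \<open>exp\<close> of the
  value of \<open>la\<close> at the common sum. Cross-multiplication makes multiplicativity of the
  character a polynomial identity.\<close>

lemma GR_schur_prod:
 fixes c :: "('r::comm_ring_1, 'n) smat"
 assumes c: "c \<in> GR" and m: "set ls \<subseteq> Wt" "set rs \<subseteq> Wt" "sum_list ls = sum_list rs"
 shows "(\<Prod>\<mu>\<leftarrow>ls. tr \<mu> (schur \<mu> c)) * (\<Prod>\<mu>\<leftarrow>rs. minor \<mu> c) =
  (\<Prod>\<mu>\<leftarrow>rs. tr \<mu> (schur \<mu> c)) * (\<Prod>\<mu>\<leftarrow>ls. minor \<mu> c)"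
proof -
 let ?F = "\<lambda>A. (\<Prod>\<mu>\<leftarrow>ls. tr \<mu> (schur \<mu> A)) * (\<Prod>\<mu>\<leftarrow>rs. minor \<mu> A) -
  (\<Prod>\<mu>\<leftarrow>rs. tr \<mu> (schur \<mu> A)) * (\<Prod>\<mu>\<leftarrow>ls. minor \<mu> A)"
 have "?F c = 0"
 proof (rule GR_Om[OF _ _ c, where F = ?F])
  show "ipair ?F ?F" by (intro pair_intro ipair.mult ipair_tr mat_pair_schur ipair_minor)
  fix A :: "(complex, 'n) smat" assume "A \<in> Om"
  then obtain v la u where A: "v \<in> UG neg" "addf la" "u \<in> UG pos" "A = v * Tor la * u"
   by (auto simp: Om_def)
  have la0: "la 0 = 0" using addfD[OF A(2), of 0 0] by simp
  have "(\<Prod>\<mu>\<leftarrow>xs. tr \<mu> (schur \<mu> A)) = (\<Prod>\<mu>\<leftarrow>xs. minor \<mu> A) * exp (la (sum_list xs))"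
   if "set xs \<subseteq> Wt" for xs
   using that by (induction xs) (simp_all add: la0 tr_schur_Om A addfD[OF A(2)] exp_add)
  thus "?F A = 0" using m by simp
 qed
 thus ?thesis by simp
qed

text \<open>For diagonal \<open>c\<close> the minors are units, with the minors of
  \<open>sadj c\<close> as inverses, and the correction term of the Schur complement vanishes. So
  the eigenvalue is \<open>tr\<close> of the complement divided by the minor, and the polynomial
  relations become multiplicativity.\<close>

lemma diagonal_characters:
 fixes c :: "('r::comm_ring_1, 'n) smat"
 assumes c: "c \<in> GR" and diag: "\<And>\<mu>. c * opr \<mu> = opr \<mu> * c"
 obtains k where "\<And>\<mu>. \<mu> \<in> Wt ==> c * opr \<mu> = k \<mu> \<cdot> opr \<mu>"
  and "\<And>\<mu>. \<mu> \<in> Wt ==> \<exists>i. k \<mu> * i = 1"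
  and "\<And>ls rs. set ls \<subseteq> Wt ==> set rs \<subseteq> Wt ==> sum_list ls = sum_list rs ==>
    prod_list (map k ls) = prod_list (map k rs)"
proof -
 have det: "sdet c = 1" by (rule GR_det[OF c])
 note inv = sadj_inverse[OF det]
 have cP: "c * oab \<mu> = oab \<mu> * c" for \<mu>
  unfolding above_def oi_sum sum_distrib_left sum_distrib_right by (simp add: diag)
 have PP: "oab \<mu> * (oab \<mu> * Z) = oab \<mu> * Z" for \<mu> and Z :: "('r, 'n) smat"
  by (simp add: mult.assoc[symmetric] oi_mult[symmetric] above_idem)
 have unit: "minor \<mu> c * minor \<mu> (sadj c) = 1" for \<mu>
 proof -
  let ?P = "oab \<mu> :: ('r, 'n) smat"
  have "sadj c * (c * ?P) * sadj c = sadj c * (?P * c) * sadj c" by (simp only: cP)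
  hence "?P * sadj c = sadj c * ?P" by (simp add: mult.assoc inv) (simp add: mult.assoc[symmetric] inv)
  hence r: "?P * c = c * ?P" "?P * sadj c = sadj c * ?P"
    "?P * (c * Z) = c * (?P * Z)" "?P * (sadj c * Z) = sadj c * (?P * Z)" "c * (sadj c * Z) = Z" for Z
   by (simp_all add: cP mult.assoc[symmetric] inv)
  have "blk \<mu> c * blk \<mu> (sadj c) = 1" unfolding blk_def using PP[of \<mu> 1]
   by (simp add: distrib_left distrib_right left_diff_distrib right_diff_distrib mult.assoc r PP)
  thus ?thesis unfolding minor_def by (metis sdet_mult sdet_1)
 qed
 define k where "k \<mu> = tr \<mu> (schur \<mu> c) * minor \<mu> (sadj c)" for \<mu>
 have k: "c * opr \<mu> = k \<mu> \<cdot> opr \<mu>" if m: "\<mu> \<in> Wt" for \<mu>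
 proof -
  have "opr \<mu> * c * oab \<mu> = (0 :: ('r, 'n) smat)"
  proof -
   have "opr \<mu> * oab \<mu> = (0 :: ('r, 'n) smat)" by (simp add: oi_mult[symmetric] above_pr)
   thus ?thesis by (simp add: mult.assoc cP) (simp add: mult.assoc[symmetric])
  qed
  moreover have "opr \<mu> * c * opr \<mu> = c * opr \<mu>"
   by (simp add: diag[symmetric] mult.assoc wt.q_idem)
  ultimately have "schur \<mu> c = minor \<mu> c \<cdot> (c * opr \<mu>)" by (simp add: schur_def)
  hence "minor \<mu> (sadj c) \<cdot> minor \<mu> c \<cdot> (c * opr \<mu>) = minor \<mu> (sadj c) \<cdot> tr \<mu> (schur \<mu> c) \<cdot> opr \<mu>"
   using GR_schur[OF c m] by simp
  thus ?thesis using unit[of \<mu>] by (simp add: k_def mult.commute)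
 qed
 have ku: "\<exists>i. k \<mu> * i = 1" if m: "\<mu> \<in> Wt" for \<mu>
 proof -
  have "opr \<mu> = opr \<mu> * (sadj c * (c * opr \<mu>))"
   by (simp add: mult.assoc[symmetric]) (simp add: mult.assoc inv wt.q_idem)
  hence "opr \<mu> = k \<mu> \<cdot> (opr \<mu> * sadj c * opr \<mu>)" by (simp add: k[OF m] mult.assoc)
  hence "tr \<mu> (opr \<mu>) = k \<mu> * tr \<mu> (opr \<mu> * sadj c * opr \<mu>)" by (metis tr_smul)
  thus ?thesis using tr_pr[OF m] by metis
 qed
 have "prod_list (map k ls) = prod_list (map k rs)"
  if s: "set ls \<subseteq> Wt" "set rs \<subseteq> Wt" "sum_list ls = sum_list rs" for ls rs
 proof -
  have kk: "prod_list (map k xs) = (\<Prod>\<mu>\<leftarrow>xs. tr \<mu> (schur \<mu> c)) * (\<Prod>\<mu>\<leftarrow>xs. minor \<mu> (sadj c))" for xs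
   by (induction xs) (simp_all add: k_def mult_ac)
  have uu: "(\<Prod>\<mu>\<leftarrow>xs. minor \<mu> c) * (\<Prod>\<mu>\<leftarrow>xs. minor \<mu> (sadj c)) = 1" for xs
  proof (induction xs)
   case (Cons a xs)
   have "(\<Prod>\<mu>\<leftarrow>a # xs. minor \<mu> c) * (\<Prod>\<mu>\<leftarrow>a # xs. minor \<mu> (sadj c)) =
     minor a c * minor a (sadj c) * ((\<Prod>\<mu>\<leftarrow>xs. minor \<mu> c) * (\<Prod>\<mu>\<leftarrow>xs. minor \<mu> (sadj c)))"
    by (simp add: mult_ac)
   thus ?case by (simp only: unit Cons) simp
  qed simp
  let ?tl = "\<Prod>\<mu>\<leftarrow>ls. tr \<mu> (schur \<mu> c)" and ?trr = "\<Prod>\<mu>\<leftarrow>rs. tr \<mu> (schur \<mu> c)"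
  let ?ml = "\<Prod>\<mu>\<leftarrow>ls. minor \<mu> c" and ?mr = "\<Prod>\<mu>\<leftarrow>rs. minor \<mu> c"
  let ?ul = "\<Prod>\<mu>\<leftarrow>ls. minor \<mu> (sadj c)" and ?ur = "\<Prod>\<mu>\<leftarrow>rs. minor \<mu> (sadj c)"
  have "?tl * ?ul = ?tl * ?ul * (?mr * ?ur)" by (simp only: uu) simp
  also have "\<dots> = ?tl * ?mr * (?ul * ?ur)" by (simp only: mult_ac)
  also have "\<dots> = ?trr * ?ml * (?ul * ?ur)" using GR_schur_prod[OF c s] by simp
  also have "\<dots> = ?trr * ?ur * (?ml * ?ul)" by (simp only: mult_ac)
  also have "\<dots> = ?trr * ?ur" by (simp only: uu) simp
  finally show ?thesis by (simp add: kk)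
 qed
 thus ?thesis using that k ku by blast
qed

section \<open>The root lattice and central elements\<close>

inductive_set zspan :: "'e set \<Rightarrow> 'e set" for S where
 zspan_0: "0 \<in> zspan S"
| zspan_base: "v \<in> S ==> v \<in> zspan S"
| zspan_add: "v \<in> zspan S ==> w \<in> zspan S ==> v + w \<in> zspan S"
| zspan_neg: "v \<in> zspan S ==> - v \<in> zspan S"

lemma zspan_diff: "v \<in> zspan S ==> w \<in> zspan S ==> v - w \<in> zspan S"
 using zspan_add[OF _ zspan_neg, of v S w] by simp

lemma zspan_scale: "v \<in> zspan S ==> real k *\<^sub>R v \<in> zspan S"
 by (induction k) (auto simp: scaleR_left_distrib intro: zspan.intros)

lemma zspan_trans: "v \<in> zspan T ==> T \<subseteq> zspan S ==> v \<in> zspan S"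
 by (induction rule: zspan.induct) (auto intro: zspan.intros)

text \<open>Root elements change weights by multiples of roots, so the group does not mix cosets of
  the root lattice.\<close>

lemma GC_weights: "A \<in> GC ==> \<mu> - \<nu> \<notin> zspan \<Phi> ==> opr \<mu> * A * opr \<nu> = 0"
proof (induction A arbitrary: \<mu> rule: GC.induct)
 case GC_1
 thus ?case using zspan_0 by (auto simp: wt.q_idem)
next
 case (GC_X \<alpha> A t)
 have "opr \<mu> * (t ^ k \<cdot> oi (D \<alpha> k) * A) * opr \<nu> = 0" for k
 proof -
  have "\<mu> - real k *\<^sub>R \<alpha> - \<nu> \<notin> zspan \<Phi>"
  proof
   assume "\<mu> - real k *\<^sub>R \<alpha> - \<nu> \<in> zspan \<Phi>"
   from zspan_add[OF this zspan_scale[OF zspan_base[OF GC_X(1)], of k]] show False using GC_X.prems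
    by simp
  qed
  from GC_X.IH[OF this] have z: "opr (\<mu> - real k *\<^sub>R \<alpha>) * A * opr \<nu> = 0" .
  have "opr \<mu> * oi (D \<alpha> k) = (oi (D \<alpha> k) * opr (\<mu> - real k *\<^sub>R \<alpha>) :: (complex, 'n) smat)"
   unfolding oi_mult[symmetric] by (simp add: pr_D[OF GC_X(1)])
  hence "opr \<mu> * (oi (D \<alpha> k) * A) * opr \<nu> = oi (D \<alpha> k) * (opr (\<mu> - real k *\<^sub>R \<alpha>) * A * opr \<nu>)"
   by (simp add: mult.assoc[symmetric])
  thus ?thesis by (simp add: z)
 qed
 thus ?case unfolding X_expand sum_distrib_right sum_distrib_left by (intro sum.neutral) simp
qed

lemma GR_weights:
 fixes B :: "('r::comm_ring_1, 'n) smat"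
 assumes "B \<in> GR" "\<mu> - \<nu> \<notin> zspan \<Phi>" shows "opr \<mu> * B * opr \<nu> = 0"
 by (rule GR_eq[OF _ _ _ assms(1), where F = "\<lambda>A. opr \<mu> * A * opr \<nu>" and G = "\<lambda>A. 0"])
  (auto intro!: pair_intro ipair_mat_id simp: GC_weights assms(2))

text \<open>\<open>K v\<close> expresses that the character of \<open>c\<close> is trivial on
  \<open>v\<close>, without inverses of eigenvalues. It holds on \<open>S\<close> and is inherited
  by the lattice generated by \<open>S\<close>; hence \<open>c\<close> is scalar on each coset of
  the root lattice, and \<open>GR_weights\<close> keeps the cosets apart.\<close>

theorem central_criterion:
 fixes c :: "('r::comm_ring_1, 'n) smat"
 assumes c: "c \<in> GR" and diag: "\<And>\<mu>. c * opr \<mu> = opr \<mu> * c"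
  and S: "S \<subseteq> \<Phi>" "\<Phi> \<subseteq> zspan S" "\<And>\<gamma>. \<gamma> \<in> S ==> c * D1 \<gamma> = D1 \<gamma> * c"
  and B: "B \<in> GR"
 shows "c * B = B * c"
proof -
 obtain k where k: "\<And>\<mu>. \<mu> \<in> Wt ==> c * opr \<mu> = k \<mu> \<cdot> opr \<mu>"
  and ku: "\<And>\<mu>. \<mu> \<in> Wt ==> \<exists>i. k \<mu> * i = 1"
  and kp: "\<And>ls rs. set ls \<subseteq> Wt ==> set rs \<subseteq> Wt ==> sum_list ls = sum_list rs ==>
    prod_list (map k ls) = prod_list (map k rs)" using diagonal_characters[OF c diag] by metis
 define K where "K v \<longleftrightarrow> (\<exists>ls rs. set ls \<subseteq> Wt \<and> set rs \<subseteq> Wt \<and> sum_list ls - sum_list rs = v \<and>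
   prod_list (map k ls) = prod_list (map k rs))" for v
 have KS: "K \<gamma>" if g: "\<gamma> \<in> S" for \<gamma>
 proof -
  have g': "\<gamma> \<in> \<Phi>" using g S by auto
  let ?e = "D1 \<gamma> :: ('r, 'n) smat"
  have he: "?e * opr \<nu> = opr (\<nu> + \<gamma>) * ?e" for \<nu> using wt.homD[OF hom_D1[OF g']] .
  have "\<exists>\<nu>. D \<gamma> (Suc 0) * pr \<nu> \<noteq> 0"
  proof (rule ccontr)
   assume "\<not> ?thesis"
   hence "D \<gamma> (Suc 0) * (\<Sum>\<nu>\<in>Wt. pr \<nu>) = 0" by (simp add: sum_distrib_left)
   hence "D \<gamma> (Suc 0) = 0" by (simp add: sum_pr)
   thus False using E_nonzero[OF g'] oi_D1[OF g'] by simp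
  qed
  then obtain \<nu>0 where n: "D \<gamma> (Suc 0) * pr \<nu>0 \<noteq> 0" by blast
  hence "pr (\<nu>0 + \<gamma>) * D \<gamma> (Suc 0) \<noteq> 0" using D_pr[OF g', of "Suc 0" \<nu>0] by simp
  hence n0: "\<nu>0 \<in> Wt" "\<nu>0 + \<gamma> \<in> Wt" using n by (auto simp: Wt_def)
  obtain i where i: "k \<nu>0 * i = 1" using ku[OF n0(1)] by blast
  define r where "r = k (\<nu>0 + \<gamma>) * i"
  \<comment> \<open>A single weight does not suffice, since \<open>D1 \<gamma> * opr \<nu>\<close>
    can be zero over R. Multiplicativity gives the same ratio \<open>r\<close> for all
    \<open>\<nu>\<close>, so \<open>r - 1\<close> kills the whole of \<open>D1 \<gamma>\<close>,
    whose coordinate is 1.\<close>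
  have "(r - 1) \<cdot> ?e * opr \<nu> = 0 * opr \<nu>" for \<nu>
  proof (cases "\<nu> \<in> Wt \<and> \<nu> + \<gamma> \<in> Wt")
   case True
   have "k (\<nu> + \<gamma>) * k \<nu>0 = k \<nu> * k (\<nu>0 + \<gamma>)"
    using kp[of "[\<nu> + \<gamma>, \<nu>0]" "[\<nu>, \<nu>0 + \<gamma>]"] True n0 by (simp add: ac_simps)
   hence "k (\<nu> + \<gamma>) * (k \<nu>0 * i) = k \<nu> * (k (\<nu>0 + \<gamma>) * i)" by (metis mult.assoc)
   hence r: "k (\<nu> + \<gamma>) = k \<nu> * r" by (simp add: i r_def)
   have "c * (?e * opr \<nu>) = k (\<nu> + \<gamma>) \<cdot> (?e * opr \<nu>)"
    unfolding he using k[of "\<nu> + \<gamma>"] True by (simp add: mult.assoc[symmetric])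
   moreover have "c * (?e * opr \<nu>) = ?e * (c * opr \<nu>)"
    by (simp add: mult.assoc[symmetric] S(3)[OF g])
   ultimately have "k \<nu> \<cdot> r \<cdot> (?e * opr \<nu>) = k \<nu> \<cdot> (?e * opr \<nu>)" using k[of \<nu>] True by (simp add: r)
   moreover obtain j where "k \<nu> * j = 1" using ku True by blast
   ultimately have "(j * k \<nu>) \<cdot> r \<cdot> (?e * opr \<nu>) = (j * k \<nu>) \<cdot> (?e * opr \<nu>)"
    by (metis smul_smul)
   thus ?thesis using \<open>k \<nu> * j = 1\<close> by (simp add: mult.commute[of j] smul_diff_left left_diff_distrib)
  next
   case False
   hence "opr \<nu> = (0 :: ('r, 'n) smat) \<or> opr (\<nu> + \<gamma>) = (0 :: ('r, 'n) smat)"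
    by (auto simp: wt.q_zero)
   hence "?e * opr \<nu> = 0" using he[of \<nu>] by (elim disjE) simp_all
   thus ?thesis by simp
  qed
  hence "(r - 1) \<cdot> ?e = 0" by (rule eq_by_pr)
  hence "\<phi> \<gamma> ((r - 1) \<cdot> ?e) = 0" by simp
  hence "r = 1" by (simp add: phi_smul phi_D1[OF g'])
  hence "k (\<nu>0 + \<gamma>) * (k \<nu>0 * i) = k \<nu>0" unfolding r_def by (metis mult.left_commute mult.right_neutral)
  hence "k (\<nu>0 + \<gamma>) = k \<nu>0" by (simp add: i)
  thus ?thesis unfolding K_def using n0 by (intro exI[of _ "[\<nu>0 + \<gamma>]"] exI[of _ "[\<nu>0]"]) simp
 qed
 have Kz: "K v" if "v \<in> zspan S" for v using that
 proof (induction rule: zspan.induct)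
  case zspan_0
  show ?case unfolding K_def by (intro exI[of _ "[]"]) simp
 next
  case (zspan_add v w)
  then obtain ls rs ls' rs' where "set ls \<subseteq> Wt" "set rs \<subseteq> Wt" "sum_list ls - sum_list rs = v"
   "prod_list (map k ls) = prod_list (map k rs)" "set ls' \<subseteq> Wt" "set rs' \<subseteq> Wt" "sum_list ls' - sum_list rs' = w"
   "prod_list (map k ls') = prod_list (map k rs')" unfolding K_def by blast
  thus ?case unfolding K_def
   by (intro exI[of _ "ls @ ls'"] exI[of _ "rs @ rs'"]) (auto simp: algebra_simps)
 next
  case (zspan_neg v)
  thus ?case unfolding K_def by (metis minus_diff_eq)
 qed (rule KS)
 have keq: "k \<mu> = k \<nu>" if m: "\<mu> \<in> Wt" "\<nu> \<in> Wt" "\<mu> - \<nu> \<in> zspan \<Phi>" for \<mu> \<nu>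
 proof -
  have "K (\<mu> - \<nu>)" by (rule Kz[OF zspan_trans[OF m(3) S(2)]])
  then obtain ls rs where l: "set ls \<subseteq> Wt" "set rs \<subseteq> Wt" "sum_list ls - sum_list rs = \<mu> - \<nu>"
   "prod_list (map k ls) = prod_list (map k rs)" unfolding K_def by blast
  have "\<mu> + sum_list rs = \<nu> + sum_list ls" using l(3) by (metis add.commute diff_add_eq eq_diff_eq)
  hence "prod_list (map k (\<mu> # rs)) = prod_list (map k (\<nu> # ls))" using l m by (intro kp) auto
  hence e: "k \<mu> * prod_list (map k rs) = k \<nu> * prod_list (map k rs)" using l(4) by simp
  have "\<exists>i. prod_list (map k xs) * i = 1" if "set xs \<subseteq> Wt" for xs using that
  proof (induction xs)
   case (Cons a xs)
   then obtain i where i: "prod_list (map k xs) * i = 1" by auto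
   obtain j where "k a * j = 1" using ku Cons by auto
   hence "k a * prod_list (map k xs) * (i * j) = 1" using i
    by (metis mult.assoc mult.commute mult.right_neutral)
   thus ?case by auto
  qed simp
  then obtain i where "prod_list (map k rs) * i = 1" using l by blast
  thus ?thesis using e by (metis mult.assoc mult.right_neutral)
 qed
 have ck: "opr \<mu> * c = k \<mu> \<cdot> opr \<mu>" if "\<mu> \<in> Wt" for \<mu> using k[OF that] diag by simp
 have "opr \<mu> * (c * B) * opr \<nu> = opr \<mu> * (B * c) * opr \<nu>" if m: "\<mu> \<in> Wt" "\<nu> \<in> Wt" for \<mu> \<nu>
 proof -
  have "opr \<mu> * (c * B) * opr \<nu> = k \<mu> \<cdot> (opr \<mu> * B * opr \<nu>)"
   using ck[OF m(1)] by (simp add: mult.assoc[symmetric])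
  moreover have "opr \<mu> * (B * c) * opr \<nu> = k \<nu> \<cdot> (opr \<mu> * B * opr \<nu>)"
   using k[OF m(2)] by (simp add: mult.assoc)
  ultimately show ?thesis using keq[OF m] GR_weights[OF B, of \<mu> \<nu>] by (cases "\<mu> - \<nu> \<in> zspan \<Phi>") auto
 qed
 hence "(\<Sum>\<mu>\<in>Wt. opr \<mu>) * (c * B) * (\<Sum>\<nu>\<in>Wt. opr \<nu>) =
   (\<Sum>\<mu>\<in>Wt. opr \<mu>) * (B * c) * (\<Sum>\<nu>\<in>Wt. opr \<nu>)"
  unfolding sum_distrib_left sum_distrib_right by simp
 thus ?thesis by (simp add: wt.q_sum)
qed

end


section \<open>Long roots\<close>

context irreducible_roots begin

text \<open>Otherwise the roots orthogonal to all of \<open>S\<close> and the remaining ones would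
  split \<open>\<Phi>\<close>.\<close>

lemma nonorthogonal_closure:
 assumes S: "S \<subseteq> \<Phi>" "S \<noteq> {}" and cl: "\<And>\<beta> s. \<beta> \<in> \<Phi> ==> s \<in> S ==> s \<bullet> \<beta> \<noteq> 0 ==> \<beta> \<in> span S"
 shows "\<beta> \<in> \<Phi> ==> \<exists>s\<in>S. s \<bullet> \<beta> \<noteq> 0" "span S = UNIV"
proof -
 define B where "B = {\<beta>\<in>\<Phi>. \<forall>s\<in>S. s \<bullet> \<beta> = 0}"
 have "B = {}"
 proof (rule ccontr)
  assume "B \<noteq> {}"
  moreover have "\<Phi> - B \<noteq> {}" using S by (fastforce simp: B_def)
  moreover have "a \<bullet> b = 0" if "a \<in> \<Phi> - B" "b \<in> B" for a b
  proof -
   have a: "a \<in> span S" using that(1) cl by (auto simp: B_def)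
   have "orthogonal b a"
    by (rule orthogonal_to_span[OF a]) (use that in \<open>auto simp: B_def orthogonal_def inner_commute\<close>)
   thus ?thesis by (simp add: orthogonal_def inner_commute)
  qed
  moreover have "(\<Phi> - B) \<inter> B = {}" "(\<Phi> - B) \<union> B = \<Phi>" by (auto simp: B_def)
  ultimately have "\<exists>A B. A \<noteq> {} \<and> B \<noteq> {} \<and> A \<inter> B = {} \<and> A \<union> B = \<Phi> \<and> (\<forall>\<alpha>\<in>A. \<forall>\<beta>\<in>B. \<alpha> \<bullet> \<beta> = 0)"
   by (intro exI[of _ "\<Phi> - B"] exI[of _ B] conjI ballI)
  thus False using irreducible unfolding irreducible_root_system_def by (elim conjE notE)
 qed
 hence ex: "\<exists>s\<in>S. s \<bullet> \<beta> \<noteq> 0" if "\<beta> \<in> \<Phi>" for \<beta> using that by (auto simp: B_def)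
 thus "\<beta> \<in> \<Phi> ==> \<exists>s\<in>S. s \<bullet> \<beta> \<noteq> 0" .
 have "\<Phi> \<subseteq> span S" using ex cl by blast
 thus "span S = UNIV" using span_roots by (metis span_minimal subspace_span top.extremum_unique)
qed

text \<open>If \<open>s\<close> is not orthogonal to \<open>\<beta>\<close>, the difference of
  \<open>s\<close> and its reflection is a nonzero multiple of \<open>\<beta>\<close>, so
  \<open>\<beta>\<close> lies in the span.\<close>

lemma reflection_closed:
 assumes S: "S \<subseteq> \<Phi>" "S \<noteq> {}" and cl: "\<And>\<beta> s. \<beta> \<in> \<Phi> ==> s \<in> S ==> s - ci s \<beta> *\<^sub>R \<beta> \<in> S"
 shows "\<beta> \<in> \<Phi> ==> \<exists>s\<in>S. s \<bullet> \<beta> \<noteq> 0" "span S = UNIV"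
proof -
 have *: "\<beta> \<in> span S" if "\<beta> \<in> \<Phi>" "s \<in> S" "s \<bullet> \<beta> \<noteq> 0" for \<beta> s
 proof -
  have "ci s \<beta> \<noteq> 0" using that by (simp add: ci_eq_0)
  hence "\<beta> = (1 / ci s \<beta>) *\<^sub>R (s - (s - ci s \<beta> *\<^sub>R \<beta>))" by simp
  also have "\<dots> \<in> span S" using that cl by (intro span_scale span_diff span_base) auto
  finally show ?thesis .
 qed
 show "\<exists>s\<in>S. s \<bullet> \<beta> \<noteq> 0" if "\<beta> \<in> \<Phi>"
  by (rule nonorthogonal_closure(1)[OF S _ that]) (rule *)
 show "span S = UNIV" by (rule nonorthogonal_closure(2)[OF S]) (rule *)
qed

lemma ex_long: "\<exists>\<theta>. long \<theta>"
proof -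
 have f: "finite (norm ` \<Phi>)" "norm ` \<Phi> \<noteq> {}" using roots_nonempty by auto
 from Max_in[OF f] obtain \<theta> where t: "Max (norm ` \<Phi>) = norm \<theta>" "\<theta> \<in> \<Phi>" by (rule imageE)
 have "norm \<beta> \<le> norm \<theta>" if "\<beta> \<in> \<Phi>" for \<beta> unfolding t(1)[symmetric] using f that by (intro Max_ge) auto
 thus ?thesis using t(2) by (auto simp: long_def)
qed

lemma reflect_inner:
 assumes "\<beta> \<noteq> 0"
 shows "(s - ci s \<beta> *\<^sub>R \<beta>) \<bullet> (t - ci t \<beta> *\<^sub>R \<beta>) = s \<bullet> t"
proof -
 have "ci t \<beta> * (ci s \<beta> * (\<beta> \<bullet> \<beta>)) = ci t \<beta> * (2 * (s \<bullet> \<beta>))"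
  "ci s \<beta> * (ci t \<beta> * (\<beta> \<bullet> \<beta>)) = ci s \<beta> * (2 * (t \<bullet> \<beta>))"
  by (simp_all only: ci_inner[OF assms])
 moreover have "ci s \<beta> * (ci t \<beta> * (\<beta> \<bullet> \<beta>)) = ci t \<beta> * (ci s \<beta> * (\<beta> \<bullet> \<beta>))" by simp
 moreover have "(s - ci s \<beta> *\<^sub>R \<beta>) \<bullet> (t - ci t \<beta> *\<^sub>R \<beta>) =
   s \<bullet> t - ci t \<beta> * (s \<bullet> \<beta>) - ci s \<beta> * (t \<bullet> \<beta>) + ci s \<beta> * (ci t \<beta> * (\<beta> \<bullet> \<beta>))"
  by (simp add: inner_diff_left inner_diff_right inner_commute[of \<beta> t] algebra_simps)
 ultimately show ?thesis by linarith
qed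

lemma long_reflect:
 assumes "long s" "\<beta> \<in> \<Phi>" shows "long (s - ci s \<beta> *\<^sub>R \<beta>)"
proof -
 have "(s - ci s \<beta> *\<^sub>R \<beta>) \<bullet> (s - ci s \<beta> *\<^sub>R \<beta>) = s \<bullet> s" by (rule reflect_inner) (use assms in simp)
 hence "norm (s - ci s \<beta> *\<^sub>R \<beta>) = norm s" by (simp add: norm_eq_sqrt_inner)
 thus ?thesis using assms reflect[OF assms(2) long_root[OF assms(1)]] by (simp add: long_def)
qed

lemma long_span: "span {\<theta>. long \<theta>} = UNIV"
 and long_nonorthogonal: "\<beta> \<in> \<Phi> ==> \<exists>\<theta>. long \<theta> \<and> \<theta> \<bullet> \<beta> \<noteq> 0"
proof -
 have h: "{\<theta>. long \<theta>} \<subseteq> \<Phi>" "{\<theta>. long \<theta>} \<noteq> {}" using ex_long long_root by auto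
 show "span {\<theta>. long \<theta>} = UNIV" by (rule reflection_closed(2)[OF h]) (simp add: long_reflect)
 assume "\<beta> \<in> \<Phi>"
 hence "\<exists>s\<in>{\<theta>. long \<theta>}. s \<bullet> \<beta> \<noteq> 0"
  by (rule reflection_closed(1)[OF h, rotated]) (simp add: long_reflect)
 thus "\<exists>\<theta>. long \<theta> \<and> \<theta> \<bullet> \<beta> \<noteq> 0" by blast
qed

lemma long_separates: "(\<And>\<theta>. long \<theta> ==> \<theta> \<bullet> v = 0) ==> v = 0"
proof -
 assume h: "\<And>\<theta>. long \<theta> ==> \<theta> \<bullet> v = 0"
 have "orthogonal v v"
  by (rule orthogonal_to_span[of v "{\<theta>. long \<theta>}"]) (use h long_span in \<open>auto simp: orthogonal_def inner_commute\<close>)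
 thus ?thesis by (simp add: orthogonal_self)
qed

lemma long_inner_self: "long \<theta> ==> long \<theta>' ==> \<theta>' \<bullet> \<theta>' = \<theta> \<bullet> \<theta>"
 using long_norm by (metis power2_norm_eq_inner)

lemma long_ratio:
 assumes th: "long \<theta>" and d: "\<delta> \<in> \<Phi>" "\<delta> \<bullet> \<theta> > 0" "\<delta> \<noteq> \<theta>"
 shows "ci \<delta> \<theta> = 1" "ci \<theta> \<delta> \<in> {1, 2, 3}" "\<theta> \<bullet> \<theta> = ci \<theta> \<delta> * (\<delta> \<bullet> \<delta>)" "2 * (\<delta> \<bullet> \<theta>) = \<theta> \<bullet> \<theta>"
proof -
 have t: "\<theta> \<in> \<Phi>" by (rule long_root[OF th])
 have n: "\<delta> \<noteq> - \<theta>" using d t by (auto simp: not_less)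
 have "ci \<delta> \<theta> > 0" using d t by (simp add: ci_pos)
 thus c: "ci \<delta> \<theta> = 1" using ci_long[OF th d(1,3) n] by auto
 thus i: "2 * (\<delta> \<bullet> \<theta>) = \<theta> \<bullet> \<theta>" using ci_inner[of \<theta> \<delta>] t by simp
 thus "\<theta> \<bullet> \<theta> = ci \<theta> \<delta> * (\<delta> \<bullet> \<delta>)" using ci_inner[of \<delta> \<theta>] d by (simp add: inner_commute)
 have "ci \<theta> \<delta> > 0" using d t by (simp add: ci_pos inner_commute)
 moreover have "ci \<theta> \<delta> < 4" using ci_prod_less[OF t d(1,3) n] c by simp
 moreover obtain k where k: "ci \<theta> \<delta> = of_int k" using ci_Ints[OF d(1) t] Ints_cases by blast
 ultimately have "k > 0" "k < 4" by auto
 hence "k = 1 \<or> k = 2 \<or> k = 3" by auto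
 thus "ci \<theta> \<delta> \<in> {1, 2, 3}" by (auto simp: k)
qed

lemma long_product:
 assumes th: "long \<theta>" "long \<delta>" "\<delta> \<noteq> \<theta>" "\<delta> \<noteq> - \<theta>"
 shows "\<delta> \<bullet> \<theta> = 0 \<or> 2 * (\<delta> \<bullet> \<theta>) = \<theta> \<bullet> \<theta> \<or> 2 * (\<delta> \<bullet> \<theta>) = - (\<theta> \<bullet> \<theta>)"
 using ci_long[OF th(1) long_root[OF th(2)] th(3,4)] ci_inner[of \<theta> \<delta>] long_root[OF th(1)] by auto

lemma long_add: "long \<theta> ==> long \<delta> ==> 2 * (\<delta> \<bullet> \<theta>) = - (\<theta> \<bullet> \<theta>) ==> long (\<theta> + \<delta>)"
proof -
 assume h: "long \<theta>" "long \<delta>" "2 * (\<delta> \<bullet> \<theta>) = - (\<theta> \<bullet> \<theta>)"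
 have t: "\<theta> \<in> \<Phi>" by (rule long_root[OF h(1)])
 have "ci \<delta> \<theta> = -1" using h(3) t by (simp add: cartan_number_def)
 thus ?thesis using long_reflect[OF h(2) t] by (simp add: add.commute)
qed

lemma long_diff: "long \<theta> ==> long \<delta> ==> 2 * (\<delta> \<bullet> \<theta>) = \<theta> \<bullet> \<theta> ==> long (\<theta> - \<delta>)"
 using long_add[of \<theta> "- \<delta>"] by simp

section \<open>Long roots at an acute angle to a short root\<close>

context
 fixes \<alpha> assumes a: "\<alpha> \<in> \<Phi>" "\<not> long \<alpha>"
begin

lemma Theta_inner: "long \<theta> ==> \<theta> \<bullet> \<alpha> > 0 ==> 2 * (\<theta> \<bullet> \<alpha>) = \<theta> \<bullet> \<theta>"
 using long_ratio(4)[of \<theta> \<alpha>] a by (auto simp: inner_commute)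

lemma Theta_ratio: "long \<theta> ==> \<theta> \<bullet> \<alpha> > 0 ==> \<theta> \<bullet> \<theta> \<ge> 2 * (\<alpha> \<bullet> \<alpha>)"
proof -
 assume h: "long \<theta>" "\<theta> \<bullet> \<alpha> > 0"
 hence h': "\<alpha> \<bullet> \<theta> > 0" "\<alpha> \<noteq> \<theta>" using a by (auto simp: inner_commute)
 note r = long_ratio[OF h(1) a(1) h']
 have "ci \<theta> \<alpha> \<noteq> 1"
 proof
  assume "ci \<theta> \<alpha> = 1"
  hence "norm \<alpha> = norm \<theta>" using r(3) by (simp add: norm_eq_sqrt_inner)
  hence "long \<alpha>" using h a by (simp add: long_def)
  thus False using a by simp
 qed
 hence "ci \<theta> \<alpha> \<ge> 2" using r(2) by auto
 hence "ci \<theta> \<alpha> * (\<alpha> \<bullet> \<alpha>) \<ge> 2 * (\<alpha> \<bullet> \<alpha>)" by (intro mult_right_mono) auto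
 thus ?thesis using r(3) by simp
qed

text \<open>The vector \<open>2 \<alpha> - \<theta> - \<theta>'\<close> has squared norm
  \<open>4 |\<alpha>|^2 - 2 |\<theta>|^2\<close>, which is at most 0.\<close>

lemma Theta_orthogonal:
 assumes t: "long \<theta>" "\<theta> \<bullet> \<alpha> > 0" "long \<theta>'" "\<theta>' \<bullet> \<alpha> > 0" "\<theta>' \<bullet> \<theta> = 0"
 shows "2 *\<^sub>R \<alpha> = \<theta> + \<theta>'" "\<theta> \<bullet> \<theta> = 2 * (\<alpha> \<bullet> \<alpha>)"
proof -
 have i: "2 * (\<theta> \<bullet> \<alpha>) = \<theta> \<bullet> \<theta>" "2 * (\<theta>' \<bullet> \<alpha>) = \<theta> \<bullet> \<theta>" "\<theta>' \<bullet> \<theta>' = \<theta> \<bullet> \<theta>"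
  using Theta_inner t long_inner_self[OF t(1,3)] by simp_all
 define w where "w = 2 *\<^sub>R \<alpha> - (\<theta> + \<theta>')"
 have w: "w \<bullet> w = 4 * (\<alpha> \<bullet> \<alpha>) - 2 * (\<theta> \<bullet> \<theta>)"
  using i t(5) by (simp add: w_def inner_diff_left inner_diff_right inner_add_left inner_add_right inner_commute)
 hence "w \<bullet> w \<le> 0" using Theta_ratio[OF t(1,2)] by simp
 hence "w = 0" by (metis inner_eq_zero_iff inner_ge_zero antisym)
 thus "2 *\<^sub>R \<alpha> = \<theta> + \<theta>'" by (simp add: w_def)
 show "\<theta> \<bullet> \<theta> = 2 * (\<alpha> \<bullet> \<alpha>)" using w \<open>w = 0\<close> by simp
qed

text \<open>Let \<open>\<delta>\<close>, up to sign, be at an acute angle to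
  \<open>\<theta>\<close>. Depending on the sign of its product with \<open>\<theta>'\<close>,
  either \<open>\<delta>\<close> or \<open>\<theta>' + \<delta>\<close> would link
  \<open>\<theta>\<close> and \<open>\<theta>'\<close>; if the product is 0, then
  \<open>\<delta> \<bullet> \<alpha>\<close> is half of what \<open>Theta_inner\<close>
  demands.\<close>

lemma Theta_isolated:
 assumes t: "long \<theta>" "\<theta> \<bullet> \<alpha> > 0" "long \<theta>'" "\<theta>' \<bullet> \<alpha> > 0" "\<theta>' \<bullet> \<theta> = 0"
  and no: "\<And>\<theta>''. long \<theta>'' ==> \<theta>'' \<bullet> \<alpha> > 0 ==> \<theta>'' \<bullet> \<theta> \<noteq> 0 ==> \<theta>'' \<bullet> \<theta>' = 0"
  and d: "long \<delta>" "\<delta> \<noteq> \<theta>" "\<delta> \<noteq> - \<theta>"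
 shows "\<delta> \<bullet> \<theta> = 0"
proof -
 note m = Theta_orthogonal[OF t]
 have q: "\<theta>' \<bullet> \<theta>' = \<theta> \<bullet> \<theta>" "\<theta> \<bullet> \<theta> > 0"
  using long_inner_self[OF t(1,3)] long_root[OF t(1)] by (auto simp: inner_gt_zero_iff)
 have al: "2 * (\<delta> \<bullet> \<alpha>) = \<delta> \<bullet> \<theta> + \<delta> \<bullet> \<theta>'" for \<delta>
  using arg_cong[OF m(1), of "\<lambda>z. \<delta> \<bullet> z"] by (simp add: inner_add_right)
 have pos: False if d: "long \<delta>" "\<delta> \<noteq> \<theta>" "\<delta> \<noteq> - \<theta>" "2 * (\<delta> \<bullet> \<theta>) = \<theta> \<bullet> \<theta>" for \<delta>
 proof -
  have "\<delta> \<noteq> \<theta>'" "\<delta> \<noteq> - \<theta>'" using d q t(5) by auto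
  then consider "\<delta> \<bullet> \<theta>' = 0" | "2 * (\<delta> \<bullet> \<theta>') = \<theta>' \<bullet> \<theta>'" | "2 * (\<delta> \<bullet> \<theta>') = - (\<theta>' \<bullet> \<theta>')"
   using long_product[OF t(3) d(1)] by blast
  thus False
  proof cases
   case 1
   hence p: "\<delta> \<bullet> \<alpha> > 0" "2 * (\<delta> \<bullet> \<alpha>) = (\<theta> \<bullet> \<theta>) / 2" using al[of \<delta>] d(4) q by linarith+
   thus False using Theta_inner[OF d(1)] long_inner_self[OF t(1) d(1)] q by linarith
  next
   case 2
   hence "\<delta> \<bullet> \<alpha> > 0" "\<delta> \<bullet> \<theta> \<noteq> 0" "\<delta> \<bullet> \<theta>' \<noteq> 0" using al[of \<delta>] d(4) q by linarith+
   thus False using no[OF d(1)] by blast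
  next
   case 3
   have l: "long (\<theta>' + \<delta>)" by (rule long_add[OF t(3) d(1) 3])
   have "2 * ((\<theta>' + \<delta>) \<bullet> \<theta>) = \<theta> \<bullet> \<theta>" "2 * ((\<theta>' + \<delta>) \<bullet> \<theta>') = \<theta> \<bullet> \<theta>"
    using 3 d(4) t(5) q by (simp_all add: inner_add_left)
   hence "(\<theta>' + \<delta>) \<bullet> \<alpha> > 0" "(\<theta>' + \<delta>) \<bullet> \<theta> \<noteq> 0" "(\<theta>' + \<delta>) \<bullet> \<theta>' \<noteq> 0"
    using al[of "\<theta>' + \<delta>"] q by linarith+
   thus False using no[OF l] by blast
  qed
 qed
 consider "\<delta> \<bullet> \<theta> = 0" | "2 * (\<delta> \<bullet> \<theta>) = \<theta> \<bullet> \<theta>" | "2 * (\<delta> \<bullet> \<theta>) = - (\<theta> \<bullet> \<theta>)"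
  using long_product[OF t(1) d] by blast
 thus ?thesis
 proof cases
  case 2
  thus ?thesis using pos[OF d] by blast
 next
  case 3
  hence "2 * (- \<delta> \<bullet> \<theta>) = \<theta> \<bullet> \<theta>" by simp
  moreover have "long (- \<delta>)" "- \<delta> \<noteq> \<theta>" "- \<delta> \<noteq> - \<theta>" using d by auto
  ultimately show ?thesis using pos by blast
 qed
qed

end

end

section \<open>Recognition of type C by its long roots\<close>

context chevalley_rep begin

text \<open>Isolation is stable under reflections, so all long roots have it and the positive ones
  form an orthogonal basis. A short root has coordinates 0 or \<open>\<plusminus>1/2\<close> in it;
  length, integrality and reducedness leave exactly two nonzero ones.\<close>

lemma isolated_type_C:
 assumes iso: "long \<theta>0" "\<And>\<delta>. long \<delta> ==> \<delta> \<noteq> \<theta>0 ==> \<delta> \<noteq> - \<theta>0 ==> \<delta> \<bullet> \<theta>0 = 0"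
 shows "type_C \<Phi>"
proof -
 define S where "S = {\<theta>. long \<theta> \<and> (\<forall>\<delta>. long \<delta> \<longrightarrow> \<delta> \<noteq> \<theta> \<longrightarrow> \<delta> \<noteq> - \<theta> \<longrightarrow> \<delta> \<bullet> \<theta> = 0)}"
 have S: "S \<subseteq> \<Phi>" "S \<noteq> {}" using iso long_root by (auto simp: S_def)
 have Scl: "s - ci s \<beta> *\<^sub>R \<beta> \<in> S" if b: "\<beta> \<in> \<Phi>" and s: "s \<in> S" for \<beta> s
 proof -
  define R where "R v = v - ci v \<beta> *\<^sub>R \<beta>" for v
  have RR: "R (R v) = v" "R (- v) = - R v" for v using b by (simp_all add: R_def ci_diff ci_scale)
  have "\<delta> \<bullet> R s = 0" if d: "long \<delta>" "\<delta> \<noteq> R s" "\<delta> \<noteq> - R s" for \<delta>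
  proof -
   have "R \<delta> \<noteq> s" "R \<delta> \<noteq> - s" using RR d by metis+
   moreover have "long (R \<delta>)" unfolding R_def by (rule long_reflect[OF d(1) b])
   ultimately have "R \<delta> \<bullet> s = 0" using s by (auto simp: S_def)
   moreover have "\<delta> \<bullet> R s = R \<delta> \<bullet> s"
   proof -
    have "R (R \<delta>) \<bullet> R s = R \<delta> \<bullet> s" unfolding R_def by (rule reflect_inner) (use b in simp)
    thus ?thesis by (simp only: RR(1))
   qed
   ultimately show ?thesis by simp
  qed
  moreover have "long (R s)" unfolding R_def by (rule long_reflect[OF _ b]) (use s in \<open>simp add: S_def\<close>)
  ultimately have "R s \<in> S" by (simp add: S_def)
  thus ?thesis by (simp add: R_def)
 qed
 have Sn: "\<exists>s\<in>S. s \<bullet> \<beta> \<noteq> 0" if "\<beta> \<in> \<Phi>" for \<beta>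
  by (rule reflection_closed(1)[OF S _ that]) (rule Scl)
 have orth: "\<delta> \<bullet> \<theta> = 0" if l: "long \<theta>" "long \<delta>" "\<delta> \<noteq> \<theta>" "\<delta> \<noteq> - \<theta>" for \<theta> \<delta>
 proof -
  obtain s where s: "s \<in> S" "s \<bullet> \<theta> \<noteq> 0" using Sn[OF long_root[OF l(1)]] by blast
  hence "\<theta> = s \<or> \<theta> = - s" using l(1) by (auto simp: S_def inner_commute)
  hence "\<theta> \<in> S" using s(1) by (auto simp: S_def)
  thus ?thesis using l by (simp add: S_def)
 qed
 define T where "T = {\<theta>. long \<theta> \<and> ht \<theta> > 0}"
 have hm: "ht (- v) = - ht v" for v using ht_scale[of "-1" v] by simp
 have TPhi: "T \<subseteq> \<Phi>" using long_root by (auto simp: T_def)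
 hence fT: "finite T" by (rule finite_subset) simp
 have LT: "\<theta> \<in> T \<or> - \<theta> \<in> T" if "long \<theta>" for \<theta>
  using that ht_root[OF long_root[OF that]] by (auto simp: T_def hm)
 obtain q where q: "\<And>\<theta>. long \<theta> ==> \<theta> \<bullet> \<theta> = q" using long_inner_self iso(1) by metis
 have q0: "q > 0" using q[OF iso(1)] long_root[OF iso(1)] by (auto simp: inner_gt_zero_iff)
 have To: "t \<bullet> t' = (if t = t' then q else 0)" if "t \<in> T" "t' \<in> T" for t t'
 proof -
  have "t \<noteq> - t'" using that by (auto simp: T_def hm)
  thus ?thesis using that orth[of t' t] q by (auto simp: T_def)
 qed
 have Tspan: "span T = UNIV"
 proof -
  have "{\<theta>. long \<theta>} \<subseteq> span T" using LT span_base span_neg by (metis add.inverse_inverse mem_Collect_eq subsetI)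
  thus ?thesis using long_span by (metis span_minimal subspace_span top.extremum_unique)
 qed
 have Tsep: "v = 0" if "\<And>t. t \<in> T ==> t \<bullet> v = 0" for v
 proof -
  have "orthogonal v v" by (rule orthogonal_to_span[of v T]) (use that Tspan in \<open>auto simp: orthogonal_def inner_commute\<close>)
  thus ?thesis by (simp add: orthogonal_self)
 qed
 have expand: "v = (\<Sum>t\<in>T. ((v \<bullet> t) / q) *\<^sub>R t)" for v
 proof -
  have "t \<bullet> (v - (\<Sum>t\<in>T. ((v \<bullet> t) / q) *\<^sub>R t)) = 0" if t: "t \<in> T" for t
  proof -
   have "t \<bullet> (\<Sum>t\<in>T. ((v \<bullet> t) / q) *\<^sub>R t) = (\<Sum>t'\<in>T. if t' = t then v \<bullet> t else 0)"
    unfolding inner_sum_right by (intro sum.cong refl) (use t q0 To in auto)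
   thus ?thesis using t fT by (simp add: inner_diff_right inner_commute)
  qed
  from Tsep[OF this] show ?thesis by simp
 qed
 have short: "\<exists>t1\<in>T. \<exists>t2\<in>T. t1 \<noteq> t2 \<and> (\<exists>a\<in>{1, -1}. \<exists>b\<in>{1, -1}. \<beta> = (a / 2) *\<^sub>R t1 + (b / 2) *\<^sub>R t2)"
  if b: "\<beta> \<in> \<Phi>" "\<not> long \<beta>" for \<beta>
 proof -
  define M where "M = {t\<in>T. \<beta> \<bullet> t \<noteq> 0}"
  have M: "2 * (\<beta> \<bullet> t) = q \<or> 2 * (\<beta> \<bullet> t) = - q" if "t \<in> M" for t
  proof -
   have t: "long t" "t \<in> \<Phi>" "\<beta> \<bullet> t \<noteq> 0" using that long_root by (auto simp: M_def T_def)
   hence "\<beta> \<noteq> t" "\<beta> \<noteq> - t" using b by auto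
   thus ?thesis using ci_long[OF t(1) b(1)] ci_inner[of t \<beta>] q[OF t(1)] t by auto
  qed
  have fM: "finite M" using fT by (simp add: M_def)
  have bM: "\<beta> = (\<Sum>t\<in>M. ((\<beta> \<bullet> t) / q) *\<^sub>R t)"
   by (subst expand) (rule sum.mono_neutral_right, use fT in \<open>auto simp: M_def\<close>)
  have "\<beta> \<bullet> \<beta> = (\<Sum>t\<in>M. ((\<beta> \<bullet> t) / q) * (\<beta> \<bullet> t))"
   by (subst (2) bM) (simp add: inner_sum_right)
  also have "\<dots> = (\<Sum>t\<in>M. q / 4)"
  proof (intro sum.cong refl)
   fix t assume "t \<in> M"
   hence "\<beta> \<bullet> t = q / 2 \<or> \<beta> \<bullet> t = - q / 2" using M by force
   thus "\<beta> \<bullet> t / q * (\<beta> \<bullet> t) = q / 4" using q0 by auto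
  qed
  finally have bb: "\<beta> \<bullet> \<beta> = real (card M) * (q / 4)" by simp
  have "\<beta> \<bullet> \<beta> \<noteq> q"
  proof
   assume "\<beta> \<bullet> \<beta> = q"
   hence "norm \<beta> = norm \<theta>0" using q[OF iso(1)] by (simp add: norm_eq_sqrt_inner)
   thus False using b iso(1) by (simp add: long_def)
  qed
  moreover have "\<beta> \<bullet> \<beta> \<le> q" using long_inner_le[OF iso(1) b(1)] q[OF iso(1)] by simp
  ultimately have "card M < 4" using bb q0 by simp
  moreover have "M \<noteq> {}" using bM b(1) by auto
  then obtain t where t: "t \<in> M" by blast
  \<comment> \<open>Three coordinates would give the Cartan number 4/3 or -4/3.\<close>
  have "card M \<noteq> 3"
  proof
   assume c: "card M = 3"
   have "t \<in> \<Phi>" using t TPhi by (auto simp: M_def)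
   then obtain k where k: "ci t \<beta> = of_int k" using ci_Ints[OF b(1)] Ints_cases by blast
   have "of_int k * (\<beta> \<bullet> \<beta>) = 2 * (\<beta> \<bullet> t)" using ci_inner[of \<beta> t] b(1) k by (simp add: inner_commute)
   hence "of_int k * (3 * (q / 4)) = q \<or> of_int k * (3 * (q / 4)) = - q" using M[OF t] bb c by auto
   hence "q * (of_int (3 * k) - of_int 4) = 0 \<or> q * (of_int (3 * k) - of_int (-4)) = 0"
    by (auto simp: algebra_simps)
   hence "(of_int (3 * k) :: real) = of_int 4 \<or> (of_int (3 * k) :: real) = of_int (-4)"
    using q0 by (simp only: mult_eq_0_iff right_minus_eq) auto
   hence "3 * k = 4 \<or> 3 * k = -4" by (simp only: of_int_eq_iff)
   thus False by presburger
  qed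
  \<comment> \<open>One coordinate would make half of a root a root.\<close>
  moreover have "card M \<noteq> 1"
  proof
   assume "card M = 1"
   hence "M = {t}" using t by (metis card_1_singletonE singletonD)
   hence "\<beta> = ((\<beta> \<bullet> t) / q) *\<^sub>R t" using bM by simp
   moreover have "(\<beta> \<bullet> t) / q = 1 / 2 \<or> (\<beta> \<bullet> t) / q = - 1 / 2" using M[OF t] q0 by (auto simp: field_simps)
   ultimately have "(1 / 2) *\<^sub>R t \<in> \<Phi> \<or> (- 1 / 2) *\<^sub>R t \<in> \<Phi>" using b(1) by auto
   thus False using reduced[of t "1 / 2"] reduced[of t "- 1 / 2"] t TPhi by (auto simp: M_def)
  qed
  moreover have "card M \<noteq> 0" using fM \<open>M \<noteq> {}\<close> by simp
  ultimately have "card M = 2" by linarith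
  then obtain t1 t2 where t12: "M = {t1, t2}" "t1 \<noteq> t2" by (meson card_2_iff)
  have "\<exists>a\<in>{1, -1}. (\<beta> \<bullet> t) / q = a / 2" if "t \<in> M" for t using M[OF that] q0 by (auto simp: field_simps)
  then obtain a b where ab: "a \<in> {1, -1}" "b \<in> {1, -1}" "(\<beta> \<bullet> t1) / q = a / 2" "(\<beta> \<bullet> t2) / q = b / 2"
   using t12(1) by (metis insertI1 insertI2)
  have "\<beta> = ((\<beta> \<bullet> t1) / q) *\<^sub>R t1 + ((\<beta> \<bullet> t2) / q) *\<^sub>R t2" using bM t12 by simp
  hence "\<beta> = (a / 2) *\<^sub>R t1 + (b / 2) *\<^sub>R t2" by (simp only: ab)
  moreover note ab(1,2)
  moreover have "t1 \<in> T" "t2 \<in> T" using t12 by (auto simp: M_def)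
  ultimately show ?thesis using t12(2) by blast
 qed
 have flip1: "(- a / 2) *\<^sub>R t1 + (b / 2) *\<^sub>R t2 \<in> \<Phi>"
  if "t1 \<in> T" "t2 \<in> T" "t1 \<noteq> t2" "(a / 2) *\<^sub>R t1 + (b / 2) *\<^sub>R t2 \<in> \<Phi>" for t1 t2 a b
 proof -
  have t: "t1 \<in> \<Phi>" using that TPhi by auto
  have "ci ((a / 2) *\<^sub>R t1 + (b / 2) *\<^sub>R t2) t1 = a"
   using To[OF that(1,1)] To[OF that(2,1)] that(3) q0 by (simp add: cartan_number_def inner_add_left)
  hence "(a / 2) *\<^sub>R t1 + (b / 2) *\<^sub>R t2 - a *\<^sub>R t1 \<in> \<Phi>" using reflect[OF t that(4)] by simp
  moreover have "(- a / 2) *\<^sub>R t1 = (a / 2) *\<^sub>R t1 - a *\<^sub>R t1"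
   by (subst scaleR_left_diff_distrib[symmetric]) simp
  ultimately show ?thesis by (simp only: diff_add_eq)
 qed
 have flip: "(a' / 2) *\<^sub>R t1 + (b' / 2) *\<^sub>R t2 \<in> \<Phi>"
  if t: "t1 \<in> T" "t2 \<in> T" "t1 \<noteq> t2" "(a / 2) *\<^sub>R t1 + (b / 2) *\<^sub>R t2 \<in> \<Phi>"
   and s: "a \<in> {1, -1}" "b \<in> {1, -1}" "a' \<in> {1, -1}" "b' \<in> {1, -1}"
  for t1 t2 :: 'e and a b a' b' :: real
 proof -
  have f2: "(c / 2) *\<^sub>R t1 + (- d / 2) *\<^sub>R t2 \<in> \<Phi>" if "(c / 2) *\<^sub>R t1 + (d / 2) *\<^sub>R t2 \<in> \<Phi>" for c d
   using flip1[of t2 t1 d c] t(1-3) that by (simp add: add.commute)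
  have "a' = a \<or> a' = - a" "b' = b \<or> b' = - b" using s by auto
  thus ?thesis using t(4) flip1[OF t(1-3) t(4)] f2[OF t(4)] f2[OF flip1[OF t(1-3) t(4)]] by auto
 qed
 \<comment> \<open>All pairs occur: being joined by a short root is transitive, because the
   difference of \<open>(t0 + s) / 2\<close> and \<open>(s + t') / 2\<close> is a root. So the set
   \<open>J\<close> reached from \<open>t0\<close> contains everything by irreducibility.\<close>
 have pair: "(1 / 2) *\<^sub>R t0 + (1 / 2) *\<^sub>R t \<in> \<Phi>" if t0: "t0 \<in> T" and t: "t \<in> T" "t \<noteq> t0" for t0 t
 proof -
  define J where "J = {t\<in>T. t = t0 \<or> (1 / 2) *\<^sub>R t0 + (1 / 2) *\<^sub>R t \<in> \<Phi>}"
  have J: "J \<subseteq> \<Phi>" "J \<noteq> {}" using TPhi t0 by (auto simp: J_def)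
  have step: "t' \<in> J" if s: "s \<in> J" and t': "t' \<in> T" "t' \<noteq> s" "(1 / 2) *\<^sub>R s + (1 / 2) *\<^sub>R t' \<in> \<Phi>" for s t'
  proof (cases "s = t0 \<or> t' = t0")
   case True
   thus ?thesis using that t0 by (auto simp: J_def)
  next
   case False
   have ne: "t0 \<noteq> s" "t0 \<noteq> t'" using False by auto
   have sT: "s \<in> T" "(1 / 2) *\<^sub>R t0 + (1 / 2) *\<^sub>R s \<in> \<Phi>" using s False by (auto simp: J_def)
   have "((1 / 2) *\<^sub>R t0 + (1 / 2) *\<^sub>R s) \<bullet> ((1 / 2) *\<^sub>R s + (1 / 2) *\<^sub>R t') = q / 4"
    using To[OF t0 sT(1)] To[OF t0 t'(1)] To[OF sT(1) sT(1)] To[OF sT(1) t'(1)] t'(2) ne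
    by (simp add: inner_add_left inner_add_right)
   moreover have "(1 / 2) *\<^sub>R t0 + (1 / 2) *\<^sub>R s \<noteq> (1 / 2) *\<^sub>R s + (1 / 2) *\<^sub>R t'"
    using ne by (simp add: add.commute)
   ultimately have "(1 / 2) *\<^sub>R t0 + (1 / 2) *\<^sub>R s - ((1 / 2) *\<^sub>R s + (1 / 2) *\<^sub>R t') \<in> \<Phi>"
    using diff_root[OF sT(2) t'(3)] q0 by simp
   hence "(1 / 2) *\<^sub>R t0 + (- 1 / 2) *\<^sub>R t' \<in> \<Phi>" by simp
   from flip[OF t0 t'(1) _ this, of 1 1] have "(1 / 2) *\<^sub>R t0 + (1 / 2) *\<^sub>R t' \<in> \<Phi>" using ne by auto
   thus ?thesis using t' by (simp add: J_def)
  qed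
  have "\<beta> \<in> span J" if b: "\<beta> \<in> \<Phi>" and s: "s \<in> J" "s \<bullet> \<beta> \<noteq> 0" for \<beta> s
  proof (cases "long \<beta>")
   case True
   have sT: "s \<in> T" using s by (simp add: J_def)
   have "\<beta> = s \<or> - \<beta> = s" using LT[OF True] To[OF sT] s(2) by (metis inner_minus_right neg_equal_0_iff_equal)
   thus ?thesis using span_base[OF s(1)] span_neg by (metis add.inverse_inverse)
  next
   case False
   obtain t1 t2 a c where w: "t1 \<in> T" "t2 \<in> T" "t1 \<noteq> t2" "a \<in> {1, -1}" "c \<in> {1, -1}"
    "\<beta> = (a / 2) *\<^sub>R t1 + (c / 2) *\<^sub>R t2" using short[OF b False] by blast
   have r: "(1 / 2) *\<^sub>R t1 + (1 / 2) *\<^sub>R t2 \<in> \<Phi>" using flip[OF w(1-3) _ w(4,5), of 1 1] b w(6) by simp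
   have sT: "s \<in> T" using s by (simp add: J_def)
   have "s = t1 \<or> s = t2" using s(2) To[OF sT w(1)] To[OF sT w(2)] by (auto simp: w(6) inner_add_right split: if_splits)
   hence "t1 \<in> J \<and> t2 \<in> J"
    using step[of t1 t2] step[of t2 t1] s(1) w r by (auto simp: add.commute)
   thus ?thesis unfolding w(6) by (intro span_add span_scale span_base) auto
  qed
  then obtain s where "s \<in> J" "s \<bullet> t \<noteq> 0" using nonorthogonal_closure(1)[OF J, of t] t TPhi by blast
  hence "t \<in> J" using To[of s t] t by (auto simp: J_def split: if_splits)
  thus ?thesis using t by (simp add: J_def)
 qed
 obtain f where f: "bij_betw f {1..card T} T" using ex_bij_betw_nat_finite_1[OF fT] by blast
 \<comment> \<open>The long roots are to be \<open>2 e i\<close>, so the coordinate vectors are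
   halves, with common squared length \<open>q / 4\<close>.\<close>
 define e where "e i = (1 / 2) *\<^sub>R f i" for i
 have fT': "f i \<in> T" if "i \<in> {1..card T}" for i using f that by (auto simp: bij_betw_def)
 have finj: "f i = f j \<longleftrightarrow> i = j" if "i \<in> {1..card T}" "j \<in> {1..card T}" for i j
  by (rule inj_on_eq_iff[OF bij_betw_imp_inj_on[OF f] that])
 have fsurj: "\<exists>i\<in>{1..card T}. t = f i" if "t \<in> T" for t
  using bij_betw_imp_surj_on[OF f] that by (metis imageE)
 have "DIM('e) \<le> card T" using dim_le_card'[OF fT] Tspan by (metis dim_UNIV dim_span)
 hence l: "card T \<ge> 2" using rank by simp
 have "\<Phi> = C_roots (card T) e"
 proof (rule Set.set_eqI)
  fix \<beta>
  show "\<beta> \<in> \<Phi> \<longleftrightarrow> \<beta> \<in> C_roots (card T) e"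
  proof
   assume b: "\<beta> \<in> \<Phi>"
   show "\<beta> \<in> C_roots (card T) e"
   proof (cases "long \<beta>")
    case True
    then obtain i where i: "i \<in> {1..card T}" "\<beta> = f i \<or> - \<beta> = f i" using LT fsurj by blast
    from i(2) have "\<beta> = f i \<or> \<beta> = - f i" by (metis minus_minus)
    hence "\<beta> = 1 *\<^sub>R (2 *\<^sub>R e i) \<or> \<beta> = (-1) *\<^sub>R (2 *\<^sub>R e i)" by (auto simp: e_def)
    thus ?thesis using i unfolding C_roots_def by blast
   next
    case False
    obtain t1 t2 a c where w: "t1 \<in> T" "t2 \<in> T" "t1 \<noteq> t2" "a \<in> {1, -1}" "c \<in> {1, -1}"
     "\<beta> = (a / 2) *\<^sub>R t1 + (c / 2) *\<^sub>R t2" using short[OF b False] by blast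
    obtain i j where ij: "i \<in> {1..card T}" "t1 = f i" "j \<in> {1..card T}" "t2 = f j" using fsurj w by metis
    hence "i \<noteq> j" "\<beta> = a *\<^sub>R e i + c *\<^sub>R e j" using w by (auto simp: e_def)
    thus ?thesis using ij w unfolding C_roots_def by blast
   qed
  next
   assume "\<beta> \<in> C_roots (card T) e"
   then consider (s) a c i j where "\<beta> = a *\<^sub>R e i + c *\<^sub>R e j" "a \<in> {1, -1}" "c \<in> {1, -1}"
     "i \<in> {1..card T}" "j \<in> {1..card T}" "i \<noteq> j"
    | (l) a i where "\<beta> = a *\<^sub>R (2 *\<^sub>R e i)" "a \<in> {1, -1}" "i \<in> {1..card T}"
    unfolding C_roots_def by blast
   thus "\<beta> \<in> \<Phi>"
   proof cases
    case s
    have ne: "f i \<noteq> f j" using finj s by simp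
    have "(1 / 2) *\<^sub>R f i + (1 / 2) *\<^sub>R f j \<in> \<Phi>" using pair[OF fT' fT', of i j] s ne by metis
    from flip[OF fT'[OF s(4)] fT'[OF s(5)] ne this _ _ s(2,3)] show ?thesis by (simp add: s(1) e_def)
   next
    case l
    thus ?thesis using fT'[OF l(3)] TPhi by (auto simp: e_def)
   qed
  qed
 qed
 moreover have "e i \<bullet> e j = (if i = j then q / 4 else 0)" if "i \<in> {1..card T}" "j \<in> {1..card T}" for i j
  using To[OF fT'[OF that(1)] fT'[OF that(2)]] finj[OF that] by (simp add: e_def)
 ultimately have "C_coordinates \<Phi> (card T) e"
  unfolding C_coordinates_def using q0 by (intro conjI exI[of _ "q / 4"]) auto
 thus ?thesis unfolding type_C_def using l by blast
qed

lemma Theta_connected: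
 assumes "\<alpha> \<in> \<Phi>" "\<not> long \<alpha>" "\<not> type_C \<Phi>"
  and t: "long \<theta>" "\<theta> \<bullet> \<alpha> > 0" "long \<theta>'" "\<theta>' \<bullet> \<alpha> > 0" "\<theta>' \<bullet> \<theta> = 0"
 shows "\<exists>\<theta>''. long \<theta>'' \<and> \<theta>'' \<bullet> \<alpha> > 0 \<and> \<theta>'' \<bullet> \<theta> \<noteq> 0 \<and> \<theta>'' \<bullet> \<theta>' \<noteq> 0"
proof (rule ccontr)
 assume "\<not> ?thesis"
 hence "\<delta> \<bullet> \<theta> = 0" if "long \<delta>" "\<delta> \<noteq> \<theta>" "\<delta> \<noteq> - \<theta>" for \<delta>
  using Theta_isolated[OF assms(1,2) t _ that] by blast
 from isolated_type_C[OF t(1) this] show False using assms(3) by blast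
qed

end


section \<open>Comparing degrees\<close>

context chevalley_rep begin

text \<open>Commuting with a long root matrix and its negative implies commuting with the projectors
  \<open>P \<delta> m\<close>; long roots span, so these separate the weights.\<close>

lemma long_diag:
 fixes c :: "('r::comm_ring_1, 'n) smat"
 assumes c: "c \<in> GR" and comm: "\<And>\<delta>. long \<delta> ==> c * D1 \<delta> = D1 \<delta> * c"
 shows "c * opr \<nu> = opr \<nu> * c"
proof -
 have cP: "c * oi (P \<delta> m) = oi (P \<delta> m) * c" if "long \<delta>" for \<delta> m
  by (rule commute_P; rule centralizer_long_all[OF _ c]) (use that comm in auto)
 have z: "opr \<mu> * c * opr \<nu> = 0" if m: "\<mu> \<in> Wt" "\<nu> \<in> Wt" "\<mu> \<noteq> \<nu>" for \<mu> \<nu>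
 proof -
  have "{\<theta>. long \<theta>} \<subseteq> \<Phi>" using long_root by auto
  then obtain \<delta> where d: "long \<delta>" "ci \<mu> \<delta> \<noteq> ci \<nu> \<delta>"
   using ci_separates[of "{\<theta>. long \<theta>}" \<mu> \<nu>] long_span m(3) by auto
  have t: "\<delta> \<in> \<Phi>" by (rule long_root[OF d(1)])
  have ne: "cint \<mu> \<delta> \<noteq> cint \<nu> \<delta>" using cint[OF Wt_integral t] m d(2) by metis
  have "opr \<mu> = opr \<mu> * (oi (P \<delta> (cint \<mu> \<delta>)) :: ('r, 'n) smat)"
   using pr_P[OF t, of \<mu> "cint \<mu> \<delta>"] by (simp add: oi_mult[symmetric])
  hence "opr \<mu> * c * opr \<nu> = opr \<mu> * oi (P \<delta> (cint \<mu> \<delta>)) * c * opr \<nu>" by simp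
  also have "\<dots> = opr \<mu> * c * (oi (P \<delta> (cint \<mu> \<delta>)) * opr \<nu>)"
   by (simp add: mult.assoc) (simp add: mult.assoc[symmetric] cP[OF d(1)])
  also have "oi (P \<delta> (cint \<mu> \<delta>)) * opr \<nu> = (0 :: ('r, 'n) smat)"
   using P_pr[OF t, of "cint \<mu> \<delta>" \<nu>] ne by (simp add: oi_mult[symmetric])
  finally show ?thesis by simp
 qed
 show ?thesis
 proof (cases "\<nu> \<in> Wt")
  case True
  have "(\<Sum>\<mu>\<in>Wt. opr \<mu>) * c * opr \<nu> = (\<Sum>\<mu>\<in>Wt. if \<mu> = \<nu> then opr \<nu> * c * opr \<nu> else 0)"
   unfolding sum_distrib_right by (intro sum.cong refl) (use z True in auto)
  hence 1: "c * opr \<nu> = opr \<nu> * c * opr \<nu>" using True by (simp add: wt.q_sum)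
  have "opr \<nu> * c * (\<Sum>\<mu>\<in>Wt. opr \<mu>) = (\<Sum>\<mu>\<in>Wt. if \<mu> = \<nu> then opr \<nu> * c * opr \<nu> else 0)"
   unfolding sum_distrib_left by (intro sum.cong refl) (use z True in auto)
  thus ?thesis using 1 True by (simp add: wt.q_sum)
 qed (simp add: wt.q_zero)
qed

lemma wt_cmp_X:
 assumes g: "\<gamma> \<in> \<Phi>" shows "wt.cmp \<gamma> (X \<gamma> t) = t \<cdot> D1 \<gamma>"
proof -
 have "\<gamma> = real k *\<^sub>R \<gamma> \<longleftrightarrow> k = Suc 0" for k
 proof
  assume "\<gamma> = real k *\<^sub>R \<gamma>"
  hence "(real k - 1) *\<^sub>R \<gamma> = 0" by (simp add: scaleR_left_diff_distrib)
  thus "k = Suc 0" using g by simp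
 qed simp
 hence "wt.cmp \<gamma> (X \<gamma> t) = (\<Sum>k<CARD('n). if k = Suc 0 then t \<cdot> D1 \<gamma> else 0)"
  unfolding X_expand wt.cmp_sum by (intro sum.cong refl) (simp add: wt.cmp_smul wt.cmp_hom[OF hom_D[OF g]])
 moreover have "CARD('n) \<le> Suc 0 ==> D \<gamma> (Suc 0) = 0" using dps_D[OF g] by (auto simp: dps_def)
 ultimately show ?thesis by auto
qed

text \<open>A diagonal \<open>c\<close> has weight 0, so the weight \<open>\<gamma>\<close> part of
  the relation can be isolated.\<close>

lemma diag_X:
 fixes c :: "('r::comm_ring_1, 'n) smat"
 assumes diag: "\<And>\<mu>. c * opr \<mu> = opr \<mu> * c" and g: "\<gamma> \<in> \<Phi>" and comm: "c * X \<gamma> 1 = X \<gamma> 1 * c"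
 shows "c * D1 \<gamma> = D1 \<gamma> * c"
proof -
 have h: "wt.hom 0 c" using diag by (simp add: wt.hom_def)
 show ?thesis using arg_cong[OF comm, of "wt.cmp \<gamma>"]
  by (simp add: wt.cmp_mult_left[OF h] wt.cmp_mult_right[OF h] wt_cmp_X[OF g])
qed

lemma cancel_right:
 fixes c :: "('r::comm_ring_1, 'n) smat"
 assumes c: "c \<in> GR" and "U * c * Z = Z * (U * c)" "c * Z = Z * c"
 shows "U * Z = Z * U"
proof -
 have "U * Z * (c * sadj c) = U * (c * Z) * sadj c" by (simp add: mult.assoc assms(3))
 also have "\<dots> = Z * U * (c * sadj c)" using assms(2) by (simp add: mult.assoc[symmetric])
 finally show ?thesis by (simp add: sadj_inverse GR_det[OF c])
qed

lemma cancel_left: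
 fixes U :: "('r::comm_ring_1, 'n) smat"
 assumes U: "U \<in> GR" and "U * c * Z = Z * (U * c)" "U * Z = Z * U"
 shows "c * Z = Z * c"
proof -
 have "sadj U * (U * c * Z) = sadj U * (U * Z * c)" using assms(2,3) by (simp add: mult.assoc)
 thus ?thesis by (simp add: mult.assoc[symmetric] sadj_inverse GR_det[OF U])
qed

lemma GR_X: "\<alpha> \<in> \<Phi> ==> X \<alpha> t \<in> GR" using GR_X_left[OF GR_1, of \<alpha> t] by simp

lemma bracket_int:
 assumes a: "\<alpha> \<in> \<Phi>" and b: "\<beta> \<in> \<Phi>" and ab: "\<alpha> + \<beta> \<in> \<Phi>" and p: "Max {k :: nat. \<beta> - real k *\<^sub>R \<alpha> \<in> \<Phi>} = p"
 shows "\<exists>N. (N = int (p + 1) \<or> N = - int (p + 1)) \<and>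
  D \<alpha> (Suc 0) * D \<beta> (Suc 0) - D \<beta> (Suc 0) * D \<alpha> (Suc 0) = N \<cdot> D (\<alpha> + \<beta>) (Suc 0)"
proof -
 have "br (E \<alpha>) (E \<beta>) = of_int (int (p + 1)) \<cdot> E (\<alpha> + \<beta>) \<or> br (E \<alpha>) (E \<beta>) = of_int (- int (p + 1)) \<cdot> E (\<alpha> + \<beta>)"
  using EE[OF a b ab] p by (simp add: Let_def)
 then obtain N where N: "N = int (p + 1) \<or> N = - int (p + 1)" "br (E \<alpha>) (E \<beta>) = of_int N \<cdot> E (\<alpha> + \<beta>)" by blast
 have "oi (D \<alpha> (Suc 0) * D \<beta> (Suc 0) - D \<beta> (Suc 0) * D \<alpha> (Suc 0)) = (oi (N \<cdot> D (\<alpha> + \<beta>) (Suc 0)) :: (complex, 'n) smat)"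
  using N(2) a b ab by (simp add: oi_diff oi_mult oi_smul)
 thus ?thesis using N(1) oi_inj[where 'a = complex] by blast
qed

end

context chevalley_long begin

abbreviation deg1 :: "'e set" where "deg1 \<equiv> {\<delta>\<in>\<Phi>. dgr \<delta> = 1}"

abbreviation lin :: "('e \<Rightarrow> 'r::comm_ring_1) \<Rightarrow> ('r, 'n) smat" where
 "lin r \<equiv> (\<Sum>\<delta>\<in>deg1. r \<delta> \<cdot> D1 \<delta>)"

lemma finite_deg1: "finite deg1" by simp

lemma upper: "set (lower_roots (- \<theta>)) = deg1" by (auto simp: lower_roots dgr_eq)

definition uelt :: "('e \<Rightarrow> 'r::comm_ring_1) \<Rightarrow> 'r \<Rightarrow> ('r, 'n) smat" where
 "uelt r s = Xs r (lower_roots (- \<theta>)) * X \<theta> s"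

lemma tri_uelt: "tri 1 (lin r) (uelt r s)"
proof -
 have "tri 1 (\<Sum>\<delta>\<leftarrow>lower_roots (- \<theta>). r \<delta> \<cdot> D1 \<delta>) (Xs r (lower_roots (- \<theta>)))"
  by (rule tri_prod_X) (use upper in auto)
 moreover have "tri 1 0 (X \<theta> s)" by (rule tri_X2) simp_all
 ultimately have "tri 1 ((\<Sum>\<delta>\<leftarrow>lower_roots (- \<theta>). r \<delta> \<cdot> D1 \<delta>) + 0) (uelt r s)"
  unfolding uelt_def by (rule tri_mult)
 thus ?thesis by (simp add: sum_list_distinct_conv_sum_set lower_roots(2) upper)
qed

lemma GR_uelt: "uelt r s \<in> GR"
 unfolding uelt_def by (rule GR_prod_X[OF _ GR_X]) (simp_all add: upper)

lemma decomposition: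
 fixes g :: "('r::comm_ring_1, 'n) smat"
 assumes g: "g \<in> GR" and comm: "g * X \<theta> 1 = X \<theta> 1 * g"
 obtains r s c where "c \<in> GR" "g = uelt r s * c" "dg.hom 0 c"
  and "\<And>k. c * oi (D \<theta> k) = oi (D \<theta> k) * c" "\<And>k. c * oi (D (- \<theta>) k) = oi (D (- \<theta>) k) * c"
  and "\<And>\<delta>. r \<delta> = - of_int (eps (- \<theta>) \<delta>) * \<phi> (- \<theta> + \<delta>) (cj g (D1 (- \<theta>)))"
proof (rule centralizer_decomposition[OF long_theta g comm])
 fix r s c
 assume h: "c \<in> GR" "\<And>k. c * oi (D \<theta> k) = oi (D \<theta> k) * c" "\<And>k. c * oi (D (- \<theta>) k) = oi (D (- \<theta>) k) * c"
  "g = Xs r (lower_roots (- \<theta>)) * X \<theta> s * c"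
  "\<And>\<delta>. r \<delta> = - of_int (eps (- \<theta>) \<delta>) * \<phi> (- \<theta> + \<delta>) (cj g (D1 (- \<theta>)))"
 have "dg.hom 0 c" unfolding dg.hom_def using commute_P[OF h(2,3)] by simp
 moreover have "g = uelt r s * c" unfolding uelt_def by (rule h(4))
 ultimately show thesis using that[OF h(1) _ _ h(2,3,5)] by blast
qed

lemma cmp_uc:
 assumes U: "tri 1 S U" and c: "dg.hom 0 c"
 shows "dg.cmp i (U * c) = dg.cmp i U * c" "dg.cmp 0 (U * c) = c" "dg.cmp 1 (U * c) = S * c" "i < 0 ==> dg.cmp i (U * c) = 0"
 using U by (auto simp: dg.cmp_mult_right[OF c] tri_def)

text \<open>\<open>U\<close> is 1 in degree 0 and has nothing below, so the lowest degree of the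
  relation only sees \<open>c\<close>.\<close>

lemma comm_top:
 assumes U: "tri 1 S U" and c: "dg.hom 0 c" and Z: "dg.hom d Z" and comm: "U * c * Z = Z * (U * c)"
 shows "c * Z = Z * c"
 using arg_cong[OF comm, of "dg.cmp d"] by (simp add: dg.cmp_mult_right[OF Z] dg.cmp_mult_left[OF Z] cmp_uc(2)[OF U c])

text \<open>One degree above the lowest, the relation sees the linear part of
  \<open>U\<close>.\<close>

lemma U_comm:
 assumes U: "tri 1 S U" and Z: "dg.hom d Z" and comm: "U * Z = Z * U"
 shows "S * Z = Z * S"
proof -
 have "dg.cmp 1 U = S" using U by (simp add: tri_def)
 thus ?thesis using arg_cong[OF comm, of "dg.cmp (d + 1)"]
  by (simp add: dg.cmp_mult_right[OF Z] dg.cmp_mult_left[OF Z])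
qed

lemma up_cmp:
 assumes "\<And>i. i < 0 ==> dg.cmp i Y = 0" "\<And>i. i < 0 ==> dg.cmp i Z = 0"
 shows "dg.cmp j (Y * Z) = (\<Sum>i\<in>{0..j}. dg.cmp i Y * dg.cmp (j - i) Z)"
proof (rule dg.cmp_mult)
 fix i assume "i \<notin> {0..j}"
 hence "i < 0 \<or> j - i < 0" by auto
 thus "dg.cmp i Y * dg.cmp (j - i) Z = 0" using assms by auto
qed simp

lemma atLeastAtMost_small: "{0..1} = {0, 1 :: int}" "{0..2} = {0, 1, 2 :: int}" by auto

text \<open>\<open>X \<beta> 1\<close> is not homogeneous, so the linear part of
  \<open>U * c\<close> also appears in degree 1, but equally on both sides.\<close>

lemma comm_X1:
 fixes U :: "('r::comm_ring_1, 'n) smat"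
 assumes U: "tri 1 S U" and c: "dg.hom 0 c" and b: "\<beta> \<in> \<Phi>" "dgr \<beta> = 1" and comm: "U * c * X \<beta> 1 = X \<beta> 1 * (U * c)"
 shows "c * D1 \<beta> = D1 \<beta> * c"
proof -
 have x: "tri 1 (1 \<cdot> D1 \<beta>) (X \<beta> 1 :: ('r, 'n) smat)" by (rule tri_X) (use b in simp_all)
 note xs = x[unfolded tri_def]
 have "dg.cmp 1 (U * c * X \<beta> 1) = (\<Sum>i\<in>{0..1}. dg.cmp i (U * c) * dg.cmp (1 - i) (X \<beta> 1))"
  by (rule up_cmp) (use cmp_uc[OF U c] xs in auto)
 moreover have "dg.cmp 1 (X \<beta> 1 * (U * c)) = (\<Sum>i\<in>{0..1}. dg.cmp i (X \<beta> 1) * dg.cmp (1 - i) (U * c))"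
  by (rule up_cmp) (use cmp_uc[OF U c] xs in auto)
 ultimately show ?thesis using comm xs cmp_uc(2,3)[OF U c] by (auto simp: atLeastAtMost_small add.commute)
qed

text \<open>In degree 2 the second-order parts meet only degree 0, which is 1, and cancel.\<close>

lemma U_comm_X1:
 fixes U :: "('r::comm_ring_1, 'n) smat"
 assumes U: "tri 1 S U" and b: "\<beta> \<in> \<Phi>" "dgr \<beta> = 1" and comm: "U * X \<beta> 1 = X \<beta> 1 * U"
 shows "S * D1 \<beta> = D1 \<beta> * S"
proof -
 have x: "tri 1 (1 \<cdot> D1 \<beta>) (X \<beta> 1 :: ('r, 'n) smat)" by (rule tri_X) (use b in simp_all)
 note xs = x[unfolded tri_def] U[unfolded tri_def]
 have "dg.cmp 2 (U * X \<beta> 1) = (\<Sum>i\<in>{0..2}. dg.cmp i U * dg.cmp (2 - i) (X \<beta> 1))"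
  by (rule up_cmp) (use xs in auto)
 moreover have "dg.cmp 2 (X \<beta> 1 * U) = (\<Sum>i\<in>{0..2}. dg.cmp i (X \<beta> 1) * dg.cmp (2 - i) U)"
  by (rule up_cmp) (use xs in auto)
 ultimately show ?thesis using comm xs by (simp add: atLeastAtMost_small)
qed

lemma hom_X_0: "\<beta> \<in> \<Phi> ==> dgr \<beta> = 0 ==> dg.hom 0 (X \<beta> t)"
proof -
 assume b: "\<beta> \<in> \<Phi>" "dgr \<beta> = 0"
 have "dg.hom 0 (oi (D \<beta> k))" for k using dg_hom_D[OF b(1), of k] b(2) by simp
 thus ?thesis unfolding X_expand by (intro dg.hom_sum dg.hom_smul)
qed

lemma bracket_coeff:
 fixes r :: "'e \<Rightarrow> 'r::comm_ring_1"
 assumes b: "\<beta> \<in> \<Phi>" and d: "\<delta> \<in> deg1"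
 shows "\<phi> (\<beta> + \<delta>) (br (D1 \<beta>) (lin r)) = r \<delta> * \<phi> (\<beta> + \<delta>) (br (D1 \<beta>) (D1 \<delta>))"
proof -
 have e: "br (D1 \<beta>) (lin r) = (\<Sum>\<delta>\<in>deg1. r \<delta> \<cdot> br (D1 \<beta>) (D1 \<delta>))"
  by (simp add: sum_distrib_left sum_distrib_right smul_diff_right sum_subtractf)
 have "\<phi> (\<beta> + \<delta>) (br (D1 \<beta>) (lin r)) = (\<Sum>\<delta>'\<in>deg1. if \<delta>' = \<delta> then r \<delta> * \<phi> (\<beta> + \<delta>) (br (D1 \<beta>) (D1 \<delta>)) else 0)"
  unfolding e phi_sum
 proof (intro sum.cong refl)
  fix \<delta>' assume d': "\<delta>' \<in> deg1"
  have "wt.hom (\<beta> + \<delta>') (br (D1 \<beta>) (oi (D \<delta>' (Suc 0))) :: ('r, 'n) smat)"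
   by (rule wt.hom_bracket[OF hom_D1 hom_D1 refl]) (use b d' in auto)
  from phi_hom[OF this, of "\<beta> + \<delta>"]
  show "\<phi> (\<beta> + \<delta>) (r \<delta>' \<cdot> br (D1 \<beta>) (oi (D \<delta>' (Suc 0)))) =
    (if \<delta>' = \<delta> then r \<delta> * \<phi> (\<beta> + \<delta>) (br (D1 \<beta>) (D1 \<delta>)) else 0)"
   by (auto simp: phi_smul)
 qed
 also have "\<dots> = r \<delta> * \<phi> (\<beta> + \<delta>) (br (D1 \<beta>) (D1 \<delta>))"
  using d by (subst sum.delta) (simp_all only: finite_deg1 if_True)
 finally show ?thesis .
qed

text \<open>The weight \<open>\<beta> + \<delta>\<close> of the bracket isolates
  \<open>r \<delta>\<close> up to a structure constant, which is a sign because
  \<open>\<beta>\<close> is long.\<close>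

lemma kill:
 fixes r :: "'e \<Rightarrow> 'r::comm_ring_1"
 assumes b: "long \<beta>" and d: "\<delta> \<in> deg1" "ci \<delta> \<beta> = -1"
  and comm: "lin r * D1 \<beta> = D1 \<beta> * lin r"
 shows "r \<delta> = 0"
proof -
 have d': "\<delta> \<in> \<Phi>" using d by simp
 have "br (D1 \<beta>) (D1 \<delta>) = (of_int (eps \<beta> \<delta>) :: 'r) \<cdot> D1 (\<beta> + \<delta>)"
  using eps(2)[OF b d' d(2), where 'r = 'r] by simp
 hence "r \<delta> * of_int (eps \<beta> \<delta>) = 0"
  using bracket_coeff[OF long_root[OF b] d(1), of r] comm long_add_root(1)[OF b d' d(2)]
  by (simp add: phi_smul phi_D1)
 thus ?thesis using eps(1)[OF b d' d(2)] by auto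
qed

section \<open>Long roots: the coefficients\<close>

lemma deg1_ratio:
 assumes "\<delta> \<in> deg1"
 shows "\<delta> \<in> \<Phi>" "ci \<delta> \<theta> = 1" "ci \<theta> \<delta> \<in> {1, 2, 3}" "\<theta> \<bullet> \<theta> = ci \<theta> \<delta> * (\<delta> \<bullet> \<delta>)" "2 * (\<delta> \<bullet> \<theta>) = \<theta> \<bullet> \<theta>"
  "\<delta> \<bullet> \<theta> > 0" "\<delta> \<noteq> \<theta>" "\<theta> - \<delta> \<in> deg1"
proof -
 show d: "\<delta> \<in> \<Phi>" "ci \<delta> \<theta> = 1" using assms by (auto simp: dgr_eq)
 show p: "\<delta> \<bullet> \<theta> > 0" using d ci_pos[of \<theta> \<delta>] by simp
 show n: "\<delta> \<noteq> \<theta>" using d by auto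
 show "ci \<theta> \<delta> \<in> {1, 2, 3}" "\<theta> \<bullet> \<theta> = ci \<theta> \<delta> * (\<delta> \<bullet> \<delta>)" "2 * (\<delta> \<bullet> \<theta>) = \<theta> \<bullet> \<theta>"
  using long_ratio[OF long_theta d(1) p n] by blast+
 have "\<theta> - \<delta> \<in> \<Phi>" using diff_root[OF theta d(1)] p n by (simp add: inner_commute)
 moreover have "ci (\<theta> - \<delta>) \<theta> = 1" using d by (simp add: ci_diff)
 ultimately show "\<theta> - \<delta> \<in> deg1" by (simp add: dgr_eq)
qed

lemma not_root_above: "\<beta> \<in> \<Phi> ==> dgr \<beta> \<ge> 0 ==> \<theta> + \<beta> \<notin> \<Phi> \<and> \<theta> + \<beta> \<noteq> 0"
proof -
 assume "\<beta> \<in> \<Phi>" "dgr \<beta> \<ge> 0"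
 hence "(of_int (dgr \<beta>) :: real) \<ge> 0" "\<beta> \<in> \<Phi>" by auto
 hence "ci \<beta> \<theta> \<ge> 0" using dgr by metis
 thus ?thesis using long_add_not_root[OF long_theta \<open>\<beta> \<in> \<Phi>\<close>] by blast
qed

context
 fixes U :: "('r::comm_ring_1, 'n) smat" and r :: "'e \<Rightarrow> 'r"
 assumes U: "tri 1 (lin r) U" "U \<in> GR"
  and comm: "\<And>\<beta>. \<beta> \<in> \<Phi> ==> \<theta> + \<beta> \<notin> \<Phi> ==> \<theta> + \<beta> \<noteq> 0 ==> U * X \<beta> 1 = X \<beta> 1 * U"
begin

lemma comm': "\<beta> \<in> \<Phi> ==> dgr \<beta> \<ge> 0 ==> U * X \<beta> 1 = X \<beta> 1 * U"
 using comm not_root_above by blast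

text \<open>Here \<open>\<delta>\<close> is long, so its bracket with
  \<open>\<theta> - \<delta>\<close>, of degree 1, has a sign as structure constant.\<close>

lemma coeff_1:
 assumes d: "\<delta> \<in> deg1" and n: "ci \<theta> \<delta> = 1" shows "r \<delta> = 0"
proof -
 note f = deg1_ratio[OF d]
 have lin: "lin r * D1 (\<theta> - \<delta>) = D1 (\<theta> - \<delta>) * lin r"
  by (rule U_comm_X1[OF U(1)]) (use f(8) comm' in auto)
 have "norm \<delta> = norm \<theta>" using f(4) n by (simp add: norm_eq_sqrt_inner)
 hence l: "long \<delta>" using long_theta f(1) by (simp add: long_def)
 have c: "ci (\<theta> - \<delta>) \<delta> = -1" using n f(1) by (simp add: ci_diff)
 have b: "\<theta> - \<delta> \<in> \<Phi>" using f(8) by simp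
 have "br (D1 \<delta>) (D1 (\<theta> - \<delta>)) = (of_int (eps \<delta> (\<theta> - \<delta>)) :: 'r) \<cdot> D1 \<theta>"
  using eps(2)[OF l b c] by simp
 hence "br (D1 (\<theta> - \<delta>)) (D1 \<delta>) = - (of_int (eps \<delta> (\<theta> - \<delta>)) :: 'r) \<cdot> D1 \<theta>"
  by (metis minus_diff_eq smul_minus_left)
 hence "r \<delta> * of_int (eps \<delta> (\<theta> - \<delta>)) = 0"
  using bracket_coeff[OF b d, of r] lin by (simp add: phi_smul phi_minus phi_D1)
 thus ?thesis using eps(1)[OF l b c] by auto
qed

text \<open>The bracket with \<open>\<theta> - \<delta>\<close> would only give
  \<open>2 r = 0\<close>. The reflection \<open>\<theta> - 2 \<delta>\<close> of
  \<open>\<theta>\<close> is long and of degree 0, and \<open>\<delta>\<close> has Cartan number -1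
  with it.\<close>

lemma coeff_2:
 assumes d: "\<delta> \<in> deg1" and n: "ci \<theta> \<delta> = 2" shows "r \<delta> = 0"
proof -
 note f = deg1_ratio[OF d]
 define \<beta> where "\<beta> = \<theta> - 2 *\<^sub>R \<delta>"
 have l: "long \<beta>" using long_reflect[OF long_theta f(1)] n by (simp add: \<beta>_def)
 have b: "\<beta> \<in> \<Phi>" by (rule long_root[OF l])
 have "ci \<beta> \<theta> = 0" using f(2) by (simp add: \<beta>_def ci_diff ci_scale)
 hence b0: "dgr \<beta> = 0" using b by (simp add: dgr_eq)
 have "U * D1 \<beta> = D1 \<beta> * U" using centralizer_long[OF l U(2) comm'[OF b]] b0 by simp
 hence lin: "lin r * D1 \<beta> = D1 \<beta> * lin r" by (rule U_comm[OF U(1) dg_hom_D1[OF b]])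
 have "\<delta> \<bullet> \<beta> = - (\<delta> \<bullet> \<delta>)" using f(4,5) n by (simp add: \<beta>_def inner_diff_right)
 moreover have "\<beta> \<bullet> \<beta> = 2 * (\<delta> \<bullet> \<delta>)" using long_inner_self[OF long_theta l] f(4) n by simp
 ultimately have "ci \<delta> \<beta> = -1" using f(1) by (simp add: cartan_number_def)
 thus ?thesis by (rule kill[OF l d _ lin])
qed

text \<open>The length ratio of G2: \<open>\<theta> - \<delta>\<close> gives \<open>3 r = 0\<close>,
  and the short root \<open>\<theta> - 2 \<delta>\<close> of degree 0 gives
  \<open>2 r = 0\<close>.\<close>

lemma coeff_3:
 assumes d: "\<delta> \<in> deg1" and n: "ci \<theta> \<delta> = 3" shows "r \<delta> = 0"
proof -
 note f = deg1_ratio[OF d]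
 define q where "q = \<delta> \<bullet> \<delta>"
 have q: "q > 0" using f(1) by (simp add: q_def inner_gt_zero_iff)
 have i: "\<delta> \<bullet> \<delta> = q" "\<theta> \<bullet> \<theta> = 3 * q" "\<delta> \<bullet> \<theta> = 3 * q / 2" "\<theta> \<bullet> \<delta> = 3 * q / 2"
  using f(4,5) n by (simp_all add: q_def inner_commute)
 define \<beta> where "\<beta> = \<theta> - \<delta>"
 define \<beta>' where "\<beta>' = \<theta> - 2 *\<^sub>R \<delta>"
 have b: "\<beta> \<in> \<Phi>" "dgr \<beta> = 1" using f(8) by (simp_all add: \<beta>_def)
 have t3: "3 *\<^sub>R \<delta> - \<theta> \<in> \<Phi>" using reflect[OF f(1) theta] neg_root n by (metis minus_diff_eq)
 have "ci \<beta> \<delta> = 1" using n f(1) by (simp add: \<beta>_def ci_diff)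
 hence b': "\<beta>' \<in> \<Phi>" using reflect[OF f(1) b(1)] by (simp add: \<beta>_def \<beta>'_def scaleR_2 algebra_simps)
 have norm_le: "v \<bullet> v \<le> 3 * q" if "v \<in> \<Phi>" for v using long_inner_le[OF long_theta that] i by simp
 \<comment> \<open>The squared length of \<open>\<delta> - k \<beta>\<close> is
   \<open>(1 - k + k^2) q\<close> and may not exceed \<open>3 q\<close>.\<close>
 have "{k :: nat. \<delta> - real k *\<^sub>R \<beta> \<in> \<Phi>} = {0, 1, 2}"
 proof (intro equalityI subsetI)
  fix k assume "k \<in> {k :: nat. \<delta> - real k *\<^sub>R \<beta> \<in> \<Phi>}"
  hence "(\<delta> - real k *\<^sub>R \<beta>) \<bullet> (\<delta> - real k *\<^sub>R \<beta>) \<le> 3 * q" using norm_le by simp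
  moreover have "(\<delta> - real k *\<^sub>R \<beta>) \<bullet> (\<delta> - real k *\<^sub>R \<beta>) = (1 - real k + (real k)\<^sup>2) * q"
   by (simp add: \<beta>_def inner_diff_left inner_diff_right i algebra_simps power2_eq_square)
  ultimately have "1 - real k + (real k)\<^sup>2 \<le> 3" using q by simp
  hence "real k * (real k - 1) \<le> 2" by (simp add: power2_eq_square algebra_simps)
  moreover have "real k * (real k - 1) \<ge> 3 * 2" if "k \<ge> 3" using that by (intro mult_mono) auto
  ultimately have "k < 3" by fastforce
  thus "k \<in> {0, 1, 2}" by auto
 next
  fix k :: nat assume "k \<in> {0, 1, 2}"
  moreover have "\<delta> - real 1 *\<^sub>R \<beta> \<in> \<Phi>" using neg_root[OF b'] by (simp add: \<beta>_def \<beta>'_def scaleR_2 algebra_simps)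
  moreover have "\<delta> - real 2 *\<^sub>R \<beta> \<in> \<Phi>"
  proof -
   have "ci (3 *\<^sub>R \<delta> - \<theta>) \<theta> = 1" using f(2) by (simp add: ci_diff ci_scale)
   hence "3 *\<^sub>R \<delta> - \<theta> - \<theta> \<in> \<Phi>" using reflect[OF theta t3] by simp
   moreover have "3 *\<^sub>R \<delta> - \<theta> - \<theta> = \<delta> - real 2 *\<^sub>R \<beta>"
    using scaleR_left_distrib[of 1 2 \<delta>] by (simp add: \<beta>_def scaleR_2 algebra_simps)
   ultimately show ?thesis by simp
  qed
  ultimately show "k \<in> {k :: nat. \<delta> - real k *\<^sub>R \<beta> \<in> \<Phi>}" using f(1) by auto
 qed
 hence "Max {k :: nat. \<delta> - real k *\<^sub>R \<beta> \<in> \<Phi>} = 2" by simp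
 from bracket_int[OF b(1) f(1) _ this] obtain N :: int where N: "N = 3 \<or> N = -3"
   "D \<beta> (Suc 0) * D \<delta> (Suc 0) - D \<delta> (Suc 0) * D \<beta> (Suc 0) = N \<cdot> D \<theta> (Suc 0)"
  by (auto simp: \<beta>_def)
 have "{k :: nat. \<delta> - real k *\<^sub>R \<beta>' \<in> \<Phi>} = {0, 1}"
 proof (intro equalityI subsetI)
  fix k assume "k \<in> {k :: nat. \<delta> - real k *\<^sub>R \<beta>' \<in> \<Phi>}"
  hence "(\<delta> - real k *\<^sub>R \<beta>') \<bullet> (\<delta> - real k *\<^sub>R \<beta>') \<le> 3 * q" using norm_le by simp
  moreover have "(\<delta> - real k *\<^sub>R \<beta>') \<bullet> (\<delta> - real k *\<^sub>R \<beta>') = (1 + real k + (real k)\<^sup>2) * q"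
   by (simp add: \<beta>'_def inner_diff_left inner_diff_right i algebra_simps power2_eq_square)
  ultimately have "1 + real k + (real k)\<^sup>2 \<le> 3" using q by simp
  hence "real k * (real k + 1) \<le> 2" by (simp add: power2_eq_square algebra_simps)
  moreover have "real k * (real k + 1) \<ge> 2 * 3" if "k \<ge> 2" using that by (intro mult_mono) auto
  ultimately have "k < 2" by fastforce
  thus "k \<in> {0, 1}" by auto
 next
  fix k :: nat assume "k \<in> {0, 1}"
  moreover have "\<delta> - \<beta>' = 3 *\<^sub>R \<delta> - \<theta>"
  proof -
   have "3 *\<^sub>R \<delta> = \<delta> + 2 *\<^sub>R \<delta>" using scaleR_left_distrib[of 1 2 \<delta>] by simp
   thus ?thesis by (simp add: \<beta>'_def)
  qed
  ultimately show "k \<in> {k :: nat. \<delta> - real k *\<^sub>R \<beta>' \<in> \<Phi>}" using f(1) t3 by auto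
 qed
 hence "Max {k :: nat. \<delta> - real k *\<^sub>R \<beta>' \<in> \<Phi>} = 1" by simp
 moreover have bd: "\<beta>' + \<delta> = \<beta>" by (simp add: \<beta>'_def \<beta>_def scaleR_2)
 ultimately obtain N' :: int where N': "N' = 2 \<or> N' = -2"
   "D \<beta>' (Suc 0) * D \<delta> (Suc 0) - D \<delta> (Suc 0) * D \<beta>' (Suc 0) = N' \<cdot> D \<beta> (Suc 0)"
  using bracket_int[OF b' f(1)] b(1) by auto
 have "\<beta> + \<delta> = \<theta>" by (simp add: \<beta>_def)
 have r3: "r \<delta> * of_int N = 0"
 proof -
  have "lin r * D1 \<beta> = D1 \<beta> * lin r"
   by (rule U_comm_X1[OF U(1) b comm']) (use b in auto)
  moreover have "br (D1 \<beta>) (D1 \<delta>) = (of_int N :: 'r) \<cdot> D1 \<theta>"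
   using N(2) by (metis oi_diff oi_mult oi_smul)
  ultimately show ?thesis using bracket_coeff[OF b(1) d, of r] by (simp add: \<open>\<beta> + \<delta> = \<theta>\<close> phi_smul phi_D1)
 qed
 have r2: "r \<delta> * of_int N' = 0"
 proof -
  have "ci \<beta>' \<theta> = 0" using f(2) by (simp add: \<beta>'_def ci_diff ci_scale)
  hence b0: "dgr \<beta>' = 0" using b' by (simp add: dgr_eq)
  have com: "lin r * X \<beta>' 1 = X \<beta>' 1 * lin r"
   by (rule U_comm[OF U(1) hom_X_0[OF b' b0] comm'[OF b']]) (simp add: b0)
  \<comment> \<open>\<open>\<beta>'\<close> is short, so its whole root element enters. A divided
    power with k \<ge> 2 could reach weight \<open>\<beta>\<close> only from
    \<open>\<delta>' = \<delta> - (k - 1) \<beta>'\<close>, which would have at least the length of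
    a long root; there the coefficient vanishes by \<open>coeff_1\<close>.\<close>
  have tm: "\<phi> \<beta> (r \<delta>' \<cdot> br (oi (D \<beta>' k)) (oi (D \<delta>' (Suc 0)))) =
    (if k = 1 then if \<delta>' = \<delta> then r \<delta> * of_int N' else 0 else 0)" if d': "\<delta>' \<in> deg1" for \<delta>' k
  proof (cases "\<delta>' + real k *\<^sub>R \<beta>' = \<beta> \<and> k \<noteq> 0")
   case False
   have h: "wt.hom (real k *\<^sub>R \<beta>' + \<delta>') (br (oi (D \<beta>' k)) (oi (D \<delta>' (Suc 0))))"
    by (rule wt.hom_bracket[OF hom_D hom_D1 refl]) (use b' d' in auto)
   hence "\<phi> \<beta> (br (oi (D \<beta>' k)) (oi (D \<delta>' (Suc 0)))) = (0 :: 'r)"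
   proof (cases "k = 0")
    case True thus ?thesis using b' by simp
   next
    case False': False
    thus ?thesis using phi_hom[OF h, of \<beta>] False by (auto simp: add.commute)
   qed
   moreover have "\<not> (k = 1 \<and> \<delta>' = \<delta>)" using False bd by (auto simp: add.commute)
   ultimately show ?thesis by (auto simp: phi_smul)
  next
   case True
   show ?thesis
   proof (cases "k = 1")
    case k1: True
    hence dd: "\<delta>' = \<delta>" using True bd by (metis add.commute add_left_cancel of_nat_1 scaleR_one)
    have "br (oi (D \<beta>' (Suc 0))) (D1 \<delta>) = (of_int N' :: 'r) \<cdot> D1 \<beta>"
     using N'(2) by (metis oi_diff oi_mult oi_smul)
    thus ?thesis using b(1) by (simp add: k1 dd phi_smul phi_D1)
   next
    case k2: False
    define m where "m = real k - 1"
    have m: "m \<ge> 1" using k2 True by (simp add: m_def)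
    have de: "\<delta>' = \<delta> - m *\<^sub>R \<beta>'"
     using True bd by (simp add: m_def scaleR_left_diff_distrib) (metis add.commute add_diff_cancel_right' add_diff_eq)
    have "\<delta>' \<bullet> \<delta>' = (1 + m + m * m) * q"
     unfolding de by (simp add: \<beta>'_def inner_diff_left inner_diff_right i algebra_simps)
    moreover have "m * m \<ge> 1 * 1" using m by (intro mult_mono) auto
    hence "(1 + m + m * m) * q \<ge> 3 * q" using m q by (intro mult_right_mono) auto
    ultimately have ge: "\<delta>' \<bullet> \<delta>' \<ge> 3 * q" by simp
    note f' = deg1_ratio[OF d']
    have "ci \<theta> \<delta>' = 1"
    proof (rule ccontr)
     assume "ci \<theta> \<delta>' \<noteq> 1"
     hence "ci \<theta> \<delta>' \<ge> 2" using f'(3) by auto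
     hence "ci \<theta> \<delta>' * (\<delta>' \<bullet> \<delta>') \<ge> 2 * (3 * q)" using ge q by (intro mult_mono) auto
     thus False using f'(4) i q by simp
    qed
    thus ?thesis using coeff_1[OF d'] k2 by simp
   qed
  qed
  have e1: "br (X \<beta>' 1) Z = (\<Sum>k<CARD('n). br (oi (D \<beta>' k)) Z)" for Z :: "('r, 'n) smat"
   by (simp add: X_expand sum_distrib_left sum_distrib_right sum_subtractf)
  have e2: "br A (lin r) = (\<Sum>\<delta>\<in>deg1. r \<delta> \<cdot> br A (D1 \<delta>))" for A
   by (simp add: sum_distrib_left sum_distrib_right smul_diff_right sum_subtractf)
  have e3: "br (X \<beta>' 1) (lin r) = (\<Sum>k<CARD('n). \<Sum>\<delta>\<in>deg1. r \<delta> \<cdot> br (oi (D \<beta>' k)) (D1 \<delta>))"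
   unfolding e1 by (simp only: e2)
  have "0 = \<phi> \<beta> (br (X \<beta>' 1) (lin r))" using com by simp
  also have "\<dots> = (\<Sum>k<CARD('n). \<Sum>\<delta>'\<in>deg1. if k = 1 then if \<delta>' = \<delta> then r \<delta> * of_int N' else 0 else 0)"
   unfolding e3 phi_sum by (intro sum.cong refl tm)
  also have "\<dots> = (\<Sum>k<CARD('n). if k = 1 then r \<delta> * of_int N' else 0)"
   by (intro sum.cong refl) (use d in auto)
  also have "\<dots> = r \<delta> * of_int N'"
  proof -
   have "CARD('n) > 1"
   proof (rule ccontr)
    assume "\<not> ?thesis"
    hence "D \<beta> (Suc 0) = 0" by (intro D_vanish[OF b(1)]) simp
    thus False using E_nonzero[OF b(1)] oi_D1[OF b(1)] by simp
   qed
   thus ?thesis by simp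
  qed
  finally show ?thesis by simp
 qed
 have "r \<delta> * 3 = 0" "r \<delta> * 2 = 0" using r3 r2 N(1) N'(1) by auto
 hence "r \<delta> * 3 - r \<delta> * 2 = 0" by simp
 thus ?thesis by (simp add: right_diff_distrib[symmetric])
qed

lemma coeff_0: "\<delta> \<in> deg1 ==> r \<delta> = 0"
 using deg1_ratio(3)[of \<delta>] coeff_1 coeff_2 coeff_3 by blast

end

text \<open>Commutation passes to \<open>c\<close> for degree 1 and for long roots of degree 0;
  brackets with \<open>- \<theta>\<close> give degree -1. Short roots of degree 0 are bypassed,
  because the roots of nonzero degree generate the root lattice.\<close>

theorem centralizer_Gamma_long:
 fixes g :: "('r::comm_ring_1, 'n) smat"
 assumes g: "g \<in> GR"
  and comm: "\<And>\<beta>. \<beta> \<in> \<Phi> ==> \<theta> + \<beta> \<notin> \<Phi> ==> \<theta> + \<beta> \<noteq> 0 ==> g * X \<beta> 1 = X \<beta> 1 * g"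
 shows "\<exists>t c. c \<in> GR \<and> (\<forall>B\<in>GR. c * B = B * c) \<and> g = c * X \<theta> t"
proof -
 have comm': "g * X \<beta> 1 = X \<beta> 1 * g" if "\<beta> \<in> \<Phi>" "dgr \<beta> \<ge> 0" for \<beta>
  using comm[OF that(1)] not_root_above[OF that] by blast
 have gt: "g * X \<theta> 1 = X \<theta> 1 * g" using comm'[OF theta] by simp
 obtain r s c where c: "c \<in> GR" "g = uelt r s * c" "dg.hom 0 c" "\<And>k. c * oi (D \<theta> k) = oi (D \<theta> k) * c"
  "\<And>k. c * oi (D (- \<theta>) k) = oi (D (- \<theta>) k) * c"
  "\<And>\<delta>. r \<delta> = - of_int (eps (- \<theta>) \<delta>) * \<phi> (- \<theta> + \<delta>) (cj g (D1 (- \<theta>)))"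
  by (rule decomposition[OF g gt]) (rule that)
 define ce where "ce \<delta> \<longleftrightarrow> c * D1 \<delta> = D1 \<delta> * c" for \<delta>
 note U = tri_uelt[of r s]
 have gX: "uelt r s * c * X \<beta> 1 = X \<beta> 1 * (uelt r s * c)" if "\<beta> \<in> \<Phi>" "dgr \<beta> \<ge> 0" for \<beta>
  using comm'[OF that] by (simp add: c(2))
 have ce1: "ce \<beta>" if "\<beta> \<in> \<Phi>" "dgr \<beta> = 1" for \<beta>
  unfolding ce_def by (rule comm_X1[OF U c(3) that gX]) (use that in auto)
 have cem1: "ce \<beta>" if b: "\<beta> \<in> \<Phi>" "dgr \<beta> = -1" for \<beta>
 proof -
  have "ci \<beta> \<theta> = -1" using b by (simp add: dgr_eq)
  hence d: "\<theta> + \<beta> \<in> \<Phi>" "ci (\<theta> + \<beta>) (- \<theta>) = -1"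
   using long_add_root(1)[OF long_theta b(1)] by (simp_all add: ci_add)
  hence "dgr (\<theta> + \<beta>) = 1" by (simp add: dgr_eq)
  hence 1: "ce (\<theta> + \<beta>)" by (rule ce1[OF d(1)])
  have l: "long (- \<theta>)" using long_theta by simp
  define N :: 'r where "N = of_int (eps (- \<theta>) (\<theta> + \<beta>))"
  have e: "br (D1 (- \<theta>)) (D1 (\<theta> + \<beta>)) = N \<cdot> D1 \<beta>"
   using eps(2)[OF l d] by (simp add: N_def)
  have "c * br (D1 (- \<theta>)) (D1 (\<theta> + \<beta>)) =
    br (D1 (- \<theta>)) (D1 (\<theta> + \<beta>)) * c"
   using intertwine_mult[OF c(5) 1[unfolded ce_def]] intertwine_mult[OF 1[unfolded ce_def] c(5)]
   by (simp add: right_diff_distrib left_diff_distrib)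
  hence "N \<cdot> (c * D1 \<beta>) = N \<cdot> (D1 \<beta> * c)" unfolding e by simp
  moreover have "N = 1 \<or> N = -1" using eps(1)[OF l d] by (auto simp: N_def)
  ultimately show ?thesis by (auto simp: ce_def)
 qed
 have ce0: "ce \<beta>" if b: "long \<beta>" "dgr \<beta> = 0" for \<beta>
 proof -
  note t = long_root[OF b(1)]
  have "c * X \<beta> 1 = X \<beta> 1 * c" by (rule comm_top[OF U c(3) hom_X_0[OF t b(2)] gX[OF t]]) (simp add: b)
  thus ?thesis using centralizer_long[OF b(1) c(1)] by (simp add: ce_def)
 qed
 have ce_ne: "ce \<beta>" if b: "\<beta> \<in> \<Phi>" "dgr \<beta> \<noteq> 0" for \<beta>
  using dgr_bound[OF b(1)] ce1[OF b(1)] cem1[OF b(1)] b(2) c(4,5) by (auto simp: ce_def)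
 have diag: "c * opr \<mu> = opr \<mu> * c" for \<mu>
 proof (rule long_diag[OF c(1)])
  fix \<delta> assume "long \<delta>"
  thus "c * D1 \<delta> = D1 \<delta> * c"
   using ce_ne[OF long_root] ce0 by (cases "dgr \<delta> = 0") (auto simp: ce_def)
 qed
 define S where "S = {\<delta>\<in>\<Phi>. dgr \<delta> \<noteq> 0}"
 have S: "S \<subseteq> \<Phi>" "S \<noteq> {}" using dgr_theta(1) theta by (auto simp: S_def intro!: exI[of _ \<theta>])
 \<comment> \<open>A root of degree 0 not orthogonal to \<open>s\<close> can be added to or
   subtracted from \<open>s\<close> without changing the degree, so it is a difference of two
   members of \<open>S\<close>.\<close>
 have near: "\<exists>s'\<in>S. \<beta> = s - s' \<or> \<beta> = s' - s" if b: "\<beta> \<in> \<Phi>" "\<beta> \<notin> S" and s: "s \<in> S" "s \<bullet> \<beta> \<noteq> 0" for \<beta> s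
 proof -
  have sP: "s \<in> \<Phi>" using s by (simp add: S_def)
  have z: "ci \<beta> \<theta> = 0" using b dgr_eq[of \<beta> 0] by (simp add: S_def)
  have sz: "ci s \<theta> \<noteq> 0" using s dgr_eq[of s 0] by (simp add: S_def)
  have inS: "v \<in> S" if "v \<in> \<Phi>" "ci v \<theta> = ci s \<theta>" for v using that sz dgr_eq[of v 0] by (simp add: S_def)
  have ne: "s \<noteq> \<beta>" "s + \<beta> \<noteq> 0" using z sz by (auto simp: eq_neg_iff_add_eq_0[symmetric])
  show ?thesis
  proof (cases "s \<bullet> \<beta> > 0")
   case True
   hence "s - \<beta> \<in> S" using diff_root[OF sP b(1)] ne by (intro inS) (simp_all add: ci_diff z)
   thus ?thesis by (intro bexI[of _ "s - \<beta>"]) auto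
  next
   case False
   hence "s + \<beta> \<in> S" using add_root[OF sP b(1)] ne s by (intro inS) (auto simp: ci_add z)
   thus ?thesis by (intro bexI[of _ "s + \<beta>"]) auto
  qed
 qed
 have ex: "\<exists>s\<in>S. s \<bullet> \<beta> \<noteq> 0" if "\<beta> \<in> \<Phi>" for \<beta>
 proof (rule nonorthogonal_closure(1)[OF S _ that])
  fix \<beta> s assume b: "\<beta> \<in> \<Phi>" and s: "s \<in> S" "s \<bullet> \<beta> \<noteq> 0"
  show "\<beta> \<in> span S"
  proof (cases "\<beta> \<in> S")
   case False
   then obtain s' where "s' \<in> S" "\<beta> = s - s' \<or> \<beta> = s' - s" using near[OF b _ s] by blast
   thus ?thesis using s(1) span_diff span_base by metis
  qed (rule span_base)
 qed
 have Sz: "\<Phi> \<subseteq> zspan S"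
 proof
  fix \<beta> assume b: "\<beta> \<in> \<Phi>"
  show "\<beta> \<in> zspan S"
  proof (cases "\<beta> \<in> S")
   case False
   obtain s where s: "s \<in> S" "s \<bullet> \<beta> \<noteq> 0" using ex[OF b] by blast
   then obtain s' where "s' \<in> S" "\<beta> = s - s' \<or> \<beta> = s' - s" using near[OF b False] by blast
   thus ?thesis using s(1) zspan_diff zspan_base by metis
  qed (rule zspan_base)
 qed
 have central: "c * B = B * c" if "B \<in> GR" for B
  by (rule central_criterion[OF c(1) diag S(1) Sz _ that]) (use ce_ne in \<open>auto simp: S_def ce_def\<close>)
 have "uelt r s * X \<beta> 1 = X \<beta> 1 * uelt r s" if b: "\<beta> \<in> \<Phi>" "\<theta> + \<beta> \<notin> \<Phi>" "\<theta> + \<beta> \<noteq> 0" for \<beta>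
  by (rule cancel_right[OF c(1) _ central[OF GR_X[OF b(1)]]]) (use comm[OF b] in \<open>simp add: c(2)\<close>)
 from coeff_0[OF U GR_uelt this] have r0: "r \<delta> = 0" if "\<delta> \<in> deg1" for \<delta> using that by blast
 have "uelt r s = X \<theta> s" unfolding uelt_def using r0 upper by (subst prod_list_eq_1) auto
 hence "g = c * X \<theta> s" using central[OF GR_X[OF theta]] c(2) by simp
 thus ?thesis using c(1) central by blast
qed

end


section \<open>Short roots outside type C\<close>

lemma prod_list_single:
 assumes "distinct xs" "a \<in> set xs" "\<And>x. x \<in> set xs ==> x \<noteq> a ==> f x = (1 :: 'a::monoid_mult)"
 shows "prod_list (map f xs) = f a" using assms
proof (induction xs)
 case (Cons x xs)
 show ?case
 proof (cases "x = a")
  case True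
  hence "prod_list (map f xs) = 1" using Cons.prems by (intro prod_list_eq_1) auto
  thus ?thesis using True by simp
 next
  case False
  thus ?thesis using Cons by auto
 qed
qed simp

context chevalley_rep begin

context
 fixes \<alpha> assumes a: "\<alpha> \<in> \<Phi>" "\<not> long \<alpha>" "\<not> type_C \<Phi>"
begin

text \<open>All long roots with positive product against \<open>\<alpha>\<close> have the same
  product with it. Hence a sum of two of them cannot be long, and their differences are orthogonal
  to \<open>\<alpha>\<close>.\<close>

lemma Theta_diff:
 assumes t: "long \<theta>" "\<theta> \<bullet> \<alpha> > 0" "long \<theta>'" "\<theta>' \<bullet> \<alpha> > 0" "\<theta>' \<bullet> \<theta> \<noteq> 0" "\<theta>' \<noteq> \<theta>"
 shows "long (\<theta> - \<theta>')" "(\<theta> - \<theta>') \<bullet> \<alpha> = 0" "2 * (\<theta>' \<bullet> \<theta>) = \<theta> \<bullet> \<theta>"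
proof -
 note T = Theta_inner[OF a(1,2)]
 have i: "\<theta> \<bullet> \<alpha> = \<theta>' \<bullet> \<alpha>" using T[OF t(1,2)] T[OF t(3,4)] long_inner_self[OF t(1,3)] by simp
 thus "(\<theta> - \<theta>') \<bullet> \<alpha> = 0" by (simp add: inner_diff_left)
 have "2 * (\<theta>' \<bullet> \<theta>) \<noteq> - (\<theta> \<bullet> \<theta>)"
 proof
  assume h: "2 * (\<theta>' \<bullet> \<theta>) = - (\<theta> \<bullet> \<theta>)"
  have l: "long (\<theta> + \<theta>')" by (rule long_add[OF t(1,3) h])
  have "2 * ((\<theta> + \<theta>') \<bullet> \<alpha>) = \<theta> \<bullet> \<theta>"
   using T[OF l] t(2,4) long_inner_self[OF t(1) l] by (simp add: inner_add_left)
  thus False using T[OF t(1,2)] t(2,4) i by (simp add: inner_add_left)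
 qed
 moreover have "\<theta>' \<noteq> - \<theta>" using t by auto
 ultimately show p: "2 * (\<theta>' \<bullet> \<theta>) = \<theta> \<bullet> \<theta>" using long_product[OF t(1,3,6)] t(5) by blast
 show "long (\<theta> - \<theta>')" by (rule long_diff[OF t(1,3) p])
qed

text \<open>Two long roots at an acute angle to \<open>\<alpha>\<close> are nonorthogonal or joined
  by one intermediate, by \<open>Theta_connected\<close>.\<close>

lemma Theta_induct:
 assumes t: "long \<theta>" "\<theta> \<bullet> \<alpha> > 0" "Q \<theta>"
  and step: "\<And>\<theta>1 \<theta>2. long \<theta>1 ==> \<theta>1 \<bullet> \<alpha> > 0 ==> long \<theta>2 ==> \<theta>2 \<bullet> \<alpha> > 0 ==> \<theta>2 \<bullet> \<theta>1 \<noteq> 0 ==> \<theta>2 \<noteq> \<theta>1 ==> Q \<theta>1 ==> Q \<theta>2"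
  and t': "long \<theta>'" "\<theta>' \<bullet> \<alpha> > 0"
 shows "Q \<theta>'"
proof (cases "\<theta>' \<bullet> \<theta> = 0")
 case True
 obtain s where s: "long s" "s \<bullet> \<alpha> > 0" "s \<bullet> \<theta> \<noteq> 0" "s \<bullet> \<theta>' \<noteq> 0"
  using Theta_connected[OF a t(1,2) t' True] by blast
 have "Q s" using step[OF t(1,2) s(1-3)] t(3) by (cases "s = \<theta>") auto
 thus ?thesis using step[OF s(1,2) t'] s(4) by (cases "\<theta>' = s") (auto simp: inner_commute)
next
 case False
 thus ?thesis using step[OF t(1,2) t'] t(3) by (cases "\<theta>' = \<theta>") auto
qed

text \<open>If there were no such \<open>\<beta>\<close>, then \<open>v\<close> would be orthogonal
  to the long roots orthogonal to \<open>\<alpha>\<close>, hence constant on those with positive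
  product. So \<open>v\<close> minus a multiple of \<open>\<alpha>\<close> would be orthogonal to
  all long roots, which span.\<close>

lemma separate:
 assumes t: "long \<theta>" "\<theta> \<bullet> \<alpha> > 0" and v: "\<And>k. v \<noteq> k *\<^sub>R \<alpha>"
 shows "\<exists>\<beta>. long \<beta> \<and> \<beta> \<bullet> \<alpha> \<ge> 0 \<and> v \<bullet> \<beta> < 0"
proof (rule ccontr)
 assume "\<not> ?thesis"
 hence h: "v \<bullet> \<beta> \<ge> 0" if "long \<beta>" "\<beta> \<bullet> \<alpha> \<ge> 0" for \<beta> using that by (meson not_less)
 have h0: "v \<bullet> \<beta> = 0" if "long \<beta>" "\<beta> \<bullet> \<alpha> = 0" for \<beta>
  using h[of \<beta>] h[of "- \<beta>"] that by simp
 define k where "k = (v \<bullet> \<theta>) / (\<alpha> \<bullet> \<theta>)"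
 have k: "v \<bullet> \<theta> = k * (\<alpha> \<bullet> \<theta>)" using t by (simp add: k_def inner_commute)
 have Q: "v \<bullet> \<theta>' = v \<bullet> \<theta>" if t': "long \<theta>'" "\<theta>' \<bullet> \<alpha> > 0" for \<theta>'
 proof (rule Theta_induct[where Q = "\<lambda>\<theta>'. v \<bullet> \<theta>' = v \<bullet> \<theta>", OF t _ _ t'])
  fix \<theta>1 \<theta>2 assume s: "long \<theta>1" "\<theta>1 \<bullet> \<alpha> > 0" "long \<theta>2" "\<theta>2 \<bullet> \<alpha> > 0" "\<theta>2 \<bullet> \<theta>1 \<noteq> 0" "\<theta>2 \<noteq> \<theta>1" "v \<bullet> \<theta>1 = v \<bullet> \<theta>"
  have "v \<bullet> (\<theta>1 - \<theta>2) = 0" by (rule h0[OF Theta_diff(1,2)[OF s(1-6)]])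
  thus "v \<bullet> \<theta>2 = v \<bullet> \<theta>" using s(7) by (simp add: inner_diff_right)
 qed simp
 have pos: "\<delta> \<bullet> (v - k *\<^sub>R \<alpha>) = 0" if d: "long \<delta>" "\<delta> \<bullet> \<alpha> > 0" for \<delta>
 proof -
  have "\<delta> \<bullet> \<alpha> = \<theta> \<bullet> \<alpha>"
   using Theta_inner[OF a(1,2) d] Theta_inner[OF a(1,2) t] long_inner_self[OF t(1) d(1)] by simp
  thus ?thesis using Q[OF d] k by (simp add: inner_diff_right inner_commute)
 qed
 have "\<delta> \<bullet> (v - k *\<^sub>R \<alpha>) = 0" if d: "long \<delta>" for \<delta>
 proof -
  consider "\<delta> \<bullet> \<alpha> > 0" | "\<delta> \<bullet> \<alpha> = 0" | "- \<delta> \<bullet> \<alpha> > 0" by fastforce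
  thus ?thesis
  proof cases
   case 1 thus ?thesis by (rule pos[OF d])
  next
   case 2 thus ?thesis using h0[OF d] by (simp add: inner_diff_right inner_commute)
  next
   case 3
   have "- \<delta> \<bullet> (v - k *\<^sub>R \<alpha>) = 0" by (rule pos[OF _ 3]) (use d in simp)
   thus ?thesis by simp
  qed
 qed
 from long_separates[OF this] show False using v[of k] by simp
qed

text \<open>If \<open>\<alpha> + \<gamma>\<close> is a root and the angle is not obtuse, then
  \<open>\<alpha> + \<gamma>\<close> is long, so \<open>\<gamma>\<close> is a difference of two
  generators. Otherwise three squared lengths would occur, each at least twice the previous one,
  while the ratio is at most 3.\<close>

lemma short_zspan: "\<Phi> \<subseteq> zspan {\<gamma>\<in>\<Phi>. long \<gamma> \<or> (\<alpha> + \<gamma> \<notin> \<Phi> \<and> \<alpha> + \<gamma> \<noteq> 0)}" (is "_ \<subseteq> zspan ?S")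
proof
 fix \<gamma> assume g: "\<gamma> \<in> \<Phi>"
 have "2 *\<^sub>R \<alpha> \<notin> \<Phi>" using reduced[OF a(1), of 2] by auto
 hence "\<alpha> \<in> ?S" using a(1) by (simp add: scaleR_2[symmetric])
 hence az: "\<alpha> \<in> zspan ?S" by (rule zspan_base)
 have neg: "\<gamma> \<in> zspan ?S" if "- \<gamma> \<in> zspan ?S" using zspan_neg[OF that] by simp
 have key: "\<gamma> \<in> zspan ?S" if g: "\<gamma> \<in> \<Phi>" "\<alpha> + \<gamma> \<in> \<Phi>" "\<alpha> \<bullet> \<gamma> \<ge> 0" for \<gamma>
 proof -
  define \<epsilon> where "\<epsilon> = \<alpha> + \<gamma>"
  have e: "\<epsilon> \<in> \<Phi>" using g by (simp add: \<epsilon>_def)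
  have "long \<epsilon>"
  proof (rule ccontr)
   assume ne: "\<not> long \<epsilon>"
   have ee: "\<epsilon> \<bullet> \<epsilon> > \<alpha> \<bullet> \<alpha>"
   proof -
    have "\<epsilon> \<bullet> \<epsilon> = \<alpha> \<bullet> \<alpha> + 2 * (\<alpha> \<bullet> \<gamma>) + \<gamma> \<bullet> \<gamma>"
     by (simp add: \<epsilon>_def inner_add_left inner_add_right inner_commute)
    moreover have "\<gamma> \<bullet> \<gamma> > 0" using g(1) by (simp add: inner_gt_zero_iff)
    ultimately show ?thesis using g(3) by linarith
   qed
   have ae: "\<alpha> \<bullet> \<epsilon> > 0"
   proof -
    have "\<alpha> \<bullet> \<alpha> > 0" using a(1) by (simp add: inner_gt_zero_iff)
    thus ?thesis using g(3) unfolding \<epsilon>_def inner_add_right by linarith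
   qed
   have ne2: "\<epsilon> \<noteq> \<alpha>" "\<epsilon> \<noteq> - \<alpha>" using ee by auto
   obtain j k where jk: "ci \<alpha> \<epsilon> = of_int j" "ci \<epsilon> \<alpha> = of_int k"
    using ci_Ints[OF e a(1)] ci_Ints[OF a(1) e] by (metis Ints_cases)
   have "ci \<alpha> \<epsilon> > 0" "ci \<epsilon> \<alpha> > 0" using ae a(1) e by (simp_all add: ci_pos inner_commute)
   hence p: "j > 0" "k > 0" using jk by auto
   have q: "of_int k * (\<alpha> \<bullet> \<alpha>) = of_int j * (\<epsilon> \<bullet> \<epsilon>)"
    using ci_inner[of \<alpha> \<epsilon>] ci_inner[of \<epsilon> \<alpha>] a(1) e jk by (simp add: inner_commute)
   have "of_int j * (\<epsilon> \<bullet> \<epsilon>) > of_int j * (\<alpha> \<bullet> \<alpha>)" using ee p by simp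
   hence "of_int k * (\<alpha> \<bullet> \<alpha>) > of_int j * (\<alpha> \<bullet> \<alpha>)" using q by simp
   hence "(of_int k :: real) > of_int j" by (rule mult_right_less_imp_less) simp
   hence kj: "k > j" by simp
   have "of_int j * of_int k < (4 :: real)" using ci_prod_less[OF a(1) e ne2] jk by simp
   hence "j * k < 4" by (metis of_int_less_iff of_int_mult of_int_numeral)
   moreover have "j * k \<ge> 2 * 3" if "j \<ge> 2" using that kj by (intro mult_mono) auto
   ultimately have j1: "j = 1" using p by fastforce
   hence "of_int k \<ge> (2 :: real)" using kj by simp
   hence "of_int k * (\<alpha> \<bullet> \<alpha>) \<ge> 2 * (\<alpha> \<bullet> \<alpha>)" by (intro mult_right_mono) auto
   hence e2: "\<epsilon> \<bullet> \<epsilon> \<ge> 2 * (\<alpha> \<bullet> \<alpha>)" using q j1 by simp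
   have ex: "\<exists>\<theta>. long \<theta> \<and> \<theta> \<bullet> v > 0" if v: "v \<in> \<Phi>" for v
   proof -
    obtain \<theta> where t: "long \<theta>" "\<theta> \<bullet> v \<noteq> 0" using long_nonorthogonal[OF v] by blast
    hence "\<theta> \<bullet> v > 0 \<or> (- \<theta>) \<bullet> v > 0" by auto
    thus ?thesis using t(1) long_minus by blast
   qed
   obtain \<theta> where t: "long \<theta>" "\<theta> \<bullet> \<epsilon> > 0" using ex[OF e] by blast
   obtain \<theta>' where t': "long \<theta>'" "\<theta>' \<bullet> \<alpha> > 0" using ex[OF a(1)] by blast
   have "\<theta> \<bullet> \<theta> \<ge> 2 * (\<epsilon> \<bullet> \<epsilon>)" by (rule Theta_ratio[OF e ne t])
   moreover have "\<theta>' \<bullet> \<theta>' \<le> 3 * (\<alpha> \<bullet> \<alpha>)"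
   proof -
    have "\<alpha> \<bullet> \<theta>' > 0" "\<alpha> \<noteq> \<theta>'" using t' a by (auto simp: inner_commute)
    note r = long_ratio[OF t'(1) a(1) this]
    have "ci \<theta>' \<alpha> \<le> 3" using r(2) by auto
    hence "ci \<theta>' \<alpha> * (\<alpha> \<bullet> \<alpha>) \<le> 3 * (\<alpha> \<bullet> \<alpha>)" by (intro mult_right_mono) auto
    thus ?thesis using r(3) by simp
   qed
   moreover have "\<theta>' \<bullet> \<theta>' = \<theta> \<bullet> \<theta>" by (rule long_inner_self[OF t(1) t'(1)])
   moreover have "\<alpha> \<bullet> \<alpha> > 0" using a(1) by (simp add: inner_gt_zero_iff)
   ultimately show False using e2 by linarith
  qed
  hence "\<epsilon> \<in> zspan ?S" using e by (intro zspan_base) simp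
  from zspan_diff[OF this az] show ?thesis by (simp add: \<epsilon>_def)
 qed
 consider "\<gamma> = \<alpha>" | "\<gamma> = - \<alpha>" | "\<alpha> + \<gamma> \<notin> \<Phi>" "\<gamma> \<noteq> - \<alpha>" | "\<alpha> - \<gamma> \<notin> \<Phi>" "\<gamma> \<noteq> \<alpha>" | "\<alpha> + \<gamma> \<in> \<Phi>" "\<alpha> - \<gamma> \<in> \<Phi>" by blast
 thus "\<gamma> \<in> zspan ?S"
 proof cases
  case 1 thus ?thesis using az by simp
 next
  case 2 thus ?thesis using zspan_neg[OF az] by simp
 next
  case 3
  hence "\<alpha> + \<gamma> \<noteq> 0" by (metis add.inverse_unique)
  thus ?thesis using 3 g by (intro zspan_base) simp
 next
  case 4
  thus ?thesis using g by (intro neg zspan_base) auto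
 next
  case 5
  show ?thesis
  proof (cases "\<alpha> \<bullet> \<gamma> \<ge> 0")
   case True thus ?thesis using key[OF g 5(1)] by simp
  next
   case False
   thus ?thesis using key[of "- \<gamma>"] g 5 by (intro neg) simp
  qed
 qed
qed

text \<open>Long roots \<open>\<beta>\<close> with \<open>\<beta> \<bullet> \<alpha> \<ge> 0\<close>
  commute with \<open>\<alpha>\<close>. They are enough to make \<open>c\<close> diagonal and, by
  \<open>separate\<close>, to kill every coefficient of \<open>U\<close> except that of
  \<open>\<alpha>\<close>.\<close>

theorem centralizer_Gamma_short:
 fixes g :: "('r::comm_ring_1, 'n) smat"
 assumes g: "g \<in> GR"
  and comm: "\<And>\<beta>. \<beta> \<in> \<Phi> ==> \<alpha> + \<beta> \<notin> \<Phi> ==> \<alpha> + \<beta> \<noteq> 0 ==> g * X \<beta> 1 = X \<beta> 1 * g"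
 shows "\<exists>t c. c \<in> GR \<and> (\<forall>B\<in>GR. c * B = B * c) \<and> g = c * X \<alpha> t"
proof -
 obtain \<theta> where t: "long \<theta>" "\<theta> \<bullet> \<alpha> > 0"
 proof -
  obtain \<theta> where "long \<theta>" "\<theta> \<bullet> \<alpha> \<noteq> 0" using long_nonorthogonal[OF a(1)] by blast
  thus ?thesis using that[of \<theta>] that[of "- \<theta>"] by (cases "\<theta> \<bullet> \<alpha> > 0") auto
 qed
 interpret cl: chevalley_long \<Phi> \<Delta> E H \<theta> by unfold_locales (rule t(1))
 have N: "\<alpha> + \<beta> \<notin> \<Phi> \<and> \<alpha> + \<beta> \<noteq> 0" if b: "long \<beta>" "\<beta> \<bullet> \<alpha> \<ge> 0" for \<beta>
 proof -
  have "ci \<alpha> \<beta> \<ge> 0" using b(2) ci_neg[of \<beta> \<alpha>] long_root[OF b(1)] by (simp add: inner_commute not_less[symmetric])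
  thus ?thesis using long_add_not_root[OF b(1) a(1)] by (simp add: add.commute)
 qed
 define ce where "ce c \<delta> \<longleftrightarrow> c * D1 \<delta> = D1 \<delta> * c" for c :: "('r, 'n) smat" and \<delta>
 have gX: "g * X \<beta> 1 = X \<beta> 1 * g" if b: "long \<beta>" "\<beta> \<bullet> \<alpha> \<ge> 0" for \<beta>
  using comm[OF long_root[OF b(1)]] N[OF b] by blast
 have gE: "ce g \<beta>" if b: "long \<beta>" "\<beta> \<bullet> \<alpha> \<ge> 0" for \<beta>
  using centralizer_long[OF b(1) g gX[OF b]] by (simp add: ce_def)
 have gt: "g * X \<theta> 1 = X \<theta> 1 * g" by (rule gX[OF t(1)]) (use t in simp)
 obtain r s c where c: "c \<in> GR" "g = cl.uelt r s * c" "cl.dg.hom 0 c" "\<And>k. c * oi (D \<theta> k) = oi (D \<theta> k) * c"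
  "\<And>k. c * oi (D (- \<theta>) k) = oi (D (- \<theta>) k) * c"
  "\<And>\<delta>. r \<delta> = - of_int (eps (- \<theta>) \<delta>) * \<phi> (- \<theta> + \<delta>) (cj g (D1 (- \<theta>)))"
  by (rule cl.decomposition[OF g gt]) (rule that)
 define U where "U = cl.uelt r s"
 have U: "cl.tri 1 (cl.lin r) U" unfolding U_def by (rule cl.tri_uelt)
 have gU: "g = U * c" by (simp add: U_def c(2))
 have cE: "ce c \<beta>" if b: "long \<beta>" "\<beta> \<bullet> \<alpha> \<ge> 0" for \<beta>
  unfolding ce_def
  by (rule cl.comm_top[OF U c(3) cl.dg_hom_D1[OF long_root[OF b(1)]]]) (use gE[OF b] in \<open>simp add: ce_def gU\<close>)
 \<comment> \<open>The decomposition provides the start \<open>- \<theta>\<close>. The bracket of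
   \<open>- \<theta>1\<close> with \<open>\<theta>1 - \<theta>2\<close> leads to
   \<open>- \<theta>2\<close>, and \<open>\<theta>1 - \<theta>2\<close> is long and orthogonal to
   \<open>\<alpha>\<close>, so \<open>cE\<close> covers it.\<close>
 have cneg: "ce c (- \<theta>')" if t': "long \<theta>'" "\<theta>' \<bullet> \<alpha> > 0" for \<theta>'
 proof (rule Theta_induct[where Q = "\<lambda>\<theta>'. ce c (- \<theta>')", OF t _ _ t'])
  show "ce c (- \<theta>)" using c(5) by (simp add: ce_def)
  fix \<theta>1 \<theta>2 assume s: "long \<theta>1" "\<theta>1 \<bullet> \<alpha> > 0" "long \<theta>2" "\<theta>2 \<bullet> \<alpha> > 0" "\<theta>2 \<bullet> \<theta>1 \<noteq> 0" "\<theta>2 \<noteq> \<theta>1" "ce c (- \<theta>1)"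
  note d = Theta_diff[OF s(1-6)]
  have 1: "ce c (\<theta>1 - \<theta>2)" using cE[OF d(1)] d(2) by simp
  have l: "long (- \<theta>1)" using s(1) by simp
  have "\<theta>1 \<bullet> \<theta>1 > 0" using long_root[OF s(1)] by (simp add: inner_gt_zero_iff)
  hence ci: "ci (\<theta>1 - \<theta>2) (- \<theta>1) = -1"
   using d(3) by (simp add: cartan_number_def inner_diff_left divide_simps)
  define M :: 'r where "M = of_int (eps (- \<theta>1) (\<theta>1 - \<theta>2))"
  have e: "br (D1 (- \<theta>1)) (D1 (\<theta>1 - \<theta>2)) = M \<cdot> D1 (- \<theta>2)"
   using eps(2)[OF l long_root[OF d(1)] ci] by (simp add: M_def)
  have "c * br (D1 (- \<theta>1)) (D1 (\<theta>1 - \<theta>2)) =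
    br (D1 (- \<theta>1)) (D1 (\<theta>1 - \<theta>2)) * c"
   using intertwine_mult[OF s(7)[unfolded ce_def] 1[unfolded ce_def]] intertwine_mult[OF 1[unfolded ce_def] s(7)[unfolded ce_def]]
   by (simp add: right_diff_distrib left_diff_distrib)
  hence "M \<cdot> (c * D1 (- \<theta>2)) = M \<cdot> (D1 (- \<theta>2) * c)" unfolding e by simp
  moreover have "M = 1 \<or> M = -1" using eps(1)[OF l long_root[OF d(1)] ci] by (auto simp: M_def)
  ultimately show "ce c (- \<theta>2)" by (auto simp: ce_def)
 qed
 have clong: "ce c \<delta>" if "long \<delta>" for \<delta>
  using cE[OF that] cneg[of "- \<delta>"] that by (cases "\<delta> \<bullet> \<alpha> \<ge> 0") auto
 have diag: "c * opr \<mu> = opr \<mu> * c" for \<mu>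
  by (rule long_diag[OF c(1)]) (use clong in \<open>simp add: ce_def\<close>)
 have UE: "ce U \<beta>" if b: "long \<beta>" "\<beta> \<bullet> \<alpha> \<ge> 0" for \<beta>
  unfolding ce_def by (rule cancel_right[OF c(1)]) (use gE[OF b] cE[OF b] in \<open>simp_all add: ce_def gU\<close>)
 have lin: "cl.lin r * D1 \<beta> = D1 \<beta> * cl.lin r" if b: "long \<beta>" "\<beta> \<bullet> \<alpha> \<ge> 0" for \<beta>
  by (rule cl.U_comm[OF U cl.dg_hom_D1[OF long_root[OF b(1)]]]) (use UE[OF b] in \<open>simp add: ce_def\<close>)
 have aT: "\<alpha> \<bullet> \<theta> > 0" "\<alpha> \<noteq> \<theta>" using t a by (auto simp: inner_commute)
 have a1: "\<alpha> \<in> cl.deg1" using long_ratio(1)[OF t(1) a(1) aT] a(1) by (simp add: cl.dgr_eq)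
 have r0: "r \<delta> = 0" if d: "\<delta> \<in> cl.deg1" "\<delta> \<noteq> \<alpha>" for \<delta>
 proof -
  note f = cl.deg1_ratio[OF d(1)]
  \<comment> \<open>If \<open>\<delta>\<close> is long with
    \<open>\<delta> \<bullet> \<alpha> \<le> 0\<close>, then \<open>separate\<close> might return
    \<open>- \<delta>\<close>, where the Cartan number is -2; in this case
    \<open>\<theta> - \<delta>\<close> is taken.\<close>
  have "\<exists>\<beta>. long \<beta> \<and> \<beta> \<bullet> \<alpha> \<ge> 0 \<and> ci \<delta> \<beta> = -1"
  proof (cases "long \<delta> \<and> \<delta> \<bullet> \<alpha> \<le> 0")
   case True
   have "2 * (\<delta> \<bullet> \<theta>) = \<theta> \<bullet> \<theta>" by (rule f(5))
   hence "long (\<theta> - \<delta>)" using long_diff[OF t(1)] True by blast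
   moreover have "(\<theta> - \<delta>) \<bullet> \<alpha> \<ge> 0" using True t(2) by (simp add: inner_diff_left)
   moreover have "ci \<delta> (\<theta> - \<delta>) = -1"
   proof -
    have i: "\<delta> \<bullet> \<delta> = \<theta> \<bullet> \<theta>" using long_inner_self[OF t(1)] True by blast
    have "(\<theta> - \<delta>) \<bullet> (\<theta> - \<delta>) = \<theta> \<bullet> \<theta>" using long_inner_self[OF t(1) \<open>long (\<theta> - \<delta>)\<close>] .
    moreover have "2 * (\<delta> \<bullet> (\<theta> - \<delta>)) = - (\<theta> \<bullet> \<theta>)" using f(5) i by (simp add: inner_diff_right)
    ultimately show ?thesis using t(1) long_root by (simp add: cartan_number_def)
   qed
   ultimately show ?thesis by blast
  next
   case False
   have "\<delta> \<noteq> k *\<^sub>R \<alpha>" for k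
   proof
    assume "\<delta> = k *\<^sub>R \<alpha>"
    hence "\<delta> = - \<alpha>" using reduced[OF a(1), of k] f(1) d(2) by auto
    thus False using f(6) aT(1) by simp
   qed
   from separate[OF t this] obtain \<beta> where b: "long \<beta>" "\<beta> \<bullet> \<alpha> \<ge> 0" "\<delta> \<bullet> \<beta> < 0" by blast
   have bP: "\<beta> \<in> \<Phi>" by (rule long_root[OF b(1)])
   have "\<delta> \<noteq> \<beta>" using b(3) by auto
   moreover have "\<delta> \<noteq> - \<beta>" using False b by auto
   moreover have "ci \<delta> \<beta> < 0" using b(3) bP by (simp add: ci_neg)
   ultimately have "ci \<delta> \<beta> = -1" using ci_long[OF b(1) f(1)] by auto
   thus ?thesis using b by blast
  qed
  then obtain \<beta> where "long \<beta>" "\<beta> \<bullet> \<alpha> \<ge> 0" "ci \<delta> \<beta> = -1" by blast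
  thus ?thesis using cl.kill[OF _ d(1)] lin by blast
 qed
 have "Xs r (lower_roots (- \<theta>)) = X \<alpha> (r \<alpha>)"
  by (rule prod_list_single[OF lower_roots(2)]) (use a1 r0 cl.upper in auto)
 hence Ue: "U = X \<alpha> (r \<alpha>) * X \<theta> s" by (simp add: U_def cl.uelt_def)
 \<comment> \<open>The parameter at \<open>\<theta>\<close> is invisible in first order. With
   \<open>\<beta>\<close> of degree -1 commuting with \<open>\<alpha>\<close>, the factor for
   \<open>\<alpha>\<close> is stripped off, and degree 1 of the remaining relation gives
   \<open>s [E \<theta>, E \<beta>] = 0\<close>.\<close>
 have s0: "s = 0"
 proof -
  have "\<theta> \<noteq> k *\<^sub>R \<alpha>" for k
  proof
   assume "\<theta> = k *\<^sub>R \<alpha>"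
   hence "\<theta> = \<alpha> \<or> \<theta> = - \<alpha>" using reduced[OF a(1), of k] long_root[OF t(1)] by auto
   thus False using t a by auto
  qed
  from separate[OF t this] obtain \<beta> where b: "long \<beta>" "\<beta> \<bullet> \<alpha> \<ge> 0" "\<theta> \<bullet> \<beta> < 0" by blast
  have bP: "\<beta> \<in> \<Phi>" by (rule long_root[OF b(1)])
  have "\<beta> \<noteq> \<theta>" "\<beta> \<noteq> - \<theta>" using b t by auto
  moreover have "ci \<beta> \<theta> < 0" using b(3) by (simp add: ci_neg inner_commute)
  ultimately have ci: "ci \<beta> \<theta> = -1" using ci_long[OF t(1) bP] by auto
  have d: "cl.dgr \<beta> = -1" using ci bP by (simp add: cl.dgr_eq)
  have h: "cl.dg.hom (-1) (D1 \<beta>)" using cl.dg_hom_D1[OF bP] d by simp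
  have "X \<alpha> (- r \<alpha>) * (U * D1 \<beta>) = X \<alpha> (- r \<alpha>) * (D1 \<beta> * U)"
   using UE[OF b(1,2)] by (simp add: ce_def)
  moreover have "X \<alpha> (- r \<alpha>) * D1 \<beta> = D1 \<beta> * X \<alpha> (- r \<alpha>)"
   using X_D_commute[OF a(1) bP] N[OF b(1,2)] by blast
  ultimately have "X \<theta> s * D1 \<beta> = D1 \<beta> * X \<theta> s"
   by (simp add: Ue mult.assoc[symmetric] X_inverse[OF a(1)]) (simp add: mult.assoc, simp add: mult.assoc[symmetric] X_inverse[OF a(1)])
  from arg_cong[OF this, of "cl.dg.cmp 1"]
  have "cl.dg.cmp 2 (X \<theta> s) * D1 \<beta> = D1 \<beta> * cl.dg.cmp 2 (X \<theta> s)"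
   by (simp add: cl.dg.cmp_mult_left[OF h] cl.dg.cmp_mult_right[OF h])
  moreover have "cl.dg.cmp 2 (X \<theta> s) = s \<cdot> D1 \<theta>"
   using cl.cmp_X_mult[OF cl.theta, of "Suc 0" s] by simp
  ultimately have "s \<cdot> br (D1 \<theta>) (D1 \<beta>) = 0" by (simp add: smul_diff_right)
  moreover have "br (D1 \<theta>) (D1 \<beta>) = (of_int (eps \<theta> \<beta>) :: 'r) \<cdot> D1 (\<theta> + \<beta>)"
   using eps(2)[OF t(1) bP ci] by simp
  ultimately have "\<phi> (\<theta> + \<beta>) ((s * of_int (eps \<theta> \<beta>)) \<cdot> D1 (\<theta> + \<beta>)) = 0" by simp
  hence "s * of_int (eps \<theta> \<beta>) = 0"
   using long_add_root(1)[OF t(1) bP ci] by (simp add: phi_smul phi_D1)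
  thus ?thesis using eps(1)[OF t(1) bP ci] by auto
 qed
 hence gXc: "g = X \<alpha> (r \<alpha>) * c" using gU Ue by simp
 have "c * B = B * c" if B: "B \<in> GR" for B
 proof (rule central_criterion[OF c(1) diag _ short_zspan _ B])
  fix \<gamma> assume gm: "\<gamma> \<in> {\<gamma>\<in>\<Phi>. long \<gamma> \<or> (\<alpha> + \<gamma> \<notin> \<Phi> \<and> \<alpha> + \<gamma> \<noteq> 0)}"
  show "c * D1 \<gamma> = D1 \<gamma> * c"
  proof (cases "long \<gamma>")
   case True thus ?thesis using clong by (simp add: ce_def)
  next
   case False
   hence n: "\<gamma> \<in> \<Phi>" "\<alpha> + \<gamma> \<notin> \<Phi>" "\<alpha> + \<gamma> \<noteq> 0" using gm by auto
   have "c * X \<gamma> 1 = X \<gamma> 1 * c"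
    by (rule cancel_left[OF GR_X[OF a(1)], of "r \<alpha>"])
     (use comm[OF n] X_commute[OF a(1) n] in \<open>simp_all add: gXc\<close>)
   thus ?thesis by (rule diag_X[OF diag n(1)])
  qed
 qed auto
 hence "(\<forall>B\<in>GR. c * B = B * c) \<and> g = c * X \<alpha> (r \<alpha>)" using gXc GR_X[OF a(1)] by metis
 thus ?thesis using c(1) by blast
qed

end

end


section \<open>Type C\<close>

lemma prod_list_commute:
 "(\<And>x. x \<in> set xs ==> f x * Z = Z * f x) ==> prod_list (map f xs) * Z = Z * (prod_list (map f xs) :: 'a::monoid_mult)"
proof (induction xs)
 case (Cons a xs)
 hence "f a * (prod_list (map f xs) * Z) = f a * (Z * prod_list (map f xs))" "f a * Z = Z * f a" by simp_all
 thus ?case by (simp add: mult.assoc) (simp add: mult.assoc[symmetric])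
qed simp

context chevalley_long begin

lemma hom_0_sadj:
 assumes "c \<in> GR" "dg.hom 0 c" shows "dg.hom 0 (sadj c)"
proof -
 note inv = sadj_inverse[OF GR_det[OF assms(1)]]
 have "sadj c * oi (P \<theta> i) = oi (P \<theta> i) * sadj c" for i
 proof -
  have "c * oi (P \<theta> i) = oi (P \<theta> i) * c" using assms(2) by (simp add: dg.hom_def)
  hence "sadj c * (c * oi (P \<theta> i)) * sadj c = sadj c * (oi (P \<theta> i) * c) * sadj c" by simp
  thus ?thesis by (simp add: mult.assoc inv) (simp add: mult.assoc[symmetric] inv)
 qed
 thus ?thesis by (simp add: dg.hom_def)
qed

text \<open>A matrix that preserves the grading has no component of a weight that changes the
  degree.\<close>

lemma phi_hom_0:
 fixes y :: "('r::comm_ring_1, 'n) smat"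
 assumes y: "dg.hom 0 y" and v: "v \<in> \<Phi>" "dgr v \<noteq> 0" shows "\<phi> v y = 0"
proof -
 have "opr (i + v) * y * opr i = (0 :: ('r, 'n) smat)" if "i \<in> Wt" for i
 proof -
  note ii = Wt_integral[OF that]
  have ne: "cint i \<theta> \<noteq> cint (i + v) \<theta>" using cint_add[OF ii root_integral[OF v(1)] theta] v(2) by simp
  have "opr i = oi (P \<theta> (cint i \<theta>)) * (opr i :: ('r, 'n) smat)"
   using P_pr[OF theta, of "cint i \<theta>" i] by (simp add: oi_mult[symmetric])
  hence "opr (i + v) * y * opr i = opr (i + v) * (y * oi (P \<theta> (cint i \<theta>))) * opr i"
   by (simp add: mult.assoc)
  also have "y * oi (P \<theta> (cint i \<theta>)) = oi (P \<theta> (cint i \<theta>)) * y" using y by (simp add: dg.hom_def)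
  also have "opr (i + v) * (oi (P \<theta> (cint i \<theta>)) * y) * opr i = oi (pr (i + v) * P \<theta> (cint i \<theta>)) * y * opr i"
   by (simp add: oi_mult mult.assoc)
  also have "pr (i + v) * P \<theta> (cint i \<theta>) = 0" using pr_P[OF theta] ne by simp
  finally show ?thesis by simp
 qed
 hence "wt.cmp v y = 0" unfolding wt.cmp_def by (intro sum.neutral) simp
 thus ?thesis by (simp add: \<phi>_def)
qed

end

context chevalley_rep begin

section \<open>Coordinates in type C\<close>

context
 fixes l :: nat and e :: "nat \<Rightarrow> 'e" and q :: real
 assumes q: "q > 0" and ee: "\<And>i j. i \<in> {1..l} ==> j \<in> {1..l} ==> e i \<bullet> e j = (if i = j then q else 0)"
  and C: "\<Phi> = C_roots l e"
begin

lemma C_cases: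
 assumes "\<beta> \<in> \<Phi>"
 obtains (long) i where "i \<in> {1..l}" "\<beta> = 2 *\<^sub>R e i \<or> \<beta> = - (2 *\<^sub>R e i)"
 | (short) a b i j where "i \<in> {1..l}" "j \<in> {1..l}" "i \<noteq> j" "a = 1 \<or> a = -1" "b = 1 \<or> b = -1" "\<beta> = a *\<^sub>R e i + b *\<^sub>R e j"
proof -
 have "\<beta> \<in> C_roots l e" using assms by (simp only: C)
 then consider (1) a b i j where "\<beta> = a *\<^sub>R e i + b *\<^sub>R e j" "a \<in> {1, - 1}" "b \<in> {1, - 1}" "i \<in> {1..l}" "j \<in> {1..l}" "i \<noteq> j"
  | (2) a i where "\<beta> = a *\<^sub>R (2 *\<^sub>R e i)" "a \<in> {1, - 1}" "i \<in> {1..l}"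
  unfolding C_roots_def by blast
 thus thesis
 proof cases
  case 1 thus thesis using short[of i j a b] by blast
 next
  case 2 thus thesis by (intro long[of i]) auto
 qed
qed

lemma C_root_long: assumes "i \<in> {1..l}" shows "2 *\<^sub>R e i \<in> \<Phi>"
proof -
 have "2 *\<^sub>R e i = 1 *\<^sub>R (2 *\<^sub>R e i)" by simp
 thus ?thesis unfolding C C_roots_def using assms by blast
qed

lemma C_root_short: "i \<in> {1..l} ==> j \<in> {1..l} ==> i \<noteq> j ==> a = 1 \<or> a = -1 ==> b = 1 \<or> b = -1 ==>
  a *\<^sub>R e i + b *\<^sub>R e j \<in> \<Phi>" unfolding C C_roots_def by blast

lemma C_inner: "\<beta> \<in> \<Phi> ==> \<beta> \<bullet> \<beta> \<le> 4 * q"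
 by (erule C_cases) (use q in \<open>auto simp: inner_add_left inner_add_right inner_diff_left inner_diff_right ee\<close>)

text \<open>Long roots have squared length \<open>4 q\<close>, so a comparison of lengths certifies
  a sum as a non-root without listing cases.\<close>

lemma C_not_root: "v \<bullet> v > 4 * q ==> v \<notin> \<Phi> \<and> v \<noteq> 0"
 using C_inner[of v] q by auto

lemma C_long: assumes i: "i \<in> {1..l}" shows "long (2 *\<^sub>R e i)"
proof -
 have "norm \<beta> \<le> norm (2 *\<^sub>R e i)" if "\<beta> \<in> \<Phi>" for \<beta>
  using C_inner[OF that] ee[OF i i] by (simp add: norm_eq_sqrt_inner real_sqrt_le_iff del: norm_scaleR)
 thus ?thesis using C_root_long[OF i] by (simp add: long_def)
qed

lemma C_long_cases:
 assumes "long \<beta>" shows "\<exists>i\<in>{1..l}. \<beta> = 2 *\<^sub>R e i \<or> \<beta> = - (2 *\<^sub>R e i)"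
 using long_root[OF assms]
proof (cases rule: C_cases)
 case (short a b i j)
 have "\<beta> \<bullet> \<beta> = 2 * q" using short by (auto simp: inner_add_left inner_add_right inner_diff_left inner_diff_right ee)
 moreover have "\<beta> \<bullet> \<beta> = 4 * q" using long_inner_self[OF C_long[OF short(1)] assms] ee[OF short(1,1)] by simp
 ultimately show ?thesis using q by simp
qed blast

lemma C_ci: "i \<in> {1..l} ==> ci \<beta> (2 *\<^sub>R e i) = (\<beta> \<bullet> e i) / q"
 using q by (simp add: cartan_number_def ee)

lemma C_deg1:
 assumes d: "\<delta> \<in> \<Phi>" and i: "i \<in> {1..l}" and ci: "ci \<delta> (2 *\<^sub>R e i) = 1"
 shows "\<exists>j\<in>{1..l}. j \<noteq> i \<and> (\<delta> = e i + e j \<or> \<delta> = e i - e j)"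
proof -
 have di: "\<delta> \<bullet> e i = q" using ci q by (simp add: C_ci[OF i])
 from d show ?thesis
 proof (cases rule: C_cases)
  case (long k)
  hence "\<delta> \<bullet> e i = 2 * (e k \<bullet> e i) \<or> \<delta> \<bullet> e i = - (2 * (e k \<bullet> e i))" by auto
  thus ?thesis unfolding di ee[OF long(1) i] using q by (cases "k = i") auto
 next
  case (short a b p k)
  have "a * (e p \<bullet> e i) + b * (e k \<bullet> e i) = q" using di short(6) by (simp add: inner_add_left)
  hence "a * (if p = i then q else 0) + b * (if k = i then q else 0) = q"
   unfolding ee[OF short(1) i] ee[OF short(2) i] .
  then consider "p = i" "k \<noteq> i" "a = 1" | "k = i" "p \<noteq> i" "b = 1"
   using short(3) q by (cases "p = i"; cases "k = i") auto
  thus ?thesis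
  proof cases
   case 1
   hence "\<delta> = e i + e k \<or> \<delta> = e i - e k" using short(5,6) by auto
   thus ?thesis using short(2) 1 by blast
  next
   case 2
   hence "\<delta> = e i + e p \<or> \<delta> = e i - e p" using short(4,6) by auto
   thus ?thesis using short(1) 2 by blast
  qed
 qed
qed

context
 fixes m n assumes mn: "m \<in> {1..l}" "n \<in> {1..l}" "m \<noteq> n"
begin

text \<open>The long roots \<open>2 e m\<close> and \<open>2 e n\<close> commute with
  \<open>e m + e n\<close>. The second decomposition is applied to the factor \<open>c1\<close> of
  the first, and the point is that it preserves what has been reached for
  \<open>2 e m\<close>.\<close>

theorem centralizer_Gamma_C:
 fixes g :: "('r::comm_ring_1, 'n) smat"
 assumes g: "g \<in> GR"
  and comm: "\<And>\<beta>. \<beta> \<in> \<Phi> ==> e m + e n + \<beta> \<notin> \<Phi> ==> e m + e n + \<beta> \<noteq> 0 ==> g * X \<beta> 1 = X \<beta> 1 * g"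
 shows "\<exists>t1 t2 t3 c. c \<in> GR \<and> (\<forall>B\<in>GR. c * B = B * c) \<and>
  g = c * X (e m + e n) t1 * X (2 *\<^sub>R e m) t2 * X (2 *\<^sub>R e n) t3"
proof -
 interpret s1: chevalley_long \<Phi> \<Delta> E H "2 *\<^sub>R e m" by unfold_locales (rule C_long[OF mn(1)])
 interpret s2: chevalley_long \<Phi> \<Delta> E H "2 *\<^sub>R e n" by unfold_locales (rule C_long[OF mn(2)])
 have em: "e m \<bullet> e m = q" "e n \<bullet> e n = q" "e m \<bullet> e n = 0" "e n \<bullet> e m = 0" using ee mn by auto
 have ei: "e i \<bullet> e i = q" "e m \<bullet> e i = 0" "e i \<bullet> e m = 0" "e n \<bullet> e i = 0" "e i \<bullet> e n = 0"
  if "i \<in> {1..l}" "i \<noteq> m" "i \<noteq> n" for i using ee mn that by auto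
 note inn = inner_add_left inner_add_right inner_diff_left inner_diff_right em
 have gX: "g * X \<beta> 1 = X \<beta> 1 * g" if "\<beta> \<in> \<Phi>" "(e m + e n + \<beta>) \<bullet> (e m + e n + \<beta>) > 4 * q" for \<beta>
  using comm[OF that(1)] C_not_root[OF that(2)] by blast
 define ce where "ce c \<delta> \<longleftrightarrow> c * D1 \<delta> = D1 \<delta> * c" for c :: "('r, 'n) smat" and \<delta>
 have gm: "g * X (2 *\<^sub>R e m) 1 = X (2 *\<^sub>R e m) 1 * g" by (rule gX) (use C_root_long mn q in \<open>auto simp: inn\<close>)
 have gn: "g * X (2 *\<^sub>R e n) 1 = X (2 *\<^sub>R e n) 1 * g" by (rule gX) (use C_root_long mn q in \<open>auto simp: inn\<close>)
 have gn': "ce g (2 *\<^sub>R e n)" using centralizer_long[OF C_long[OF mn(2)] g gn] by (simp add: ce_def)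
 have gi: "ce g (2 *\<^sub>R e i)" "ce g (- (2 *\<^sub>R e i))" if i: "i \<in> {1..l}" "i \<noteq> m" "i \<noteq> n" for i
 proof -
  note L = C_long[OF i(1)]
  have "g * X (2 *\<^sub>R e i) 1 = X (2 *\<^sub>R e i) 1 * g"
   by (rule gX) (use C_root_long[OF i(1)] q in \<open>simp_all add: inn ei[OF i]\<close>)
  thus "ce g (2 *\<^sub>R e i)" using centralizer_long[OF L g] by (simp add: ce_def)
  have "g * X (- (2 *\<^sub>R e i)) 1 = X (- (2 *\<^sub>R e i)) 1 * g"
   by (rule gX) (use C_root_long[OF i(1)] q in \<open>simp_all add: inn ei[OF i]\<close>)
  thus "ce g (- (2 *\<^sub>R e i))" using centralizer_long[OF _ g, of "- (2 *\<^sub>R e i)"] L by (simp add: ce_def)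
 qed
 obtain r1 t1 c1 where c1: "c1 \<in> GR" "g = s1.uelt r1 t1 * c1" "s1.dg.hom 0 c1"
  "\<And>k. c1 * oi (D (2 *\<^sub>R e m) k) = oi (D (2 *\<^sub>R e m) k) * c1"
  "\<And>k. c1 * oi (D (- (2 *\<^sub>R e m)) k) = oi (D (- (2 *\<^sub>R e m)) k) * c1"
  "\<And>\<delta>. r1 \<delta> = - of_int (eps (- (2 *\<^sub>R e m)) \<delta>) * \<phi> (- (2 *\<^sub>R e m) + \<delta>) (cj g (oi (D (- (2 *\<^sub>R e m)) (Suc 0))))"
  by (rule s1.decomposition[OF g gm]) (rule that)
 define U1 where "U1 = s1.uelt r1 t1"
 have U1: "s1.tri 1 (s1.lin r1) U1" unfolding U1_def by (rule s1.tri_uelt)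
 have g1: "g = U1 * c1" by (simp add: U1_def c1(2))
 have top1: "ce c1 \<beta>" if "\<beta> \<in> \<Phi>" "ce g \<beta>" for \<beta>
  unfolding ce_def by (rule s1.comm_top[OF U1 c1(3) s1.dg_hom_D1[OF that(1)]]) (use that in \<open>simp add: ce_def g1\<close>)
 have c1i: "ce c1 (2 *\<^sub>R e i)" "ce c1 (- (2 *\<^sub>R e i))" if i: "i \<in> {1..l}" "i \<noteq> m" "i \<noteq> n" for i
  using gi[OF i] C_root_long[OF i(1)] by (auto intro!: top1)
 have c1n: "ce c1 (2 *\<^sub>R e n)" by (rule top1[OF s2.theta gn'])
 have c1X: "c1 * X (2 *\<^sub>R e n) 1 = X (2 *\<^sub>R e n) 1 * c1"
  by (rule commute_X, rule centralizer_long_all[OF C_long[OF mn(2)] c1(1)]) (use c1n in \<open>simp add: ce_def\<close>)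
 obtain r2 t2 c2 where c2: "c2 \<in> GR" "c1 = s2.uelt r2 t2 * c2" "s2.dg.hom 0 c2"
  "\<And>k. c2 * oi (D (2 *\<^sub>R e n) k) = oi (D (2 *\<^sub>R e n) k) * c2"
  "\<And>k. c2 * oi (D (- (2 *\<^sub>R e n)) k) = oi (D (- (2 *\<^sub>R e n)) k) * c2"
  "\<And>\<delta>. r2 \<delta> = - of_int (eps (- (2 *\<^sub>R e n)) \<delta>) * \<phi> (- (2 *\<^sub>R e n) + \<delta>) (cj c1 (oi (D (- (2 *\<^sub>R e n)) (Suc 0))))"
  by (rule s2.decomposition[OF c1(1) c1X]) (rule that)
 define U2 where "U2 = s2.uelt r2 t2"
 have U2: "s2.tri 1 (s2.lin r2) U2" unfolding U2_def by (rule s2.tri_uelt)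
 have c12: "c1 = U2 * c2" by (simp add: U2_def c2(2))
 have U2G: "U2 \<in> GR" unfolding U2_def by (rule s2.GR_uelt)
 have top2: "ce c2 \<beta>" if "\<beta> \<in> \<Phi>" "ce c1 \<beta>" for \<beta>
  unfolding ce_def by (rule s2.comm_top[OF U2 c2(3) s2.dg_hom_D1[OF that(1)]]) (use that in \<open>simp add: ce_def c12\<close>)
 have c2i: "ce c2 (2 *\<^sub>R e i)" "ce c2 (- (2 *\<^sub>R e i))" if i: "i \<in> {1..l}" "i \<noteq> m" "i \<noteq> n" for i
  using c1i[OF i] C_root_long[OF i(1)] by (auto intro!: top2)
 \<comment> \<open>\<open>c1\<close> preserves the grading by \<open>2 e m\<close>, in which
   \<open>- 2 e n\<close> has degree 0. Up to sign the coefficient of \<open>\<delta>\<close> in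
   \<open>U2\<close> is a coordinate of the conjugated root matrix of \<open>- 2 e n\<close> at a
   root of nonzero degree, hence zero.\<close>
 have r20: "r2 \<delta> = 0" if d: "\<delta> \<in> s2.deg1" "\<delta> \<bullet> e m \<noteq> 0" for \<delta>
 proof -
  have L: "long (- (2 *\<^sub>R e n))" using C_long[OF mn(2)] by simp
  have ci: "ci \<delta> (- (2 *\<^sub>R e n)) = -1" using s2.deg1_ratio(2)[OF d(1)] by simp
  have v: "- (2 *\<^sub>R e n) + \<delta> \<in> \<Phi>" by (rule long_add_root(1)[OF L _ ci]) (use d in simp)
  have "ci (- (2 *\<^sub>R e n) + \<delta>) (2 *\<^sub>R e m) \<noteq> 0"
   using d(2) q by (simp add: C_ci[OF mn(1)] inn)
  hence v0: "s1.dgr (- (2 *\<^sub>R e n) + \<delta>) \<noteq> 0" using s1.dgr_eq[OF v, of 0] by simp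
  have nr: "- (2 *\<^sub>R e n) \<in> \<Phi>" using s2.theta by simp
  have "ci (- (2 *\<^sub>R e n)) (2 *\<^sub>R e m) = 0" by (simp add: C_ci[OF mn(1)] em)
  hence "s1.dgr (- (2 *\<^sub>R e n)) = 0" using s1.dgr_eq[OF nr, of 0] by simp
  hence "s1.dg.hom 0 (oi (D (- (2 *\<^sub>R e n)) (Suc 0)))" using s1.dg_hom_D1[OF nr] by simp
  hence "s1.dg.hom (0 + 0 + 0) (cj c1 (oi (D (- (2 *\<^sub>R e n)) (Suc 0))))"
   unfolding cj_def by (intro s1.dg.hom_mult c1(3) s1.hom_0_sadj[OF c1(1,3)])
  hence "\<phi> (- (2 *\<^sub>R e n) + \<delta>) (cj c1 (oi (D (- (2 *\<^sub>R e n)) (Suc 0)))) = 0"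
   using s1.phi_hom_0[OF _ v v0] by simp
  thus ?thesis unfolding c2(6) by simp
 qed
 \<comment> \<open>The remaining roots of \<open>U2\<close> are orthogonal to \<open>e m\<close>, so
   their sums with \<open>\<plusminus>2 e m\<close> are too long to be roots. Thus \<open>U2\<close>
   commutes with these root matrices, and \<open>c2\<close> inherits commutation from
   \<open>c1\<close>.\<close>
 have c2m: "c2 * oi (D \<tau> k) = oi (D \<tau> k) * c2" if t: "\<tau> = 2 *\<^sub>R e m \<or> \<tau> = - (2 *\<^sub>R e m)" for \<tau> k
 proof (rule cancel_left[OF U2G])
  show "U2 * c2 * oi (D \<tau> k) = oi (D \<tau> k) * (U2 * c2)" using t c1(4,5) by (auto simp: c12)
  have tP: "\<tau> \<in> \<Phi>" using t s1.theta by auto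
  have X: "X \<delta> s * oi (D \<tau> k) = oi (D \<tau> k) * X \<delta> s" if "\<delta> \<in> \<Phi>" "(\<delta> + \<tau>) \<bullet> (\<delta> + \<tau>) > 4 * q" for \<delta> and s :: 'r
   using X_D_commute[OF that(1) tP] C_not_root[OF that(2)] by blast
  have "X \<delta> (r2 \<delta>) * oi (D \<tau> k) = oi (D \<tau> k) * X \<delta> (r2 \<delta>)" if d: "\<delta> \<in> s2.deg1" for \<delta>
  proof (cases "\<delta> \<bullet> e m = 0")
   case True
   have d': "\<delta> \<in> \<Phi>" "ci \<delta> (2 *\<^sub>R e n) = 1" using s2.deg1_ratio(1,2)[OF d] by blast+
   obtain j where j: "j \<in> {1..l}" "j \<noteq> n" "\<delta> = e n + e j \<or> \<delta> = e n - e j" using C_deg1[OF d'(1) mn(2) d'(2)] by blast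
   have jm: "j \<noteq> m" using True j(3) q by (auto simp: inn)
   show ?thesis by (rule X[OF d'(1)]) (use j(3) t q in \<open>auto simp: inn ei[OF j(1) jm j(2)]\<close>)
  next
   case False
   thus ?thesis using r20[OF d] d by simp
  qed
  hence "Xs r2 (lower_roots (- (2 *\<^sub>R e n))) * oi (D \<tau> k) =
    oi (D \<tau> k) * Xs r2 (lower_roots (- (2 *\<^sub>R e n)))"
   by (intro prod_list_commute) (use s2.upper in blast)
  moreover have "X (2 *\<^sub>R e n) t2 * oi (D \<tau> k) = oi (D \<tau> k) * X (2 *\<^sub>R e n) t2"
   by (rule X[OF s2.theta]) (use t q in \<open>auto simp: inn\<close>)
  ultimately show "U2 * oi (D \<tau> k) = oi (D \<tau> k) * U2"
   unfolding U2_def s2.uelt_def by (simp add: mult.assoc) (simp add: mult.assoc[symmetric])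
 qed
 have c2long: "ce c2 \<delta>" if "long \<delta>" for \<delta>
 proof -
  obtain i where "i \<in> {1..l}" "\<delta> = 2 *\<^sub>R e i \<or> \<delta> = - (2 *\<^sub>R e i)" using C_long_cases[OF \<open>long \<delta>\<close>] by blast
  thus ?thesis using c2i[of i] c2m c2(4,5) by (cases "i = m"; cases "i = n") (auto simp: ce_def)
 qed
 have diag: "c2 * opr \<mu> = opr \<mu> * c2" for \<mu>
  by (rule long_diag[OF c2(1)]) (use c2long in \<open>simp add: ce_def\<close>)
 have c2s: "ce c2 (e m + b *\<^sub>R e j)" if j: "j \<in> {1..l}" "j \<noteq> m" "b = 1 \<or> b = -1" "j = n ==> b = 1" for j b
 proof -
  have r: "e m + b *\<^sub>R e j \<in> \<Phi>" using C_root_short[OF mn(1) j(1), of 1 b] j by simp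
  have big: "(e m + e n + (e m + b *\<^sub>R e j)) \<bullet> (e m + e n + (e m + b *\<^sub>R e j)) > 4 * q"
  proof (cases "j = n")
   case True thus ?thesis using j(4) q by (simp add: inn)
  next
   case False
   thus ?thesis using j(3) q by (auto simp: inn ei[OF j(1,2) False])
  qed
  have "ci (e m + b *\<^sub>R e j) (2 *\<^sub>R e m) = 1" using q ee[OF j(1) mn(1)] j(2) by (simp add: C_ci[OF mn(1)] inn)
  hence d: "s1.dgr (e m + b *\<^sub>R e j) = 1" using r by (simp add: s1.dgr_eq)
  have "ce c1 (e m + b *\<^sub>R e j)" unfolding ce_def
   by (rule s1.comm_X1[OF U1 c1(3) r d]) (use gX[OF r big] in \<open>simp add: g1\<close>)
  thus ?thesis by (rule top2[OF r])
 qed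
 define S where "S = {\<delta>\<in>\<Phi>. ce c2 \<delta>}"
 have zl: "2 *\<^sub>R e i \<in> zspan S" if "i \<in> {1..l}" for i
  using C_root_long[OF that] c2long[OF C_long[OF that]] by (intro zspan_base) (simp add: S_def)
 \<comment> \<open>The missing root \<open>e m - e n\<close> is reached in the lattice as
   \<open>(e m + e n) - 2 e n\<close>.\<close>
 have zs: "e m + b *\<^sub>R e j \<in> zspan S" if j: "j \<in> {1..l}" "j \<noteq> m" "b = 1 \<or> b = -1" for j b
 proof (cases "j = n \<and> b = -1")
  case True
  have "e m + 1 *\<^sub>R e n \<in> zspan S"
   using C_root_short[OF mn, of 1 1] c2s[of n 1] mn by (intro zspan_base) (simp add: S_def)
  from zspan_diff[OF this zl[OF mn(2)]] show ?thesis using True by (simp add: scaleR_2)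
 next
  case False
  hence "ce c2 (e m + b *\<^sub>R e j)" using j by (intro c2s) auto
  thus ?thesis using C_root_short[OF mn(1) j(1), of 1 b] j by (intro zspan_base) (simp add: S_def)
 qed
 have Sz: "\<Phi> \<subseteq> zspan S"
 proof
  fix \<beta> assume "\<beta> \<in> \<Phi>"
  thus "\<beta> \<in> zspan S"
  proof (cases rule: C_cases)
   case (long i)
   thus ?thesis using zl[OF long(1)] zspan_neg by auto
  next
   case (short a b i j)
   have one: "a *\<^sub>R e m + b *\<^sub>R e j \<in> zspan S" if "j \<in> {1..l}" "j \<noteq> m" "a = 1 \<or> a = -1" "b = 1 \<or> b = -1" for a b j
   proof (cases "a = 1")
    case True thus ?thesis using zs[OF that(1,2,4)] by simp
   next
    case False
    have "- b = 1 \<or> - b = -1" using that(4) by auto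
    from zspan_neg[OF zs[OF that(1,2) this]] show ?thesis using False that(3) by auto
   qed
   show ?thesis
   proof (cases "i = m \<or> j = m")
    case True
    thus ?thesis using one[of j a b] one[of i b a] short by (auto simp: add.commute)
   next
    case False
    have "- b = 1 \<or> - b = -1" using short(5) by auto
    from zspan_diff[OF zs[OF short(1) _ short(4)] zs[OF short(2) _ this]] show ?thesis
     using False by (simp add: short(6))
   qed
  qed
 qed
 have central: "c2 * B = B * c2" if "B \<in> GR" for B
  by (rule central_criterion[OF c2(1) diag _ Sz _ that]) (auto simp: S_def ce_def)
 have U1E: "ce U1 \<beta>" if "ce g \<beta>" "ce c1 \<beta>" for \<beta>
  unfolding ce_def by (rule cancel_right[OF c1(1)]) (use that in \<open>simp_all add: ce_def g1\<close>)
 have lin1: "s1.lin r1 * D1 \<beta> = D1 \<beta> * s1.lin r1" if "\<beta> \<in> \<Phi>" "ce g \<beta>" for \<beta>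
  by (rule s1.U_comm[OF U1 s1.dg_hom_D1[OF that(1)]]) (use U1E[OF that(2) top1[OF that]] in \<open>simp add: ce_def\<close>)
 have U2E: "ce U2 \<beta>" if "ce c1 \<beta>" "ce c2 \<beta>" for \<beta>
  unfolding ce_def by (rule cancel_right[OF c2(1)]) (use that in \<open>simp_all add: ce_def c12\<close>)
 have lin2: "s2.lin r2 * D1 \<beta> = D1 \<beta> * s2.lin r2" if "\<beta> \<in> \<Phi>" "ce c1 \<beta>" for \<beta>
  by (rule s2.U_comm[OF U2 s2.dg_hom_D1[OF that(1)]]) (use U2E[OF that(2) top2[OF that]] in \<open>simp add: ce_def\<close>)
 have sep: "\<exists>\<beta>. long \<beta> \<and> ci \<delta> \<beta> = -1 \<and> (\<beta> = 2 *\<^sub>R e j \<or> \<beta> = - (2 *\<^sub>R e j))"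
  if "\<delta> = e i + e j \<or> \<delta> = e i - e j" "i \<in> {1..l}" "j \<in> {1..l}" "i \<noteq> j" for \<delta> i j
 proof -
  have "ci (e i + e j) (- (2 *\<^sub>R e j)) = -1" "ci (e i - e j) (2 *\<^sub>R e j) = -1"
   using that(2-4) q by (simp_all add: C_ci inner_add_left inner_diff_left ee)
  thus ?thesis using that(1) C_long[OF that(3)] long_minus by blast
 qed
 have a1: "e m + e n \<in> s1.deg1"
 proof -
  have r: "e m + e n \<in> \<Phi>" using C_root_short[OF mn, of 1 1] by simp
  moreover have "ci (e m + e n) (2 *\<^sub>R e m) = 1" using q by (simp add: C_ci[OF mn(1)] inn)
  ultimately show ?thesis by (simp add: s1.dgr_eq)
 qed
 have r10: "r1 \<delta> = 0" if d: "\<delta> \<in> s1.deg1" "\<delta> \<noteq> e m + e n" for \<delta>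
 proof -
  have d': "\<delta> \<in> \<Phi>" "ci \<delta> (2 *\<^sub>R e m) = 1" using s1.deg1_ratio(1,2)[OF d(1)] by blast+
  obtain j where j: "j \<in> {1..l}" "j \<noteq> m" "\<delta> = e m + e j \<or> \<delta> = e m - e j" using C_deg1[OF d'(1) mn(1) d'(2)] by blast
  show ?thesis
  proof (cases "j = n")
   case True
   hence "ci \<delta> (2 *\<^sub>R e n) = -1" using j(3) d(2) q by (auto simp: C_ci[OF mn(2)] inn)
   thus ?thesis by (rule s1.kill[OF C_long[OF mn(2)] d(1) _ lin1[OF s2.theta gn']])
  next
   case False
   obtain \<beta> where b: "long \<beta>" "ci \<delta> \<beta> = -1" "\<beta> = 2 *\<^sub>R e j \<or> \<beta> = - (2 *\<^sub>R e j)"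
    using sep[OF j(3) mn(1) j(1)] j(2) by blast
   hence "ce g \<beta>" using gi[OF j(1,2) False] by auto
   thus ?thesis using s1.kill[OF b(1) d(1) b(2)] lin1[OF long_root[OF b(1)]] by blast
  qed
 qed
 have r20': "r2 \<delta> = 0" if d: "\<delta> \<in> s2.deg1" for \<delta>
 proof -
  have d': "\<delta> \<in> \<Phi>" "ci \<delta> (2 *\<^sub>R e n) = 1" using s2.deg1_ratio(1,2)[OF d] by blast+
  obtain j where j: "j \<in> {1..l}" "j \<noteq> n" "\<delta> = e n + e j \<or> \<delta> = e n - e j" using C_deg1[OF d'(1) mn(2) d'(2)] by blast
  show ?thesis
  proof (cases "j = m")
   case True
   thus ?thesis using r20[OF d] j(3) q by (auto simp: inn)
  next
   case False
   obtain \<beta> where b: "long \<beta>" "ci \<delta> \<beta> = -1" "\<beta> = 2 *\<^sub>R e j \<or> \<beta> = - (2 *\<^sub>R e j)"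
    using sep[OF j(3) mn(2) j(1)] j(2) by blast
   hence "ce c1 \<beta>" using c1i[OF j(1) False j(2)] by auto
   thus ?thesis using s2.kill[OF b(1) d b(2)] lin2[OF long_root[OF b(1)]] by blast
  qed
 qed
 have "Xs r1 (lower_roots (- (2 *\<^sub>R e m))) = X (e m + e n) (r1 (e m + e n))"
  by (rule prod_list_single[OF lower_roots(2)]) (use a1 r10 s1.upper in auto)
 hence 1: "U1 = X (e m + e n) (r1 (e m + e n)) * X (2 *\<^sub>R e m) t1" by (simp add: U1_def s1.uelt_def)
 have "Xs r2 (lower_roots (- (2 *\<^sub>R e n))) = 1"
  by (rule prod_list_eq_1) (use r20' s2.upper in auto)
 hence 2: "U2 = X (2 *\<^sub>R e n) t2" by (simp add: U2_def s2.uelt_def)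
 have "U1 * U2 \<in> GR" unfolding 1 2 mult.assoc
  by (intro GR_X_left GR_X s1.theta s2.theta) (use a1 in auto)
 hence "g = c2 * (U1 * U2)" using central by (simp add: g1 c12 mult.assoc)
 hence "g = c2 * X (e m + e n) (r1 (e m + e n)) * X (2 *\<^sub>R e m) t1 * X (2 *\<^sub>R e n) t2"
  by (simp add: 1 2 mult.assoc)
 thus ?thesis using c2(1) central by blast
qed

end

end

end


section \<open>Chevalley bases\<close>

lemma smat_mult: "smat (A ** B) = smat A * smat (B :: 'a::comm_ring_1^'n::finite^'n)" by (simp add: times_smat.abs_eq)
lemma smat_mat_1: "smat (mat 1) = (1 :: ('a::comm_ring_1, 'n::finite) smat)" by (simp add: one_smat_def)
lemma smat_scale: "smat (map_matrix ((*) c) A) = c \<cdot> smat (A :: 'a::comm_ring_1^'n::finite^'n)"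
 by (rule smat_eqI) (simp add: ent.abs_eq map_matrix_def)
lemma smat_power: "smat (matrix_pow A k) = smat A ^ k" for A :: "'a::comm_ring_1^'n::finite^'n"
 by (induction k) (simp_all add: matrix_pow_def smat_mat_1 smat_mult)
lemma smat_eq_iff: "smat A = smat B \<longleftrightarrow> A = B" for A :: "'a^'n::finite^'n" by (simp add: smat_inject)

context complex_lie_algebra begin

lemma bracket_sum_left: "bracket (sum f A) y = (\<Sum>a\<in>A. bracket (f a) y)"
proof -
 have "bracket 0 y = 0" using bracket_add_left[of 0 0 y] by simp
 thus ?thesis by (induction A rule: infinite_finite_induct) (simp_all add: bracket_add_left)
qed
lemma bracket_sum_right: "bracket y (sum f A) = (\<Sum>a\<in>A. bracket y (f a))"
proof -
 have "bracket y 0 = 0" using bracket_add_right[of y 0 0] by simp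
 thus ?thesis by (induction A rule: infinite_finite_induct) (simp_all add: bracket_add_right)
qed

end

locale chevalley_data = irreducible_roots \<Phi> + L: complex_lie_algebra sm br
 for \<Phi> :: "'e::euclidean_space set" and sm :: "complex \<Rightarrow> 'l::ab_group_add \<Rightarrow> 'l" and br +
 fixes \<Delta> :: "'e set" and h x :: "'e \<Rightarrow> 'l" and \<rho> :: "'l \<Rightarrow> complex^'n::finite^'n"
 assumes basis: "L.chevalley_basis \<Phi> \<Delta> h x"
  and faithful: "faithful_representation sm br \<rho>"
  and admissible: "admissible_basis \<Phi> x \<rho>"
begin

lemma root_base: "root_base \<Phi> \<Delta>"
 and h_h: "\<delta> \<in> \<Delta> ==> \<epsilon> \<in> \<Delta> ==> br (h \<delta>) (h \<epsilon>) = 0"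
 and h_x: "\<delta> \<in> \<Delta> ==> \<alpha> \<in> \<Phi> ==> br (h \<delta>) (x \<alpha>) = sm (of_real (ci \<alpha> \<delta>)) (x \<alpha>)"
 and x_x_neg: "\<alpha> \<in> \<Phi> ==> \<exists>c :: 'e \<Rightarrow> int. coroot \<alpha> = (\<Sum>\<delta>\<in>\<Delta>. of_int (c \<delta>) *\<^sub>R coroot \<delta>) \<and>
    br (x \<alpha>) (x (- \<alpha>)) = (\<Sum>\<delta>\<in>\<Delta>. sm (of_int (c \<delta>)) (h \<delta>))"
 and x_x: "\<alpha> \<in> \<Phi> ==> \<beta> \<in> \<Phi> ==> \<alpha> + \<beta> \<in> \<Phi> ==>
    (let r = Max {k :: nat. \<beta> - real k *\<^sub>R \<alpha> \<in> \<Phi>} in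
     br (x \<alpha>) (x \<beta>) = sm (of_nat (r + 1)) (x (\<alpha> + \<beta>)) \<or>
     br (x \<alpha>) (x \<beta>) = sm (- of_nat (r + 1)) (x (\<alpha> + \<beta>)))"
 and x_x_0: "\<alpha> \<in> \<Phi> ==> \<beta> \<in> \<Phi> ==> \<alpha> + \<beta> \<notin> \<Phi> ==> \<alpha> + \<beta> \<noteq> 0 ==> br (x \<alpha>) (x \<beta>) = 0"
 and indep: "L.independent (h ` \<Delta> \<union> x ` \<Phi>)"
 using basis unfolding L.chevalley_basis_def by blast+

lemma x_nonzero: "\<alpha> \<in> \<Phi> ==> x \<alpha> \<noteq> 0" using indep L.dependent_zero by (metis UnI2 image_eqI)

definition rep :: "'l \<Rightarrow> (complex, 'n) smat" where "rep y = smat (\<rho> y)"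

lemma rep_add: "rep (y + z) = rep y + rep z"
 using faithful by (simp add: rep_def faithful_representation_def plus_smat.abs_eq)
lemma rep_sm: "rep (sm c y) = c \<cdot> rep y"
 using faithful by (simp add: rep_def faithful_representation_def smat_scale)
lemma rep_br: "rep (br y z) = rep y * rep z - rep z * rep y"
 using faithful by (simp add: rep_def faithful_representation_def smat_mult[symmetric] minus_smat.abs_eq)
lemma rep_0 [simp]: "rep 0 = 0" using rep_add[of 0 0] by simp
lemma rep_sum: "rep (sum f A) = (\<Sum>a\<in>A. rep (f a))"
 by (induction A rule: infinite_finite_induct) (simp_all add: rep_add)
lemma rep_eq_0: "rep y = 0 \<longleftrightarrow> y = 0"
proof
 assume "rep y = 0"
 hence "\<rho> y = \<rho> 0" using rep_0 by (simp add: rep_def smat_eq_iff[symmetric])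
 thus "y = 0" using faithful by (auto simp: faithful_representation_def dest: injD)
qed simp

abbreviation "hr \<alpha> \<equiv> br (x \<alpha>) (x (- \<alpha>))"

text \<open>The coroots of the base are independent, so the integral expansion of the coroot of
  \<open>\<delta>\<close> is trivial, and with it that of the bracket.\<close>

lemma hr_base:
 assumes d: "\<delta> \<in> \<Delta>" shows "hr \<delta> = h \<delta>"
proof -
 have D: "\<Delta> \<subseteq> \<Phi>" "independent \<Delta>" using root_base by (auto simp: root_base_def)
 have fin: "finite \<Delta>" by (rule finite_subset[OF D(1) finite_roots])
 obtain c :: "'e \<Rightarrow> int" where c: "coroot \<delta> = (\<Sum>\<epsilon>\<in>\<Delta>. of_int (c \<epsilon>) *\<^sub>R coroot \<epsilon>)"
  "hr \<delta> = (\<Sum>\<epsilon>\<in>\<Delta>. sm (of_int (c \<epsilon>)) (h \<epsilon>))"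
  using x_x_neg[of \<delta>] d D by auto
 define u where "u \<epsilon> = (of_int (c \<epsilon>) - (if \<epsilon> = \<delta> then 1 else 0)) * (2 / (\<epsilon> \<bullet> \<epsilon>))" for \<epsilon>
 have "(\<Sum>\<epsilon>\<in>\<Delta>. u \<epsilon> *\<^sub>R \<epsilon>) = (\<Sum>\<epsilon>\<in>\<Delta>. of_int (c \<epsilon>) *\<^sub>R coroot \<epsilon> - (if \<epsilon> = \<delta> then coroot \<delta> else 0))"
  by (intro sum.cong refl) (auto simp: u_def coroot_def scaleR_diff_left[symmetric] left_diff_distrib diff_divide_distrib)
 also have "\<dots> = 0" using d fin c(1) by (simp add: sum_subtractf)
 finally have "u \<epsilon> = 0" if "\<epsilon> \<in> \<Delta>" for \<epsilon>
  using real_vector.independentD[OF D(2) fin subset_refl _ that, of u] by blast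
 hence k: "c \<epsilon> = (if \<epsilon> = \<delta> then 1 else 0)" if "\<epsilon> \<in> \<Delta>" for \<epsilon>
  using that D(1) root_nonzero by (fastforce simp: u_def subset_eq split: if_splits)
 have "hr \<delta> = (\<Sum>\<epsilon>\<in>\<Delta>. if \<epsilon> = \<delta> then h \<delta> else 0)"
  unfolding c(2) by (intro sum.cong refl) (auto simp: k)
 thus ?thesis using d fin by simp
qed

lemma hr_x:
 assumes a: "\<alpha> \<in> \<Phi>" and b: "\<beta> \<in> \<Phi>" shows "br (hr \<alpha>) (x \<beta>) = sm (of_real (ci \<beta> \<alpha>)) (x \<beta>)"
proof -
 obtain c :: "'e \<Rightarrow> int" where c: "coroot \<alpha> = (\<Sum>\<delta>\<in>\<Delta>. of_int (c \<delta>) *\<^sub>R coroot \<delta>)"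
  "hr \<alpha> = (\<Sum>\<delta>\<in>\<Delta>. sm (of_int (c \<delta>)) (h \<delta>))"
  using x_x_neg[OF a] by auto
 have "br (hr \<alpha>) (x \<beta>) = sm (\<Sum>\<delta>\<in>\<Delta>. of_int (c \<delta>) * of_real (ci \<beta> \<delta>)) (x \<beta>)"
  by (simp add: c(2) L.bracket_sum_left L.bracket_scale_left h_x b L.scale_sum_left)
 moreover have "ci \<beta> \<alpha> = (\<Sum>\<delta>\<in>\<Delta>. of_int (c \<delta>) * ci \<beta> \<delta>)"
  by (simp add: ci_coroot c(1) inner_sum_right)
 ultimately show ?thesis by simp
qed

sublocale chevalley_rep \<Phi> \<Delta> "\<lambda>\<alpha>. rep (x \<alpha>)" "\<lambda>\<alpha>. rep (hr \<alpha>)"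
proof
 fix \<alpha> \<beta> assume a: "\<alpha> \<in> \<Phi>"
 show "rep (hr \<alpha>) = rep (x \<alpha>) * rep (x (- \<alpha>)) - rep (x (- \<alpha>)) * rep (x \<alpha>)" by (rule rep_br)
 show "rep (x \<alpha>) \<noteq> 0" using x_nonzero[OF a] by (simp add: rep_eq_0)
 show "divisible (rep (x \<alpha>))" using admissible a
  by (simp add: divisible_def dp_def rep_def smat_power[symmetric] ent.abs_eq admissible_basis_def)
 obtain c :: "'e \<Rightarrow> int" where c: "coroot \<alpha> = (\<Sum>\<delta>\<in>\<Delta>. of_int (c \<delta>) *\<^sub>R coroot \<delta>)"
  "hr \<alpha> = (\<Sum>\<delta>\<in>\<Delta>. sm (of_int (c \<delta>)) (h \<delta>))"
  using x_x_neg[OF a] by auto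
 have "rep (hr \<alpha>) = (\<Sum>\<delta>\<in>\<Delta>. of_int (c \<delta>) \<cdot> rep (hr \<delta>))"
  by (simp add: c(2) rep_sum rep_sm hr_base)
 thus "\<exists>c :: 'e \<Rightarrow> int. coroot \<alpha> = (\<Sum>\<delta>\<in>\<Delta>. of_int (c \<delta>) *\<^sub>R coroot \<delta>) \<and>
   rep (hr \<alpha>) = (\<Sum>\<delta>\<in>\<Delta>. of_int (c \<delta>) \<cdot> rep (hr \<delta>))"
  using c(1) by blast
 assume b: "\<beta> \<in> \<Phi>"
 show "rep (hr \<alpha>) * rep (x \<beta>) - rep (x \<beta>) * rep (hr \<alpha>) = of_real (ci \<beta> \<alpha>) \<cdot> rep (x \<beta>)"
  by (simp only: rep_br[symmetric] hr_x[OF a b] rep_sm)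
 obtain d :: "'e \<Rightarrow> int" where d: "hr \<beta> = (\<Sum>\<delta>\<in>\<Delta>. sm (of_int (d \<delta>)) (h \<delta>))"
  using x_x_neg[OF b] by auto
 have "br (hr \<alpha>) (hr \<beta>) = 0" unfolding c(2) d
  by (simp add: L.bracket_sum_left L.bracket_sum_right L.bracket_scale_left L.bracket_scale_right h_h)
 thus "rep (hr \<alpha>) * rep (hr \<beta>) = rep (hr \<beta>) * rep (hr \<alpha>)"
  using rep_br[of "hr \<alpha>" "hr \<beta>"] by simp
 show "rep (x \<alpha>) * rep (x \<beta>) = rep (x \<beta>) * rep (x \<alpha>)" if "\<alpha> + \<beta> \<notin> \<Phi>" "\<alpha> + \<beta> \<noteq> 0"
  using rep_br[of "x \<alpha>" "x \<beta>"] x_x_0[OF a b that] by simp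
 show "let r = Max {k :: nat. \<beta> - real k *\<^sub>R \<alpha> \<in> \<Phi>} in
   rep (x \<alpha>) * rep (x \<beta>) - rep (x \<beta>) * rep (x \<alpha>) = of_nat (r + 1) \<cdot> rep (x (\<alpha> + \<beta>)) \<or>
   rep (x \<alpha>) * rep (x \<beta>) - rep (x \<beta>) * rep (x \<alpha>) = (- of_nat (r + 1)) \<cdot> rep (x (\<alpha> + \<beta>))"
  if "\<alpha> + \<beta> \<in> \<Phi>"
  using x_x[OF a b that] unfolding Let_def rep_br[symmetric] rep_sm[symmetric] by metis
qed (rule root_base)

lemma smat_root_elt: "smat (root_elt \<rho> x \<alpha> t) = X \<alpha> t"
proof (rule smat_eqI)
 fix i j
 have "ent (D \<alpha> k) i j = \<lfloor>Re (ent (dp (rep (x \<alpha>)) k) i j)\<rfloor>" for k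
  by (simp add: D_def idp_def int_smat_def ent.abs_eq)
 hence "ent (D \<alpha> k) i j = divided_power (\<rho> (x \<alpha>)) k $ i $ j" for k
  by (simp add: dp_def rep_def smat_power[symmetric] ent.abs_eq divided_power_def map_matrix_def)
 thus "ent (smat (root_elt \<rho> x \<alpha> t)) i j = ent (X \<alpha> t) i j"
  by (simp add: X_expand root_elt_def ent.abs_eq ent_sum)
qed

text \<open>\<open>m_inv\<close> is a definite description; existence and uniqueness are checked
  directly for root elements.\<close>

lemma SL_inv_root_elt:
 fixes t :: "'r::comm_ring_1"
 assumes a: "\<alpha> \<in> \<Phi>" shows "inv\<^bsub>SL\<^esub> (root_elt \<rho> x \<alpha> t) = root_elt \<rho> x \<alpha> (- t)"
proof -
 have i: "root_elt \<rho> x \<alpha> s ** root_elt \<rho> x \<alpha> (- s) = mat 1"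
  "root_elt \<rho> x \<alpha> (- s) ** root_elt \<rho> x \<alpha> s = mat 1" for s :: 'r
  using X_inverse[OF a, of s] unfolding smat_root_elt[symmetric] smat_mult[symmetric] smat_mat_1[symmetric] smat_eq_iff by auto
 have d: "det (root_elt \<rho> x \<alpha> s) = 1" for s :: 'r
  using sdet_X[OF a, of s] unfolding smat_root_elt[symmetric] by (simp add: sdet.abs_eq)
 show ?thesis unfolding m_inv_def
 proof (rule the_equality)
  fix B assume B: "B \<in> carrier SL \<and> root_elt \<rho> x \<alpha> t \<otimes>\<^bsub>SL\<^esub> B = \<one>\<^bsub>SL\<^esub> \<and> B \<otimes>\<^bsub>SL\<^esub> root_elt \<rho> x \<alpha> t = \<one>\<^bsub>SL\<^esub>"
  have "B = root_elt \<rho> x \<alpha> (- t) ** (root_elt \<rho> x \<alpha> t ** B)" by (simp add: matrix_mul_assoc i)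
  thus "B = root_elt \<rho> x \<alpha> (- t)" using B by (simp add: SL_def)
 qed (simp add: SL_def i d)
qed

lemma smat_elementary_group:
 "smat ` (elementary_group \<rho> x \<Phi> :: (complex^'n^'n) set) = GC"
proof (intro subset_antisym subsetI)
 fix B assume "B \<in> smat ` (elementary_group \<rho> x \<Phi> :: (complex^'n^'n) set)"
 then obtain A where A: "A \<in> generate SL {root_elt \<rho> x \<alpha> t | \<alpha> t. \<alpha> \<in> \<Phi>}" "B = smat A"
  by (auto simp: elementary_group_def)
 from A(1) have "smat A \<in> GC"
 proof (induction A rule: generate.induct)
  case one
  thus ?case by (simp add: SL_def smat_mat_1 GC_1)
 next
  case (incl A)
  thus ?case by (auto simp: smat_root_elt GC_X1)
 next
  case (inv A)
  then obtain \<alpha> t where a: "\<alpha> \<in> \<Phi>" "A = root_elt \<rho> x \<alpha> t" by auto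
  thus ?case by (simp add: SL_inv_root_elt smat_root_elt GC_X1)
 next
  case (eng A B)
  thus ?case by (simp add: SL_def smat_mult GC_mult)
 qed
 thus "B \<in> GC" by (simp add: A)
next
 fix B assume "B \<in> GC"
 thus "B \<in> smat ` (elementary_group \<rho> x \<Phi> :: (complex^'n^'n) set)"
 proof (induction B rule: GC.induct)
  case GC_1
  have "mat 1 \<in> (elementary_group \<rho> x \<Phi> :: (complex^'n^'n) set)"
   unfolding elementary_group_def using generate.one[of SL] by (simp add: SL_def)
  thus ?case by (metis imageI smat_mat_1)
 next
  case (GC_X \<alpha> B t)
  then obtain A where A: "A \<in> elementary_group \<rho> x \<Phi>" "B = smat A" by auto
  have "root_elt \<rho> x \<alpha> t \<in> generate SL {root_elt \<rho> x \<alpha> t | \<alpha> t. \<alpha> \<in> \<Phi>}"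
   using GC_X by (intro generate.incl) auto
  hence "root_elt \<rho> x \<alpha> t ** A \<in> elementary_group \<rho> x \<Phi>"
   using A(1) generate.eng[of _ SL] by (fastforce simp: SL_def elementary_group_def)
  thus ?case unfolding A(2) smat_root_elt[symmetric] smat_mult[symmetric] by (rule imageI)
 qed
qed

lemma chevalley_group_iff: "A \<in> chevalley_group \<rho> x \<Phi> \<longleftrightarrow> smat A \<in> GR"
proof -
 have "(\<forall>B\<in>(elementary_group \<rho> x \<Phi> :: (complex^'n^'n) set). eval_matrix_poly p B = 0) \<longleftrightarrow> (\<forall>B\<in>GC. ev p B = 0)" for p
  unfolding smat_elementary_group[symmetric] by (simp add: ev_def smat_inverse)
 thus ?thesis by (simp add: chevalley_group_def GR_def SL_def sdet.abs_eq ev_def smat_inverse)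
qed

text \<open>Roots whose sum with \<open>\<alpha>\<close> is neither a root nor zero give commuting
  root elements over every ring; these members of \<open>Gamma_set\<close> carry the
  argument.\<close>

lemma root_elt_in_Gamma_set:
 assumes a: "\<alpha> \<in> \<Phi>" and b: "\<beta> \<in> \<Phi>" and ab: "\<alpha> + \<beta> \<notin> \<Phi>" "\<alpha> + \<beta> \<noteq> 0"
 shows "root_elt \<rho> x \<beta> 1 \<in> (Gamma_set \<rho> x \<Phi> \<alpha> :: ('r::comm_ring_1^'n^'n) set)"
proof -
 have "X \<beta> 1 * X \<alpha> 1 * X \<beta> (- 1) * X \<alpha> (- 1) = X \<alpha> 1 * (X \<beta> 1 * X \<beta> (- 1)) * X \<alpha> (- 1 :: 'r)"
  by (simp only: mult.assoc X_commute[OF a b ab, of 1 1, symmetric])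
 also have "\<dots> = 1" using a b by (simp add: X_inverse)
 finally have "commutator SL (root_elt \<rho> x \<beta> 1) (root_elt \<rho> x \<alpha> 1) = (mat 1 :: 'r^'n^'n)"
  unfolding smat_root_elt[symmetric] smat_mult[symmetric] smat_mat_1[symmetric] smat_eq_iff
  by (simp add: commutator_def SL_inv_root_elt a b) (simp add: SL_def)
 thus ?thesis using b by (auto simp: Gamma_set_def)
qed

section \<open>Centralizers in the given group\<close>

context
 fixes G :: "('r::comm_ring_1^'n^'n) set"
 assumes G: "G = chevalley_group \<rho> x \<Phi> \<or> large_subgroup \<rho> x \<Phi> G"
begin

lemma G_GR: "g \<in> G ==> smat g \<in> GR"
proof -
 have "G \<subseteq> chevalley_group \<rho> x \<Phi>"
  using G subgroup.subset[of G "SL\<lparr>carrier := chevalley_group \<rho> x \<Phi>\<rparr>"] by (auto simp: large_subgroup_def)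
 thus "g \<in> G ==> smat g \<in> GR" using chevalley_group_iff by blast
qed

lemma G_root_elt:
 assumes g: "g \<in> G" and a: "\<alpha> \<in> \<Phi>" shows "g ** root_elt \<rho> x \<alpha> t \<in> G"
 using G
proof
 assume "G = chevalley_group \<rho> x \<Phi>"
 thus ?thesis using GR_X_right[OF G_GR[OF g] a, of t]
  by (simp add: chevalley_group_iff smat_mult smat_root_elt)
next
 assume l: "large_subgroup \<rho> x \<Phi> G"
 have "root_elt \<rho> x \<alpha> t \<in> generate SL {root_elt \<rho> x \<alpha> t | \<alpha> t. \<alpha> \<in> \<Phi>}"
  using a by (intro generate.incl) auto
 hence "root_elt \<rho> x \<alpha> t \<in> G" using l by (auto simp: large_subgroup_def elementary_group_def)
 thus ?thesis
  using l g subgroup.m_closed[of G "SL\<lparr>carrier := chevalley_group \<rho> x \<Phi>\<rparr>" g]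
  by (auto simp: large_subgroup_def SL_def)
qed

lemma centralizer_Gamma:
 assumes g: "g \<in> centralizer G (Gamma_set \<rho> x \<Phi> \<alpha>)" and a: "\<alpha> \<in> \<Phi>"
 shows "g \<in> G" "\<And>\<beta>. \<beta> \<in> \<Phi> ==> \<alpha> + \<beta> \<notin> \<Phi> ==> \<alpha> + \<beta> \<noteq> 0 ==> smat g * X \<beta> 1 = X \<beta> 1 * smat g"
proof -
 fix \<beta> assume "\<beta> \<in> \<Phi>" "\<alpha> + \<beta> \<notin> \<Phi>" "\<alpha> + \<beta> \<noteq> 0"
 hence "g ** root_elt \<rho> x \<beta> 1 = root_elt \<rho> x \<beta> 1 ** g"
  using g root_elt_in_Gamma_set[OF a] by (auto simp: centralizer_def)
 thus "smat g * X \<beta> 1 = X \<beta> 1 * smat g"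
  unfolding smat_root_elt[symmetric] smat_mult[symmetric] smat_eq_iff .
qed (use g in \<open>simp add: centralizer_def\<close>)

lemma centerI:
 assumes "c \<in> G" "\<And>B. B \<in> GR ==> smat c * B = B * smat c" shows "c \<in> center G"
 using assms(1) assms(2)[OF G_GR]
 by (auto simp: center_def centralizer_def smat_mult[symmetric] smat_eq_iff)

lemma root_elt_cancel:
 "\<alpha> \<in> \<Phi> ==> A ** root_elt \<rho> x \<alpha> t ** root_elt \<rho> x \<alpha> (- t) = (A :: 'r^'n^'n)"
 unfolding smat_eq_iff[symmetric] smat_mult smat_root_elt by (simp add: mult.assoc X_inverse)

lemma centralizer_Gamma_G:
 assumes a: "\<alpha> \<in> \<Phi>" "\<not> (type_C \<Phi> \<and> short_root \<Phi> \<alpha>)"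
  and g: "g \<in> centralizer G (Gamma_set \<rho> x \<Phi> \<alpha>)"
 shows "\<exists>t. \<exists>c\<in>center G. g = c ** root_elt \<rho> x \<alpha> t"
proof -
 note gG = centralizer_Gamma(1)[OF g a(1)] note comm = centralizer_Gamma(2)[OF g a(1)]
 have "\<exists>t c. c \<in> GR \<and> (\<forall>B\<in>GR. c * B = B * c) \<and> smat g = c * X \<alpha> t"
 proof (cases "long \<alpha>")
  case True
  interpret chevalley_long \<Phi> \<Delta> "\<lambda>\<alpha>. rep (x \<alpha>)" "\<lambda>\<alpha>. rep (hr \<alpha>)" \<alpha> by unfold_locales (rule True)
  show ?thesis by (rule centralizer_Gamma_long[OF G_GR[OF gG] comm])
 next
  case False
  hence "\<not> type_C \<Phi>" using a by (auto simp: long_def short_root_def not_le)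
  thus ?thesis by (rule centralizer_Gamma_short[OF a(1) False _ G_GR[OF gG] comm])
 qed
 then obtain t c where c: "\<And>B. B \<in> GR ==> c * B = B * c" "smat g = c * X \<alpha> t" by blast
 define c' where "c' = of_smat c"
 have sc: "smat c' = c" by (simp add: c'_def of_smat_inverse)
 have gc: "g = c' ** root_elt \<rho> x \<alpha> t"
  unfolding smat_eq_iff[symmetric] smat_mult smat_root_elt sc by (rule c(2))
 \<comment> \<open>The central factor was found in \<open>GR\<close>; solving for it shows that it
   lies in a large subgroup \<open>G\<close> as well.\<close>
 have c': "c' = g ** root_elt \<rho> x \<alpha> (- t)" unfolding gc by (rule root_elt_cancel[OF a(1), symmetric])
 have "c' \<in> G" unfolding c' by (rule G_root_elt[OF gG a(1)])
 hence "c' \<in> center G" by (rule centerI) (unfold sc, rule c(1))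
 thus ?thesis using gc by blast
qed

lemma centralizer_Gamma_G_C:
 assumes l: "l \<ge> 2" and C: "C_coordinates \<Phi> l e"
  and g: "g \<in> centralizer G (Gamma_set \<rho> x \<Phi> (e 1 + e 2))"
 shows "\<exists>t1 t2 t3. \<exists>c\<in>center G. g = c ** root_elt \<rho> x (e 1 + e 2) t1
   ** root_elt \<rho> x (2 *\<^sub>R e 1) t2 ** root_elt \<rho> x (2 *\<^sub>R e 2) t3"
proof -
 obtain q where q: "q > 0" "\<And>i j. i \<in> {1..l} ==> j \<in> {1..l} ==> e i \<bullet> e j = (if i = j then q else 0)"
  and R: "\<Phi> = C_roots l e" using C by (auto simp: C_coordinates_def)
 have i: "1 \<in> {1..l}" "2 \<in> {1..l}" "(1::nat) \<noteq> 2" using l by auto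
 have s: "e 1 + e 2 \<in> \<Phi>" unfolding R C_roots_def
  using i by (intro UnI1 CollectI exI[of _ 1] exI[of _ 1] exI[of _ "1::nat"] exI[of _ "2::nat"]) simp
 have d: "2 *\<^sub>R e i \<in> \<Phi>" if "i \<in> {1..l}" for i unfolding R C_roots_def
  using that by (intro UnI2 CollectI exI[of _ 1] exI[of _ i]) simp
 note gG = centralizer_Gamma(1)[OF g s] note comm = centralizer_Gamma(2)[OF g s]
 obtain t1 t2 t3 c where c: "\<And>B. B \<in> GR ==> c * B = B * c"
  "smat g = c * X (e 1 + e 2) t1 * X (2 *\<^sub>R e 1) t2 * X (2 *\<^sub>R e 2) t3"
  using centralizer_Gamma_C[OF q R i G_GR[OF gG] comm] by blast
 define c' where "c' = of_smat c"
 have sc: "smat c' = c" by (simp add: c'_def of_smat_inverse)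
 have gc: "g = c' ** root_elt \<rho> x (e 1 + e 2) t1 ** root_elt \<rho> x (2 *\<^sub>R e 1) t2 ** root_elt \<rho> x (2 *\<^sub>R e 2) t3"
  unfolding smat_eq_iff[symmetric] smat_mult smat_root_elt sc by (rule c(2))
 have c': "c' = g ** root_elt \<rho> x (2 *\<^sub>R e 2) (- t3) ** root_elt \<rho> x (2 *\<^sub>R e 1) (- t2) ** root_elt \<rho> x (e 1 + e 2) (- t1)"
  unfolding gc by (simp only: root_elt_cancel s d i)
 have "c' \<in> G" unfolding c' by (simp only: G_root_elt gG s d i)
 hence "c' \<in> center G" by (rule centerI) (unfold sc, rule c(1))
 thus ?thesis using gc by blast
qed

end

end

theorem mainTheorem1:
  fixes \<Phi> \<Delta> :: "'e::euclidean_space set"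
    and smul :: "complex \<Rightarrow> 'l::ab_group_add \<Rightarrow> 'l"
    and bracket :: "'l \<Rightarrow> 'l \<Rightarrow> 'l"
    and h x :: "'e \<Rightarrow> 'l"
    and \<rho> :: "'l \<Rightarrow> complex^'n^'n"
    and G :: "('r::comm_ring_1^'n^'n) set"
  assumes "irreducible_root_system \<Phi>"
    and "DIM('e) > 1"
    and "complex_semisimple_lie_algebra smul bracket"
    and "complex_lie_algebra.chevalley_basis smul bracket \<Phi> \<Delta> h x"
    and "faithful_representation smul bracket \<rho>"
    and "admissible_basis \<Phi> x \<rho>"
    and "G = chevalley_group \<rho> x \<Phi> \<or> large_subgroup \<rho> x \<Phi> G"
  shows "(\<forall>\<alpha>\<in>\<Phi>. \<not> (type_C \<Phi> \<and> short_root \<Phi> \<alpha>) \<longrightarrow>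
            (\<forall>g\<in>centralizer G (Gamma_set \<rho> x \<Phi> \<alpha>).
               \<exists>t. \<exists>c\<in>center G. g = c ** root_elt \<rho> x \<alpha> t))
       \<and> (\<forall>l e. l \<ge> 2 \<and> C_coordinates \<Phi> l e \<longrightarrow>
            (\<forall>g\<in>centralizer G (Gamma_set \<rho> x \<Phi> (e 1 + e 2)).
               \<exists>t1 t2 t3. \<exists>c\<in>center G.
                 g = c ** root_elt \<rho> x (e 1 + e 2) t1
                       ** root_elt \<rho> x (2 *\<^sub>R e 1) t2
                       ** root_elt \<rho> x (2 *\<^sub>R e 2) t3))"
proof -
 interpret chevalley_data \<Phi> smul bracket \<Delta> h x \<rho> using assms(1-6)
  by (simp add: chevalley_data_def irreducible_roots_def chevalley_data_axioms_def complex_semisimple_lie_algebra_def)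
 show ?thesis using centralizer_Gamma_G[OF assms(7)] centralizer_Gamma_G_C[OF assms(7)] by blast
qed

end
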